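(* Let $k$ be an algebraically closed field with $\operatorname{char}(k)=2$, and let $F=k(\!(\alpha)\!)(\!(\beta)\!)$ be the field of iterated Laurent series in two variables over $k$. Then $F$ is 3-linked but not 4-linked; that is, any three quaternion algebras over $F$ are linked, but there exist four quaternion algebras over $F$ that are not linked.
   Context: For a field $F$ of characteristic 2, the quaternion algebras over $F$ are the algebras $[\gamma,\delta)_{2,F}=F\langle x,y : x^2+x=\gamma,\ y^2=\delta,\ yxy^{-1}=x+1\rangle$ with $\gamma\in F$ and $\delta\in F^\times$ (split algebras are allowed). Quaternion algebras $A_1,\dots,A_m$ over $F$ are called linked if there exists a quadratic field extension $K/F$ (separable or purely inseparable) that splits all of them, i.e. $A_i\otimes_F K\cong M_2(K)$ for every $i$. A field $F$ is called $m$-linked if any $m$ quaternion algebras over $F$ are linked. $k(\!(\alpha)\!)(\!(\beta)\!)$ denotes the field of Laurent series in $\beta$ over the field $k(\!(\alpha)\!)$ of Laurent series in $\alpha$ over $k$. *)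

theory Defs
  imports "HOL-Algebra.Algebra" "HOL-Algebra.Algebraic_Closure_Type"
begin

text \<open>
  A unital associative algebra over a commutative ring \<open>F\<close> is a (not necessarily commutative) ring
  together with its structure map \<open>c \<mapsto> c \<cdot> 1\<close> from \<open>F\<close>. (The locale \<^locale>\<open>algebra\<close> of the library
  is restricted to commutative algebras.)
\<close>

record ('f, 'a) ualg = "'a ring" +
  scalar :: "'f \<Rightarrow> 'a"

definition make_ualg :: "'a ring \<Rightarrow> ('f \<Rightarrow> 'a) \<Rightarrow> ('f, 'a) ualg" where
  "make_ualg R s = ring.extend R (ualg.fields s)"

definition ualg_iso ::
  "('f, 'm) ring_scheme \<Rightarrow> ('f, 'a) ualg \<Rightarrow> ('f, 'b) ualg \<Rightarrow> ('a \<Rightarrow> 'b) set" where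
  "ualg_iso F A B = {\<phi> \<in> ring_iso A B. \<forall>c\<in>carrier F. \<phi> (scalar A c) = scalar B c}"


subsection \<open>Monoid algebras, presented quaternion algebras, tensor products\<close>

definition fun_supp :: "('r, 'p) ring_scheme \<Rightarrow> ('m \<Rightarrow> 'r) \<Rightarrow> 'm set" where
  "fun_supp R f = {u. f u \<noteq> \<zero>\<^bsub>R\<^esub>}"

definition single :: "('r, 'p) ring_scheme \<Rightarrow> 'm \<Rightarrow> 'r \<Rightarrow> 'm \<Rightarrow> 'r" where
  "single R u c = (\<lambda>x. if x = u then c else \<zero>\<^bsub>R\<^esub>)"

text \<open>The monoid algebra \<open>R[M]\<close>: finitely supported functions with the convolution product.\<close>

definition monoid_algebra ::
  "('r, 'p) ring_scheme \<Rightarrow> ('m, 'q) monoid_scheme \<Rightarrow> ('r, 'm \<Rightarrow> 'r) ualg" where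
  "monoid_algebra R M =
     \<lparr>carrier = {f. range f \<subseteq> carrier R \<and> fun_supp R f \<subseteq> carrier M \<and> finite (fun_supp R f)},
      monoid.mult = (\<lambda>f g x. \<Oplus>\<^bsub>R\<^esub>u\<in>fun_supp R f. \<Oplus>\<^bsub>R\<^esub>v\<in>fun_supp R g.
                if u \<otimes>\<^bsub>M\<^esub> v = x then f u \<otimes>\<^bsub>R\<^esub> g v else \<zero>\<^bsub>R\<^esub>),
      monoid.one = single R \<one>\<^bsub>M\<^esub> \<one>\<^bsub>R\<^esub>,
      ring.zero = (\<lambda>x. \<zero>\<^bsub>R\<^esub>),
      ring.add = (\<lambda>f g x. f x \<oplus>\<^bsub>R\<^esub> g x),
      scalar = single R \<one>\<^bsub>M\<^esub>\<rparr>"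

datatype gen = Gx | Gy

definition free_monoid :: "'a list monoid" where
  "free_monoid = \<lparr>carrier = UNIV, monoid.mult = (@), monoid.one = []\<rparr>"

text \<open>The free associative algebra \<open>F\<langle>x,y\<rangle>\<close>.\<close>

abbreviation free_alg :: "('f, 'm) ring_scheme \<Rightarrow> ('f, gen list \<Rightarrow> 'f) ualg" where
  "free_alg F \<equiv> monoid_algebra F free_monoid"

text \<open>
  The algebra \<open>[\<gamma>,\<delta>)\<close> over \<open>F\<close>, the quotient of \<open>F\<langle>x,y\<rangle>\<close> by the relations \<open>x\<^sup>2 + x = \<gamma>\<close>,
  \<open>y\<^sup>2 = \<delta>\<close> and \<open>y x y\<^sup>-\<^sup>1 = x + 1\<close>. As \<open>\<delta>\<close> is a unit, so is \<open>y\<close> modulo the second relation, and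
  the third one is written as \<open>y x = (x + 1) y\<close>.
\<close>

definition quaternion_ideal ::
  "('f, 'm) ring_scheme \<Rightarrow> 'f \<Rightarrow> 'f \<Rightarrow> (gen list \<Rightarrow> 'f) set" where
  "quaternion_ideal F \<gamma> \<delta> =
    (let P = free_alg F; x = single F [Gx] \<one>\<^bsub>F\<^esub>; y = single F [Gy] \<one>\<^bsub>F\<^esub> in
      Idl\<^bsub>P\<^esub> {(x \<otimes>\<^bsub>P\<^esub> x \<oplus>\<^bsub>P\<^esub> x) \<ominus>\<^bsub>P\<^esub> scalar P \<gamma>,
            y \<otimes>\<^bsub>P\<^esub> y \<ominus>\<^bsub>P\<^esub> scalar P \<delta>,
            y \<otimes>\<^bsub>P\<^esub> x \<ominus>\<^bsub>P\<^esub> (x \<oplus>\<^bsub>P\<^esub> \<one>\<^bsub>P\<^esub>) \<otimes>\<^bsub>P\<^esub> y})"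

definition quaternion_algebra ::
  "('f, 'm) ring_scheme \<Rightarrow> 'f \<Rightarrow> 'f \<Rightarrow> ('f, (gen list \<Rightarrow> 'f) set) ualg" where
  "quaternion_algebra F \<gamma> \<delta> =
    (let P = free_alg F; I = quaternion_ideal F \<gamma> \<delta> in
      make_ualg (P Quot I) (\<lambda>c. I +>\<^bsub>P\<^esub> scalar P c))"

text \<open>
  The tensor product \<open>A \<otimes>\<^sub>F B\<close>, with \<open>B\<close> commutative, as a \<open>B\<close>-algebra via \<open>b \<mapsto> 1 \<otimes> b\<close>. It is the
  free abelian group on \<open>A \<times> B\<close> modulo the bilinearity relations; the componentwise product on
  \<open>A \<times> B\<close> makes that free abelian group the monoid ring \<open>\<int>[A \<times> B]\<close>. The additive subgroup
  generated by the relations is stable under multiplication, so it is the ideal they generate.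
\<close>

abbreviation tensor_cover ::
  "('f, 'a) ualg \<Rightarrow> ('f, 'b) ualg \<Rightarrow> (int, 'a \<times> 'b \<Rightarrow> int) ualg" where
  "tensor_cover A B \<equiv> monoid_algebra int_ring (A \<times>\<times> B)"

definition tensor_ideal ::
  "('f, 'm) ring_scheme \<Rightarrow> ('f, 'a) ualg \<Rightarrow> ('f, 'b) ualg \<Rightarrow> ('a \<times> 'b \<Rightarrow> int) set" where
  "tensor_ideal F A B =
    (let P = tensor_cover A B; e = (\<lambda>a b. single int_ring (a, b) 1) in
      Idl\<^bsub>P\<^esub>
        ({e (a \<oplus>\<^bsub>A\<^esub> a') b \<ominus>\<^bsub>P\<^esub> (e a b \<oplus>\<^bsub>P\<^esub> e a' b) | a a' b.
            a \<in> carrier A \<and> a' \<in> carrier A \<and> b \<in> carrier B} \<union>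
         {e a (b \<oplus>\<^bsub>B\<^esub> b') \<ominus>\<^bsub>P\<^esub> (e a b \<oplus>\<^bsub>P\<^esub> e a b') | a b b'.
            a \<in> carrier A \<and> b \<in> carrier B \<and> b' \<in> carrier B} \<union>
         {e (scalar A c \<otimes>\<^bsub>A\<^esub> a) b \<ominus>\<^bsub>P\<^esub> e a (scalar B c \<otimes>\<^bsub>B\<^esub> b) | c a b.
            c \<in> carrier F \<and> a \<in> carrier A \<and> b \<in> carrier B}))"

definition tensor ::
  "('f, 'm) ring_scheme \<Rightarrow> ('f, 'a) ualg \<Rightarrow> ('f, 'b) ualg \<Rightarrow> ('b, ('a \<times> 'b \<Rightarrow> int) set) ualg" where
  "tensor F A B =
    (let P = tensor_cover A B; I = tensor_ideal F A B in
      make_ualg (P Quot I) (\<lambda>b. I +>\<^bsub>P\<^esub> single int_ring (\<one>\<^bsub>A\<^esub>, b) 1))"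


subsection \<open>Splitting and linkage\<close>

text \<open>The \<open>2 \<times> 2\<close> matrices over \<open>K\<close>, with rows and columns indexed by \<^typ>\<open>bool\<close>.\<close>

definition mat2 :: "('k, 'm) ring_scheme \<Rightarrow> ('k, bool \<Rightarrow> bool \<Rightarrow> 'k) ualg" where
  "mat2 K =
     \<lparr>carrier = {M. \<forall>i j. M i j \<in> carrier K},
      monoid.mult = (\<lambda>M N i j. \<Oplus>\<^bsub>K\<^esub>l\<in>UNIV. M i l \<otimes>\<^bsub>K\<^esub> N l j),
      monoid.one = (\<lambda>i j. if i = j then \<one>\<^bsub>K\<^esub> else \<zero>\<^bsub>K\<^esub>),
      ring.zero = (\<lambda>i j. \<zero>\<^bsub>K\<^esub>),
      ring.add = (\<lambda>M N i j. M i j \<oplus>\<^bsub>K\<^esub> N i j),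
      scalar = (\<lambda>c i j. if i = j then c else \<zero>\<^bsub>K\<^esub>)\<rparr>"

definition quadratic_extension :: "('f, 'm) ring_scheme \<Rightarrow> ('f, 'k) ualg \<Rightarrow> bool" where
  "quadratic_extension F K \<longleftrightarrow>
     field K \<and> scalar K \<in> ring_hom F K \<and>
     ring.dimension K 2 (scalar K ` carrier F) (carrier K)"

definition splits :: "('f, 'm) ring_scheme \<Rightarrow> ('f, 'k) ualg \<Rightarrow> ('f, 'a) ualg \<Rightarrow> bool" where
  "splits F K A \<longleftrightarrow> ualg_iso K (tensor F A K) (mat2 K) \<noteq> {}"

text \<open>
  A quadratic extension of \<open>F\<close> is in bijection with \<open>F \<times> F\<close>, so up to isomorphism every one of them
  has its carrier in the type \<open>'f \<times> 'f\<close>. The operations on \<open>K\<close> are arbitrary, not componentwise.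
\<close>

definition linked :: "('f, 'm) ring_scheme \<Rightarrow> nat \<Rightarrow> (nat \<Rightarrow> ('f, 'a) ualg) \<Rightarrow> bool" where
  "linked F m A \<longleftrightarrow>
     (\<exists>K :: ('f, 'f \<times> 'f) ualg. quadratic_extension F K \<and> (\<forall>i<m. splits F K (A i)))"

definition m_linked :: "('f, 'm) ring_scheme \<Rightarrow> nat \<Rightarrow> bool" where
  "m_linked F m \<longleftrightarrow>
     (\<forall>\<gamma> \<delta>. (\<forall>i<m. \<gamma> i \<in> carrier F \<and> \<delta> i \<in> carrier F - {\<zero>\<^bsub>F\<^esub>}) \<longrightarrow>
        linked F m (\<lambda>i. quaternion_algebra F (\<gamma> i) (\<delta> i)))"

end

theory Submission
  imports Defs
begin

text \<open>
  In characteristic 2 the algebra \<open>[\<gamma>,\<delta>)\<close> is split by a field \<open>K\<close> if and only if \<open>\<gamma> = t\<^sup>2 + t + \<delta> z\<^sup>2\<close> for some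
  \<open>t, z\<close> in \<open>K\<close>.

  Three algebras: triples of elements with a common trace, taken modulo a common scalar, form a space of dimension
  nine on which equality of the three norms amounts to two quadratic equations. A nonzero solution yields a common
  quadratic splitting field. Up to isomorphism \<open>\<gamma>\<close> and \<open>\<delta>\<close> are Laurent polynomials in \<open>\<beta>\<close>, so it suffices that \<open>m\<close>
  quadratic forms in more than \<open>4 m\<close> variables over \<open>E[\<beta>]\<close>, \<open>E = k((\<alpha>))\<close>, have a common zero. By Tsen's count of
  parameters this follows if \<open>m\<close> forms in more than \<open>2 m\<close> variables over \<open>E\<close> do. Over \<open>k[\<alpha>]\<close> this is Tsen's count
  again, and a sequence of approximate zeros over \<open>k[[\<alpha>]]\<close> is lifted to an exact one as in Greenberg's theorem:
  among the polynomial relations that the sequence satisfies in the limit along a free ultrafilter, one of minimal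
  degree is separable in some variable, and Hensel's lemma eliminates that variable.

  Four algebras: for \<open>[1/(\<alpha>\<beta>),\<alpha>)\<close>, \<open>[1/\<alpha>,\<beta>)\<close>, \<open>[1/\<beta>,\<alpha>)\<close>, \<open>[u/(\<alpha>\<beta>),\<alpha>)\<close> with \<open>u \<noteq> 0, 1\<close> a common splitting
  field gives an element of the field that all four norm forms represent. Comparing the parities of the exponents
  of its leading term, and its leading coefficient (\<open>1\<close> or \<open>u\<close>), rules this out.
\<close>

section \<open>Places and systems of quadratic forms\<close>

text \<open>The numbers decide the theorem. Let \<open>C\<close> be such that \<open>m\<close>
  quadratic forms in more than \<open>C m\<close> variables always have a common nontrivial zero:
  \<open>C\<close> is 1 over \<open>k\<close>, 2 over \<open>k[\<alpha>]\<close> and still 2 over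
  \<open>E\<close>, and 4 over \<open>E[\<beta>]\<close>. Three algebras give 2 equations in 9
  variables, and 9 > 8; four algebras would give 3 equations in 12 variables, where 12 > 12 just
  fails.

  The two variables are treated differently. In \<beta> the tails of \<gamma> and \<delta> are
  absorbed by values of \<open>t^2 + t\<close> and by norms, so polynomials suffice. The
  coefficients in \<open>E\<close> remain arbitrary series, so for \<alpha> approximate zeros have
  to be lifted. The obstacle there is that \<open>E\<close> is imperfect: a relation may contain
  only even powers of every variable, and then all its derivatives vanish. It is overcome because 1
  and \<alpha> form a basis of \<open>E\<close> over its squares.

  Over \<open>k\<close> itself common zeros come from a deformation that is solvable by power series
  and is then specialised along a place. Separable and inseparable quadratic extensions are treated
  together through a generator with \<theta>^2 = s \<theta> + N.\<close>

definition hom_graph :: "('l::field \<times> 'k::field) set \<Rightarrow> bool" where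
  "hom_graph G \<longleftrightarrow> (1, 1) \<in> G \<and> (\<forall>b. (0, b) \<in> G \<longrightarrow> b = 0) \<and>
     (\<forall>a b c d. (a, b) \<in> G \<longrightarrow> (c, d) \<in> G \<longrightarrow> (a - c, b - d) \<in> G \<and> (a * c, b * d) \<in> G)"

context
  fixes G :: "('l::field \<times> 'k::field) set"
  assumes G: "hom_graph G"
begin

lemma hom_graph_one: "(1, 1) \<in> G"
  and hom_graph_diff: "(a, b) \<in> G \<Longrightarrow> (c, d) \<in> G \<Longrightarrow> (a - c, b - d) \<in> G"
  and hom_graph_mult: "(a, b) \<in> G \<Longrightarrow> (c, d) \<in> G \<Longrightarrow> (a * c, b * d) \<in> G"
  and hom_graph_zeroD: "(0, b) \<in> G \<Longrightarrow> b = 0"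
  using G by (auto simp: hom_graph_def)

lemma hom_graph_zero: "(0, 0) \<in> G"
  using hom_graph_diff[OF hom_graph_one hom_graph_one] by simp

lemma hom_graph_uminus: "(a, b) \<in> G \<Longrightarrow> (- a, - b) \<in> G"
  using hom_graph_diff[OF hom_graph_zero] by fastforce

lemma hom_graph_add: "(a, b) \<in> G \<Longrightarrow> (c, d) \<in> G \<Longrightarrow> (a + c, b + d) \<in> G"
  using hom_graph_diff[OF _ hom_graph_uminus] by fastforce

lemma hom_graph_unique: "(a, b) \<in> G \<Longrightarrow> (a, c) \<in> G \<Longrightarrow> b = c"
  using hom_graph_diff[of a b a c] hom_graph_zeroD by fastforce

lemma hom_graph_sum: "(\<And>i. i \<in> S \<Longrightarrow> (f i, g i) \<in> G) \<Longrightarrow> (sum f S, sum g S) \<in> G"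
  by (induction S rule: infinite_finite_induct) (auto intro: hom_graph_zero hom_graph_add)

lemma hom_graph_power: "(a, b) \<in> G \<Longrightarrow> (a ^ n, b ^ n) \<in> G"
  by (induction n) (auto intro: hom_graph_one hom_graph_mult)

definition poly_graph :: "'l poly \<Rightarrow> 'k poly \<Rightarrow> bool" where
  "poly_graph p q \<longleftrightarrow> (\<forall>i. (poly.coeff p i, poly.coeff q i) \<in> G)"

lemma poly_graph_diff: "poly_graph p q \<Longrightarrow> poly_graph p' q' \<Longrightarrow> poly_graph (p - p') (q - q')"
  by (auto simp: poly_graph_def intro: hom_graph_diff)

lemma poly_graph_mult: "poly_graph p q \<Longrightarrow> poly_graph p' q' \<Longrightarrow> poly_graph (p * p') (q * q')"
  by (auto simp: poly_graph_def coeff_mult intro!: hom_graph_sum hom_graph_mult)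

lemma poly_graph_monom: "(a, b) \<in> G \<Longrightarrow> poly_graph (Polynomial.monom a n) (Polynomial.monom b n)"
  by (auto simp: poly_graph_def intro: hom_graph_zero)

lemma poly_graph_smult: "(a, b) \<in> G \<Longrightarrow> poly_graph p q \<Longrightarrow> poly_graph (Polynomial.smult a p) (Polynomial.smult b q)"
  by (auto simp: poly_graph_def intro!: hom_graph_mult)

text \<open>Candidate for extending a partial homomorphism by x -> a. It is closed under the ring
  operations in any case; being single-valued is the only obstruction. Working with graphs of
  homomorphisms on subrings lets chains be glued by plain unions.\<close>

definition adjoin :: "'l \<Rightarrow> 'k \<Rightarrow> ('l \<times> 'k) set" where
  "adjoin x a = {(poly p x, poly q a) | p q. poly_graph p q}"

lemma adjoin_superset: "G \<subseteq> adjoin x a"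
proof
  fix z assume "z \<in> G"
  then have "poly_graph [:fst z:] [:snd z:]"
    using poly_graph_monom[of "fst z" "snd z" 0] by (simp add: monom_0)
  then show "z \<in> adjoin x a"
    unfolding adjoin_def by (intro CollectI exI[of _ "[:fst z:]"] exI[of _ "[:snd z:]"]) auto
qed

lemma adjoin_contains: "(x, a) \<in> adjoin x a"
proof -
  have "poly_graph [:0, 1:] [:0, 1:]"
    using poly_graph_monom[OF hom_graph_one, of 1] by (simp add: monom_altdef)
  then show ?thesis
    unfolding adjoin_def by (intro CollectI exI[of _ "[:0, 1:]"]) auto
qed

lemma hom_graph_adjoin:
  assumes "\<And>p q. poly_graph p q \<Longrightarrow> poly p x = 0 \<Longrightarrow> poly q a = 0"
  shows "hom_graph (adjoin x a)"
  unfolding hom_graph_def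
proof (intro conjI allI impI)
  show "(1, 1) \<in> adjoin x a"
    using adjoin_superset hom_graph_one by blast
  fix b c d e
  assume "(b, c) \<in> adjoin x a" "(d, e) \<in> adjoin x a"
  then obtain p q p' q' where *: "poly_graph p q" "poly_graph p' q'" "b = poly p x" "c = poly q a"
    "d = poly p' x" "e = poly q' a"
    by (auto simp: adjoin_def)
  show "(b - d, c - e) \<in> adjoin x a"
    unfolding adjoin_def using poly_graph_diff[OF *(1,2)] *(3-)
    by (intro CollectI exI[of _ "p - p'"] exI[of _ "q - q'"]) auto
  show "(b * d, c * e) \<in> adjoin x a"
    unfolding adjoin_def using poly_graph_mult[OF *(1,2)] *(3-)
    by (intro CollectI exI[of _ "p * p'"] exI[of _ "q * q'"]) auto
qed (use assms in \<open>auto simp: adjoin_def\<close>)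

end

text \<open>The subring of a maximal partial homomorphism is local: a relation for 1/r times a power
  of r is a relation between elements of the subring, so sending 1/r to 1/s is consistent and by
  maximality already part of the graph.\<close>

lemma hom_graph_maximal_inverse:
  fixes G :: "('l::field \<times> 'k::field) set"
  assumes G: "hom_graph G" and max: "\<And>G'. hom_graph G' \<Longrightarrow> G \<subseteq> G' \<Longrightarrow> G' = G"
    and r: "(r, s) \<in> G" and s: "s \<noteq> 0"
  shows "(inverse r, inverse s) \<in> G"
proof -
  have r0: "r \<noteq> 0"
    using hom_graph_zeroD[OF G] r s by auto
  have "poly q (inverse s) = 0" if pq: "poly_graph G p q" and p0: "poly p (inverse r) = 0" for p q
  proof -
    define n where "n = max (Polynomial.degree p) (Polynomial.degree q)"
    \<comment> \<open>Clearing denominators reverses the coefficients. The identity is stated for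
      any field because it is applied to \<open>p\<close> in the source and to \<open>q\<close> in
      the target.\<close>
    have ev: "poly f (inverse y) * y ^ n = (\<Sum>i\<le>n. poly.coeff f i * y ^ (n - i))"
      if "Polynomial.degree f \<le> n" "y \<noteq> 0" for y :: "'z::field" and f
    proof -
      have "poly f (inverse y) = (\<Sum>i\<le>n. poly.coeff f i * inverse y ^ i)"
        unfolding poly_altdef using that(1)
        by (intro sum.mono_neutral_left) (auto simp: coeff_eq_0)
      then have "poly f (inverse y) * y ^ n = (\<Sum>i\<le>n. poly.coeff f i * inverse y ^ i * y ^ n)"
        by (simp add: sum_distrib_right)
      also have "\<dots> = (\<Sum>i\<le>n. poly.coeff f i * y ^ (n - i))"
        using that(2) by (intro sum.cong refl) (simp add: power_inverse power_diff field_simps)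
      finally show ?thesis .
    qed
    have "((\<Sum>i\<le>n. poly.coeff p i * r ^ (n - i)), (\<Sum>i\<le>n. poly.coeff q i * s ^ (n - i))) \<in> G"
      using pq r by (intro hom_graph_sum[OF G] hom_graph_mult[OF G] hom_graph_power[OF G])
        (auto simp: poly_graph_def[OF G])
    then have "(poly p (inverse r) * r ^ n, poly q (inverse s) * s ^ n) \<in> G"
      using r0 s by (subst (1 2) ev) (auto simp: n_def)
    then show ?thesis
      using hom_graph_zeroD[OF G, of "poly q (inverse s) * s ^ n"] p0 s by auto
  qed
  then have "hom_graph (adjoin G (inverse r) (inverse s))"
    by (intro hom_graph_adjoin[OF G])
  then show ?thesis
    using max adjoin_superset[OF G] adjoin_contains[OF G] by metis
qed

text \<open>The images of the polynomials with root x form an ideal over the target field. A common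
  root a of this ideal would allow the extension by x -> a; over an algebraically closed field an
  ideal without common root contains 1.\<close>

lemma hom_graph_maximal_relation:
  fixes G :: "('l::field \<times> 'k::alg_closed_field) set"
  assumes G: "hom_graph G" and max: "\<And>G'. hom_graph G' \<Longrightarrow> G \<subseteq> G' \<Longrightarrow> G' = G"
    and x: "x \<notin> Domain G"
  shows "\<exists>p. poly_graph G p 1 \<and> poly p x = 0"
proof -
  define I where "I = {q. \<exists>p. poly_graph G p q \<and> poly p x = 0}"
  have no_root: "\<exists>q\<in>I. poly q a \<noteq> 0" for a
  proof (rule ccontr)
    assume "\<not> ?thesis"
    then have "hom_graph (adjoin G x a)"
      by (intro hom_graph_adjoin[OF G]) (auto simp: I_def)
    then have "(x, a) \<in> G"
      using max adjoin_superset[OF G] adjoin_contains[OF G] by metis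
    with x show False by auto
  qed
  obtain g0 where "g0 \<in> I \<and> g0 \<noteq> 0"
    using no_root[of 0] by (metis poly_0)
  from ex_has_least_nat[of "\<lambda>h. h \<in> I \<and> h \<noteq> 0", OF this, of Polynomial.degree]
  obtain g where g: "g \<in> I" "g \<noteq> 0" and gmin: "\<And>h. h \<in> I \<Longrightarrow> h \<noteq> 0 \<Longrightarrow> Polynomial.degree g \<le> Polynomial.degree h"
    by auto
  obtain pg where pg: "poly_graph G pg g" "poly pg x = 0"
    using g by (auto simp: I_def)
  obtain c where c: "(c, poly.coeff g (Polynomial.degree g)) \<in> G"
    using pg by (auto simp: poly_graph_def[OF G])
  \<comment> \<open>Maximality makes the lift \<open>c\<close> of the leading coefficient invertible
    in the subring, so that division by \<open>g\<close> can be mirrored by a division of source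
    polynomials.\<close>
  have lc: "(inverse c, inverse (poly.coeff g (Polynomial.degree g))) \<in> G"
    by (rule hom_graph_maximal_inverse[OF G max c]) (use g in auto)
  have "g dvd h" if "h \<in> I" for h
    using that
  proof (induction "Polynomial.degree h" arbitrary: h rule: less_induct)
    case less
    show ?case
    proof (cases "h = 0")
      case False
      obtain ph where ph: "poly_graph G ph h" "poly ph x = 0"
        using less.prems by (auto simp: I_def)
      have deg: "Polynomial.degree g \<le> Polynomial.degree h"
        using gmin less.prems False by auto
      obtain d where d: "(d, poly.coeff h (Polynomial.degree h)) \<in> G"
        using ph by (auto simp: poly_graph_def[OF G])
      define b where "b = poly.coeff h (Polynomial.degree h) * inverse (poly.coeff g (Polynomial.degree g))"
      define m where "m = Polynomial.monom b (Polynomial.degree h - Polynomial.degree g)"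
      have m: "poly_graph G (Polynomial.monom (d * inverse c) (Polynomial.degree h - Polynomial.degree g)) m"
        unfolding m_def b_def by (intro poly_graph_monom[OF G] hom_graph_mult[OF G] d lc)
      have I: "h - m * g \<in> I"
        unfolding I_def using poly_graph_diff[OF G ph(1) poly_graph_mult[OF G m pg(1)]] ph(2) pg(2)
        by (intro CollectI exI) auto
      have "b \<noteq> 0"
        using False g by (auto simp: b_def)
      then have "Polynomial.degree (m * g) = Polynomial.degree h"
        using g deg by (subst degree_mult_eq) (auto simp: m_def degree_monom_eq)
      moreover have "poly.coeff (m * g) (Polynomial.degree h) = poly.coeff h (Polynomial.degree h)"
        using deg g by (simp add: m_def coeff_monom_mult b_def)
      ultimately have "h - m * g = 0 \<or> Polynomial.degree (h - m * g) < Polynomial.degree h"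
        by (intro eq_zero_or_degree_less degree_diff_le) auto
      then have "g dvd h - m * g"
        using less.hyps[OF _ I] by auto
      then show ?thesis
        by (metis dvd_add_times_triv_right_iff diff_add_cancel)
    qed auto
  qed
  then have "Polynomial.degree g = 0"
    using no_root alg_closed_imp_poly_has_root[of g]
    by (metis dvdE mult_zero_left gr0I poly_mult)
  then obtain e where e: "g = [:e:]"
    by (rule degree_eq_zeroE)
  then have "poly_graph G (Polynomial.smult (inverse c) pg) (Polynomial.smult (inverse e) g)"
    using lc by (intro poly_graph_smult[OF G] pg) auto
  moreover have "Polynomial.smult (inverse e) g = 1"
    using g e by (simp add: one_pCons)
  ultimately show ?thesis
    using pg(2) by (intro exI[of _ "Polynomial.smult (inverse c) pg"]) auto
qed

text \<open>The degree reduction in Chevalley's theorem. A relation that maps to the polynomial 1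
  has a constant term that is a unit, and all its other coefficients map to 0. So the relation for
  1/x, multiplied by a power of x, can cancel the top term of the relation for x.\<close>

lemma hom_graph_maximal_degree_lt:
  fixes G :: "('l::field \<times> 'k::alg_closed_field) set"
  assumes G: "hom_graph G" and max: "\<And>G'. hom_graph G' \<Longrightarrow> G \<subseteq> G' \<Longrightarrow> G' = G"
    and p: "poly_graph G p 1" "poly p x = 0"
    and p': "poly_graph G p' 1" "poly p' (inverse x) = 0"
    and le: "Polynomial.degree p' \<le> Polynomial.degree p"
  shows "\<exists>q. poly_graph G q 1 \<and> poly q x = 0 \<and> Polynomial.degree q < Polynomial.degree p"
proof -
  define n m where "n = Polynomial.degree p" and "m = Polynomial.degree p'"
  have c: "(poly.coeff p i, if i = 0 then 1 else 0) \<in> G" "(poly.coeff p' i, if i = 0 then 1 else 0) \<in> G" for i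
    using p(1)[unfolded poly_graph_def[OF G], rule_format, of i]
      p'(1)[unfolded poly_graph_def[OF G], rule_format, of i]
    unfolding coeff_1 of_bool_def by simp_all
  have nz: "poly.coeff p' 0 \<noteq> 0" "poly.coeff p 0 \<noteq> 0"
    using c[of 0] hom_graph_zeroD[OF G, of 1] by auto
  have "n \<noteq> 0"
  proof
    assume "n = 0"
    then obtain a where "p = [:a:]"
      using degree_eq_zeroE n_def by metis
    with nz p(2) show False by auto
  qed
  have x0: "x \<noteq> 0"
    using p(2) nz by (auto simp: poly_0_coeff_0)
  have "(inverse (poly.coeff p' 0), inverse 1) \<in> G"
    by (rule hom_graph_maximal_inverse[OF G max]) (use c(2)[of 0] in auto)
  then have inv: "(inverse (poly.coeff p' 0), 1) \<in> G"
    by simp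
  define u where "u = poly.coeff p n * inverse (poly.coeff p' 0)"
  have u: "(u, 0) \<in> G"
    using hom_graph_mult[OF G c(1)[of n] inv] \<open>n \<noteq> 0\<close> by (auto simp: u_def)
  \<comment> \<open>\<open>w\<close> is u T^n p'(1/T). It vanishes at x and has the same T^n
    coefficient as \<open>p\<close>; since \<open>u\<close> maps to 0, the difference
    \<open>p - w\<close> still maps to 1.\<close>
  define w where "w = (\<Sum>i\<le>m. Polynomial.monom (u * poly.coeff p' i) (n - i))"
  have w_deg: "Polynomial.degree w \<le> n"
    unfolding w_def by (intro degree_sum_le) (auto intro: order.trans[OF degree_monom_le])
  have cw: "poly.coeff w j = (if j \<le> n \<and> n - j \<le> m then u * poly.coeff p' (n - j) else 0)" for j
  proof -
    have "poly.coeff w j = (\<Sum>i\<le>m. if n - i = j then u * poly.coeff p' i else 0)"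
      by (simp add: w_def Polynomial.coeff_sum)
    also have "\<dots> = (\<Sum>i\<le>m. if i = n - j \<and> j \<le> n then u * poly.coeff p' i else 0)"
      using le by (intro sum.cong refl) (auto simp: n_def m_def)
    also have "\<dots> = (if j \<le> n \<and> n - j \<le> m then u * poly.coeff p' (n - j) else 0)"
      by (cases "j \<le> n") auto
    finally show ?thesis .
  qed
  have "poly w x = (\<Sum>i\<le>m. u * poly.coeff p' i * x ^ (n - i))"
    by (simp add: w_def poly_sum poly_monom)
  also have "\<dots> = (\<Sum>i\<le>m. u * x ^ n * (poly.coeff p' i * inverse x ^ i))"
    using le x0 by (intro sum.cong refl) (simp add: n_def m_def power_diff power_inverse field_simps)
  also have "\<dots> = u * x ^ n * poly p' (inverse x)"
    by (simp add: poly_altdef m_def sum_distrib_left)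
  finally have "poly w x = 0"
    using p'(2) by simp
  moreover have "poly_graph G (p - w) 1"
    unfolding poly_graph_def[OF G]
  proof
    fix j
    have "(poly.coeff w j, 0) \<in> G"
      unfolding cw using hom_graph_mult[OF G u c(2)[of "n - j"]] hom_graph_zero[OF G] by auto
    from hom_graph_diff[OF G c(1)[of j] this]
    show "(poly.coeff (p - w) j, poly.coeff 1 j) \<in> G"
      by (simp add: coeff_1 split: if_splits)
  qed
  moreover have "Polynomial.degree (p - w) < n"
  proof -
    have "poly.coeff (p - w) n = 0"
      using nz by (simp add: cw u_def)
    moreover have "Polynomial.degree (p - w) \<le> n"
      by (rule degree_diff_le) (use w_deg in \<open>auto simp: n_def\<close>)
    ultimately show ?thesis
      using eq_zero_or_degree_less[of "p - w" n] \<open>n \<noteq> 0\<close> by auto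
  qed
  ultimately show ?thesis
    using p(2) by (intro exI[of _ "p - w"]) (auto simp: n_def)
qed

text \<open>If both failed, there would be relations of least degree for x and for 1/x, and the one
  of larger degree could be shortened with the help of the other.\<close>

lemma hom_graph_maximal_dichotomy:
  fixes G :: "('l::field \<times> 'k::alg_closed_field) set"
  assumes G: "hom_graph G" and max: "\<And>G'. hom_graph G' \<Longrightarrow> G \<subseteq> G' \<Longrightarrow> G' = G"
  shows "x \<in> Domain G \<or> inverse x \<in> Domain G"
proof (rule ccontr)
  assume neg: "\<not> ?thesis"
  define P where "P = (\<lambda>y p. poly_graph G p 1 \<and> poly p y = 0)"
  have arg_mn: "\<exists>p. P y p \<and> (\<forall>q. P y q \<longrightarrow> Polynomial.degree p \<le> Polynomial.degree q)"
    if "y \<notin> Domain G" for y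
  proof -
    from hom_graph_maximal_relation[OF G max that] obtain p0 where "P y p0"
      by (auto simp: P_def)
    from ex_has_least_nat[of "P y", OF this, of Polynomial.degree] show ?thesis .
  qed
  obtain p where p: "P x p" "\<And>q. P x q \<Longrightarrow> Polynomial.degree p \<le> Polynomial.degree q"
    using arg_mn[of x] neg by auto
  obtain p' where p': "P (inverse x) p'" "\<And>q. P (inverse x) q \<Longrightarrow> Polynomial.degree p' \<le> Polynomial.degree q"
    using arg_mn[of "inverse x"] neg by auto
  show False
  proof (cases "Polynomial.degree p' \<le> Polynomial.degree p")
    case True
    then show False
      using hom_graph_maximal_degree_lt[OF G max, of p x p'] p(1) p'(1) p(2)
      unfolding P_def by (meson linorder_not_le)
  next
    case False
    then show False
      using hom_graph_maximal_degree_lt[OF G max, of p' "inverse x" p] p(1) p'(1) p'(2)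
      unfolding P_def by (metis linorder_not_le nat_le_linear inverse_inverse_eq)
  qed
qed

text \<open>Chevalley's extension theorem. Zorn's lemma gives a maximal graph, whose domain is a
  valuation ring by the dichotomy. Elements outside the domain have the value infinity, expressed by
  1/x -> 0.\<close>

theorem place_extension:
  fixes G0 :: "('l::field \<times> 'k::alg_closed_field) set"
  assumes "hom_graph G0"
  shows "\<exists>G. hom_graph G \<and> G0 \<subseteq> G \<and> (\<forall>x. x \<in> Domain G \<or> (inverse x, 0) \<in> G)"
proof -
  have "\<exists>G\<in>{G. hom_graph G \<and> G0 \<subseteq> G}. \<forall>G'\<in>{G. hom_graph G \<and> G0 \<subseteq> G}. G \<subseteq> G' \<longrightarrow> G' = G"
  proof (rule subset_Zorn_nonempty)
    show "{G. hom_graph G \<and> G0 \<subseteq> G} \<noteq> {}"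
      using assms by auto
    fix C assume C: "C \<noteq> {}" "subset.chain {G. hom_graph G \<and> G0 \<subseteq> G} C"
    then have C1: "\<And>G. G \<in> C \<Longrightarrow> hom_graph G" "\<And>G. G \<in> C \<Longrightarrow> G0 \<subseteq> G"
      and C2: "\<And>G G'. G \<in> C \<Longrightarrow> G' \<in> C \<Longrightarrow> G \<subseteq> G' \<or> G' \<subseteq> G"
      by (auto simp: subset_chain_def subset_eq)
    have "hom_graph (\<Union>C)"
      unfolding hom_graph_def
    proof (intro conjI allI impI)
      show "(1, 1) \<in> \<Union>C"
        using C C1 hom_graph_one by blast
    next
      fix b assume "(0, b) \<in> \<Union>C"
      then show "b = 0"
        using C1 hom_graph_zeroD by blast
    next
      fix a b c d assume "(a, b) \<in> \<Union>C" "(c, d) \<in> \<Union>C"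
      then obtain G1 G2 where "G1 \<in> C" "(a, b) \<in> G1" "G2 \<in> C" "(c, d) \<in> G2"
        by blast
      with C2[of G1 G2] obtain G where G: "G \<in> C" "(a, b) \<in> G" "(c, d) \<in> G"
        by blast
      then show "(a - c, b - d) \<in> \<Union>C" "(a * c, b * d) \<in> \<Union>C"
        using hom_graph_diff[OF C1(1)] hom_graph_mult[OF C1(1)] by blast+
    qed
    then show "\<Union>C \<in> {G. hom_graph G \<and> G0 \<subseteq> G}"
      using C C1 by auto
  qed
  then obtain G where "G \<in> {G. hom_graph G \<and> G0 \<subseteq> G}"
    and *: "\<forall>G'\<in>{G. hom_graph G \<and> G0 \<subseteq> G}. G \<subseteq> G' \<longrightarrow> G' = G"
    by (rule bexE)
  then have G: "hom_graph G" "G0 \<subseteq> G"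
    by auto
  have max: "G' = G" if "hom_graph G'" "G \<subseteq> G'" for G'
    using * that G(2) by (metis (no_types, lifting) mem_Collect_eq subset_trans)
  \<comment> \<open>A nonzero value of 1/x would be inverted within the maximal graph and would put
    x itself into the domain.\<close>
  have "(inverse x, 0) \<in> G" if x: "x \<notin> Domain G" for x
  proof -
    obtain b where b: "(inverse x, b) \<in> G"
      using hom_graph_maximal_dichotomy[OF G(1) max] x by blast
    have "b = 0"
      using hom_graph_maximal_inverse[OF G(1) max b] x by (metis Domain.DomainI inverse_inverse_eq)
    with b show ?thesis by simp
  qed
  with G show ?thesis by (intro exI[of _ G]) auto
qed

section \<open>Systems of quadratic forms over an algebraically closed field\<close>

definition quad :: "nat \<Rightarrow> (nat \<Rightarrow> nat \<Rightarrow> 'e::comm_ring_1) \<Rightarrow> (nat \<Rightarrow> 'e) \<Rightarrow> 'e" where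
  "quad n a x = (\<Sum>i<n. \<Sum>j<n. a i j * (x i * x j))"

text \<open>\<open>C\<close> plays the part of 2^i for a C_i field in the theory of Tsen and Lang.
  The matrices \<open>a l\<close> are general ones, because a symmetric matrix has no mixed terms in
  characteristic 2.\<close>

definition quadrics_solvable :: "'e::comm_ring_1 itself \<Rightarrow> nat \<Rightarrow> bool" where
  "quadrics_solvable _ C \<longleftrightarrow> (\<forall>m n (a :: nat \<Rightarrow> nat \<Rightarrow> nat \<Rightarrow> 'e). C * m < n \<longrightarrow>
     (\<exists>x. (\<exists>i<n. x i \<noteq> 0) \<and> (\<forall>l<m. quad n (a l) x = 0)))"

text \<open>Contraction principle for the X-adic topology: the iterates starting from 0 become
  stationary in each coefficient. The index type \<open>'i\<close> accommodates systems of
  equations.\<close>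

lemma fps_fixpoint:
  fixes \<Psi> :: "('i \<Rightarrow> 'a::comm_ring_1 fps) \<Rightarrow> 'i \<Rightarrow> 'a fps"
  assumes contr: "\<And>n y z i. (\<And>i k. k < n \<Longrightarrow> fps_nth (y i) k = fps_nth (z i) k) \<Longrightarrow>
    fps_nth (\<Psi> y i) n = fps_nth (\<Psi> z i) n"
  shows "\<exists>y. \<forall>i. y i = \<Psi> y i"
proof -
  define Y where "Y = (\<lambda>j. (\<Psi> ^^ j) (\<lambda>_. 0))"
  have Y_Suc: "Y (Suc j) = \<Psi> (Y j)" for j
    by (simp add: Y_def)
  have step: "fps_nth (Y j i) k = fps_nth (Y (Suc j) i) k" if "k < j" for j i k
    using that
  proof (induction j arbitrary: i k)
    case (Suc j)
    have "fps_nth (\<Psi> (Y j) i) k = fps_nth (\<Psi> (Y (Suc j)) i) k"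
      by (rule contr) (use Suc in auto)
    then show ?case
      unfolding Y_Suc[symmetric] .
  qed auto
  have stable: "fps_nth (Y j i) k = fps_nth (Y (Suc k) i) k" if "k < j" for j i k
    using that
  proof (induction j)
    case (Suc j)
    show ?case
      using Suc step[of k j i] by (cases "k = j") auto
  qed auto
  \<comment> \<open>Coefficient \<open>k\<close> is final from the iterate \<open>Suc k\<close>
    on.\<close>
  define y where "y = (\<lambda>i. Abs_fps (\<lambda>k. fps_nth (Y (Suc k) i) k))"
  have "fps_nth (y i) k = fps_nth (\<Psi> y i) k" for i k
  proof -
    have "fps_nth (\<Psi> (Y k) i) k = fps_nth (\<Psi> y i) k"
      by (rule contr) (auto simp: y_def intro: stable)
    then show ?thesis
      by (simp add: y_def Y_Suc)
  qed
  then show ?thesis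
    by (intro exI[of _ y] allI fps_ext)
qed

definition agree :: "nat \<Rightarrow> 'a::comm_ring_1 fps \<Rightarrow> 'a fps \<Rightarrow> bool" where
  "agree n f g \<longleftrightarrow> (\<forall>k<n. fps_nth f k = fps_nth g k)"

lemma agree_refl: "agree n f f"
  by (simp add: agree_def)

lemma agree_add: "agree n f g \<Longrightarrow> agree n f' g' \<Longrightarrow> agree n (f + f') (g + g')"
  by (simp add: agree_def)

lemma agree_diff: "agree n f g \<Longrightarrow> agree n f' g' \<Longrightarrow> agree n (f - f') (g - g')"
  by (simp add: agree_def)

lemma agree_mult: "agree n f g \<Longrightarrow> agree n f' g' \<Longrightarrow> agree n (f * f') (g * g')"
  by (auto simp: agree_def fps_mult_nth intro!: sum.cong)

lemma agree_sum: "(\<And>i. i \<in> S \<Longrightarrow> agree n (f i) (g i)) \<Longrightarrow> agree n (sum f S) (sum g S)"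
  by (auto simp: agree_def fps_sum_nth intro!: sum.cong)

lemma agree_X_mult: "agree n f g \<Longrightarrow> agree (Suc n) (fps_X * f) (fps_X * g)"
  by (auto simp: agree_def)

lemma agree_power: "agree n f g \<Longrightarrow> agree n (f ^ k) (g ^ k)"
  by (induction k) (auto intro: agree_refl agree_mult)

lemma agree_quad: "(\<And>i. agree n (y i) (z i)) \<Longrightarrow> agree n (quad d a y) (quad d a z)"
  unfolding quad_def by (intro agree_sum agree_mult agree_refl)

text \<open>With X = u these series are the polynomials in t = 1/u, and the graph is the evaluation
  at t = 0. A place extending it carries a solution found near u = 0 over to t = 0, at the opposite
  end.\<close>

lemma hom_graph_fls_nonpos:
  "hom_graph {(f :: 'k::field fls, fls_nth f 0) | f. \<forall>n>0. fls_nth f n = 0}"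
proof -
  have mult: "fls_nth (f * g) n = (if n = 0 then fls_nth f 0 * fls_nth g 0 else 0)"
    if f: "\<forall>n>0. fls_nth f n = 0" and g: "\<forall>n>0. fls_nth g n = 0" and n: "n \<ge> 0" for f g :: "'k fls" and n
  proof -
    have 0: "fls_nth f i * fls_nth g (n - i) = (if i = 0 \<and> n = 0 then fls_nth f 0 * fls_nth g 0 else 0)" for i
    proof (cases "i = 0 \<and> n = 0")
      case False
      then have "i > 0 \<or> n - i > 0"
        using n by auto
      then show ?thesis
        using f g False by auto
    qed auto
    have "fls_nth (f * g) n =
      (\<Sum>i=fls_subdegree f..n - fls_subdegree g. if i = 0 \<and> n = 0 then fls_nth f 0 * fls_nth g 0 else 0)"
      unfolding fls_times_nth(2) by (intro sum.cong refl 0)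
    also have "\<dots> = (if n = 0 then fls_nth f 0 * fls_nth g 0 else 0)"
      by auto
    finally show ?thesis .
  qed
  show ?thesis
    unfolding hom_graph_def
    by (auto simp: mult)
qed

text \<open>Divisibility in a valuation ring is a total order. Dividing a solution vector by such a
  coordinate makes it specialisable, with one coordinate equal to 1.\<close>

lemma hom_graph_dominating:
  assumes G: "hom_graph G" and val: "\<And>x. x \<in> Domain G \<or> (inverse x, 0) \<in> G"
    and S: "finite S" "S \<noteq> {}" "0 \<notin> S"
  shows "\<exists>j\<in>S. \<forall>i\<in>S. i / j \<in> Domain G"
  using S
proof (induction S rule: finite_ne_induct)
  case (singleton x)
  then show ?case
    using hom_graph_one[OF G] by auto
next
  case (insert x S)
  then obtain j where j: "j \<in> S" "\<And>i. i \<in> S \<Longrightarrow> i / j \<in> Domain G"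
    by auto
  have "j \<noteq> 0" "x \<noteq> 0"
    using insert.prems j by auto
  show ?case
  proof (cases "x / j \<in> Domain G")
    case True
    then show ?thesis
      using j by auto
  next
    case False
    then have jx: "j / x \<in> Domain G"
      using val[of "x / j"] by (auto simp: Domain.simps)
    have "i / x \<in> Domain G" if "i \<in> S" for i
    proof -
      have "(i / j) * (j / x) \<in> Domain G"
        using j(2)[OF that] jx hom_graph_mult[OF G] by fast
      then show ?thesis
        using \<open>j \<noteq> 0\<close> by simp
    qed
    moreover have "x / x \<in> Domain G"
      using \<open>x \<noteq> 0\<close> hom_graph_one[OF G] by auto
    ultimately show ?thesis
      by auto
  qed
qed

lemma hom_graph_quad:
  assumes G: "hom_graph G" and "\<And>i j. (a i j, b i j) \<in> G" "\<And>i. (x i, z i) \<in> G"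
  shows "(quad n a x, quad n b z) \<in> G"
  unfolding quad_def by (intro hom_graph_sum[OF G] hom_graph_mult[OF G] assms)

lemma quad_divide: "quad n a (\<lambda>i. x i / c) = quad n a x / c ^ 2"
  for x :: "nat \<Rightarrow> 'e::field"
  by (simp add: quad_def sum_divide_distrib power2_eq_square)

lemma fps_to_fls_sum: "fps_to_fls (sum f S) = (\<Sum>i\<in>S. fps_to_fls (f i))"
  by (induction S rule: infinite_finite_induct) auto

lemma fps_to_fls_quad: "fps_to_fls (quad n a x) = quad n (\<lambda>i j. fps_to_fls (a i j)) (\<lambda>i. fps_to_fls (x i))"
  by (simp add: quad_def fps_to_fls_sum fls_times_fps_to_fls)

text \<open>Writing \<open>u = 1/t\<close>, the perturbed system \<open>q\<^sub>l(y) + t (y\<^sub>l\<^sub>+\<^sub>1\<^sup>2 - y\<^sub>l\<^sub>+\<^sub>1 y\<^sub>0) = 0\<close>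
  has a solution over \<open>k((u))\<close> by successive approximation. A place of \<open>k((u))\<close> extending
  \<open>t \<mapsto> 0\<close> specialises it to a zero of the original system.\<close>

theorem quadrics_solvable_alg_closed: "quadrics_solvable TYPE('k::alg_closed_field) 1"
  unfolding quadrics_solvable_def
proof (intro allI impI)
  fix m n :: nat and a :: "nat \<Rightarrow> nat \<Rightarrow> nat \<Rightarrow> 'k"
  assume mn: "1 * m < n"
  \<comment> \<open>At u = 0 the perturbed system has the simple zero (1, 0, ..., 0). The ansatz
    keeps coordinate 0 equal to 1 and scales the deviation by X. Coordinates above \<open>m\<close>
    stay 0, and m + 1 coordinates are available since m < n.\<close>
  define Y :: "(nat \<Rightarrow> 'k fps) \<Rightarrow> nat \<Rightarrow> 'k fps"
    where "Y = (\<lambda>u i. if i = 0 then 1 else if i \<le> m then fps_X * u (i - 1) else 0)"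
  define q where "q = (\<lambda>l. quad n (\<lambda>i j. fps_const (a l i j)))"
  \<comment> \<open>The unknowns enter \<open>q\<close> only through X times themselves and their
    squares carry a factor X, so the right-hand side is a contraction. Multiplied by X it is the
    perturbed equation for y.\<close>
  have "\<exists>u. \<forall>l. u l = (\<lambda>u l. fps_X * u l ^ 2 + q l (Y u)) u l"
  proof (rule fps_fixpoint)
    fix N i and y z :: "nat \<Rightarrow> 'k fps"
    assume "\<And>i k. k < N \<Longrightarrow> fps_nth (y i) k = fps_nth (z i) k"
    then have A: "agree N (y i) (z i)" for i
      by (simp add: agree_def)
    have "agree (Suc N) (fps_X * y i ^ 2 + q i (Y y)) (fps_X * z i ^ 2 + q i (Y z))"
      unfolding q_def Y_def
      by (intro agree_add agree_X_mult agree_power agree_quad A) (auto intro: agree_refl agree_X_mult A)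
    then show "fps_nth (fps_X * y i ^ 2 + q i (Y y)) N = fps_nth (fps_X * z i ^ 2 + q i (Y z)) N"
      by (simp add: agree_def)
  qed
  then obtain u where u: "u l = fps_X * u l ^ 2 + q l (Y u)" for l
    by auto
  define y where "y = (\<lambda>i. fps_to_fls (Y u i))"
  have y0: "y 0 = 1"
    by (simp add: y_def Y_def)
  have eq: "quad n (\<lambda>i j. fls_const (a l i j)) y + fls_X_inv * (y (Suc l) ^ 2 - y (Suc l) * y 0) = 0" if "l < m" for l
  proof -
    have Y_l: "Y u (Suc l) = fps_X * u l"
      using that by (simp add: Y_def)
    have "fps_X * u l = fps_X * (fps_X * u l ^ 2 + q l (Y u))"
      using u[of l] by (rule arg_cong)
    also have "\<dots> = (fps_X * u l) ^ 2 + fps_X * q l (Y u)"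
      by (simp add: power2_eq_square algebra_simps)
    finally have "Y u (Suc l) = Y u (Suc l) ^ 2 + fps_X * q l (Y u)"
      unfolding Y_l .
    then have "fps_to_fls (Y u (Suc l)) = fps_to_fls (Y u (Suc l) ^ 2 + fps_X * q l (Y u))"
      by (rule arg_cong)
    then have "y (Suc l) = y (Suc l) ^ 2 + fls_X * quad n (\<lambda>i j. fls_const (a l i j)) y"
      by (simp only: y_def q_def fps_to_fls_plus fps_to_fls_power fls_times_fps_to_fls fps_X_to_fls
          fps_to_fls_quad fps_const_to_fls)
    then have "y (Suc l) ^ 2 - y (Suc l) * y 0 = - (fls_X * quad n (\<lambda>i j. fls_const (a l i j)) y)"
      by (simp add: y0 algebra_simps)
    moreover have "fls_X_inv * (fls_X * z) = z" for z :: "'k fls"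
      by (simp add: mult.assoc[symmetric] fls_inverse_X[symmetric])
    ultimately show ?thesis
      by simp
  qed
  obtain G :: "('k fls \<times> 'k) set" where G: "hom_graph G"
    and G0: "{(f, fls_nth f 0) | f. \<forall>n>0. fls_nth f n = 0} \<subseteq> G"
    and val': "\<forall>x. x \<in> Domain G \<or> (inverse x, 0) \<in> G"
    using place_extension[OF hom_graph_fls_nonpos] by (elim exE conjE)
  from val' have val: "x \<in> Domain G \<or> (inverse x, 0) \<in> G" for x
    by (rule spec)
  have t: "(fls_X_inv, 0) \<in> G" and const: "(fls_const c, c) \<in> G" for c
    using G0 by auto
  \<comment> \<open>The coordinates of \<open>y\<close> may lie outside the domain of the place, so
    the vector is first normalised by a dominating one; the set is nonempty because
    \<open>y 0 = 1\<close>.\<close>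
  have "\<exists>j\<in>y ` {..m} - {0}. \<forall>i\<in>y ` {..m} - {0}. i / j \<in> Domain G"
    using y0 by (intro hom_graph_dominating[OF G val]) (auto intro!: exI[of _ "0::nat"])
  then obtain j where j: "j \<le> m" "y j \<noteq> 0" "\<And>i. i \<le> m \<Longrightarrow> y i \<noteq> 0 \<Longrightarrow> y i / y j \<in> Domain G"
    by auto
  have "\<exists>z. (y i / y j, z) \<in> G" for i
  proof (cases "y i = 0")
    case False
    then have "i \<le> m"
      by (auto simp: y_def Y_def split: if_splits)
    then show ?thesis using j(3) False by auto
  next
    case True
    then show ?thesis
      using hom_graph_zero[OF G] by auto
  qed
  then obtain z where "\<forall>i. (y i / y j, z i) \<in> G"
    using choice[of "\<lambda>i z. (y i / y j, z) \<in> G"] by auto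
  then have z: "(y i / y j, z i) \<in> G" for i
    by simp
  have "z j = 1"
    using hom_graph_unique[OF G z[of j]] j(2) hom_graph_one[OF G] by simp
  moreover have "quad n (a l) z = 0" if "l < m" for l
  proof -
    have "(quad n (\<lambda>i j. fls_const (a l i j)) (\<lambda>i. y i / y j) +
       fls_X_inv * ((y (Suc l) / y j) ^ 2 - (y (Suc l) / y j) * (y 0 / y j)),
       quad n (a l) z + 0 * (z (Suc l) ^ 2 - z (Suc l) * z 0)) \<in> G"
      by (intro hom_graph_add[OF G] hom_graph_quad[OF G] hom_graph_mult[OF G] hom_graph_diff[OF G]
          hom_graph_power[OF G] t const z)
    also have "quad n (\<lambda>i j. fls_const (a l i j)) (\<lambda>i. y i / y j) +
       fls_X_inv * ((y (Suc l) / y j) ^ 2 - (y (Suc l) / y j) * (y 0 / y j)) =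
       (quad n (\<lambda>i j. fls_const (a l i j)) y + fls_X_inv * (y (Suc l) ^ 2 - y (Suc l) * y 0)) / y j ^ 2"
      using j(2) by (simp add: quad_divide field_simps power2_eq_square)
    finally show ?thesis
      using hom_graph_zeroD[OF G] eq[OF that] by auto
  qed
  ultimately show "\<exists>x. (\<exists>i<n. x i \<noteq> 0) \<and> (\<forall>l<m. quad n (a l) x = 0)"
    using j(1) mn by (intro exI[of _ z]) (auto intro!: exI[of _ j])
qed

section \<open>Tsen's count of parameters for polynomials\<close>

lemma sum_div_mod:
  fixes f :: "nat \<Rightarrow> nat \<Rightarrow> 'a::comm_monoid_add"
  shows "(\<Sum>u<n * N. f (u div N) (u mod N)) = (\<Sum>i<n. \<Sum>p<N. f i p)"
proof (induction n)
  case (Suc n)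
  have "{..<Suc n * N} = {..<n * N} \<union> {n * N..<n * N + N}"
    by auto
  then have "(\<Sum>u<Suc n * N. f (u div N) (u mod N)) =
    (\<Sum>u<n * N. f (u div N) (u mod N)) + (\<Sum>u=n * N..<n * N + N. f (u div N) (u mod N))"
    by (simp add: sum.union_disjoint ivl_disj_int)
  also have "(\<Sum>u=n * N..<n * N + N. f (u div N) (u mod N)) =
      (\<Sum>p<N. f ((n * N + p) div N) ((n * N + p) mod N))"
    by (rule sum.reindex_bij_witness[of _ "\<lambda>p. n * N + p" "\<lambda>u. u - n * N"]) auto
  also have "\<dots> = (\<Sum>p<N. f n p)"
    by (intro sum.cong refl) auto
  finally show ?case
    by (simp add: Suc.IH)
qed auto

text \<open>Tsen's argument: unknown polynomials with \<open>N\<close> coefficients turn \<open>m\<close> quadratic forms whose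
  coefficients have degree at most \<open>d\<close> into \<open>m (d + 2 N)\<close> forms in \<open>n N\<close> variables.\<close>

theorem quadrics_solvable_poly:
  assumes "quadrics_solvable TYPE('e::field) C"
  shows "quadrics_solvable TYPE('e poly) (2 * C)"
  unfolding quadrics_solvable_def
proof (intro allI impI)
  fix m n :: nat and a :: "nat \<Rightarrow> nat \<Rightarrow> nat \<Rightarrow> 'e poly"
  assume mn: "2 * C * m < n"
  define d where "d = (\<Sum>l<m. \<Sum>i<n. \<Sum>j<n. Polynomial.degree (a l i j))"
  have d: "Polynomial.degree (a l i j) \<le> d" if "l < m" "i < n" "j < n" for l i j
  proof -
    have "Polynomial.degree (a l i j) \<le> (\<Sum>j<n. Polynomial.degree (a l i j))"
      using that by (intro member_le_sum) auto
    also have "\<dots> \<le> (\<Sum>i<n. \<Sum>j<n. Polynomial.degree (a l i j))"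
      using that by (intro member_le_sum[of i _ "\<lambda>i. \<Sum>j<n. Polynomial.degree (a l i j)"]) auto
    also have "\<dots> \<le> d"
      unfolding d_def using that
      by (intro member_le_sum[of l _ "\<lambda>l. \<Sum>i<n. \<Sum>j<n. Polynomial.degree (a l i j)"]) auto
    finally show ?thesis .
  qed
  \<comment> \<open>Since n is at least 2 C m + 1, the required inequality C m (d + 2 N) < n N holds
    as soon as N > C m d.\<close>
  define N where "N = C * m * d + 1"
  \<comment> \<open>A product of a coefficient and two unknowns has degree at most d + 2 (N - 1),
    which is below \<open>R\<close>.\<close>
  define R where "R = d + 2 * N"
  \<comment> \<open>Pairs are packed into single indices: \<open>v\<close> encodes a form and a
    coefficient position of it, \<open>u\<close> a variable and an exponent.\<close>
  define b where "b = (\<lambda>v u u'. poly.coeff (a (v div R) (u div N) (u' div N) *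
    Polynomial.monom 1 (u mod N + u' mod N)) (v mod R))"
  have "C * (m * R) < n * N"
  proof -
    have "C * (m * R) = C * m * d + 2 * C * m * N"
      by (simp add: R_def algebra_simps)
    also have "\<dots> < N + 2 * C * m * N"
      by (simp add: N_def)
    also have "\<dots> = (2 * C * m + 1) * N"
      by simp
    also have "\<dots> \<le> n * N"
      using mn by (intro mult_right_mono) auto
    finally show ?thesis .
  qed
  then obtain y where y: "\<exists>u<n * N. y u \<noteq> 0" "\<And>v. v < m * R \<Longrightarrow> quad (n * N) (b v) y = 0"
    using assms unfolding quadrics_solvable_def by blast
  define x where "x = (\<lambda>i. \<Sum>p<N. Polynomial.monom (y (i * N + p)) p)"
  have N0: "N > 0"
    by (simp add: N_def)
  have "R > 0"
    using N0 by (simp add: R_def)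
  have cx: "poly.coeff (x i) p = (if p < N then y (i * N + p) else 0)" for i p
    by (simp add: x_def Polynomial.coeff_sum)
  have degx: "Polynomial.degree (x i) \<le> N - 1" for i
    by (rule degree_le) (auto simp: cx)
  have main: "quad n (a l) x = 0" if l: "l < m" for l
  proof (rule poly_eqI)
    fix r
    show "poly.coeff (quad n (a l) x) r = poly.coeff 0 r"
    proof (cases "r < R")
      case True
      have v: "l * R + r < m * R"
      proof -
        have "l * R + r < (l + 1) * R"
          using True by simp
        also have "\<dots> \<le> m * R"
          using l by (intro mult_right_mono) auto
        finally show ?thesis .
      qed
      have *: "(l * R + r) div R = l" "(l * R + r) mod R = r"
        using True by auto
      have "poly.coeff (quad n (a l) x) r = (\<Sum>i<n. \<Sum>j<n. poly.coeff (a l i j * (x i * x j)) r)"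
        by (simp add: quad_def Polynomial.coeff_sum)
      also have "\<dots> = (\<Sum>i<n. \<Sum>j<n. \<Sum>p<N. \<Sum>p'<N.
          poly.coeff (a l i j * Polynomial.monom 1 (p + p')) r * (y (i * N + p) * y (j * N + p')))"
      proof (intro sum.cong refl)
        fix i j
        have "x i * x j = (\<Sum>p<N. \<Sum>p'<N.
          Polynomial.smult (y (i * N + p) * y (j * N + p')) (Polynomial.monom 1 (p + p')))"
          unfolding x_def sum_product by (simp add: mult_monom smult_monom)
        then have "a l i j * (x i * x j) = (\<Sum>p<N. \<Sum>p'<N.
          Polynomial.smult (y (i * N + p) * y (j * N + p')) (a l i j * Polynomial.monom 1 (p + p')))"
          by (simp add: sum_distrib_left)
        then show "poly.coeff (a l i j * (x i * x j)) r = (\<Sum>p<N. \<Sum>p'<N.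
          poly.coeff (a l i j * Polynomial.monom 1 (p + p')) r * (y (i * N + p) * y (j * N + p')))"
          by (simp add: Polynomial.coeff_sum mult.commute)
      qed
      also have "\<dots> = (\<Sum>i<n. \<Sum>p<N. \<Sum>j<n. \<Sum>p'<N.
          poly.coeff (a l i j * Polynomial.monom 1 (p + p')) r * (y (i * N + p) * y (j * N + p')))"
        by (intro sum.cong refl sum.swap)
      also have "\<dots> = (\<Sum>u<n * N. \<Sum>u'<n * N. b (l * R + r) u u' * (y u * y u'))"
      proof -
        define g where "g = (\<lambda>i p j p'. poly.coeff (a l i j * Polynomial.monom 1 (p + p')) r *
          (y (i * N + p) * y (j * N + p')))"
        have inner: "(\<Sum>u'<n * N. g i p (u' div N) (u' mod N)) = (\<Sum>j<n. \<Sum>p'<N. g i p j p')" for i p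
          by (rule sum_div_mod)
        have "(\<Sum>u<n * N. \<Sum>u'<n * N. g (u div N) (u mod N) (u' div N) (u' mod N)) =
          (\<Sum>i<n. \<Sum>p<N. \<Sum>j<n. \<Sum>p'<N. g i p j p')"
          unfolding inner by (rule sum_div_mod)
        then show ?thesis
          using True by (simp add: b_def * g_def)
      qed
      also have "\<dots> = 0"
        using y(2)[OF v] by (simp add: quad_def)
      finally show ?thesis
        by simp
    next
      case False
      have degR: "Polynomial.degree (a l i j * (x i * x j)) < R" if "i < n" "j < n" for i j
      proof -
        have "Polynomial.degree (a l i j * (x i * x j)) \<le> d + ((N - 1) + (N - 1))"
          by (intro order.trans[OF degree_mult_le] add_mono d l that degx)
        then show ?thesis
          using N0 by (simp add: R_def)
      qed
      then have "poly.coeff (a l i j * (x i * x j)) r = 0" if "i < n" "j < n" for i j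
        using degR[OF that] False by (intro coeff_eq_0) linarith
      then show ?thesis
        by (simp add: quad_def Polynomial.coeff_sum)
    qed
  qed
  obtain u where u: "u < n * N" "y u \<noteq> 0"
    using y(1) by auto
  have "poly.coeff (x (u div N)) (u mod N) \<noteq> 0"
    using u N0 by (simp add: cx)
  then have "x (u div N) \<noteq> 0"
    by auto
  moreover have "u div N < n"
    using u(1) N0 by (simp add: less_mult_imp_div_less)
  ultimately show "\<exists>x. (\<exists>i<n. x i \<noteq> 0) \<and> (\<forall>l<m. quad n (a l) x = 0)"
    using main by (intro exI[of _ x]) auto
qed

section \<open>Laurent series in characteristic 2\<close>

lemma char2_add_self: "CHAR('a::ring_1) = 2 \<Longrightarrow> x + x = (0::'a)"
  by (metis mult_2 mult_zero_left of_nat_CHAR of_nat_numeral)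

lemma char2_square_add: "CHAR('a::comm_ring_1) = 2 \<Longrightarrow> (x + y) ^ 2 = x ^ 2 + (y::'a) ^ 2"
  using char2_add_self[of "x * y"] by (simp add: power2_eq_square algebra_simps)

lemma char2_square_sum:
  "CHAR('a::comm_ring_1) = 2 \<Longrightarrow> (sum f S) ^ 2 = (\<Sum>i\<in>S. (f i :: 'a) ^ 2)"
  by (induction S rule: infinite_finite_induct) (simp_all add: char2_square_add)

lemma char2_of_nat: "CHAR('a::ring_1) = 2 \<Longrightarrow> of_nat n = (if even n then 0 else (1::'a))"
  using char2_add_self[of "1::'a"] by (induction n) auto

text \<open>The terms with indices i and n - i are equal and cancel; only the middle term survives,
  and it exists for even n.\<close>

lemma fls_square_nth:
  fixes f :: "'a::field fls"
  assumes "CHAR('a) = 2"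
  shows "fls_nth (f ^ 2) n = (if even n then fls_nth f (n div 2) ^ 2 else 0)"
proof -
  define s where "s = fls_subdegree f"
  define h where "h = (\<lambda>i. fls_nth f i * fls_nth f (n - i))"
  have "fls_nth (f ^ 2) n = sum h {s..n - s}"
    by (simp add: power2_eq_square fls_times_nth(2) s_def h_def)
  also have "{s..n - s} = ({i \<in> {s..n - s}. 2 * i < n} \<union> {i \<in> {s..n - s}. 2 * i > n}) \<union> {i \<in> {s..n - s}. 2 * i = n}"
    by auto
  also have "sum h \<dots> = sum h {i \<in> {s..n - s}. 2 * i < n} + sum h {i \<in> {s..n - s}. 2 * i > n} + sum h {i \<in> {s..n - s}. 2 * i = n}"
    by (subst sum.union_disjoint; (subst sum.union_disjoint)?) (auto intro: finite_subset[of _ "{s..n - s}"])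
  also have "sum h {i \<in> {s..n - s}. 2 * i > n} = sum h {i \<in> {s..n - s}. 2 * i < n}"
    by (rule sum.reindex_bij_witness[of _ "\<lambda>i. n - i" "\<lambda>i. n - i"]) (auto simp: h_def mult.commute)
  also have "sum h {i \<in> {s..n - s}. 2 * i < n} + sum h {i \<in> {s..n - s}. 2 * i < n} = 0"
    using assms by (rule char2_add_self)
  also have "sum h {i \<in> {s..n - s}. 2 * i = n} = (if even n then fls_nth f (n div 2) ^ 2 else 0)"
  proof (cases "even n")
    case True
    then obtain r where r: "n = 2 * r" by auto
    have "{i \<in> {s..n - s}. 2 * i = n} = (if r \<ge> s then {r} else {})"
      using r by auto
    then show ?thesis
      using r by (auto simp: h_def power2_eq_square s_def)
  next
    case False
    then have "{i \<in> {s..n - s}. 2 * i = n} = {}" by auto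
    then show ?thesis
      using False by (simp only: sum.empty if_False)
  qed
  finally show ?thesis by simp
qed

text \<open>\<open>k\<close> is perfect, so the even coefficients of \<open>c\<close> form a square
  and the odd ones X times a square: 1 and X are a basis of k((X)) over its subfield of
  squares.\<close>

lemma fls_square_decomposition:
  fixes c :: "'k::alg_closed_field fls"
  assumes "CHAR('k) = 2"
  shows "\<exists>a b. c = a ^ 2 + fls_X * b ^ 2"
proof -
  have "\<exists>y. y ^ 2 = x" for x :: 'k
    using nth_root_exists[of 2 x] by auto
  then obtain r where r: "r x ^ 2 = x" for x :: 'k
    by metis
  have r0: "r 0 = 0"
    using r[of 0] by simp
  obtain N where N: "\<And>n. n < N \<Longrightarrow> fls_nth c n = 0"
    by (metis fls_eq0_below_subdegree)
  define a where "a = Abs_fls (\<lambda>j. r (fls_nth c (2 * j)))"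
  define b where "b = Abs_fls (\<lambda>j. r (fls_nth c (2 * j + 1)))"
  have a: "fls_nth a j = r (fls_nth c (2 * j))" and b: "fls_nth b j = r (fls_nth c (2 * j + 1))" for j
  proof -
    \<comment> \<open>The bound -|N| serves the even and the odd indices at once, whatever the sign
      of \<open>N\<close>.\<close>
    have "2 * n < N" "2 * n + 1 < N" if "n < - \<bar>N\<bar>" for n
      using that by (auto simp: abs_if split: if_splits)
    then show "fls_nth a j = r (fls_nth c (2 * j))" "fls_nth b j = r (fls_nth c (2 * j + 1))"
      unfolding a_def b_def
      by (subst nth_Abs_fls_lower_bound[of "- \<bar>N\<bar>"]; simp add: N r0)+
  qed
  have "fls_nth c n = fls_nth (a ^ 2 + fls_X * b ^ 2) n" for n
  proof (cases "even n")
    case True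
    then show ?thesis
      by (simp add: fls_X_times_conv_shift fls_square_nth[OF assms] a r)
  next
    case False
    then have "2 * ((n - 1) div 2) + 1 = n"
      by presburger
    with False show ?thesis
      by (simp add: fls_X_times_conv_shift fls_square_nth[OF assms] b r)
  qed
  then show ?thesis
    by (metis fls_eqI)
qed

text \<open>Valuation at least \<open>N\<close>, phrased by coefficients so that 0 satisfies it for
  every \<open>N\<close>, whereas \<open>fls_subdegree 0\<close> is 0.\<close>

definition vge :: "'a::zero fls \<Rightarrow> int \<Rightarrow> bool" where
  "vge f N \<longleftrightarrow> (\<forall>k<N. fls_nth f k = 0)"

lemma vge_zero: "vge 0 N"
  by (simp add: vge_def)

lemma vge_mono: "vge f N \<Longrightarrow> M \<le> N \<Longrightarrow> vge f M"
  by (auto simp: vge_def)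

lemma vge_add: "vge f N \<Longrightarrow> vge g N \<Longrightarrow> vge (f + g) N"
  for f :: "'a::ab_group_add fls"
  by (simp add: vge_def)

lemma vge_diff: "vge f N \<Longrightarrow> vge g N \<Longrightarrow> vge (f - g) N"
  for f :: "'a::ab_group_add fls"
  by (simp add: vge_def)

lemma vge_mult: "vge f M \<Longrightarrow> vge g N \<Longrightarrow> vge (f * g) (M + N)"
  for f :: "'a::field fls"
proof (cases "f = 0 \<or> g = 0")
  case False
  assume "vge f M" "vge g N"
  then have "M \<le> fls_subdegree f" "N \<le> fls_subdegree g"
    using False by (auto simp: vge_def intro!: fls_subdegree_geI)
  then show "vge (f * g) (M + N)"
    unfolding vge_def by (auto intro!: fls_times_nth_eq0)
qed (auto simp: vge_zero)

lemma not_vge_mult: "\<not> vge f M \<Longrightarrow> \<not> vge g N \<Longrightarrow> \<not> vge (f * g) (M + N)"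
  for f :: "'a::field fls"
proof
  assume *: "\<not> vge f M" "\<not> vge g N" "vge (f * g) (M + N)"
  then have nz: "f \<noteq> 0" "g \<noteq> 0"
    by (auto simp: vge_zero)
  have "\<exists>k<M. fls_nth f k \<noteq> 0" "\<exists>k<N. fls_nth g k \<noteq> 0"
    using *(1,2) by (simp_all add: vge_def)
  then have "fls_subdegree f < M" "fls_subdegree g < N"
    by (meson fls_subdegree_leI le_less_trans)+
  then have "fls_subdegree f + fls_subdegree g < M + N"
    by linarith
  then have "fls_nth (f * g) (fls_subdegree f + fls_subdegree g) = 0"
    using *(3) unfolding vge_def by blast
  then show False
    using nz by (simp only: fls_times_base mult_eq_0_iff nth_fls_subdegree_zero_iff simp_thms)
qed

lemma vge_fps_to_fls: "vge (fps_to_fls f) 0"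
  by (simp add: vge_def)

lemma vge_0_regpart: "vge f 0 \<Longrightarrow> fps_to_fls (fls_regpart f) = f"
  by (intro fls_eqI) (auto simp: vge_def)

lemma vge_exists: "\<exists>K\<ge>0. vge f (- int K)"
  by (rule exI[of _ "nat (- fls_subdegree f)"]) (auto simp: vge_def)

lemma not_vge_diff:
  fixes f :: "'a::ab_group_add fls"
  assumes "\<not> vge f N" "vge (f - g) M" "N \<le> M"
  shows "\<not> vge g N"
proof
  assume "vge g N"
  then have "vge ((f - g) + g) N"
    by (intro vge_add vge_mono[OF assms(2,3)])
  with assms(1) show False by simp
qed

section \<open>Hensel's lemma\<close>

lemma poly_taylor:
  fixes p :: "'a::idom poly"
  shows "\<exists>q. \<forall>h. poly p (a + h) = poly p a + poly (pderiv p) a * h + h ^ 2 * poly q h"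
proof (induction p)
  case 0
  then show ?case by (intro exI[of _ 0]) simp
next
  case (pCons c p)
  then obtain q where q: "\<And>h. poly p (a + h) = poly p a + poly (pderiv p) a * h + h ^ 2 * poly q h"
    by blast
  show ?case
    by (rule exI[of _ "[:poly (pderiv p) a:] + [:a, 1:] * q"])
      (simp only: poly_pCons q, simp add: pderiv_pCons algebra_simps power2_eq_square)
qed

lemma agree_poly: "agree n x y \<Longrightarrow> agree n (poly p x) (poly p y)"
  by (induction p) (auto intro: agree_refl agree_add agree_mult)

text \<open>Look for the root a + X^(v+s) u. Dividing the Taylor expansion by X^(2v+s) leaves r + w
  u + X^s u^2 q = 0; because \<open>w\<close> is a unit and s > 0, solving this for u is a
  contraction.\<close>

lemma fps_hensel:
  fixes p :: "'a::field fps poly"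
  assumes D: "poly (pderiv p) a = fps_X ^ v * w" and w: "fps_nth w 0 \<noteq> 0"
    and r: "poly p a = fps_X ^ (2 * v + s) * r" and s: "s > 0"
  shows "\<exists>u. poly p (a + fps_X ^ (v + s) * u) = 0"
proof -
  obtain q where q: "\<And>h. poly p (a + h) = poly p a + poly (pderiv p) a * h + h ^ 2 * poly q h"
    using poly_taylor by blast
  define \<Psi> where "\<Psi> = (\<lambda>(u :: unit \<Rightarrow> 'a fps) (i::unit).
    - inverse w * (r + fps_X * (fps_X ^ (s - 1) * (u () ^ 2 * poly q (fps_X ^ (v + s) * u ())))))"
  have "\<exists>u. \<forall>i. u i = \<Psi> u i"
  proof (rule fps_fixpoint)
    fix n i and y z :: "unit \<Rightarrow> 'a fps"
    assume "\<And>i k. k < n \<Longrightarrow> fps_nth (y i) k = fps_nth (z i) k"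
    then have "agree n (y ()) (z ())"
      by (simp add: agree_def)
    then have "agree (Suc n) (\<Psi> y i) (\<Psi> z i)"
      unfolding \<Psi>_def
      by (intro agree_mult[of "Suc n" "- inverse w"] agree_add[of "Suc n" r] agree_X_mult agree_refl
          agree_mult agree_power agree_poly)
    then show "fps_nth (\<Psi> y i) n = fps_nth (\<Psi> z i) n"
      by (simp add: agree_def)
  qed
  then obtain u where u: "u = - inverse w * (r + fps_X * (fps_X ^ (s - 1) * (u ^ 2 * poly q (fps_X ^ (v + s) * u))))"
    unfolding \<Psi>_def by (metis (no_types, lifting))
  have "w * u = w * (- inverse w * (r + fps_X * (fps_X ^ (s - 1) * (u ^ 2 * poly q (fps_X ^ (v + s) * u)))))"
    using u by (rule arg_cong)
  also have "\<dots> = - (r + fps_X ^ s * (u ^ 2 * poly q (fps_X ^ (v + s) * u)))"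
    using w s by (simp add: mult.assoc[symmetric] inverse_mult_eq_1' power_eq_if)
  finally have *: "r + w * u + fps_X ^ s * (u ^ 2 * poly q (fps_X ^ (v + s) * u)) = 0"
    by simp
  have "poly p (a + fps_X ^ (v + s) * u) =
    fps_X ^ (2 * v + s) * (r + w * u + fps_X ^ s * (u ^ 2 * poly q (fps_X ^ (v + s) * u)))"
    unfolding q D r by (simp add: algebra_simps power_add power_mult_distrib power2_eq_square mult_2 mult_2_right)
  with * show ?thesis
    by auto
qed

text \<open>A version with a mere upper bound \<open>e\<close> for the valuation v of the
  derivative, since the bound is what remains uniform along a sequence. Replacing s by s' = s + 2 (e
  - v) keeps 2v + s' = 2e + s, and the precision v + s' of the root is at least e + s.\<close>

lemma fls_hensel:
  fixes p :: "nat \<Rightarrow> 'a::field fls"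
  assumes p: "\<And>i. i \<le> d \<Longrightarrow> vge (p i) 0" and a: "vge a 0"
    and D: "\<not> vge (\<Sum>i\<le>d. of_nat i * p i * a ^ (i - 1)) (int e + 1)"
    and P: "vge (\<Sum>i\<le>d. p i * a ^ i) (int (2 * e + s))" and s: "s > 0"
  shows "\<exists>b. vge b 0 \<and> vge (b - a) (int (e + s)) \<and> (\<Sum>i\<le>d. p i * b ^ i) = 0"
proof -
  define q where "q = (\<Sum>i\<le>d. Polynomial.monom (fls_regpart (p i)) i)"
  define A where "A = fls_regpart a"
  have fls_sum: "fps_to_fls (sum f S) = (\<Sum>i\<in>S. fps_to_fls (f i))" for f :: "nat \<Rightarrow> 'a fps" and S
    by (rule fps_to_fls_sum)
  have ev: "fps_to_fls (poly q z) = (\<Sum>i\<le>d. p i * fps_to_fls z ^ i)" for z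
    by (auto simp: q_def poly_sum poly_monom fls_sum fls_times_fps_to_fls fps_to_fls_power
        vge_0_regpart[OF p] intro!: sum.cong)
  have "pderiv q = (\<Sum>i\<le>d. Polynomial.monom (of_nat i * fls_regpart (p i)) (i - 1))"
    unfolding q_def by (induction d) (simp_all add: pderiv_monom pderiv_add)
  then have ev': "fps_to_fls (poly (pderiv q) z) = (\<Sum>i\<le>d. of_nat i * p i * fps_to_fls z ^ (i - 1))" for z
    by (auto simp: poly_sum poly_monom fls_sum fls_times_fps_to_fls fps_to_fls_power
        vge_0_regpart[OF p] fps_to_fls_of_nat intro!: sum.cong)
  have A: "fps_to_fls A = a"
    by (simp add: A_def vge_0_regpart a)
  define D where "D = poly (pderiv q) A"
  have D1: "\<not> vge (fps_to_fls D) (int e + 1)"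
    using D by (simp add: D_def ev' A)
  then have "D \<noteq> 0"
    by (auto simp: vge_zero)
  define v where "v = subdegree D"
  have ve: "v \<le> e"
  proof (rule ccontr)
    assume "\<not> v \<le> e"
    then have "vge (fps_to_fls D) (int e + 1)"
      by (auto simp: vge_def v_def intro!: nth_less_subdegree_zero)
    with D1 show False ..
  qed
  define s' where "s' = s + 2 * (e - v)"
  have "poly q A = fps_X ^ (2 * v + s') * fps_shift (2 * v + s') (poly q A)"
  proof (intro fps_ext)
    fix k
    have "fps_nth (poly q A) k = 0" if "k < 2 * v + s'"
    proof -
      have "int k < int (2 * e + s)"
        using that ve by (simp add: s'_def)
      then have "fls_nth (fps_to_fls (poly q A)) (int k) = 0"
        using P unfolding ev A vge_def by blast
      then show ?thesis by simp
    qed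
    then show "fps_nth (poly q A) k = fps_nth (fps_X ^ (2 * v + s') * fps_shift (2 * v + s') (poly q A)) k"
      by (simp add: fps_X_power_mult_nth)
  qed
  moreover have "poly (pderiv q) A = fps_X ^ v * unit_factor D"
    unfolding D_def[symmetric] v_def using subdegree_decompose[of D] by (simp add: mult.commute fps_unit_factor_def)
  moreover have "fps_nth (unit_factor D) 0 \<noteq> 0"
    using \<open>D \<noteq> 0\<close> by simp
  ultimately obtain u where u: "poly q (A + fps_X ^ (v + s') * u) = 0"
    using fps_hensel[of q A v "unit_factor D" s'] s by (auto simp: s'_def)
  define b where "b = fps_to_fls (A + fps_X ^ (v + s') * u)"
  have "b - a = fps_to_fls (fps_X ^ (v + s') * u)"
    by (simp add: b_def A)
  moreover have "vge (fps_to_fls (fps_X ^ (v + s') * u)) (int (e + s))"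
    using ve by (auto simp: vge_def fps_X_power_mult_nth s'_def)
  moreover have "(\<Sum>i\<le>d. p i * b ^ i) = 0"
    unfolding b_def ev[symmetric] u by simp
  moreover have "vge b 0"
    unfolding b_def by (rule vge_fps_to_fls)
  ultimately show ?thesis
    by (intro exI[of _ b]) simp
qed

text \<open>In the order of filters smaller means finer, so an ultrafilter is a minimal proper
  filter and Zorn's lemma is applied to the reversed order.\<close>

lemma free_ultrafilter_exists:
  "\<exists>U :: nat filter. U \<noteq> bot \<and> U \<le> sequentially \<and> (\<forall>P. eventually P U \<or> eventually (\<lambda>x. \<not> P x) U)"
proof -
  define S where "S = {U :: nat filter. U \<noteq> bot \<and> U \<le> sequentially}"
  have "\<exists>m\<in>S. \<forall>a\<in>S. a \<le> m \<longrightarrow> a = m"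
  proof (rule predicate_Zorn[of S "\<lambda>a b. b \<le> a"])
    show "partial_order_on S (relation_of (\<lambda>a b. b \<le> a) S)"
      by (rule partial_order_on_relation_ofI) auto
    fix C assume C: "C \<in> Chains (relation_of (\<lambda>a b. b \<le> a) S)"
    then have CS: "C \<subseteq> S" and ch: "\<And>a b. a \<in> C \<Longrightarrow> b \<in> C \<Longrightarrow> a \<le> b \<or> b \<le> a"
      by (auto simp: Chains_def relation_of_def)
    show "\<exists>u\<in>S. \<forall>a\<in>C. u \<le> a"
    proof (cases "C = {}")
      case True
      then show ?thesis
        by (intro bexI[of _ sequentially]) (auto simp: S_def)
    next
      case False
      \<comment> \<open>In a chain, an event that holds eventually for the infimum already does so
        for a member, and the members are proper.\<close>
      have "Inf C \<noteq> bot"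
      proof
        assume "Inf C = bot"
        then have "eventually (\<lambda>_. False) (Inf C)"
          by simp
        moreover have "\<exists>x\<in>C. x \<le> inf F G" if "F \<in> C" "G \<in> C" for F G
          using ch[OF that] that by (auto intro: bexI[of _ F] bexI[of _ G])
        ultimately obtain c where "c \<in> C" "eventually (\<lambda>_. False) c"
          using eventually_Inf_base[OF False, of "\<lambda>_. False"] by auto
        with CS show False
          by (auto simp: S_def eventually_False)
      qed
      moreover have "Inf C \<le> sequentially"
        using False CS by (auto simp: S_def intro: Inf_lower2)
      ultimately show ?thesis
        by (intro bexI[of _ "Inf C"]) (auto simp: S_def Inf_lower)
    qed
  qed
  then obtain U where U: "U \<in> S" and max: "\<And>V. V \<in> S \<Longrightarrow> V \<le> U \<Longrightarrow> V = U"
    by auto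
  have "eventually P U \<or> eventually (\<lambda>x. \<not> P x) U" for P
  proof (rule disjCI)
    assume "\<not> eventually (\<lambda>x. \<not> P x) U"
    then have "inf U (principal {x. P x}) \<noteq> bot"
      by (simp add: trivial_limit_def eventually_inf_principal)
    then have "inf U (principal {x. P x}) = U"
      using U by (intro max) (auto simp: S_def intro: le_infI1)
    moreover have "eventually P (inf U (principal {x. P x}))"
      by (simp add: eventually_inf_principal)
    ultimately show "eventually P U"
      by simp
  qed
  with U show ?thesis
    unfolding S_def by (intro exI[of _ U]) simp
qed

section \<open>Approximate common zeros over Laurent series fields\<close>

text \<open>Polynomials are handled as functions of a point. \<open>I\<close> records the variables
  that may occur; eliminating the variable \<open>j\<close> means passing to
  \<open>I - {j}\<close>.\<close>

inductive_set polyfun :: "nat set \<Rightarrow> ((nat \<Rightarrow> 'e::comm_ring_1) \<Rightarrow> 'e) set" for I where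
  polyfun_const: "(\<lambda>_. c) \<in> polyfun I"
| polyfun_var: "i \<in> I \<Longrightarrow> (\<lambda>x. x i) \<in> polyfun I"
| polyfun_add: "f \<in> polyfun I \<Longrightarrow> g \<in> polyfun I \<Longrightarrow> (\<lambda>x. f x + g x) \<in> polyfun I"
| polyfun_mult: "f \<in> polyfun I \<Longrightarrow> g \<in> polyfun I \<Longrightarrow> (\<lambda>x. f x * g x) \<in> polyfun I"

lemma polyfun_mono: "f \<in> polyfun I \<Longrightarrow> I \<subseteq> J \<Longrightarrow> f \<in> polyfun J"
  by (induction rule: polyfun.induct) (auto intro: polyfun.intros)

lemma polyfun_diff:
  assumes "f \<in> polyfun I" "g \<in> polyfun I"
  shows "(\<lambda>x. f x - g x) \<in> polyfun I"
proof -
  have "(\<lambda>x. f x + (- 1) * g x) \<in> polyfun I"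
    by (intro polyfun_add polyfun_mult[OF polyfun_const] assms)
  then show ?thesis by simp
qed

lemma polyfun_sum:
  "(\<And>t. t \<in> T \<Longrightarrow> f t \<in> polyfun I) \<Longrightarrow> (\<lambda>x. \<Sum>t\<in>T. f t x) \<in> polyfun I"
  by (induction T rule: infinite_finite_induct) (auto intro: polyfun.intros)

lemma polyfun_prod:
  "(\<And>t. t \<in> T \<Longrightarrow> f t \<in> polyfun I) \<Longrightarrow> (\<lambda>x. \<Prod>t\<in>T. f t x) \<in> polyfun I"
  by (induction T rule: infinite_finite_induct) (auto intro: polyfun.intros)

lemma polyfun_power: "f \<in> polyfun I \<Longrightarrow> (\<lambda>x. f x ^ n) \<in> polyfun I"
  by (induction n) (auto intro: polyfun.intros)

lemma polyfun_cong: "f \<in> polyfun I \<Longrightarrow> (\<And>i. i \<in> I \<Longrightarrow> x i = y i) \<Longrightarrow> f x = f y"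
  by (induction rule: polyfun.induct) auto

lemma polyfun_if: "f \<in> polyfun I \<Longrightarrow> (\<lambda>x. if b then f x else 0) \<in> polyfun I"
  by (cases b) (auto intro: polyfun_const)

lemma polyfun_quad: "(\<lambda>x. quad n a x) \<in> polyfun {..<n}"
  unfolding quad_def by (intro polyfun_sum polyfun_mult polyfun_const polyfun_var) auto

definition close_on :: "nat set \<Rightarrow> int \<Rightarrow> (nat \<Rightarrow> 'e::field fls) \<Rightarrow> (nat \<Rightarrow> 'e fls) \<Rightarrow> bool" where
  "close_on I N x y \<longleftrightarrow> (\<forall>i\<in>I. vge (x i) 0 \<and> vge (y i) 0 \<and> vge (x i - y i) N)"

text \<open>Only the coefficients of \<open>f\<close> can contribute poles on integral points. So
  one constant \<open>K\<close> bounds both the poles of the values and the loss of precision, for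
  all points and all \<open>N\<close> at once.\<close>

lemma polyfun_continuous:
  fixes f :: "(nat \<Rightarrow> 'e::field fls) \<Rightarrow> 'e fls"
  assumes "f \<in> polyfun I"
  shows "\<exists>K::nat. \<forall>x y N. close_on I N x y \<longrightarrow> vge (f x) (- int K) \<and> vge (f x - f y) (N - int K)"
  using assms
proof (induction rule: polyfun.induct)
  case (polyfun_const c)
  obtain K where "vge c (- int K)"
    using vge_exists by blast
  then show ?case
    by (intro exI[of _ K]) (auto simp: vge_zero)
next
  case (polyfun_var i)
  then show ?case
    by (intro exI[of _ 0]) (auto simp: close_on_def)
next
  case (polyfun_add f g)
  then obtain K K' where
    K: "\<And>x y N. close_on I N x y \<Longrightarrow> vge (f x) (- int K) \<and> vge (f x - f y) (N - int K)" and
    K': "\<And>x y N. close_on I N x y \<Longrightarrow> vge (g x) (- int K') \<and> vge (g x - g y) (N - int K')"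
    by (elim exE) (metis (no_types, lifting))
  show ?case
  proof (intro exI[of _ "K + K'"] allI impI conjI)
    fix x y :: "nat \<Rightarrow> 'e fls" and N assume c: "close_on I N x y"
    show "vge (f x + g x) (- int (K + K'))"
      using K[OF c] K'[OF c] by (intro vge_add) (auto intro: vge_mono)
    have "vge ((f x - f y) + (g x - g y)) (N - int (K + K'))"
      using K[OF c] K'[OF c] by (intro vge_add) (auto intro: vge_mono)
    then show "vge (f x + g x - (f y + g y)) (N - int (K + K'))"
      by (simp add: algebra_simps)
  qed
next
  case (polyfun_mult f g)
  then obtain K K' where
    K: "\<And>x y N. close_on I N x y \<Longrightarrow> vge (f x) (- int K) \<and> vge (f x - f y) (N - int K)" and
    K': "\<And>x y N. close_on I N x y \<Longrightarrow> vge (g x) (- int K') \<and> vge (g x - g y) (N - int K')"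
    by (elim exE) (metis (no_types, lifting))
  show ?case
  proof (intro exI[of _ "K + K'"] allI impI conjI)
    fix x y :: "nat \<Rightarrow> 'e fls" and N assume c: "close_on I N x y"
    then have c': "close_on I 0 y y"
      by (simp add: close_on_def vge_zero)
    show "vge (f x * g x) (- int (K + K'))"
      using vge_mult[OF K[OF c, THEN conjunct1] K'[OF c, THEN conjunct1]] by simp
    have "vge ((f x - f y) * g x + f y * (g x - g y)) (N - int (K + K'))"
      using vge_mult[OF K[OF c, THEN conjunct2] K'[OF c, THEN conjunct1]]
        vge_mult[OF K[OF c', THEN conjunct1] K'[OF c, THEN conjunct2]]
      by (intro vge_add) (auto simp: algebra_simps)
    then show "vge (f x * g x - (f y * g y)) (N - int (K + K'))"
      by (simp add: algebra_simps)
  qed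
qed

section \<open>Polynomial functions with explicit coefficients\<close>

definition exponents :: "nat set \<Rightarrow> nat \<Rightarrow> (nat \<Rightarrow> nat) set" where
  "exponents I D = {\<mu>. (\<forall>i. i \<notin> I \<longrightarrow> \<mu> i = 0) \<and> sum \<mu> I \<le> D}"

definition mono_eval :: "nat set \<Rightarrow> (nat \<Rightarrow> nat) \<Rightarrow> (nat \<Rightarrow> 'e::comm_ring_1) \<Rightarrow> 'e" where
  "mono_eval I \<mu> x = (\<Prod>i\<in>I. x i ^ \<mu> i)"

text \<open>Kept apart from \<open>polyfun\<close> because a nontrivial relation is one with a
  nonzero coefficient, and because the descent on the total degree \<open>D\<close> acts on
  coefficients rather than on values.\<close>

definition mpoly_eval :: "nat set \<Rightarrow> nat \<Rightarrow> ((nat \<Rightarrow> nat) \<Rightarrow> 'e) \<Rightarrow> (nat \<Rightarrow> 'e::comm_ring_1) \<Rightarrow> 'e" where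
  "mpoly_eval I D c x = (\<Sum>\<mu>\<in>exponents I D. c \<mu> * mono_eval I \<mu> x)"

lemma finite_exponents: "finite I \<Longrightarrow> finite (exponents I D)"
proof -
  assume I: "finite I"
  have "exponents I D \<subseteq> {\<mu>. \<forall>i. (i \<in> I \<longrightarrow> \<mu> i \<in> {..D}) \<and> (i \<notin> I \<longrightarrow> \<mu> i = 0)}"
  proof (intro subsetI CollectI allI conjI impI)
    fix \<mu> i assume \<mu>: "\<mu> \<in> exponents I D"
    show "\<mu> i \<in> {..D}" if "i \<in> I"
      using member_le_sum[OF that _ I, of \<mu>] \<mu> by (simp add: exponents_def)
    show "\<mu> i = 0" if "i \<notin> I"
      using \<mu> that by (simp add: exponents_def)
  qed
  then show ?thesis
    by (rule finite_subset) (intro finite_set_of_finite_funs I, simp)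
qed

lemma mono_eval_add: "mono_eval I (\<lambda>i. \<mu> i + \<nu> i) x = mono_eval I \<mu> x * mono_eval I \<nu> x"
  by (simp add: mono_eval_def power_add prod.distrib)

lemma exponents_add:
  "\<mu> \<in> exponents I D \<Longrightarrow> \<nu> \<in> exponents I D' \<Longrightarrow> (\<lambda>i. \<mu> i + \<nu> i) \<in> exponents I (D + D')"
  by (auto simp: exponents_def sum.distrib)

text \<open>Collects terms with equal exponents, as they arise from products and from partial
  derivatives.\<close>

lemma sum_monomials:
  assumes I: "finite I" and T: "finite T" "\<And>t. t \<in> T \<Longrightarrow> e t \<in> exponents I D"
  shows "(\<Sum>t\<in>T. b t * mono_eval I (e t) x) = mpoly_eval I D (\<lambda>\<rho>. \<Sum>t\<in>{t\<in>T. e t = \<rho>}. b t) x"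
proof -
  have "(\<Sum>t\<in>T. b t * mono_eval I (e t) x) =
    (\<Sum>\<rho>\<in>exponents I D. \<Sum>t\<in>{t\<in>T. e t = \<rho>}. b t * mono_eval I (e t) x)"
    by (rule sum.group[symmetric]) (use T finite_exponents[OF I] in auto)
  also have "\<dots> = mpoly_eval I D (\<lambda>\<rho>. \<Sum>t\<in>{t\<in>T. e t = \<rho>}. b t) x"
    by (simp add: mpoly_eval_def sum_distrib_right)
  finally show ?thesis .
qed

lemma exponents_mono: "D \<le> D' \<Longrightarrow> exponents I D \<subseteq> exponents I D'"
  by (auto simp: exponents_def)

lemma polyfun_mpoly_eval:
  assumes I: "finite I" and f: "f \<in> polyfun I"
  shows "\<exists>D c. f = mpoly_eval I D c"
  using f
proof (induction rule: polyfun.induct)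
  case (polyfun_const c)
  have "(\<lambda>_. c) = mpoly_eval I 0 (\<lambda>\<rho>. \<Sum>t\<in>{t\<in>{()}. (\<lambda>_. 0) = \<rho>}. c)"
    using sum_monomials[OF I, of "{()}" "\<lambda>_ _. 0" 0 "\<lambda>_. c"]
    by (auto simp: exponents_def mono_eval_def)
  then show ?case by blast
next
  case (polyfun_var i)
  let ?\<mu> = "\<lambda>j. if j = i then 1 else 0 :: nat"
  have "x i = mono_eval I ?\<mu> x" for x :: "nat \<Rightarrow> 'a"
  proof -
    have "mono_eval I ?\<mu> x = (\<Prod>j\<in>I. if j = i then x i else 1)"
      unfolding mono_eval_def by (intro prod.cong) auto
    then show ?thesis
      using polyfun_var I by simp
  qed
  then have "(\<lambda>x::nat \<Rightarrow> 'a. x i) = mpoly_eval I 1 (\<lambda>\<rho>. \<Sum>t\<in>{t\<in>{()}. ?\<mu> = \<rho>}. 1)"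
    using sum_monomials[OF I, of "{()}" "\<lambda>_. ?\<mu>" 1 "\<lambda>_. 1 :: 'a"] polyfun_var I
    by (auto simp: exponents_def)
  then show ?case by blast
next
  case (polyfun_add f g)
  then obtain D c D' c' where fg: "f = mpoly_eval I D c" "g = mpoly_eval I D' c'"
    by blast
  have "f x + g x = mpoly_eval I (max D D') (\<lambda>\<rho>. (if \<rho> \<in> exponents I D then c \<rho> else 0) +
      (if \<rho> \<in> exponents I D' then c' \<rho> else 0)) x" for x
  proof -
    have "mpoly_eval I (max D D') (\<lambda>\<rho>. (if \<rho> \<in> exponents I D then c \<rho> else 0) +
      (if \<rho> \<in> exponents I D' then c' \<rho> else 0)) x =
      (\<Sum>\<rho>\<in>exponents I (max D D'). if \<rho> \<in> exponents I D then c \<rho> * mono_eval I \<rho> x else 0) +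
      (\<Sum>\<rho>\<in>exponents I (max D D'). if \<rho> \<in> exponents I D' then c' \<rho> * mono_eval I \<rho> x else 0)"
      unfolding mpoly_eval_def sum.distrib[symmetric]
      by (intro sum.cong refl) (auto simp: distrib_right)
    also have "\<dots> = mpoly_eval I D c x + mpoly_eval I D' c' x"
      unfolding mpoly_eval_def
      using exponents_mono[of D "max D D'" I] exponents_mono[of D' "max D D'" I]
      by (intro arg_cong2[of _ _ _ _ "(+)"] sum.mono_neutral_cong_right finite_exponents I) auto
    finally show ?thesis
      by (simp add: fg)
  qed
  then have "(\<lambda>x. f x + g x) = mpoly_eval I (max D D') (\<lambda>\<rho>. (if \<rho> \<in> exponents I D then c \<rho> else 0) +
      (if \<rho> \<in> exponents I D' then c' \<rho> else 0))"
    by (rule ext)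
  then show ?case by blast
next
  case (polyfun_mult f g)
  then obtain D c D' c' where fg: "f = mpoly_eval I D c" "g = mpoly_eval I D' c'"
    by blast
  let ?T = "exponents I D \<times> exponents I D'"
  let ?e = "\<lambda>(\<mu>, \<nu>) i. \<mu> i + \<nu> i :: nat"
  let ?b = "\<lambda>(\<mu>, \<nu>). c \<mu> * c' \<nu>"
  have "f x * g x = mpoly_eval I (D + D') (\<lambda>\<rho>. \<Sum>t\<in>{t\<in>?T. ?e t = \<rho>}. ?b t) x" for x
  proof -
    have "f x * g x = (\<Sum>\<mu>\<in>exponents I D. \<Sum>\<nu>\<in>exponents I D'. c \<mu> * c' \<nu> * mono_eval I (\<lambda>i. \<mu> i + \<nu> i) x)"
      unfolding fg mpoly_eval_def sum_product by (intro sum.cong refl) (simp add: mono_eval_add mult_ac)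
    also have "\<dots> = (\<Sum>t\<in>?T. ?b t * mono_eval I (?e t) x)"
      by (simp add: sum.cartesian_product case_prod_unfold)
    also have "\<dots> = mpoly_eval I (D + D') (\<lambda>\<rho>. \<Sum>t\<in>{t\<in>?T. ?e t = \<rho>}. ?b t) x"
      by (rule sum_monomials) (auto intro: I finite_exponents exponents_add)
    finally show ?thesis .
  qed
  then have "(\<lambda>x. f x * g x) = mpoly_eval I (D + D') (\<lambda>\<rho>. \<Sum>t\<in>{t\<in>?T. ?e t = \<rho>}. ?b t)"
    by (rule ext)
  then show ?case by blast
qed

text \<open>A polynomial in one variable whose coefficients depend on the point. \<open>n\<close> is
  the number of coefficients, so formal degree d is written \<open>pol (Suc d)\<close>, with leading
  coefficient \<open>p d\<close>.\<close>

definition pol :: "nat \<Rightarrow> (nat \<Rightarrow> (nat \<Rightarrow> 'e) \<Rightarrow> 'e) \<Rightarrow> (nat \<Rightarrow> 'e) \<Rightarrow> 'e::idom poly" where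
  "pol n p x = (\<Sum>i<n. Polynomial.monom (p i x) i)"

lemma coeff_pol: "poly.coeff (pol n p x) i = (if i < n then p i x else 0)"
  by (simp add: pol_def Polynomial.coeff_sum)

lemma poly_pol: "poly (pol n p x) z = (\<Sum>i<n. p i x * z ^ i)"
  by (simp add: pol_def poly_sum poly_monom)

lemma pderiv_pol: "pderiv (pol n p x) = (\<Sum>i<n. Polynomial.monom (of_nat i * p i x) (i - 1))"
  unfolding pol_def by (induction n) (simp_all add: pderiv_add pderiv_monom)

lemma poly_pderiv_pol: "poly (pderiv (pol n p x)) z = (\<Sum>i<n. of_nat i * p i x * z ^ (i - 1))"
  by (simp add: pderiv_pol poly_sum poly_monom)

lemma polyfun_univariate:
  fixes f :: "(nat \<Rightarrow> 'e::idom) \<Rightarrow> 'e"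
  assumes "f \<in> polyfun I"
  shows "\<exists>n p. (\<forall>i. p i \<in> polyfun (I - {j})) \<and> (\<forall>x. f x = poly (pol n p x) (x j))"
  using assms
proof (induction rule: polyfun.induct)
  case (polyfun_const c)
  show ?case
    by (rule exI[of _ 1], rule exI[of _ "\<lambda>_ _. c"]) (auto simp: poly_pol intro: polyfun.intros)
next
  case (polyfun_var i)
  show ?case
  proof (cases "i = j")
    case True
    then show ?thesis
      by (intro exI[of _ 2] exI[of _ "\<lambda>k _. if k = 1 then 1 else 0"])
        (auto simp: poly_pol numeral_2_eq_2 intro: polyfun.intros)
  next
    case False
    then show ?thesis
      using polyfun_var by (intro exI[of _ 1] exI[of _ "\<lambda>_ x. x i"]) (auto simp: poly_pol intro: polyfun.intros)
  qed
next
  case (polyfun_add f g)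
  then obtain n p n' p' where p: "\<And>i. p i \<in> polyfun (I - {j})" "\<And>x. f x = poly (pol n p x) (x j)"
    and p': "\<And>i. p' i \<in> polyfun (I - {j})" "\<And>x. g x = poly (pol n' p' x) (x j)"
    by (elim exE conjE) blast
  define q where "q = (\<lambda>i x. (if i < n then p i x else 0) + (if i < n' then p' i x else 0))"
  have "pol n p x + pol n' p' x = pol (max n n') q x" for x
    by (rule poly_eqI) (auto simp: coeff_pol q_def)
  then have "f x + g x = poly (pol (max n n') q x) (x j)" for x
    using p(2) p'(2) by (metis poly_add)
  moreover have "q i \<in> polyfun (I - {j})" for i
    unfolding q_def by (intro polyfun.polyfun_add polyfun_if p(1) p'(1))
  ultimately show ?case
    by blast
next
  case (polyfun_mult f g)
  then obtain n p n' p' where p: "\<And>i. p i \<in> polyfun (I - {j})" "\<And>x. f x = poly (pol n p x) (x j)"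
    and p': "\<And>i. p' i \<in> polyfun (I - {j})" "\<And>x. g x = poly (pol n' p' x) (x j)"
    by (elim exE conjE) blast
  define q where "q = (\<lambda>i x. \<Sum>k\<le>i. (if k < n then p k x else 0) * (if i - k < n' then p' (i - k) x else 0))"
  have "pol n p x * pol n' p' x = pol (n + n') q x" for x
    by (rule poly_eqI) (auto simp: coeff_pol q_def coeff_mult intro!: sum.neutral)
  then have "f x * g x = poly (pol (n + n') q x) (x j)" for x
    using p(2) p'(2) by (metis poly_mult)
  moreover have "q i \<in> polyfun (I - {j})" for i
    unfolding q_def
    by (intro polyfun_sum polyfun.polyfun_mult polyfun_if p(1) p'(1))
  ultimately show ?case
    by blast
qed

section \<open>Bounded sequences modulo null sequences along an ultrafilter\<close>

locale approximating_sequence =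
  fixes U :: "nat filter" and xs :: "nat \<Rightarrow> nat \<Rightarrow> 'k::alg_closed_field fls"
  assumes proper: "U \<noteq> bot" and free: "U \<le> sequentially"
    and ultra: "eventually P U \<or> eventually (\<lambda>c. \<not> P c) U"
    and integral: "vge (xs c i) 0"
    and char2: "CHAR('k) = 2"
begin

text \<open>These are the sequences of infinite valuation in the ultrapower. Bounded sequences
  modulo null ones form an integral domain containing k((X)), in which relations that
  \<open>xs\<close> satisfies with ever higher precision become exact.\<close>

definition nullseq :: "(nat \<Rightarrow> 'k fls) \<Rightarrow> bool" where
  "nullseq h \<longleftrightarrow> (\<forall>N. eventually (\<lambda>c. vge (h c) N) U)"

definition bdseq :: "(nat \<Rightarrow> 'k fls) \<Rightarrow> bool" where
  "bdseq h \<longleftrightarrow> (\<exists>K::nat. \<forall>c. vge (h c) (- int K))"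

lemma nullseq_zero: "nullseq (\<lambda>_. 0)"
  by (simp add: nullseq_def vge_zero)

lemma nullseq_add: "nullseq f \<Longrightarrow> nullseq g \<Longrightarrow> nullseq (\<lambda>c. f c + g c)"
proof -
  assume "nullseq f" "nullseq g"
  then have "eventually (\<lambda>c. vge (f c) N) U" "eventually (\<lambda>c. vge (g c) N) U" for N
    by (simp_all add: nullseq_def)
  then have "eventually (\<lambda>c. vge (f c + g c) N) U" for N
    by (rule eventually_elim2) (rule vge_add)
  then show ?thesis
    by (simp add: nullseq_def)
qed

lemma nullseq_diff: "nullseq f \<Longrightarrow> nullseq g \<Longrightarrow> nullseq (\<lambda>c. f c - g c)"
proof -
  assume "nullseq f" "nullseq g"
  then have "eventually (\<lambda>c. vge (f c) N) U" "eventually (\<lambda>c. vge (g c) N) U" for N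
    by (simp_all add: nullseq_def)
  then have "eventually (\<lambda>c. vge (f c - g c) N) U" for N
    by (rule eventually_elim2) (rule vge_diff)
  then show ?thesis
    by (simp add: nullseq_def)
qed

lemma nullseq_sum: "(\<And>t. t \<in> T \<Longrightarrow> nullseq (f t)) \<Longrightarrow> nullseq (\<lambda>c. \<Sum>t\<in>T. f t c)"
  by (induction T rule: infinite_finite_induct) (auto intro: nullseq_zero nullseq_add)

lemma nullseq_mult:
  assumes "nullseq f" "bdseq g"
  shows "nullseq (\<lambda>c. f c * g c)"
  unfolding nullseq_def
proof
  fix N
  obtain K where K: "vge (g c) (- int K)" for c
    using assms(2) by (auto simp: bdseq_def)
  have "eventually (\<lambda>c. vge (f c) (N + int K)) U"
    using assms(1) by (simp add: nullseq_def)
  then show "eventually (\<lambda>c. vge (f c * g c) N) U"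
    by eventually_elim (use vge_mult[OF _ K] in fastforce)
qed

lemma bdseq_const: "bdseq (\<lambda>_. a)"
  using vge_exists[of a] by (auto simp: bdseq_def)

lemma bdseq_add: "bdseq f \<Longrightarrow> bdseq g \<Longrightarrow> bdseq (\<lambda>c. f c + g c)"
proof -
  assume "bdseq f" "bdseq g"
  then obtain K K' where "\<And>c. vge (f c) (- int K)" "\<And>c. vge (g c) (- int K')"
    by (auto simp: bdseq_def)
  then have "vge (f c + g c) (- int (K + K'))" for c
    by (intro vge_add) (rule vge_mono, assumption, simp)+
  then show ?thesis
    unfolding bdseq_def by blast
qed

lemma bdseq_mult: "bdseq f \<Longrightarrow> bdseq g \<Longrightarrow> bdseq (\<lambda>c. f c * g c)"
proof -
  assume "bdseq f" "bdseq g"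
  then obtain K K' where "\<And>c. vge (f c) (- int K)" "\<And>c. vge (g c) (- int K')"
    by (auto simp: bdseq_def)
  then have "vge (f c * g c) (- int K + - int K')" for c
    by (rule vge_mult)
  then have "vge (f c * g c) (- int (K + K'))" for c
    by simp
  then show ?thesis
    unfolding bdseq_def by blast
qed

lemma bdseq_power: "bdseq f \<Longrightarrow> bdseq (\<lambda>c. f c ^ n)"
  by (induction n) (auto intro: bdseq_const bdseq_mult)

lemma close_on_self: "close_on I N (xs c) (xs c)"
  by (simp add: close_on_def integral vge_zero)

lemma bdseq_polyfun: "f \<in> polyfun I \<Longrightarrow> bdseq (\<lambda>c. f (xs c))"
  unfolding bdseq_def using polyfun_continuous[of f I] close_on_self[of I 0] by meson

lemma bdseq_xs: "bdseq (\<lambda>c. xs c i)"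
  unfolding bdseq_def using integral by (intro exI[of _ 0]) simp

text \<open>This is what the ultrafilter provides: a sequence that is not null has its valuation
  bounded above on a set of the ultrafilter.\<close>

lemma not_nullseqD: "\<not> nullseq f \<Longrightarrow> \<exists>N. eventually (\<lambda>c. \<not> vge (f c) N) U"
  unfolding nullseq_def using ultra by blast

lemma not_nullseqI: "eventually (\<lambda>c. \<not> vge (f c) N) U \<Longrightarrow> \<not> nullseq f"
proof
  assume *: "eventually (\<lambda>c. \<not> vge (f c) N) U" "nullseq f"
  then have "eventually (\<lambda>c. vge (f c) N) U"
    by (simp add: nullseq_def)
  with *(1) have "eventually (\<lambda>_. False) U"
    by eventually_elim simp
  then show False
    using proper by (simp add: eventually_False)
qed

text \<open>Upper bounds for valuations add up. Being null is thus a prime condition, which allows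
  leading coefficients to be cancelled.\<close>

lemma nullseq_prime: "\<not> nullseq f \<Longrightarrow> \<not> nullseq g \<Longrightarrow> \<not> nullseq (\<lambda>c. f c * g c)"
proof -
  assume "\<not> nullseq f" "\<not> nullseq g"
  then obtain M N where "eventually (\<lambda>c. \<not> vge (f c) M) U" "eventually (\<lambda>c. \<not> vge (g c) N) U"
    using not_nullseqD by blast
  then have "eventually (\<lambda>c. \<not> vge (f c * g c) (M + N)) U"
    by eventually_elim (rule not_vge_mult)
  then show ?thesis
    by (rule not_nullseqI)
qed

lemma nullseq_const: "nullseq (\<lambda>_. a) \<Longrightarrow> a = 0"
proof (rule ccontr)
  assume *: "nullseq (\<lambda>_. a)" "a \<noteq> 0"
  have "\<not> vge a (fls_subdegree a + 1)"
    using *(2) by (auto simp: vge_def)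
  then show False
    using not_nullseqI[of "\<lambda>_. a" "fls_subdegree a + 1"] *(1) by simp
qed

lemma not_nullseq_power: "\<not> nullseq f \<Longrightarrow> \<not> nullseq (\<lambda>c. f c ^ n)"
  by (induction n) (use nullseq_const[of 1] nullseq_prime in auto)

text \<open>A square occupies only even exponents and X times a square only odd ones, so nothing can
  cancel. In other words, 1 and X stay independent over the squares of the limit ring.\<close>

lemma nullseq_square:
  assumes "nullseq (\<lambda>c. g c ^ 2 + fls_X * h c ^ 2)"
  shows "nullseq g" "nullseq h"
proof -
  have *: "vge a N \<and> vge b N" if "vge (a ^ 2 + fls_X * b ^ 2) (2 * N)" for a b :: "'k fls" and N
  proof -
    have z: "fls_nth (a ^ 2 + fls_X * b ^ 2) k = 0" if "k < 2 * N" for k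
      using \<open>vge _ (2 * N)\<close> that by (simp add: vge_def)
    have "fls_nth a k = 0 \<and> fls_nth b k = 0" if k: "k < N" for k
    proof -
      have lt: "2 * k < 2 * N" "2 * k + 1 < 2 * N"
        using k by auto
      show ?thesis
        using z[OF lt(1)] z[OF lt(2)]
        by (simp add: fls_square_nth[OF char2] fls_X_times_conv_shift)
    qed
    then show ?thesis
      by (simp add: vge_def)
  qed
  have "eventually (\<lambda>c. vge (g c) N \<and> vge (h c) N) U" for N
    using assms[unfolded nullseq_def, rule_format, of "2 * N"] by eventually_elim (rule *)
  then show "nullseq g" "nullseq h"
    by (simp_all add: nullseq_def eventually_conj_iff)
qed

text \<open>A nonzero relation of minimal total degree is separable in one of the variables: otherwise all
  its exponents are even, and it splits as \<open>g\<^sup>2 + X h\<^sup>2\<close> with relations \<open>g\<close>, \<open>h\<close> of smaller degree.\<close>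

lemma separable_relation:
  assumes I: "finite I" and rel: "\<exists>\<mu>\<in>exponents I D0. c0 \<mu> \<noteq> 0" "nullseq (\<lambda>c. mpoly_eval I D0 c0 (xs c))"
  shows "\<exists>j\<in>I. \<exists>n p. (\<forall>i. p i \<in> polyfun (I - {j})) \<and> nullseq (\<lambda>c. poly (pol n p (xs c)) (xs c j)) \<and>
    \<not> nullseq (\<lambda>c. poly (pderiv (pol n p (xs c))) (xs c j))"
proof -
  define R where "R = (\<lambda>D. \<exists>c0. (\<exists>\<mu>\<in>exponents I D. c0 \<mu> \<noteq> 0) \<and> nullseq (\<lambda>c. mpoly_eval I D c0 (xs c)))"
  have "R D0"
    using rel by (auto simp: R_def)
  define D where "D = (LEAST D. R D)"
  have "R D"
    unfolding D_def by (rule LeastI) fact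
  have Dmin: "\<not> R D'" if "D' < D" for D'
    using that unfolding D_def by (rule not_less_Least)
  obtain a \<mu>0 where \<mu>0: "\<mu>0 \<in> exponents I D" "a \<mu>0 \<noteq> 0" and null: "nullseq (\<lambda>c. mpoly_eval I D a (xs c))"
    using \<open>R D\<close> unfolding R_def by (elim exE conjE bexE)
  note fin = finite_exponents[OF I]
  show ?thesis
  proof (cases "\<exists>\<mu>\<in>exponents I D. a \<mu> \<noteq> 0 \<and> (\<exists>j\<in>I. odd (\<mu> j))")
    case True
    then obtain \<mu>1 j where \<mu>1: "\<mu>1 \<in> exponents I D" "a \<mu>1 \<noteq> 0" and j: "j \<in> I" "odd (\<mu>1 j)"
      by (elim bexE conjE)
    define p where "p = (\<lambda>i x. \<Sum>\<mu>\<in>{\<mu>\<in>exponents I D. \<mu> j = i}. a \<mu> * (\<Prod>k\<in>I - {j}. x k ^ \<mu> k) :: 'k fls)"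
    have pf: "p i \<in> polyfun (I - {j})" for i
      unfolding p_def by (intro polyfun_sum polyfun_mult polyfun_const polyfun_prod polyfun_power polyfun_var)
    have le: "\<mu> i \<le> D" if "\<mu> \<in> exponents I D" "i \<in> I" for \<mu> i
      using member_le_sum[OF that(2) _ I, of \<mu>] that(1) by (simp add: exponents_def)
    have me: "mono_eval I \<mu> x = x j ^ \<mu> j * (\<Prod>k\<in>I - {j}. x k ^ \<mu> k)" for \<mu> and x :: "nat \<Rightarrow> 'k fls"
      unfolding mono_eval_def by (rule prod.remove[OF I j(1)])
    have group: "(\<Sum>i<Suc D. \<Sum>\<mu>\<in>{\<mu>\<in>exponents I D. \<mu> j = i}. F \<mu>) = (\<Sum>\<mu>\<in>exponents I D. F \<mu>)"
      for F :: "(nat \<Rightarrow> nat) \<Rightarrow> 'k fls"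
      by (rule sum.group) (use fin le j in \<open>auto simp: less_Suc_eq_le\<close>)
    have ev: "poly (pol (Suc D) p x) (x j) = mpoly_eval I D a x" for x
    proof -
      have "poly (pol (Suc D) p x) (x j) = (\<Sum>i<Suc D. \<Sum>\<mu>\<in>{\<mu>\<in>exponents I D. \<mu> j = i}. a \<mu> * mono_eval I \<mu> x)"
        unfolding poly_pol p_def sum_distrib_right by (intro sum.cong refl) (auto simp: me mult_ac)
      then show ?thesis
        unfolding group mpoly_eval_def .
    qed
    \<comment> \<open>Formal derivative in the variable \<open>j\<close>. Lowering its exponent by
      one is injective on the monomials that contain it, so no terms merge: the coefficient at
      \<open>e \<mu>1\<close> is an odd multiple of \<open>a \<mu>1\<close>, hence nonzero.\<close>
    define T where "T = {\<mu>\<in>exponents I D. \<mu> j \<ge> 1}"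
    define e where "e = (\<lambda>\<mu>::nat\<Rightarrow>nat. \<mu>(j := \<mu> j - 1))"
    define b where "b = (\<lambda>\<mu>. of_nat (\<mu> j) * a \<mu>)"
    have e: "e \<mu> \<in> exponents I (D - 1)" if "\<mu> \<in> T" for \<mu>
    proof -
      have "sum (e \<mu>) I = (\<mu> j - 1) + sum \<mu> (I - {j})"
        using sum.remove[OF I j(1), of "e \<mu>"] by (simp add: e_def)
      moreover have "sum \<mu> I = \<mu> j + sum \<mu> (I - {j})"
        by (rule sum.remove[OF I j(1)])
      ultimately show ?thesis
        using that j(1) by (auto simp: T_def exponents_def e_def)
    qed
    have inj: "\<mu> = \<nu>" if "\<mu> \<in> T" "\<nu> \<in> T" "e \<mu> = e \<nu>" for \<mu> \<nu>
    proof
      fix i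
      have "e \<mu> i = e \<nu> i"
        using that(3) by simp
      moreover have "\<mu> j \<ge> 1" "\<nu> j \<ge> 1"
        using that by (auto simp: T_def)
      ultimately show "\<mu> i = \<nu> i"
        by (cases "i = j") (auto simp: e_def)
    qed
    have \<mu>1T: "\<mu>1 \<in> T"
      using \<mu>1 j(2) by (cases "\<mu>1 j") (auto simp: T_def)
    define a' where "a' = (\<lambda>\<rho>. \<Sum>t\<in>{t\<in>T. e t = \<rho>}. b t)"
    have ev': "poly (pderiv (pol (Suc D) p x)) (x j) = mpoly_eval I (D - 1) a' x" for x
    proof -
      have "poly (pderiv (pol (Suc D) p x)) (x j) =
        (\<Sum>i<Suc D. \<Sum>\<mu>\<in>{\<mu>\<in>exponents I D. \<mu> j = i}. b \<mu> * (x j ^ (\<mu> j - 1) * (\<Prod>k\<in>I - {j}. x k ^ \<mu> k)))"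
        unfolding poly_pderiv_pol p_def sum_distrib_right sum_distrib_left
        by (intro sum.cong refl) (auto simp: b_def mult_ac)
      also have "\<dots> = (\<Sum>\<mu>\<in>exponents I D. b \<mu> * (x j ^ (\<mu> j - 1) * (\<Prod>k\<in>I - {j}. x k ^ \<mu> k)))"
        by (rule group)
      also have "\<dots> = (\<Sum>\<mu>\<in>T. b \<mu> * (x j ^ (\<mu> j - 1) * (\<Prod>k\<in>I - {j}. x k ^ \<mu> k)))"
        by (rule sum.mono_neutral_right) (auto simp: fin T_def b_def not_le)
      also have "\<dots> = (\<Sum>\<mu>\<in>T. b \<mu> * mono_eval I (e \<mu>) x)"
        by (intro sum.cong refl) (auto simp: me e_def intro!: prod.cong)
      also have "\<dots> = mpoly_eval I (D - 1) a' x"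
        unfolding a'_def by (rule sum_monomials[OF I _ e]) (auto simp: T_def fin)
      finally show ?thesis .
    qed
    \<comment> \<open>A null derivative would be a nontrivial relation of total degree at most
      \<open>D - 1\<close>, against the choice of \<open>D\<close>.\<close>
    have "\<not> nullseq (\<lambda>c. poly (pderiv (pol (Suc D) p (xs c))) (xs c j))"
    proof
      assume "nullseq (\<lambda>c. poly (pderiv (pol (Suc D) p (xs c))) (xs c j))"
      then have "nullseq (\<lambda>c. mpoly_eval I (D - 1) a' (xs c))"
        unfolding ev' .
      moreover have "a' (e \<mu>1) \<noteq> 0"
      proof -
        have "{t\<in>T. e t = e \<mu>1} = {\<mu>1}"
          using inj \<mu>1T by auto
        then have "a' (e \<mu>1) = b \<mu>1"
          by (simp add: a'_def)
        moreover have "of_nat (\<mu>1 j) = (1 :: 'k fls)"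
          using j(2) char2_of_nat[where 'a = "'k fls"] char2 by simp
        ultimately show ?thesis
          using \<mu>1(2) by (simp add: b_def)
      qed
      ultimately have "R (D - 1)"
        unfolding R_def using e[OF \<mu>1T] by (intro exI[of _ a'] conjI bexI[of _ "e \<mu>1"])
      moreover have "D - 1 < D"
        using le[OF \<mu>1(1) j(1)] j(2) by (cases "\<mu>1 j") auto
      ultimately show False
        using Dmin by blast
    qed
    moreover have "nullseq (\<lambda>c. poly (pol (Suc D) p (xs c)) (xs c j))"
      unfolding ev by (rule null)
    ultimately show ?thesis
      using pf by (intro bexI[OF _ j(1)] exI[of _ "Suc D"] exI[of _ p]) simp
  next
    case False
    define dbl where "dbl = (\<lambda>(\<nu>::nat\<Rightarrow>nat) i. 2 * \<nu> i)"
    have "\<exists>g h. a \<mu> = g ^ 2 + fls_X * h ^ 2" for \<mu>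
      by (rule fls_square_decomposition[OF char2])
    then obtain g h where gh: "a \<mu> = g \<mu> ^ 2 + fls_X * h \<mu> ^ 2" for \<mu>
      by metis
    have dbl_in: "dbl \<nu> \<in> exponents I D" if "\<nu> \<in> exponents I (D div 2)" for \<nu>
      using that by (auto simp: exponents_def dbl_def simp flip: sum_distrib_left)
    have dbl_surj: "\<exists>\<nu>\<in>exponents I (D div 2). \<mu> = dbl \<nu>" if "\<mu> \<in> exponents I D" "a \<mu> \<noteq> 0" for \<mu>
    proof (intro bexI)
      have "even (\<mu> i)" for i
        using False that by (cases "i \<in> I") (auto simp: exponents_def)
      then have half: "\<mu> i = 2 * (\<mu> i div 2)" for i
        by simp
      then show "\<mu> = dbl (\<lambda>i. \<mu> i div 2)"
        by (auto simp: dbl_def)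
      have "sum \<mu> I = (\<Sum>i\<in>I. 2 * (\<mu> i div 2))"
        by (intro sum.cong refl half)
      then have "sum \<mu> I = 2 * (\<Sum>i\<in>I. \<mu> i div 2)"
        by (simp only: sum_distrib_left)
      then show "(\<lambda>i. \<mu> i div 2) \<in> exponents I (D div 2)"
        using that(1) by (auto simp: exponents_def)
    qed
    have inj: "inj_on dbl (exponents I (D div 2))"
      by (auto simp: inj_on_def dbl_def fun_eq_iff)
    define G where "G = mpoly_eval I (D div 2) (\<lambda>\<nu>. g (dbl \<nu>))"
    define H where "H = mpoly_eval I (D div 2) (\<lambda>\<nu>. h (dbl \<nu>))"
    have sq: "(mpoly_eval I (D div 2) (\<lambda>\<nu>. f (dbl \<nu>)) x) ^ 2 =
       (\<Sum>\<nu>\<in>exponents I (D div 2). f (dbl \<nu>) ^ 2 * mono_eval I (dbl \<nu>) x)" for f and x :: "nat \<Rightarrow> 'k fls"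
    proof -
      have "mono_eval I (dbl \<nu>) x = mono_eval I \<nu> x ^ 2" for \<nu>
        by (simp add: mono_eval_def dbl_def power_mult mult.commute[of 2] prod_power_distrib)
      then show ?thesis
        unfolding mpoly_eval_def by (subst char2_square_sum) (simp_all add: char2 power_mult_distrib)
    qed
    have "mpoly_eval I D a x = G x ^ 2 + fls_X * H x ^ 2" for x
    proof -
      have "mpoly_eval I D a x = (\<Sum>\<mu>\<in>dbl ` exponents I (D div 2). a \<mu> * mono_eval I \<mu> x)"
        unfolding mpoly_eval_def
        by (rule sum.mono_neutral_right) (use fin dbl_in dbl_surj in auto)
      also have "\<dots> = (\<Sum>\<nu>\<in>exponents I (D div 2). a (dbl \<nu>) * mono_eval I (dbl \<nu>) x)"
        by (subst sum.reindex[OF inj]) simp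
      also have "\<dots> = G x ^ 2 + fls_X * H x ^ 2"
        unfolding G_def H_def sq gh by (simp add: sum.distrib sum_distrib_left algebra_simps)
      finally show ?thesis .
    qed
    then have "nullseq (\<lambda>c. G (xs c) ^ 2 + fls_X * H (xs c) ^ 2)"
      using null by simp
    then have nGH: "nullseq (\<lambda>c. G (xs c))" "nullseq (\<lambda>c. H (xs c))"
      by (rule nullseq_square)+
    obtain \<nu>0 where \<nu>0: "\<nu>0 \<in> exponents I (D div 2)" "\<mu>0 = dbl \<nu>0"
      using dbl_surj[OF \<mu>0] by blast
    have "g \<mu>0 \<noteq> 0 \<or> h \<mu>0 \<noteq> 0"
      using \<mu>0(2) gh[of \<mu>0] by auto
    then have "R (D div 2)"
    proof
      assume "g \<mu>0 \<noteq> 0"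
      then show ?thesis
        unfolding R_def using nGH(1) \<nu>0 unfolding G_def by (intro exI[of _ "\<lambda>\<nu>. g (dbl \<nu>)"]) auto
    next
      assume "h \<mu>0 \<noteq> 0"
      then show ?thesis
        unfolding R_def using nGH(2) \<nu>0 unfolding H_def by (intro exI[of _ "\<lambda>\<nu>. h (dbl \<nu>)"]) auto
    qed
    \<comment> \<open>\<open>D div 2\<close> is smaller than \<open>D\<close> unless
      \<open>D = 0\<close>; in that case the relation is a nonzero constant, which is not
      null.\<close>
    with Dmin[of "D div 2"] have "D = 0"
      by fastforce
    then have "\<mu> = (\<lambda>_. 0)" if "\<mu> \<in> exponents I D" for \<mu>
      using that I by (auto simp: exponents_def fun_eq_iff)
    then have "exponents I D = {\<mu>0}"
      using \<mu>0(1) by auto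
    then have "mpoly_eval I D a x = a \<mu>0" for x
      using \<open>\<And>\<mu>. \<mu> \<in> exponents I D \<Longrightarrow> \<mu> = (\<lambda>_. 0)\<close>[OF \<mu>0(1)] by (simp add: mpoly_eval_def mono_eval_def)
    then show ?thesis
      using null nullseq_const[of "a \<mu>0"] \<mu>0(2) by simp
  qed
qed

end

lemma polyfun_continuous_uniform:
  fixes F :: "((nat \<Rightarrow> 'e::field fls) \<Rightarrow> 'e fls) set"
  assumes "finite F" "F \<subseteq> polyfun I"
  shows "\<exists>K::nat. \<forall>f\<in>F. \<forall>x y N. close_on I N x y \<longrightarrow> vge (f x) (- int K) \<and> vge (f x - f y) (N - int K)"
proof -
  have "\<forall>f\<in>F. \<exists>K::nat. \<forall>x y N. close_on I N x y \<longrightarrow> vge (f x) (- int K) \<and> vge (f x - f y) (N - int K)"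
    using polyfun_continuous assms(2) by blast
  from bchoice[OF this] obtain K :: "_ \<Rightarrow> nat" where "\<forall>f\<in>F. \<forall>x y N. close_on I N x y \<longrightarrow>
      vge (f x) (- int (K f)) \<and> vge (f x - f y) (N - int (K f))"
    by (elim exE)
  then have K: "vge (f x) (- int (K f)) \<and> vge (f x - f y) (N - int (K f))"
    if "f \<in> F" "close_on I N x y" for f and x y :: "nat \<Rightarrow> 'e fls" and N
    using that by simp
  show ?thesis
  proof (intro exI[of _ "\<Sum>f\<in>F. K f"] ballI allI impI)
    fix f and x y :: "nat \<Rightarrow> 'e fls" and N assume f: "f \<in> F" and c: "close_on I N x y"
    have "K f \<le> (\<Sum>f\<in>F. K f)"
      using f assms(1) by (intro member_le_sum) auto
    then show "vge (f x) (- int (\<Sum>f\<in>F. K f)) \<and> vge (f x - f y) (N - int (\<Sum>f\<in>F. K f))"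
      using K[OF f c] by (auto intro: vge_mono simp del: of_nat_sum)
  qed
qed

section \<open>Division by a minimal relation and elimination of a variable\<close>

context approximating_sequence
begin

text \<open>Division without denominators, at the price of powers of the leading coefficient
  \<open>P d\<close>. The remainder is a relation of degree below d, so by minimality its
  coefficients are null one by one and not only its value. The bound on the derivative of
  \<open>S\<close> is there for differentiating the identity later.\<close>

lemma pseudo_division:
  assumes P: "\<And>i. P i \<in> polyfun J" and Pn: "nullseq (\<lambda>c. poly (pol (Suc d) P (xs c)) (xs c j))"
    and min: "\<forall>e Q. e < d \<longrightarrow> (\<forall>i. Q i \<in> polyfun J) \<longrightarrow>
      nullseq (\<lambda>c. poly (pol (Suc e) Q (xs c)) (xs c j)) \<longrightarrow> nullseq (\<lambda>c. Q e (xs c))"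
    and g: "\<And>i. g i \<in> polyfun J" and gn: "nullseq (\<lambda>c. poly (pol n g (xs c)) (xs c j))"
  shows "\<exists>a S r. (\<forall>i. r i \<in> polyfun J) \<and> (\<forall>i<d. nullseq (\<lambda>c. r i (xs c))) \<and>
    bdseq (\<lambda>c. poly (S (xs c)) (xs c j)) \<and> bdseq (\<lambda>c. poly (pderiv (S (xs c))) (xs c j)) \<and>
    (\<forall>x. Polynomial.smult (P d x ^ a) (pol n g x) = S x * pol (Suc d) P x + pol d r x)"
  using g gn
proof (induction n arbitrary: g)
  case (Suc e)
  show ?case
  proof (cases "e < d")
    case True
    \<comment> \<open>Coefficients are peeled off from the top: each leading one is null by
      minimality, and removing its term leaves a shorter relation.\<close>
    have null_all: "\<forall>i<m. nullseq (\<lambda>c. g i (xs c))"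
      if "m \<le> d" "nullseq (\<lambda>c. poly (pol m g (xs c)) (xs c j))" for m
      using that
    proof (induction m)
      case (Suc m)
      have top: "nullseq (\<lambda>c. g m (xs c))"
        using min Suc.prems Suc_le_lessD \<open>\<And>i. g i \<in> polyfun J\<close> by blast
      have "nullseq (\<lambda>c. poly (pol (Suc m) g (xs c)) (xs c j) - g m (xs c) * xs c j ^ m)"
        using Suc.prems by (intro nullseq_diff nullseq_mult top bdseq_power bdseq_xs) auto
      then have "nullseq (\<lambda>c. poly (pol m g (xs c)) (xs c j))"
        by (simp add: poly_pol)
      with Suc top show ?case
        by (auto simp: less_Suc_eq)
    qed auto
    define r where "r = (\<lambda>i x. if i < Suc e then g i x else 0)"
    have "pol (Suc e) g x = pol d r x" for x
      using True by (intro poly_eqI) (auto simp: coeff_pol r_def)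
    moreover have "\<forall>i. r i \<in> polyfun J"
      unfolding r_def using Suc.prems(1) by (auto intro: polyfun_if)
    moreover have "nullseq (\<lambda>c. r i (xs c))" for i
      using null_all[of "Suc e"] True Suc.prems(2) unfolding r_def
      by (cases "i < Suc e") (auto simp: nullseq_zero)
    ultimately show ?thesis
      by (intro exI[of _ 0] exI[of _ "\<lambda>_. 0"] exI[of _ r]) (auto simp: bdseq_const)
  next
    case False
    \<comment> \<open>Cross-multiplication cancels the coefficient of degree \<open>e\<close>, so
      \<open>e\<close> coefficients remain.\<close>
    define g' where "g' = (\<lambda>i x. P d x * g i x - (if e - d \<le> i then g e x * P (i - (e - d)) x else 0))"
    have g': "g' i \<in> polyfun J" for i
      unfolding g'_def by (intro polyfun_diff polyfun_mult polyfun_if P Suc.prems)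
    have step: "Polynomial.smult (P d x) (pol (Suc e) g x) =
      Polynomial.monom (g e x) (e - d) * pol (Suc d) P x + pol e g' x" for x
      using False by (intro poly_eqI) (auto simp: coeff_pol g'_def coeff_monom_mult less_Suc_eq)
    have "poly (pol e g' x) z = P d x * poly (pol (Suc e) g x) z - g e x * z ^ (e - d) * poly (pol (Suc d) P x) z" for x z
      using arg_cong[OF step[of x], of "\<lambda>p. poly p z"] by (simp add: poly_monom)
    moreover have "nullseq (\<lambda>c. poly (pol (Suc e) g (xs c)) (xs c j) * P d (xs c) -
       poly (pol (Suc d) P (xs c)) (xs c j) * (g e (xs c) * xs c j ^ (e - d)))"
      by (intro nullseq_diff nullseq_mult Suc.prems Pn bdseq_mult bdseq_power bdseq_xs
          bdseq_polyfun[OF P] bdseq_polyfun[OF Suc.prems(1)])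
    ultimately have "nullseq (\<lambda>c. poly (pol e g' (xs c)) (xs c j))"
      by (simp add: mult_ac)
    from Suc.IH[OF g' this] obtain a S r where r: "\<forall>i. r i \<in> polyfun J" "\<forall>i<d. nullseq (\<lambda>c. r i (xs c))"
      and S: "bdseq (\<lambda>c. poly (S (xs c)) (xs c j))" "bdseq (\<lambda>c. poly (pderiv (S (xs c))) (xs c j))"
      and eq: "\<forall>x. Polynomial.smult (P d x ^ a) (pol e g' x) = S x * pol (Suc d) P x + pol d r x"
      by auto
    define S' where "S' = (\<lambda>x. Polynomial.smult (P d x ^ a) (Polynomial.monom (g e x) (e - d)) + S x)"
    have "Polynomial.smult (P d x ^ Suc a) (pol (Suc e) g x) = S' x * pol (Suc d) P x + pol d r x" for x
    proof -
      have "Polynomial.smult (P d x ^ Suc a) (pol (Suc e) g x) =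
        Polynomial.smult (P d x ^ a) (Polynomial.smult (P d x) (pol (Suc e) g x))"
        by (simp add: mult.commute)
      also have "\<dots> = Polynomial.smult (P d x ^ a) (Polynomial.monom (g e x) (e - d)) * pol (Suc d) P x
         + Polynomial.smult (P d x ^ a) (pol e g' x)"
        unfolding step by (simp add: smult_add_right)
      also have "\<dots> = S' x * pol (Suc d) P x + pol d r x"
        unfolding eq[rule_format] S'_def by (simp add: distrib_right)
      finally show ?thesis .
    qed
    moreover have "bdseq (\<lambda>c. poly (S' (xs c)) (xs c j))"
    proof -
      have "bdseq (\<lambda>c. P d (xs c) ^ a * (g e (xs c) * xs c j ^ (e - d)) + poly (S (xs c)) (xs c j))"
        by (intro bdseq_add bdseq_mult bdseq_power bdseq_xs S bdseq_polyfun[OF P] bdseq_polyfun[OF Suc.prems(1)])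
      then show ?thesis
        by (simp add: S'_def poly_monom)
    qed
    moreover have "bdseq (\<lambda>c. poly (pderiv (S' (xs c))) (xs c j))"
    proof -
      have "bdseq (\<lambda>c. P d (xs c) ^ a * ((of_nat (e - d) * g e (xs c)) * xs c j ^ (e - d - 1)) +
          poly (pderiv (S (xs c))) (xs c j))"
        by (intro bdseq_add bdseq_mult bdseq_power bdseq_xs bdseq_const S bdseq_polyfun[OF P] bdseq_polyfun[OF Suc.prems(1)])
      then show ?thesis
        by (simp add: S'_def pderiv_add pderiv_smult pderiv_monom poly_monom)
    qed
    ultimately show ?thesis
      using r by (intro exI[of _ "Suc a"] exI[of _ S'] exI[of _ r]) auto
  qed
qed (auto intro!: exI[of _ 0] exI[of _ "\<lambda>_. 0"] exI[of _ "\<lambda>_ _. 0"] polyfun_const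
      simp: pol_def bdseq_const nullseq_zero)

text \<open>Separability passes from \<open>p\<close> to a relation \<open>P\<close> of least
  degree. Were the derivative of \<open>P\<close> null, differentiating the pseudo-division of
  \<open>p\<close> by \<open>P\<close> would make a power of \<open>P d\<close> times the derivative
  of \<open>p\<close> null, although neither factor is null.\<close>

lemma minimal_relation:
  assumes p: "\<And>i. p i \<in> polyfun J" and null: "nullseq (\<lambda>c. poly (pol n p (xs c)) (xs c j))"
    and sep: "\<not> nullseq (\<lambda>c. poly (pderiv (pol n p (xs c))) (xs c j))"
  shows "\<exists>d P. (\<forall>i. P i \<in> polyfun J) \<and> nullseq (\<lambda>c. poly (pol (Suc d) P (xs c)) (xs c j)) \<and>
    \<not> nullseq (\<lambda>c. P d (xs c)) \<and> \<not> nullseq (\<lambda>c. poly (pderiv (pol (Suc d) P (xs c))) (xs c j)) \<and>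
    (\<forall>e Q. e < d \<longrightarrow> (\<forall>i. Q i \<in> polyfun J) \<longrightarrow> nullseq (\<lambda>c. poly (pol (Suc e) Q (xs c)) (xs c j)) \<longrightarrow>
      nullseq (\<lambda>c. Q e (xs c)))"
proof -
  define R where "R = (\<lambda>d. \<exists>Q. (\<forall>i. Q i \<in> polyfun J) \<and>
    nullseq (\<lambda>c. poly (pol (Suc d) Q (xs c)) (xs c j)) \<and> \<not> nullseq (\<lambda>c. Q d (xs c)))"
  \<comment> \<open>If every relation had a null leading coefficient, then from the top down all
    coefficients of \<open>p\<close> would be null, and with them its derivative.\<close>
  have "\<exists>d. R d"
  proof (rule ccontr)
    assume nR: "\<nexists>d. R d"
    have "m \<le> n \<Longrightarrow> nullseq (\<lambda>c. poly (pol (n - m) p (xs c)) (xs c j)) \<and>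
      (\<forall>i. n - m \<le> i \<longrightarrow> i < n \<longrightarrow> nullseq (\<lambda>c. p i (xs c)))" for m
    proof (induction m)
      case (Suc m)
      define k where "k = n - Suc m"
      have k: "n - m = Suc k"
        using Suc.prems by (simp add: k_def)
      have n1: "nullseq (\<lambda>c. poly (pol (Suc k) p (xs c)) (xs c j))"
        using Suc k by simp
      then have top: "nullseq (\<lambda>c. p k (xs c))"
        using nR p unfolding R_def by blast
      have "nullseq (\<lambda>c. poly (pol (Suc k) p (xs c)) (xs c j) - p k (xs c) * xs c j ^ k)"
        by (intro nullseq_diff nullseq_mult n1 top bdseq_power bdseq_xs)
      then have "nullseq (\<lambda>c. poly (pol k p (xs c)) (xs c j))"
        by (simp add: poly_pol)
      moreover have "nullseq (\<lambda>c. p i (xs c))" if "k \<le> i" "i < n" for i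
        using Suc that top k by (cases "i = k") auto
      ultimately show ?case
        by (simp add: k_def)
    qed (use null in simp)
    from this[of n] have "nullseq (\<lambda>c. p i (xs c))" if "i < n" for i
      using that by simp
    then have "nullseq (\<lambda>c. \<Sum>i<n. p i (xs c) * (of_nat i * xs c j ^ (i - 1)))"
      by (intro nullseq_sum nullseq_mult bdseq_mult bdseq_const bdseq_power bdseq_xs) auto
    then show False
      using sep by (simp add: poly_pderiv_pol mult_ac)
  qed
  then obtain d0 where "R d0" ..
  define d where "d = (LEAST d. R d)"
  have "R d"
    unfolding d_def using \<open>R d0\<close> by (rule LeastI)
  then obtain P where P: "\<And>i. P i \<in> polyfun J" "nullseq (\<lambda>c. poly (pol (Suc d) P (xs c)) (xs c j))"
    "\<not> nullseq (\<lambda>c. P d (xs c))"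
    unfolding R_def by blast
  have min: "\<forall>e Q. e < d \<longrightarrow> (\<forall>i. Q i \<in> polyfun J) \<longrightarrow>
    nullseq (\<lambda>c. poly (pol (Suc e) Q (xs c)) (xs c j)) \<longrightarrow> nullseq (\<lambda>c. Q e (xs c))"
  proof (intro allI impI)
    fix e Q assume *: "e < d" "\<forall>i. Q i \<in> polyfun J" "nullseq (\<lambda>c. poly (pol (Suc e) Q (xs c)) (xs c j))"
    have "\<not> R e"
      using *(1) unfolding d_def by (rule not_less_Least)
    then show "nullseq (\<lambda>c. Q e (xs c))"
      using *(2,3) unfolding R_def by blast
  qed
  obtain a S r where r: "\<forall>i. r i \<in> polyfun J" "\<forall>i<d. nullseq (\<lambda>c. r i (xs c))"
    and S: "bdseq (\<lambda>c. poly (S (xs c)) (xs c j))" "bdseq (\<lambda>c. poly (pderiv (S (xs c))) (xs c j))"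
    and eq: "\<forall>x. Polynomial.smult (P d x ^ a) (pol n p x) = S x * pol (Suc d) P x + pol d r x"
    using pseudo_division[where P = P and d = d and g = p and j = j and n = n and J = J, OF P(1,2) min p null] by auto
  have "\<not> nullseq (\<lambda>c. poly (pderiv (pol (Suc d) P (xs c))) (xs c j))"
  proof
    assume *: "nullseq (\<lambda>c. poly (pderiv (pol (Suc d) P (xs c))) (xs c j))"
    have "nullseq (\<lambda>c. \<Sum>i<d. r i (xs c) * (of_nat i * xs c j ^ (i - 1)))"
      using r(2) by (intro nullseq_sum nullseq_mult bdseq_mult bdseq_const bdseq_power bdseq_xs) auto
    then have r': "nullseq (\<lambda>c. poly (pderiv (pol d r (xs c))) (xs c j))"
      by (simp add: poly_pderiv_pol mult_ac)
    have "P d x ^ a * poly (pderiv (pol n p x)) z = poly (pol (Suc d) P x) z * poly (pderiv (S x)) z +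
      poly (pderiv (pol (Suc d) P x)) z * poly (S x) z + poly (pderiv (pol d r x)) z" for x z
      using arg_cong[OF eq[rule_format, of x], of "\<lambda>p. poly (pderiv p) z"]
      by (simp add: pderiv_smult pderiv_add pderiv_mult algebra_simps)
    moreover have "nullseq (\<lambda>c. poly (pol (Suc d) P (xs c)) (xs c j) * poly (pderiv (S (xs c))) (xs c j) +
      poly (pderiv (pol (Suc d) P (xs c))) (xs c j) * poly (S (xs c)) (xs c j) + poly (pderiv (pol d r (xs c))) (xs c j))"
      by (intro nullseq_add nullseq_mult P S * r')
    ultimately have "nullseq (\<lambda>c. P d (xs c) ^ a * poly (pderiv (pol n p (xs c))) (xs c j))"
      by simp
    then show False
      using nullseq_prime[OF not_nullseq_power[OF P(3), of a] sep] by simp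
  qed
  then show ?thesis
    using P min by (intro exI[of _ d] exI[of _ P]) blast
qed

text \<open>Moving the other coordinates within precision \<open>M\<close> changes \<open>P\<close>,
  its derivative and its leading coefficient too little to disturb Hensel's hypotheses. So
  \<open>x j\<close> can be corrected for every nearby y', and \<open>P d\<close> stays nonzero and
  can be cancelled afterwards.\<close>

lemma hensel_step:
  assumes I: "j \<in> I" and P: "\<And>i. P i \<in> polyfun (I - {j})"
    and null: "nullseq (\<lambda>c. poly (pol (Suc d) P (xs c)) (xs c j))"
    and lc: "\<not> nullseq (\<lambda>c. P d (xs c))"
    and sep: "\<not> nullseq (\<lambda>c. poly (pderiv (pol (Suc d) P (xs c))) (xs c j))"
  shows "\<exists>M::nat. eventually (\<lambda>c. \<forall>y'. close_on (I - {j}) (int M) y' (xs c) \<longrightarrow>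
    (\<exists>b. close_on I (int N) (y'(j := b)) (xs c) \<and> P d (y'(j := b)) \<noteq> 0 \<and>
      poly (pol (Suc d) P (y'(j := b))) b = 0)) U"
proof -
  define Pv where "Pv = (\<lambda>x. poly (pol (Suc d) P x) (x j))"
  define Pd where "Pd = (\<lambda>x. poly (pderiv (pol (Suc d) P x)) (x j))"
  have PI: "P i \<in> polyfun I" for i
    by (rule polyfun_mono[OF P]) auto
  have "Pv \<in> polyfun I" "Pd \<in> polyfun I"
    unfolding Pv_def Pd_def poly_pol poly_pderiv_pol using I
    by (intro polyfun_sum polyfun_mult polyfun_power polyfun_var polyfun_const PI; simp)+
  then have "P ` {..d} \<union> {Pv, Pd} \<subseteq> polyfun I"
    using PI by auto
  then have "\<exists>K::nat. \<forall>f\<in>P ` {..d} \<union> {Pv, Pd}. \<forall>x y N. close_on I N x y \<longrightarrow>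
      vge (f x) (- int K) \<and> vge (f x - f y) (N - int K)"
    by (intro polyfun_continuous_uniform) auto
  then obtain K :: nat where "\<forall>f\<in>P ` {..d} \<union> {Pv, Pd}. \<forall>x y N. close_on I N x y \<longrightarrow>
      vge (f x) (- int K) \<and> vge (f x - f y) (N - int K)"
    by (elim exE)
  then have K: "vge (f x) (- int K) \<and> vge (f x - f y) (N - int K)"
    if "f \<in> P ` {..d} \<union> {Pv, Pd}" "close_on I N x y" for f and x y :: "nat \<Rightarrow> 'k fls" and N
    using that by blast
  obtain N1 where N1: "eventually (\<lambda>c. \<not> vge (P d (xs c)) N1) U"
    using not_nullseqD[OF lc] by blast
  obtain N2 where N2: "eventually (\<lambda>c. \<not> vge (Pd (xs c)) N2) U"
    using not_nullseqD[OF sep] unfolding Pd_def by blast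
  \<comment> \<open>After multiplication by X^K the derivative has valuation at most
    \<open>e\<close>. \<open>M\<close> dominates all precisions below, including the loss
    \<open>K\<close> by continuity.\<close>
  define e where "e = nat (max 0 (N2 + int K))"
  define s where "s = Suc N"
  define M where "M = 2 * e + s + K + nat \<bar>N1\<bar> + nat \<bar>N2\<bar> + N"
  have N3: "eventually (\<lambda>c. vge (Pv (xs c)) (int (2 * e + s))) U"
    using null by (simp add: nullseq_def Pv_def)
  have e: "N2 + int K \<le> int e"
    by (simp add: e_def)
  show ?thesis
  proof (rule exI[of _ M], use N1 N2 N3 in eventually_elim, intro allI impI)
    fix c y'
    assume N1: "\<not> vge (P d (xs c)) N1" and N2: "\<not> vge (Pd (xs c)) N2"
      and N3: "vge (Pv (xs c)) (int (2 * e + s))"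
      and y': "close_on (I - {j}) (int M) y' (xs c)"
    define x where "x = y'(j := xs c j)"
    have x: "close_on I (int M) x (xs c)"
      using y' by (auto simp: close_on_def x_def integral vge_zero)
    then have x': "close_on I (int M) (xs c) x"
      unfolding close_on_def vge_def by (auto simp: fls_minus_nth)
    have PK: "vge (P i x) (- int K)" if "i \<le> d" for i
      using K[OF _ x, of "P i"] that by auto
    have "\<not> vge (P d x) N1"
      by (rule not_vge_diff[OF N1, of _ "int M - int K"]) (use K[OF _ x', of "P d"] in \<open>auto simp: M_def\<close>)
    then have lc0: "P d x \<noteq> 0"
      by (auto simp: vge_zero)
    have Pd: "\<not> vge (Pd x) N2"
      by (rule not_vge_diff[OF N2, of _ "int M - int K"]) (use K[OF _ x', of Pd] in \<open>auto simp: M_def\<close>)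
    have "vge (Pv x - Pv (xs c)) (int M - int K)"
      using K[OF _ x, of Pv] by auto
    then have "vge ((Pv x - Pv (xs c)) + Pv (xs c)) (int (2 * e + s))"
      by (intro vge_add N3) (rule vge_mono, assumption, simp add: M_def)
    then have Pv: "vge (Pv x) (int (2 * e + s))"
      by simp
    \<comment> \<open>The factor X^K makes the coefficients of \<open>P\<close> integral, as
      Hensel's lemma demands.\<close>
    have XK: "vge (fls_X ^ K :: 'k fls) (int K)" "\<not> vge (fls_X ^ K :: 'k fls) (int K + 1)"
      by (auto simp: vge_def)
    define p where "p = (\<lambda>i. fls_X ^ K * P i x)"
    define a where "a = xs c j"
    have "vge (p i) 0" if "i \<le> d" for i
      using vge_mult[OF XK(1) PK[OF that]] by (simp add: p_def)
    moreover have "vge a 0"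
      by (simp add: a_def integral)
    moreover have "\<not> vge (\<Sum>i\<le>d. of_nat i * p i * a ^ (i - 1)) (int e + 1)"
    proof -
      have "(\<Sum>i\<le>d. of_nat i * p i * a ^ (i - 1)) = fls_X ^ K * Pd x"
        by (auto simp: Pd_def poly_pderiv_pol p_def a_def x_def sum_distrib_left mult_ac lessThan_Suc_atMost intro!: sum.cong)
      then show ?thesis
        using not_vge_mult[OF XK(2) Pd] e vge_mono[of _ "int e + 1" "int K + 1 + N2"] by auto
    qed
    moreover have "vge (\<Sum>i\<le>d. p i * a ^ i) (int (2 * e + s))"
    proof -
      have "(\<Sum>i\<le>d. p i * a ^ i) = fls_X ^ K * Pv x"
        by (auto simp: Pv_def poly_pol p_def a_def x_def sum_distrib_left mult_ac lessThan_Suc_atMost intro!: sum.cong)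
      then show ?thesis
        using vge_mult[OF XK(1) Pv] by (auto intro: vge_mono)
    qed
    moreover have "s > 0"
      by (simp add: s_def)
    ultimately obtain b where b: "vge b 0" "vge (b - a) (int (e + s))" "(\<Sum>i\<le>d. p i * b ^ i) = 0"
      using fls_hensel[of d p a e s] by blast
    define y where "y = y'(j := b)"
    have Py: "P i y = P i x" for i
      by (rule polyfun_cong[OF P]) (auto simp: y_def x_def)
    have "fls_X ^ K * poly (pol (Suc d) P y) b = 0"
      using b(3) by (simp only: p_def poly_pol Py sum_distrib_left lessThan_Suc_atMost mult.assoc)
    then have "poly (pol (Suc d) P y) b = 0"
      by simp
    moreover have "close_on I (int N) y (xs c)"
      unfolding close_on_def
    proof (intro ballI conjI)
      fix i assume i: "i \<in> I"
      show "vge (y i) 0" "vge (xs c i) 0"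
        using b(1) y' i integral by (auto simp: y_def close_on_def)
      show "vge (y i - xs c i) (int N)"
      proof (cases "i = j")
        case True
        then show ?thesis
          using vge_mono[OF b(2), of "int N"] by (simp add: y_def a_def s_def)
      next
        case False
        then have "vge (y i - xs c i) (int M)"
          using y' i by (simp add: y_def close_on_def)
        then show ?thesis
          by (rule vge_mono) (simp add: M_def)
      qed
    qed
    ultimately show "\<exists>b. close_on I (int N) (y'(j := b)) (xs c) \<and> P d (y'(j := b)) \<noteq> 0 \<and>
      poly (pol (Suc d) P (y'(j := b))) b = 0"
      using lc0 Py[of d] by (intro exI[of _ b]) (simp add: y_def)
  qed
qed

text \<open>Lifting in the manner of Greenberg. Up to a power of \<open>P d\<close>, each function
  is a multiple of \<open>P\<close> plus a remainder whose coefficients are null and involve one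
  variable less. The induction hypothesis makes these coefficients vanish exactly, then Hensel's
  lemma makes \<open>P\<close> vanish. The precision \<open>N\<close> is arbitrary so that the
  induction can supply the \<open>M\<close> that \<open>hensel_step\<close> asks for.\<close>

theorem lift_common_zeros:
  assumes "finite I" "finite Fs" "\<And>f. f \<in> Fs \<Longrightarrow> f \<in> polyfun I \<and> nullseq (\<lambda>c. f (xs c))"
  shows "eventually (\<lambda>c. \<exists>y. close_on I (int N) y (xs c) \<and> (\<forall>f\<in>Fs. f y = 0)) U"
  using assms
proof (induction "card I" arbitrary: I Fs N rule: less_induct)
  case (less I Fs N)
  note I = less.prems(1)
  have Fs: "f \<in> polyfun I" "nullseq (\<lambda>c. f (xs c))" if "f \<in> Fs" for f
    using less.prems(3)[OF that] by auto
  show ?case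
  proof (cases "\<exists>D c0. (\<exists>\<mu>\<in>exponents I D. c0 \<mu> \<noteq> 0) \<and> nullseq (\<lambda>c. mpoly_eval I D c0 (xs c))")
    \<comment> \<open>Without any relation the members of \<open>Fs\<close> vanish identically, and
      \<open>xs c\<close> itself serves.\<close>
    case False
    have "f x = 0" if f_in: "f \<in> Fs" for f x
    proof -
      obtain D c0 where f: "f = mpoly_eval I D c0"
        using polyfun_mpoly_eval[OF I Fs(1)[OF f_in]] by blast
      then have "\<forall>\<mu>\<in>exponents I D. c0 \<mu> = 0"
        using False Fs(2)[OF f_in] by blast
      then show ?thesis
        by (simp add: f mpoly_eval_def)
    qed
    then have "\<exists>y. close_on I (int N) y (xs c) \<and> (\<forall>f\<in>Fs. f y = 0)" for c
      using close_on_self by blast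
    then show ?thesis
      by simp
  next
    case True
    then obtain D0 c0 where "\<exists>\<mu>\<in>exponents I D0. c0 \<mu> \<noteq> 0" "nullseq (\<lambda>c. mpoly_eval I D0 c0 (xs c))"
      by blast
    from separable_relation[OF I this] obtain j n p where j: "j \<in> I"
      and p: "\<And>i. p i \<in> polyfun (I - {j})" "nullseq (\<lambda>c. poly (pol n p (xs c)) (xs c j))"
        "\<not> nullseq (\<lambda>c. poly (pderiv (pol n p (xs c))) (xs c j))"
      by auto
    from minimal_relation[OF p] obtain d P where P: "\<And>i. P i \<in> polyfun (I - {j})"
      "nullseq (\<lambda>c. poly (pol (Suc d) P (xs c)) (xs c j))"
      "\<not> nullseq (\<lambda>c. P d (xs c))" "\<not> nullseq (\<lambda>c. poly (pderiv (pol (Suc d) P (xs c))) (xs c j))"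
      and min: "\<forall>e Q. e < d \<longrightarrow> (\<forall>i. Q i \<in> polyfun (I - {j})) \<longrightarrow>
        nullseq (\<lambda>c. poly (pol (Suc e) Q (xs c)) (xs c j)) \<longrightarrow> nullseq (\<lambda>c. Q e (xs c))"
      by auto
    have "\<exists>a S r. (\<forall>i. r i \<in> polyfun (I - {j})) \<and> (\<forall>i<d. nullseq (\<lambda>c. r i (xs c))) \<and>
      (\<forall>x. P d x ^ a * f x = S x * poly (pol (Suc d) P x) (x j) + poly (pol d r x) (x j))"
      if f: "f \<in> Fs" for f
    proof -
      obtain m g where g: "\<And>i. g i \<in> polyfun (I - {j})" "\<And>x. f x = poly (pol m g x) (x j)"
        using polyfun_univariate[OF Fs(1)[OF f], of j] by blast
      then have "nullseq (\<lambda>c. poly (pol m g (xs c)) (xs c j))"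
        using Fs(2)[OF f] by simp
      from pseudo_division[where P = P and d = d and g = g and j = j and n = m and J = "I - {j}", OF P(1,2) min g(1) this] obtain a S r where
        r: "\<forall>i. r i \<in> polyfun (I - {j})" "\<forall>i<d. nullseq (\<lambda>c. r i (xs c))" and
        eq: "\<forall>x. Polynomial.smult (P d x ^ a) (pol m g x) = S x * pol (Suc d) P x + pol d r x"
        by auto
      have "P d x ^ a * f x = poly (S x) (x j) * poly (pol (Suc d) P x) (x j) + poly (pol d r x) (x j)" for x
        using arg_cong[OF eq[rule_format, of x], of "\<lambda>p. poly p (x j)"] by (simp add: g(2))
      with r show ?thesis
        by (intro exI[of _ a] exI[of _ "\<lambda>x. poly (S x) (x j)"] exI[of _ r]) auto
    qed
    then have "\<forall>f\<in>Fs. \<exists>a S r. (\<forall>i. r i \<in> polyfun (I - {j})) \<and> (\<forall>i<d. nullseq (\<lambda>c. r i (xs c))) \<and>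
      (\<forall>x. P d x ^ a * f x = S x * poly (pol (Suc d) P x) (x j) + poly (pol d r x) (x j))"
      by blast
    then have "\<exists>a S r. \<forall>f\<in>Fs. (\<forall>i. r f i \<in> polyfun (I - {j})) \<and> (\<forall>i<d. nullseq (\<lambda>c. r f i (xs c))) \<and>
      (\<forall>x. P d x ^ a f * f x = S f x * poly (pol (Suc d) P x) (x j) + poly (pol d (r f) x) (x j))"
      unfolding bchoice_iff .
    then obtain a S r where aSr: "\<forall>f\<in>Fs. (\<forall>i. r f i \<in> polyfun (I - {j})) \<and> (\<forall>i<d. nullseq (\<lambda>c. r f i (xs c))) \<and>
      (\<forall>x. P d x ^ a f * f x = S f x * poly (pol (Suc d) P x) (x j) + poly (pol d (r f) x) (x j))"
      by (elim exE)
    have r: "r f i \<in> polyfun (I - {j})" "i < d \<Longrightarrow> nullseq (\<lambda>c. r f i (xs c))" if "f \<in> Fs" for f i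
      using aSr that by simp_all
    have eq: "P d x ^ a f * f x = S f x * poly (pol (Suc d) P x) (x j) + poly (pol d (r f) x) (x j)" if "f \<in> Fs" for f x
      using aSr that by simp
    obtain M where M: "eventually (\<lambda>c. \<forall>y'. close_on (I - {j}) (int M) y' (xs c) \<longrightarrow>
      (\<exists>b. close_on I (int N) (y'(j := b)) (xs c) \<and> P d (y'(j := b)) \<noteq> 0 \<and>
        poly (pol (Suc d) P (y'(j := b))) b = 0)) U"
      using hensel_step[OF j P] by blast
    \<comment> \<open>The coefficients of all remainders are the new system, in the variables other
      than \<open>j\<close>.\<close>
    define Fs' where "Fs' = (\<lambda>(f, i). r f i) ` (Fs \<times> {..<d})"
    have "eventually (\<lambda>c. \<exists>y. close_on (I - {j}) (int M) y (xs c) \<and> (\<forall>f\<in>Fs'. f y = 0)) U"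
    proof (rule less.hyps)
      show "card (I - {j}) < card I"
        using I j by (rule card_Diff1_less)
    qed (use I less.prems(2) r in \<open>auto simp: Fs'_def\<close>)
    with M show ?thesis
    proof eventually_elim
      case (elim c)
      then obtain y' where y': "close_on (I - {j}) (int M) y' (xs c)" "\<forall>f\<in>Fs'. f y' = 0"
        by blast
      with elim(1) obtain b where b: "close_on I (int N) (y'(j := b)) (xs c)" "P d (y'(j := b)) \<noteq> 0"
        "poly (pol (Suc d) P (y'(j := b))) b = 0"
        by blast
      define y where "y = y'(j := b)"
      have "f y = 0" if f: "f \<in> Fs" for f
      proof -
        have "r f i y = 0" if "i < d" for i
        proof -
          have "r f i y = r f i y'"
            by (rule polyfun_cong[OF r(1)[OF f]]) (auto simp: y_def)
          also have "\<dots> = 0"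
            using y'(2) f that by (auto simp: Fs'_def)
          finally show ?thesis .
        qed
        then have "poly (pol d (r f) y) b = 0"
          by (simp add: poly_pol)
        \<comment> \<open>Both the multiple of \<open>P\<close> and the remainder vanish at
          \<open>y\<close>; what remains is cancelled using that \<open>P d\<close> is nonzero
          there.\<close>
        then have "P d y ^ a f * f y = 0"
          using eq[OF f, of y] b(3) by (simp add: y_def)
        then show ?thesis
          using b(2) by (simp add: y_def)
      qed
      then show ?case
        using b(1) by (auto simp: y_def)
    qed
  qed
qed

end

section \<open>Common zeros over Laurent series in one variable\<close>

lemma quad_cong: "(\<And>i j. i < n \<Longrightarrow> j < n \<Longrightarrow> a i j = b i j) \<Longrightarrow> quad n a x = quad n b x"
  by (simp add: quad_def)

lemma quad_scale: "quad n a (\<lambda>i. c * x i) = c ^ 2 * quad n a x"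
  by (simp add: quad_def sum_distrib_left power2_eq_square mult_ac)

lemma quad_scale_coeff: "quad n (\<lambda>i j. c * a i j) x = c * quad n a x"
  by (simp add: quad_def sum_distrib_left mult_ac)

lemma fps_of_poly_quad:
  "fps_of_poly (quad n a x) = quad n (\<lambda>i j. fps_of_poly (a i j)) (\<lambda>i. fps_of_poly (x i))"
  for x :: "nat \<Rightarrow> 'e::idom poly"
  by (simp add: quad_def fps_of_poly_sum fps_of_poly_mult)

text \<open>Truncation modulo X^c turns the coefficients into polynomials, for which exact zeros
  exist. Dividing by the highest common power of X leaves a coordinate that is a unit; otherwise the
  zeros could converge to the zero vector.\<close>

lemma approximate_zero:
  fixes b :: "nat \<Rightarrow> nat \<Rightarrow> nat \<Rightarrow> 'k::field fps"
  assumes sol: "quadrics_solvable TYPE('k poly) C" and mn: "C * m < n"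
  shows "\<exists>z. (\<exists>i<n. fps_nth (z i) 0 \<noteq> 0) \<and> (\<forall>l<m. agree c (quad n (b l) z) 0)"
proof -
  define tr :: "'k fps \<Rightarrow> 'k poly" where "tr = (\<lambda>f. \<Sum>k<c. Polynomial.monom (fps_nth f k) k)"
  have tr: "agree c f (fps_of_poly (tr f))" for f
    by (simp add: agree_def tr_def Polynomial.coeff_sum)
  obtain x where x: "\<exists>i<n. x i \<noteq> 0" "\<And>l. l < m \<Longrightarrow> quad n (\<lambda>i j. tr (b l i j)) x = 0"
    using sol[unfolded quadrics_solvable_def, rule_format, OF mn, of "\<lambda>l i j. tr (b l i j)"] by auto
  define w where "w = (\<lambda>i. fps_of_poly (x i))"
  define S where "S = {i. i < n \<and> w i \<noteq> 0}"
  have S: "finite S" "S \<noteq> {}"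
    using x(1) by (auto simp: S_def w_def)
  define e where "e = Min (subdegree ` (w ` S))"
  have "e \<in> subdegree ` (w ` S)"
    unfolding e_def using S by (intro Min_in) auto
  then obtain i0 where i0: "i0 < n" "w i0 \<noteq> 0" "subdegree (w i0) = e"
    by (auto simp: S_def)
  have e_le: "e \<le> subdegree (w i)" if "i < n" "w i \<noteq> 0" for i
    unfolding e_def using S that by (intro Min_le) (auto simp: S_def)
  define z where "z = (\<lambda>i. fps_shift e (w i))"
  have wz: "w i = fps_X ^ e * z i" if "i < n" for i
  proof (cases "w i = 0")
    case False
    then show ?thesis
      using e_le[OF that] by (simp add: z_def fps_shift_times_fps_X_power mult.commute[of "fps_X ^ e"])
  qed (simp add: z_def)
  have "agree c (quad n (b l) z) 0" if l: "l < m" for l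
  proof -
    have "quad n (\<lambda>i j. fps_of_poly (tr (b l i j))) w = 0"
      using arg_cong[OF x(2)[OF l], of fps_of_poly] by (simp add: fps_of_poly_quad w_def)
    also have "quad n (\<lambda>i j. fps_of_poly (tr (b l i j))) w = quad n (\<lambda>i j. fps_of_poly (tr (b l i j))) (\<lambda>i. fps_X ^ e * z i)"
      unfolding quad_def by (intro sum.cong refl) (simp add: wz)
    finally have "quad n (\<lambda>i j. fps_of_poly (tr (b l i j))) z = 0"
      by (simp add: quad_scale)
    moreover have "agree c (quad n (b l) z) (quad n (\<lambda>i j. fps_of_poly (tr (b l i j))) z)"
      unfolding quad_def by (intro agree_sum agree_mult agree_refl tr)
    ultimately show ?thesis
      by simp
  qed
  moreover have "fps_nth (z i0) 0 \<noteq> 0"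
    using i0 by (simp add: z_def nth_subdegree_nonzero flip: i0(3))
  ultimately show ?thesis
    using i0(1) by blast
qed

theorem quadrics_solvable_fls:
  assumes char2: "CHAR('k::alg_closed_field) = 2"
  shows "quadrics_solvable TYPE('k fls) 2"
  unfolding quadrics_solvable_def
proof (intro allI impI)
  fix m n :: nat and a :: "nat \<Rightarrow> nat \<Rightarrow> nat \<Rightarrow> 'k fls"
  assume mn: "2 * m < n"
  have "\<exists>K::nat. \<forall>l i j. l < m \<longrightarrow> i < n \<longrightarrow> j < n \<longrightarrow> vge (a l i j) (- int K)"
  proof -
    define K where "K = (\<lambda>l i j. SOME K. vge (a l i j) (- int K))"
    have K: "vge (a l i j) (- int (K l i j))" for l i j
      unfolding K_def using vge_exists[of "a l i j"] by (auto intro: someI)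
    define K' where "K' = (\<Sum>(l, i, j)\<in>{..<m} \<times> {..<n} \<times> {..<n}. K l i j)"
    have "K l i j \<le> K'" if "l < m" "i < n" "j < n" for l i j
      using member_le_sum[of "(l, i, j)" "{..<m} \<times> {..<n} \<times> {..<n}" "\<lambda>(l, i, j). K l i j"] that
      by (auto simp: K'_def)
    then show ?thesis
      using vge_mono[OF K] by (intro exI[of _ K']) auto
  qed
  then obtain K :: nat where K: "\<And>l i j. l < m \<Longrightarrow> i < n \<Longrightarrow> j < n \<Longrightarrow> vge (a l i j) (- int K)"
    by blast
  define b where "b = (\<lambda>l i j. fls_regpart (fls_X ^ K * a l i j))"
  have b: "fps_to_fls (b l i j) = fls_X ^ K * a l i j" if "l < m" "i < n" "j < n" for l i j
  proof -
    have "vge (fls_X ^ K :: 'k fls) (int K)"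
      by (simp add: vge_def)
    from vge_mult[OF this K[OF that]] show ?thesis
      unfolding b_def by (intro vge_0_regpart) simp
  qed
  have quad_b: "quad n (\<lambda>i j. fps_to_fls (b l i j)) x = fls_X ^ K * quad n (a l) x" if "l < m" for l x
  proof -
    have "quad n (\<lambda>i j. fps_to_fls (b l i j)) x = quad n (\<lambda>i j. fls_X ^ K * a l i j) x"
      using that by (intro quad_cong b)
    then show ?thesis
      by (simp add: quad_scale_coeff)
  qed
  have "quadrics_solvable TYPE('k poly) (2 * 1)"
    by (intro quadrics_solvable_poly quadrics_solvable_alg_closed)
  then have "\<exists>z. (\<exists>i<n. fps_nth (z i) 0 \<noteq> 0) \<and> (\<forall>l<m. agree c (quad n (b l) z) 0)" for c
    by (rule approximate_zero) (use mn in simp)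
  then obtain z where z: "\<And>c. \<exists>i<n. fps_nth (z c i) 0 \<noteq> 0" "\<And>c l. l < m \<Longrightarrow> agree c (quad n (b l) (z c)) 0"
    by metis
  define xs where "xs = (\<lambda>c i. fps_to_fls (z c i))"
  obtain U :: "nat filter" where U: "U \<noteq> bot" "U \<le> sequentially"
    "\<forall>P. eventually P U \<or> eventually (\<lambda>x. \<not> P x) U"
    using free_ultrafilter_exists by auto
  interpret approximating_sequence U xs
    by unfold_locales (use U char2 in \<open>auto simp: xs_def vge_fps_to_fls\<close>)
  have "nullseq (\<lambda>c. quad n (\<lambda>i j. fps_to_fls (b l i j)) (xs c))" if l: "l < m" for l
    unfolding nullseq_def
  proof
    fix N
    have "eventually (\<lambda>c. c \<ge> nat N) U"
      using U(2) by (rule filter_leD) (rule eventually_ge_at_top)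
    then show "eventually (\<lambda>c. vge (quad n (\<lambda>i j. fps_to_fls (b l i j)) (xs c)) N) U"
    proof eventually_elim
      case (elim c)
      have "vge (fps_to_fls (quad n (b l) (z c))) N"
        using z(2)[OF l, of c] elim by (auto simp: vge_def agree_def)
      then show ?case
        by (simp add: fps_to_fls_quad xs_def)
    qed
  qed
  \<comment> \<open>Precision 1 is enough: it preserves constant terms, and one of them is
    nonzero.\<close>
  then have "eventually (\<lambda>c. \<exists>y. close_on {..<n} (int 1) y (xs c) \<and>
      (\<forall>f\<in>(\<lambda>l. quad n (\<lambda>i j. fps_to_fls (b l i j))) ` {..<m}. f y = 0)) U"
    by (intro lift_common_zeros) (auto intro: polyfun_quad)
  then obtain c y where y: "close_on {..<n} (int 1) y (xs c)"
    "\<forall>l<m. quad n (\<lambda>i j. fps_to_fls (b l i j)) y = 0"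
    using eventually_happens'[OF U(1)] by fastforce
  obtain i where i: "i < n" "fps_nth (z c i) 0 \<noteq> 0"
    using z(1) by blast
  have "fls_nth (y i - xs c i) 0 = 0"
    using y(1) i(1) by (auto simp: close_on_def vge_def)
  then have "y i \<noteq> 0"
    using i(2) by (auto simp: xs_def)
  moreover have "quad n (a l) y = 0" if "l < m" for l
    using y(2) quad_b[OF that, of y] that by simp
  ultimately show "\<exists>x. (\<exists>i<n. x i \<noteq> 0) \<and> (\<forall>l<m. quad n (a l) x = 0)"
    using i(1) by blast
qed

section \<open>Common splitting fields of three algebras\<close>

lemma char2_two_eq_zero: "CHAR('a::ring_1) = 2 \<Longrightarrow> (2::'a) = 0"
  using char2_add_self[of "1::'a"] by simp

lemma char2_move: "CHAR('a::ring_1) = 2 \<Longrightarrow> x + y = z \<Longrightarrow> y = x + (z::'a)"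
  by (metis add.assoc add_0 char2_add_self)

text \<open>\<open>K\<close> is a subset of a fixed field, so subfields of one algebraic closure can
  be compared. With \<open>K = UNIV\<close> it expresses splitting over the base field
  itself.\<close>

definition splits_in :: "'a::field set \<Rightarrow> 'a \<Rightarrow> 'a \<Rightarrow> bool" where
  "splits_in K \<gamma> \<delta> \<longleftrightarrow> (\<exists>t\<in>K. \<exists>z\<in>K. \<gamma> = t ^ 2 + t + \<delta> * z ^ 2)"

definition field_closed :: "'a::field set \<Rightarrow> bool" where
  "field_closed K \<longleftrightarrow> 0 \<in> K \<and> 1 \<in> K \<and>
     (\<forall>x\<in>K. \<forall>y\<in>K. x + y \<in> K \<and> x * y \<in> K) \<and> (\<forall>x\<in>K. inverse x \<in> K)"

lemma field_closedD:
  assumes "field_closed K"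
  shows "0 \<in> K" "1 \<in> K" "x \<in> K \<Longrightarrow> y \<in> K \<Longrightarrow> x + y \<in> K" "x \<in> K \<Longrightarrow> y \<in> K \<Longrightarrow> x * y \<in> K"
    "x \<in> K \<Longrightarrow> inverse x \<in> K" "x \<in> K \<Longrightarrow> y \<in> K \<Longrightarrow> x / y \<in> K" "x \<in> K \<Longrightarrow> x ^ n \<in> K"
proof -
  show "0 \<in> K" and one: "1 \<in> K" "x \<in> K \<Longrightarrow> y \<in> K \<Longrightarrow> x + y \<in> K"
    and mult: "x \<in> K \<Longrightarrow> y \<in> K \<Longrightarrow> x * y \<in> K" and "x \<in> K \<Longrightarrow> inverse x \<in> K" for x y
    using assms by (auto simp: field_closed_def)
  then show "x \<in> K \<Longrightarrow> y \<in> K \<Longrightarrow> x / y \<in> K" for x y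
    by (simp add: field_class.field_divide_inverse)
  show "x \<in> K \<Longrightarrow> x ^ n \<in> K"
    by (induction n) (auto intro: one mult)
qed

text \<open>The norm form of \<open>[\<gamma>,\<delta>)\<close> is \<open>r\<^sup>2 + r s + \<gamma> s\<^sup>2 + \<delta> (z\<^sup>2 + z w + \<gamma> w\<^sup>2)\<close>. The quotient of
  \<open>r + s x\<close> by \<open>z + w x\<close> has norm \<open>\<delta>\<close> from the quadratic algebra \<open>x\<^sup>2 + x = \<gamma>\<close>; it is
  proportional to \<open>A + D x\<close> below.\<close>

lemma isotropic_imp_splits:
  fixes \<gamma> \<delta> r s z w :: "'a::field"
  assumes char2: "CHAR('a) = 2" and K: "field_closed K"
    and mem: "\<gamma> \<in> K" "\<delta> \<in> K" "r \<in> K" "s \<in> K" "z \<in> K" "w \<in> K" and \<delta>: "\<delta> \<noteq> 0"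
    and iso: "r ^ 2 + r * s + \<gamma> * s ^ 2 = \<delta> * (z ^ 2 + z * w + \<gamma> * w ^ 2)"
    and nz: "r \<noteq> 0 \<or> s \<noteq> 0 \<or> z \<noteq> 0 \<or> w \<noteq> 0"
  shows "splits_in K \<gamma> \<delta>"
proof -
  note two = char2_two_eq_zero[OF char2] and c2 = char2_add_self[OF char2]
  note cl = field_closedD[OF K]
  define n where "n = z ^ 2 + z * w + \<gamma> * w ^ 2"
  define A where "A = r * (z + w) + s * w * \<gamma>"
  define D where "D = r * w + s * z"
  \<comment> \<open>A + D x is the product of r + s x with the conjugate z + w + w x, so its norm is
    the product of the two norms, up to terms with the factor 2.\<close>
  have "A ^ 2 + A * D + \<gamma> * D ^ 2 = (r ^ 2 + r * s + \<gamma> * s ^ 2) * n +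
      2 * (r ^ 2 * w ^ 2 + r ^ 2 * z * w + 2 * (r * s * z * w * \<gamma>) + r * s * w ^ 2 * \<gamma>)"
    unfolding A_def D_def n_def by (simp add: algebra_simps power2_eq_square)
  then have norm: "A ^ 2 + A * D + \<gamma> * D ^ 2 = \<delta> * n ^ 2"
    using iso by (simp add: two n_def power2_eq_square mult_ac)
  have memb: "A \<in> K" "D \<in> K" "n \<in> K"
    unfolding A_def D_def n_def by (intro cl mem)+
  \<comment> \<open>When \<delta> = p^2, the choice t = \<gamma>, z = \<gamma>/p works because
    \<gamma>^2 then occurs twice.\<close>
  have square: "splits_in K \<gamma> \<delta>" if "\<delta> = p ^ 2" "p \<in> K" for p
  proof -
    have "p \<noteq> 0"
      using that \<delta> by auto
    then have "\<gamma> = \<gamma> ^ 2 + \<gamma> + \<delta> * (\<gamma> / p) ^ 2"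
      using c2[of "\<gamma> ^ 2"] that by (simp add: power_divide algebra_simps)
    then show ?thesis
      unfolding splits_in_def using mem(1) cl(6)[OF mem(1) that(2)] by blast
  qed
  have as: "splits_in K \<gamma> \<delta>" if "\<gamma> * v ^ 2 = u ^ 2 + u * v + \<delta> * n' ^ 2" "v \<noteq> 0" "u \<in> K" "v \<in> K" "n' \<in> K" for u v n'
  proof -
    have "\<gamma> = (u / v) ^ 2 + u / v + \<delta> * (n' / v) ^ 2"
      using that(1,2) by (simp add: field_simps power2_eq_square)
    then show ?thesis
      unfolding splits_in_def using cl(6) that by blast
  qed
  show ?thesis
  \<comment> \<open>For D = 0 and n nonzero, \<delta> is the square of A/n. For n = 0 one of z + w
    x, r + s x is a nonzero element of norm 0; dividing by its x-coefficient solves \<gamma> = t^2 +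
    t.\<close>
  proof (cases "D = 0")
    case False
    have "\<gamma> * D ^ 2 = A ^ 2 + A * D + \<delta> * n ^ 2"
      using char2_move[OF char2 norm] .
    then show ?thesis
      using as False memb by blast
  next
    case D: True
    show ?thesis
    proof (cases "n = 0")
      case False
      have "\<delta> = (A / n) ^ 2"
        using norm D False by (simp add: field_simps)
      then show ?thesis
        using square cl(6) memb by blast
    next
      case n: True
      show ?thesis
      proof (cases "w = 0")
        case False
        have "\<gamma> * w ^ 2 = z ^ 2 + z * w + \<delta> * 0 ^ 2"
          using char2_move[OF char2 n[unfolded n_def]] by simp
        then show ?thesis
          using as False mem cl(1) by blast
      next
        case w: True
        then have z: "z = 0"
          using n by (simp add: n_def)
        then have iso': "r ^ 2 + r * s + \<gamma> * s ^ 2 = 0"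
          using iso w by simp
        then have "s \<noteq> 0"
          using nz w z by auto
        moreover have "\<gamma> * s ^ 2 = r ^ 2 + r * s + \<delta> * 0 ^ 2"
          using char2_move[OF char2 iso'] by simp
        ultimately show ?thesis
          using as mem cl(1) by blast
      qed
    qed
  qed
qed

text \<open>With t = X u and f = X h the equation reads u = h - X u^2, a contraction.\<close>

lemma fls_artin_schreier:
  fixes f :: "'e::field fls"
  assumes "vge f 1"
  shows "\<exists>t. t ^ 2 + t = f"
proof -
  define h where "h = fls_regpart (fls_shift 1 f)"
  have f: "f = fps_to_fls (fps_X * h)"
    using assms by (intro fls_eqI) (auto simp: h_def vge_def)
  have "\<exists>u. \<forall>i. u i = (\<lambda>u (i::unit). h - fps_X * (u i) ^ 2) u i"
  proof (rule fps_fixpoint)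
    fix n i and y z :: "unit \<Rightarrow> 'e fps"
    assume "\<And>i k. k < n \<Longrightarrow> fps_nth (y i) k = fps_nth (z i) k"
    then have "agree (Suc n) (h - fps_X * (y i) ^ 2) (h - fps_X * (z i) ^ 2)"
      by (intro agree_diff agree_refl agree_X_mult agree_power) (simp add: agree_def)
    then show "fps_nth (h - fps_X * (y i) ^ 2) n = fps_nth (h - fps_X * (z i) ^ 2) n"
      by (simp add: agree_def)
  qed
  then obtain u where "u () = h - fps_X * u () ^ 2"
    by auto
  then have "u () + fps_X * u () ^ 2 = h"
    by (metis diff_add_cancel)
  then have "f = fps_to_fls ((fps_X * u ()) ^ 2 + fps_X * u ())"
    unfolding f by (simp add: power2_eq_square algebra_simps flip: distrib_left)
  then show ?thesis
    by (intro exI[of _ "fps_to_fls (fps_X * u ())"]) (simp add: fps_to_fls_power)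
qed

section \<open>Reduction to Laurent polynomials\<close>

definition laurent_poly :: "'e::field fls \<Rightarrow> bool" where
  "laurent_poly f \<longleftrightarrow> (\<exists>K p. fls_X ^ K * f = fps_to_fls (fps_of_poly p))"

lemma laurent_poly_0: "laurent_poly 0"
  unfolding laurent_poly_def by (intro exI[of _ 0]) simp

lemma laurent_poly_1: "laurent_poly 1"
  unfolding laurent_poly_def by (intro exI[of _ 0] exI[of _ 1]) simp

lemma laurent_poly_shift:
  fixes f :: "'e::field fls"
  assumes "fls_X ^ K * f = fps_to_fls (fps_of_poly p)" "K \<le> K'"
  shows "fls_X ^ K' * f = fps_to_fls (fps_of_poly (Polynomial.monom 1 (K' - K) * p))"
proof -
  have "fls_X ^ K' * f = fls_X ^ (K' - K) * (fls_X ^ K * f)"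
    using assms(2) by (simp add: mult.assoc[symmetric] flip: power_add)
  also have "\<dots> = fps_to_fls (fps_X ^ (K' - K) * fps_of_poly p)"
    by (simp add: assms(1) fls_times_fps_to_fls fps_to_fls_power)
  also have "fps_X ^ (K' - K) * fps_of_poly p = fps_of_poly (Polynomial.monom 1 (K' - K) * p)"
    unfolding fps_of_poly_mult fps_of_poly_monom' ..
  finally show ?thesis .
qed

lemma laurent_poly_add: "laurent_poly f \<Longrightarrow> laurent_poly g \<Longrightarrow> laurent_poly (f + g)"
proof -
  assume "laurent_poly f" "laurent_poly g"
  then obtain K p K' q where "fls_X ^ K * f = fps_to_fls (fps_of_poly p)" "fls_X ^ K' * g = fps_to_fls (fps_of_poly q)"
    by (auto simp: laurent_poly_def)
  then have "fls_X ^ max K K' * f = fps_to_fls (fps_of_poly (Polynomial.monom 1 (max K K' - K) * p))"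
    "fls_X ^ max K K' * g = fps_to_fls (fps_of_poly (Polynomial.monom 1 (max K K' - K') * q))"
    by (auto intro!: laurent_poly_shift)
  then have "fls_X ^ max K K' * (f + g) = fps_to_fls (fps_of_poly (Polynomial.monom 1 (max K K' - K) * p + Polynomial.monom 1 (max K K' - K') * q))"
    by (simp only: distrib_left fps_of_poly_add fps_to_fls_plus)
  then show ?thesis
    unfolding laurent_poly_def by blast
qed

lemma laurent_poly_mult: "laurent_poly f \<Longrightarrow> laurent_poly g \<Longrightarrow> laurent_poly (f * g)"
proof -
  assume "laurent_poly f" "laurent_poly g"
  then obtain K p K' q where *: "fls_X ^ K * f = fps_to_fls (fps_of_poly p)" "fls_X ^ K' * g = fps_to_fls (fps_of_poly q)"
    by (auto simp: laurent_poly_def)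
  have "fls_X ^ (K + K') * (f * g) = (fls_X ^ K * f) * (fls_X ^ K' * g)"
    by (simp add: power_add mult_ac)
  then have "fls_X ^ (K + K') * (f * g) = fps_to_fls (fps_of_poly (p * q))"
    by (simp only: * fps_of_poly_mult fls_times_fps_to_fls)
  then show ?thesis
    unfolding laurent_poly_def by blast
qed

lemma laurent_poly_approximation: "\<exists>g. laurent_poly g \<and> vge (f - g) (int N)"
proof -
  obtain K where K: "vge f (- int K)"
    using vge_exists by blast
  define p where "p = (\<Sum>k<N + K. Polynomial.monom (fls_nth f (int k - int K)) k)"
  define g where "g = fls_shift (int K) (fps_to_fls (fps_of_poly p))"
  have cp: "poly.coeff p k = (if k < N + K then fls_nth f (int k - int K) else 0)" for k
    by (simp add: p_def Polynomial.coeff_sum)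
  have "fls_X ^ K * g = fps_to_fls (fps_of_poly p)"
    by (simp add: g_def fls_X_power_times_conv_shift)
  moreover have "vge (f - g) (int N)"
    unfolding vge_def
  proof (intro allI impI)
    fix k assume "k < int N"
    then show "fls_nth (f - g) k = 0"
      using K by (cases "k + int K < 0") (auto simp: g_def cp vge_def)
  qed
  ultimately show ?thesis
    unfolding laurent_poly_def by blast
qed

lemma laurent_quadrics_solvable:
  assumes sol: "quadrics_solvable TYPE('e::field poly) C" and mn: "C * m < n"
    and a: "\<And>l i j. laurent_poly (a l i j)"
  shows "\<exists>x :: nat \<Rightarrow> 'e fls. (\<exists>i<n. x i \<noteq> 0) \<and> (\<forall>l<m. quad n (a l) x = 0)"
proof -
  have "\<exists>K. \<exists>p. fls_X ^ K * a l i j = fps_to_fls (fps_of_poly p)" for l i j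
    using a by (simp add: laurent_poly_def)
  then obtain K where K: "\<exists>p. fls_X ^ K l i j * a l i j = fps_to_fls (fps_of_poly p)" for l i j
    by metis
  define K' where "K' = (\<Sum>(l, i, j)\<in>{..<m} \<times> {..<n} \<times> {..<n}. K l i j)"
  have le: "K l i j \<le> K'" if "l < m" "i < n" "j < n" for l i j
    using member_le_sum[of "(l, i, j)" "{..<m} \<times> {..<n} \<times> {..<n}" "\<lambda>(l, i, j). K l i j"] that
    by (auto simp: K'_def)
  have "\<exists>p. l < m \<longrightarrow> i < n \<longrightarrow> j < n \<longrightarrow> fls_X ^ K' * a l i j = fps_to_fls (fps_of_poly p)" for l i j
    using K[of l i j] le[of l i j] laurent_poly_shift by blast
  then obtain p where p: "\<And>l i j. l < m \<Longrightarrow> i < n \<Longrightarrow> j < n \<Longrightarrow> fls_X ^ K' * a l i j = fps_to_fls (fps_of_poly (p l i j))"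
    by metis
  obtain y where y: "\<exists>i<n. y i \<noteq> 0" "\<And>l. l < m \<Longrightarrow> quad n (p l) y = 0"
    using sol[unfolded quadrics_solvable_def, rule_format, OF mn, of p] by auto
  define x where "x = (\<lambda>i. fps_to_fls (fps_of_poly (y i)))"
  have "quad n (a l) x = 0" if l: "l < m" for l
  proof -
    have "fls_X ^ K' * quad n (a l) x = quad n (\<lambda>i j. fls_X ^ K' * a l i j) x"
      by (simp add: quad_scale_coeff)
    also have "\<dots> = quad n (\<lambda>i j. fps_to_fls (fps_of_poly (p l i j))) x"
      using l by (intro quad_cong p)
    also have "\<dots> = fps_to_fls (fps_of_poly (quad n (p l) y))"
      by (simp add: x_def fps_of_poly_quad fps_to_fls_quad)
    finally show ?thesis
      using y(2)[OF l] by simp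
  qed
  moreover have "\<exists>i<n. x i \<noteq> 0"
    using y(1) by (simp add: x_def)
  ultimately show ?thesis
    by blast
qed

lemma quad_of_monomials:
  fixes cs :: "('e::field fls \<times> nat \<times> nat) list"
  assumes "\<And>c p q. (c, p, q) \<in> set cs \<Longrightarrow> laurent_poly c \<and> p < n \<and> q < n"
  shows "\<exists>a. (\<forall>i j. laurent_poly (a i j)) \<and> (\<forall>x. quad n a x = (\<Sum>(c, p, q)\<leftarrow>cs. c * (x p * x q)))"
  using assms
proof (induction cs)
  case Nil
  then show ?case
    by (intro exI[of _ "\<lambda>_ _. 0"]) (simp add: quad_def laurent_poly_0)
next
  case (Cons t cs)
  obtain c p q where t: "t = (c, p, q)"
    by (cases t)
  then have c: "laurent_poly c" "p < n" "q < n"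
    using Cons.prems[of c p q] by auto
  obtain a where a: "\<And>i j. laurent_poly (a i j)" "\<And>x. quad n a x = (\<Sum>(c, p, q)\<leftarrow>cs. c * (x p * x q))"
    using Cons by (auto simp: t)
  define a' where "a' = (\<lambda>i j. (if i = p \<and> j = q then c else 0) + a i j)"
  have "quad n a' x = c * (x p * x q) + quad n a x" for x
  proof -
    have "quad n a' x = (\<Sum>i<n. \<Sum>j<n. (if i = p then if j = q then c * (x p * x q) else 0 else 0)) + quad n a x"
      unfolding quad_def a'_def sum.distrib[symmetric] by (intro sum.cong refl) (auto simp: distrib_right)
    also have "(\<Sum>i<n. \<Sum>j<n. (if i = p then if j = q then c * (x p * x q) else 0 else 0)) =
      (\<Sum>i<n. if i = p then c * (x p * x q) else 0)"
      using c by (intro sum.cong refl) simp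
    also have "\<dots> = c * (x p * x q)"
      using c by simp
    finally show ?thesis .
  qed
  moreover have "laurent_poly (a' i j)" for i j
    unfolding a'_def by (auto intro: laurent_poly_add laurent_poly_0 c a)
  ultimately show ?case
    using a(2) by (intro exI[of _ a']) (simp add: t)
qed

text \<open>Two changes preserve splitting: \<gamma> by some v^2 + v, and \<delta> by a factor 1 + q
  + \<gamma> q^2, a norm from x^2 + x = \<gamma>. Every series of positive valuation has the form
  t^2 + t, so small changes are of this kind; q = u/\<gamma> with u^2 + u = \<gamma> m yields the
  norm 1 + m. For \<gamma> = 0 the algebra is already split.\<close>

lemma splits_in_approximation:
  fixes \<gamma> \<delta> :: "'e::field fls"
  assumes char2: "CHAR('e) = 2" and \<delta>: "\<delta> \<noteq> 0"
  shows "\<exists>\<gamma>' \<delta>'. laurent_poly \<gamma>' \<and> laurent_poly \<delta>' \<and> \<delta>' \<noteq> 0 \<and>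
    (\<forall>K. field_closed K \<longrightarrow> range to_ac \<subseteq> K \<longrightarrow> splits_in K (to_ac \<gamma>') (to_ac \<delta>') \<longrightarrow>
      splits_in K (to_ac \<gamma>) (to_ac \<delta>))"
proof (cases "\<gamma> = 0")
  case True
  have "splits_in K (to_ac \<gamma>) (to_ac \<delta>)" if "field_closed K" for K
    using field_closedD(1)[OF that] True unfolding splits_in_def by (intro bexI[of _ 0]) auto
  then show ?thesis
    using laurent_poly_1 by (intro exI[of _ 1] conjI) auto
next
  case \<gamma>: False
  have charL: "CHAR('e fls alg_closure) = 2"
    by (simp add: char2)
  obtain \<gamma>' where \<gamma>': "laurent_poly \<gamma>'" "vge (\<gamma> - \<gamma>') (int 1)"
    using laurent_poly_approximation by blast
  then obtain v where v: "v ^ 2 + v = \<gamma> - \<gamma>'"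
    using fls_artin_schreier[of "\<gamma> - \<gamma>'"] by auto
  obtain K\<gamma> where K\<gamma>: "vge \<gamma> (- int K\<gamma>)"
    using vge_exists by blast
  \<comment> \<open>This precision keeps the leading term of \<delta> and gives \<gamma> (\<delta>'
    - \<delta>)/\<delta> positive valuation.\<close>
  define M where "M = nat \<bar>fls_subdegree \<delta>\<bar> + K\<gamma> + 1"
  obtain \<delta>' where \<delta>': "laurent_poly \<delta>'" "vge (\<delta> - \<delta>') (int M)"
    using laurent_poly_approximation by blast
  have "\<delta>' \<noteq> 0"
  proof
    assume "\<delta>' = 0"
    then have "fls_nth \<delta> (fls_subdegree \<delta>) = 0"
      using \<delta>'(2) by (auto simp: vge_def M_def)
    with \<delta> show False by simp
  qed
  define m where "m = (\<delta>' - \<delta>) * inverse \<delta>"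
  have "vge (inverse \<delta>) (- fls_subdegree \<delta>)"
    using fls_inverse_subdegree[of \<delta>] unfolding vge_def by (metis fls_eq0_below_subdegree)
  moreover have "vge (\<delta>' - \<delta>) (int M)"
    using \<delta>'(2) by (auto simp: vge_def)
  ultimately have "vge m (int M + - fls_subdegree \<delta>)"
    unfolding m_def by (intro vge_mult)
  then have "vge m (1 + int K\<gamma>)"
    by (rule vge_mono) (simp add: M_def)
  then have "vge (\<gamma> * m) 1"
    using vge_mult[OF K\<gamma>] by fastforce
  then obtain u where u: "u ^ 2 + u = \<gamma> * m"
    using fls_artin_schreier by blast
  define q where "q = u / \<gamma>"
  have "1 + q + \<gamma> * q ^ 2 = 1 + (u ^ 2 + u) / \<gamma>"
    using \<gamma> by (simp add: q_def field_simps power2_eq_square)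
  also have "\<dots> = 1 + m"
    using \<gamma> by (simp add: u)
  also have "\<delta> * (1 + m) = \<delta>'"
    using \<delta> by (simp add: m_def algebra_simps)
  finally have \<delta>'_eq: "\<delta>' = \<delta> * (1 + q + \<gamma> * q ^ 2)"
    by simp
  have "splits_in K (to_ac \<gamma>) (to_ac \<delta>)"
    if K: "field_closed K" "range to_ac \<subseteq> K" and sp: "splits_in K (to_ac \<gamma>') (to_ac \<delta>')" for K
  proof -
    note cl = field_closedD[OF K(1)]
    have ac: "to_ac f \<in> K" for f
      using K(2) by auto
    obtain t z where tz: "t \<in> K" "z \<in> K" "to_ac \<gamma>' = t ^ 2 + t + to_ac \<delta>' * z ^ 2"
      using sp by (auto simp: splits_in_def)
    have \<gamma>_eq: "to_ac \<gamma> = to_ac v ^ 2 + to_ac v + to_ac \<gamma>'"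
    proof -
      have "\<gamma> = v ^ 2 + v + \<gamma>'"
        using v by simp
      then have "to_ac \<gamma> = to_ac (v ^ 2 + v + \<gamma>')"
        by (rule arg_cong)
      then show ?thesis
        by simp
    qed
    \<comment> \<open>The isotropic vector: t + v + x has norm \<delta>' z^2, which equals \<delta>
      times the norm of z + q z x.\<close>
    show ?thesis
    proof (rule isotropic_imp_splits[OF charL K(1)])
      have "(t + to_ac v) ^ 2 + (t + to_ac v) * 1 + to_ac \<gamma> * 1 ^ 2 =
        2 * (to_ac v ^ 2 + to_ac v + t ^ 2 + t + t * to_ac v) + to_ac \<delta>' * z ^ 2"
        unfolding \<gamma>_eq tz(3) by (simp add: algebra_simps power2_eq_square)
      also have "\<dots> = to_ac \<delta>' * z ^ 2"
        by (simp add: char2_two_eq_zero[OF charL])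
      also have "\<dots> = to_ac \<delta> * (z ^ 2 + z * (to_ac q * z) + to_ac \<gamma> * (to_ac q * z) ^ 2)"
        unfolding \<delta>'_eq by (simp add: algebra_simps power2_eq_square)
      finally show "(t + to_ac v) ^ 2 + (t + to_ac v) * 1 + to_ac \<gamma> * 1 ^ 2 =
        to_ac \<delta> * (z ^ 2 + z * (to_ac q * z) + to_ac \<gamma> * (to_ac q * z) ^ 2)" .
    qed (use \<delta> in \<open>auto intro!: cl ac tz(1,2)\<close>)
  qed
  then show ?thesis
    using \<gamma>'(1) \<delta>'(1) \<open>\<delta>' \<noteq> 0\<close> by (intro exI[of _ \<gamma>'] exI[of _ \<delta>']) simp
qed

section \<open>Quadratic extensions inside the algebraic closure\<close>

definition simple_extension :: "'a::field alg_closure \<Rightarrow> 'a alg_closure set" where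
  "simple_extension \<theta> = {to_ac a + to_ac b * \<theta> | a b. True}"

lemma range_to_ac_subset_simple_extension: "range to_ac \<subseteq> simple_extension \<theta>"
proof
  fix x :: "'a alg_closure" assume "x \<in> range to_ac"
  then obtain a where "x = to_ac a + to_ac 0 * \<theta>"
    by auto
  then show "x \<in> simple_extension \<theta>"
    unfolding simple_extension_def by blast
qed

lemma generator_in_simple_extension: "\<theta> \<in> simple_extension \<theta>"
proof -
  have "\<theta> = to_ac 0 + to_ac 1 * \<theta>"
    by simp
  then show ?thesis
    unfolding simple_extension_def by blast
qed

lemma simple_extension_eq_0_iff:
  assumes "\<theta> \<notin> range to_ac"
  shows "to_ac a + to_ac b * \<theta> = 0 \<longleftrightarrow> a = 0 \<and> b = 0"
proof
  assume eq: "to_ac a + to_ac b * \<theta> = 0"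
  have "b = 0"
  proof (rule ccontr)
    assume "b \<noteq> 0"
    then have "\<theta> = to_ac (- a / b)"
      using eq by (simp add: field_simps eq_neg_iff_add_eq_0)
    with assms show False by (metis rangeI)
  qed
  with eq show "a = 0 \<and> b = 0"
    by simp
qed simp

lemma field_closed_simple_extension:
  fixes \<theta> :: "'a::field alg_closure"
  assumes char2: "CHAR('a) = 2" and \<theta>: "\<theta> ^ 2 = to_ac s * \<theta> + to_ac N" "\<theta> \<notin> range to_ac"
  shows "field_closed (simple_extension \<theta>)"
  unfolding field_closed_def
proof (intro conjI ballI)
  have charL: "CHAR('a alg_closure) = 2"
    by (simp add: char2)
  have mem: "to_ac a + to_ac b * \<theta> \<in> simple_extension \<theta>" for a b
    unfolding simple_extension_def by blast
  show "0 \<in> simple_extension \<theta>" "1 \<in> simple_extension \<theta>"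
    using range_to_ac_subset_simple_extension[of \<theta>] by (metis rangeI subsetD to_ac_0, metis rangeI subsetD to_ac_1)
  fix x assume "x \<in> simple_extension \<theta>"
  then obtain a b where x: "x = to_ac a + to_ac b * \<theta>"
    by (auto simp: simple_extension_def)
  {
    fix y assume "y \<in> simple_extension \<theta>"
    then obtain c d where y: "y = to_ac c + to_ac d * \<theta>"
      by (auto simp: simple_extension_def)
    have "x + y = to_ac (a + c) + to_ac (b + d) * \<theta>"
      by (simp add: x y algebra_simps)
    then show "x + y \<in> simple_extension \<theta>"
      using mem by metis
    have "x * y = to_ac a * to_ac c + (to_ac a * to_ac d + to_ac b * to_ac c) * \<theta> + to_ac b * to_ac d * \<theta> ^ 2"
      by (simp add: x y algebra_simps power2_eq_square)
    also have "\<dots> = to_ac (a * c + b * d * N) + to_ac (a * d + b * c + b * d * s) * \<theta>"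
      unfolding \<theta>(1) by (simp add: algebra_simps)
    finally show "x * y \<in> simple_extension \<theta>"
      using mem by metis
  }
  show "inverse x \<in> simple_extension \<theta>"
  proof (cases "x = 0")
    case True
    then show ?thesis
      using mem[of 0 0] by simp
  next
    case False
    define n where "n = a ^ 2 + a * b * s + b ^ 2 * N"
    \<comment> \<open>The conjugate of x, obtained by replacing \<theta> with s + \<theta>; the
      product x y is the norm and lies in the base field.\<close>
    define y where "y = to_ac (a + b * s) + to_ac b * \<theta>"
    have "x * y = to_ac a ^ 2 + to_ac a * to_ac b * to_ac s + to_ac b ^ 2 * (\<theta> ^ 2 + to_ac s * \<theta>) + 2 * (to_ac a * to_ac b * \<theta>)"
      by (simp add: x y_def algebra_simps power2_eq_square)
    also have "\<theta> ^ 2 + to_ac s * \<theta> = to_ac N"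
      unfolding \<theta>(1) using char2_add_self[OF charL, of "to_ac s * \<theta>"] by (simp add: add_ac)
    finally have xy: "x * y = to_ac n"
      by (simp add: n_def char2_two_eq_zero[OF charL])
    have "y \<noteq> 0"
    proof
      assume "y = 0"
      then have "a + b * s = 0 \<and> b = 0"
        unfolding y_def simple_extension_eq_0_iff[OF \<theta>(2)] .
      with False x show False by auto
    qed
    with False xy have "n \<noteq> 0"
      by auto
    then have "inverse x = to_ac ((a + b * s) / n) + to_ac (b / n) * \<theta>"
      using xy False by (simp add: inverse_eq_divide y_def field_simps)
    then show ?thesis
      using mem by metis
  qed
qed

lemma field_closed_range_to_ac: "field_closed (range to_ac)"
  unfolding field_closed_def
proof (intro conjI ballI)
  show "0 \<in> range to_ac" "1 \<in> range to_ac"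
    by (metis rangeI to_ac_0, metis rangeI to_ac_1)
  show "x + y \<in> range to_ac" "x * y \<in> range to_ac" if "x \<in> range to_ac" "y \<in> range to_ac" for x y
    using that by (auto simp flip: to_ac_add to_ac_mult)
  show "inverse x \<in> range to_ac" if "x \<in> range to_ac" for x
    using that by (auto simp flip: to_ac_inverse)
qed

text \<open>Elements of the three algebras with equal reduced traces \<open>s\<close> and equal reduced norms \<open>N\<close>,
  modulo a common scalar, form a nine-dimensional space; two quadratic equations in nine variables are solvable.\<close>

lemma common_subfield_nonsplit:
  fixes \<gamma> \<delta> :: "nat \<Rightarrow> 'e::field fls"
  assumes char2: "CHAR('e) = 2" and sol: "quadrics_solvable TYPE('e poly) 4"
    and lp: "\<And>i. i < 3 \<Longrightarrow> laurent_poly (\<gamma> i)" "\<And>i. i < 3 \<Longrightarrow> laurent_poly (\<delta> i)"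
    and \<delta>: "\<And>i. i < 3 \<Longrightarrow> \<delta> i \<noteq> 0"
    and ns: "\<And>i. i < 3 \<Longrightarrow> \<not> splits_in (range to_ac) (to_ac (\<gamma> i)) (to_ac (\<delta> i))"
  shows "\<exists>\<theta> s N. \<theta> ^ 2 = to_ac s * \<theta> + to_ac N \<and> \<theta> \<notin> range to_ac \<and>
    (\<forall>i<3. splits_in (simple_extension \<theta>) (to_ac (\<gamma> i)) (to_ac (\<delta> i)))"
proof -
  have charF: "CHAR('e fls) = 2" and charL: "CHAR('e fls alg_closure) = 2"
    by (simp_all add: char2)
  \<comment> \<open>Coordinates: x_0 is the trace s, x_1 and x_2 are T_1 and T_2, where T_0 = 0 uses
    up the common scalar, and x_3, ..., x_8 are the pairs z_i, w_i. The list consists of the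
    monomials of norm 0 plus norm l + 1.\<close>
  define cs where "cs = (\<lambda>l. [(\<gamma> 0 + \<gamma> (l + 1), 0, 0), (1, 0, l + 1), (1, l + 1, l + 1),
    (\<delta> 0, 3, 3), (\<delta> 0, 3, 4), (\<delta> 0 * \<gamma> 0, 4, 4),
    (\<delta> (l + 1), 2 * l + 5, 2 * l + 5), (\<delta> (l + 1), 2 * l + 5, 2 * l + 6),
    (\<delta> (l + 1) * \<gamma> (l + 1), 2 * l + 6, 2 * l + 6)] :: ('e fls \<times> nat \<times> nat) list)"
  have "\<exists>a. (\<forall>i j. laurent_poly (a i j)) \<and> (l < 2 \<longrightarrow> (\<forall>x. quad 9 a x = (\<Sum>(c, p, q)\<leftarrow>cs l. c * (x p * x q))))" for l
  proof (cases "l < 2")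
    case True
    then have "\<exists>a. (\<forall>i j. laurent_poly (a i j)) \<and> (\<forall>x. quad 9 a x = (\<Sum>(c, p, q)\<leftarrow>cs l. c * (x p * x q)))"
      by (intro quad_of_monomials) (auto simp: cs_def intro!: laurent_poly_add laurent_poly_mult laurent_poly_1 lp)
    then show ?thesis by auto
  next
    case False
    then show ?thesis
      using laurent_poly_0 by (intro exI[of _ "\<lambda>_ _. 0"]) simp
  qed
  then obtain a where a: "\<And>l i j. laurent_poly (a l i j)"
    "\<And>l x. l < 2 \<Longrightarrow> quad 9 (a l) x = (\<Sum>(c, p, q)\<leftarrow>cs l. c * (x p * x q))"
    by metis
  \<comment> \<open>Here 4 * 2 < 9 is what makes the count work.\<close>
  obtain x where x: "\<exists>i<9. x i \<noteq> 0" "\<And>l. l < 2 \<Longrightarrow> quad 9 (a l) x = 0"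
    using laurent_quadrics_solvable[where a = a and m = 2 and n = 9, OF sol _ a(1)] by auto
  define s where "s = x 0"
  define T where "T = (\<lambda>i. if i = 0 then 0 else x i)"
  define z where "z = (\<lambda>i. x (2 * i + 3))"
  define w where "w = (\<lambda>i. x (2 * i + 4))"
  define nrm where "nrm = (\<lambda>i. T i ^ 2 + T i * s + \<gamma> i * s ^ 2 + \<delta> i * (z i ^ 2 + z i * w i + \<gamma> i * w i ^ 2))"
  define N where "N = nrm 0"
  have eq: "nrm i = N" if i: "i < 3" for i
  proof (cases "i = 0")
    case False
    define l where "l = i - 1"
    have l: "i = l + 1" "l < 2"
      using i False by (auto simp: l_def)
    have "N + nrm i = (\<Sum>(c, p, q)\<leftarrow>cs l. c * (x p * x q))"
      unfolding N_def nrm_def cs_def T_def z_def w_def s_def l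
      by (simp add: algebra_simps power2_eq_square numeral_eq_Suc)
    also have "\<dots> = 0"
      using a(2)[OF l(2)] x(2)[OF l(2)] by simp
    finally show ?thesis
      using char2_move[OF charF, of N "nrm i" 0] by simp
  qed (simp add: N_def)
  \<comment> \<open>If s and all z_i, w_i were 0, equality of the norms would read T_i^2 = T_0^2 =
    0, so the solution would be trivial.\<close>
  have nontriv: "\<exists>i<3. s \<noteq> 0 \<or> z i \<noteq> 0 \<or> w i \<noteq> 0"
  proof (rule ccontr)
    assume neg: "\<not> ?thesis"
    then have 0: "s = 0" "\<And>i. i < 3 \<Longrightarrow> z i = 0" "\<And>i. i < 3 \<Longrightarrow> w i = 0"
      by (auto dest: spec[of _ "0::nat"])
    then have "N = 0"
      by (simp add: N_def nrm_def T_def)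
    then have T: "T i = 0" if "i < 3" for i
      using eq[OF that] 0 that by (simp add: nrm_def)
    have "x i = 0" if "i < 9" for i
    proof -
      have "i \<in> {0,1,2,3,4,5,6,7,8}"
        using that by auto
      then show ?thesis
        using 0(1) 0(2)[of 0] 0(2)[of 1] 0(2)[of 2] 0(3)[of 0] 0(3)[of 1] 0(3)[of 2] T[of 1] T[of 2]
        by (auto simp: s_def z_def w_def T_def)
    qed
    with x(1) show False by blast
  qed
  obtain \<theta> where "poly [:to_ac N, to_ac s, 1:] \<theta> = 0"
    using alg_closed_imp_poly_has_root[of "[:to_ac N, to_ac s, 1:]"] by auto
  then have "(to_ac s * \<theta> + to_ac N) + \<theta> ^ 2 = 0"
    by (simp add: algebra_simps power2_eq_square)
  from char2_move[OF charL this] have \<theta>: "\<theta> ^ 2 = to_ac s * \<theta> + to_ac N"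
    by simp
  \<comment> \<open>The element T_i + s x + (z_i + w_i x) y has trace s and norm N, and \<theta> is
    a root of its characteristic polynomial. Adding \<theta> to it therefore gives an element of
    norm 0.\<close>
  have iso: "(to_ac (T i) + \<theta>) ^ 2 + (to_ac (T i) + \<theta>) * to_ac s + to_ac (\<gamma> i) * to_ac s ^ 2 =
      to_ac (\<delta> i) * (to_ac (z i) ^ 2 + to_ac (z i) * to_ac (w i) + to_ac (\<gamma> i) * to_ac (w i) ^ 2)"
    if "i < 3" for i
  proof -
    define Q where "Q = to_ac (\<delta> i) * (to_ac (z i) ^ 2 + to_ac (z i) * to_ac (w i) + to_ac (\<gamma> i) * to_ac (w i) ^ 2)"
    define P where "P = to_ac (T i) ^ 2 + to_ac (T i) * to_ac s + to_ac (\<gamma> i) * to_ac s ^ 2"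
    have "P + Q = to_ac (nrm i)"
      by (simp add: P_def Q_def nrm_def)
    then have PQ: "Q = P + to_ac N"
      using eq[OF that] char2_move[OF charL] by metis
    have "(to_ac (T i) + \<theta>) ^ 2 + (to_ac (T i) + \<theta>) * to_ac s + to_ac (\<gamma> i) * to_ac s ^ 2 =
      P + \<theta> ^ 2 + \<theta> * to_ac s + 2 * (to_ac (T i) * \<theta>)"
      by (simp add: P_def algebra_simps power2_eq_square)
    also have "\<dots> = P + to_ac N + 2 * (\<theta> * to_ac s)"
      unfolding \<theta> by (simp add: char2_two_eq_zero[OF charL])
    finally show ?thesis
      by (simp add: char2_two_eq_zero[OF charL] PQ[unfolded Q_def])
  qed
  \<comment> \<open>A root in the base field would give an isotropic vector there and split one of
    the algebras, contrary to \<open>ns\<close>.\<close>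
  have \<theta>_notin: "\<theta> \<notin> range to_ac"
  proof
    assume "\<theta> \<in> range to_ac"
    then obtain f where f: "\<theta> = to_ac f"
      by auto
    obtain i where i: "i < 3" "s \<noteq> 0 \<or> z i \<noteq> 0 \<or> w i \<noteq> 0"
      using nontriv by blast
    have "splits_in (range to_ac) (to_ac (\<gamma> i)) (to_ac (\<delta> i))"
      by (rule isotropic_imp_splits[OF charL field_closed_range_to_ac _ _ _ _ _ _ _ iso[OF i(1)]])
        (use i \<delta> in \<open>auto simp: f simp flip: to_ac_add\<close>)
    with ns i(1) show False by blast
  qed
  have K: "field_closed (simple_extension \<theta>)"
    using field_closed_simple_extension[OF charF \<theta> \<theta>_notin] .
  have ac: "to_ac f \<in> simple_extension \<theta>" for f
    using range_to_ac_subset_simple_extension by auto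
  have "splits_in (simple_extension \<theta>) (to_ac (\<gamma> i)) (to_ac (\<delta> i))" if i: "i < 3" for i
  proof (rule isotropic_imp_splits[OF charL K _ _ _ _ _ _ _ iso[OF i]])
    show "to_ac (T i) + \<theta> \<in> simple_extension \<theta>"
      by (intro field_closedD[OF K] ac generator_in_simple_extension)
    have "to_ac (T i) + \<theta> \<noteq> 0"
    proof
      assume "to_ac (T i) + \<theta> = 0"
      then have "\<theta> = to_ac (T i)"
        using char2_move[OF charL] by (metis add_0_right)
      with \<theta>_notin show False by auto
    qed
    then show "to_ac (T i) + \<theta> \<noteq> 0 \<or> to_ac s \<noteq> 0 \<or> to_ac (z i) \<noteq> 0 \<or> to_ac (w i) \<noteq> 0"
      by simp
  qed (use \<delta>[OF i] in \<open>auto intro: ac\<close>)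
  with \<theta> \<theta>_notin show ?thesis
    by blast
qed

text \<open>Algebras that are split from the outset would spoil the argument that \<theta> generates
  a proper extension. They are replaced by a nonsplit one of the family; whatever splits that one
  contains the base field and splits them too.\<close>

theorem common_splitting_extension:
  fixes \<gamma> \<delta> :: "nat \<Rightarrow> 'e::field fls"
  assumes char2: "CHAR('e) = 2" and sol: "quadrics_solvable TYPE('e) 2"
    and \<delta>: "\<And>i. i < 3 \<Longrightarrow> \<delta> i \<noteq> 0"
  shows "\<exists>\<theta> s N. \<theta> ^ 2 = to_ac s * \<theta> + to_ac N \<and> \<theta> \<notin> range to_ac \<and>
    (\<forall>i<3. splits_in (simple_extension \<theta>) (to_ac (\<gamma> i)) (to_ac (\<delta> i)))"
proof -
  have charF: "CHAR('e fls) = 2"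
    by (simp add: char2)
  have sol4: "quadrics_solvable TYPE('e poly) 4"
    using quadrics_solvable_poly[OF sol] by simp
  define S where "S = (\<lambda>K i. splits_in K (to_ac (\<gamma> i)) (to_ac (\<delta> i)))"
  have S_mono: "S K i" if "S (range to_ac) i" "range to_ac \<subseteq> K" for K i
    using that unfolding S_def splits_in_def by blast
  show ?thesis
  proof (cases "\<forall>i<3. S (range to_ac) i")
    case True
    \<comment> \<open>Any quadratic extension will do here; X has no square root because squares
      have only even exponents.\<close>
    obtain \<theta> :: "'e fls alg_closure" where \<theta>: "\<theta> ^ 2 = to_ac fls_X"
      using nth_root_exists[of 2 "to_ac fls_X"] by auto
    have "\<theta> \<notin> range to_ac"
    proof
      assume "\<theta> \<in> range to_ac"
      then obtain f where "\<theta> = to_ac f" by auto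
      then have f: "f ^ 2 = fls_X"
        using \<theta> by (simp flip: to_ac_power)
      have "fls_nth (f ^ 2) 1 = 0"
        by (simp add: fls_square_nth[OF char2])
      then show False
        unfolding f by simp
    qed
    moreover have "S (simple_extension \<theta>) i" if "i < 3" for i
      using S_mono True that range_to_ac_subset_simple_extension by blast
    ultimately show ?thesis
      using \<theta> unfolding S_def by (intro exI[of _ \<theta>] exI[of _ 0] exI[of _ fls_X]) simp
  next
    case False
    then obtain i0 where i0: "i0 < 3" "\<not> S (range to_ac) i0"
      by blast
    \<comment> \<open>Reindexing that puts the nonsplit algebra \<open>i0\<close> in the place of
      the split ones.\<close>
    define r where "r = (\<lambda>i. if S (range to_ac) i then i0 else i)"
    have r: "r i < 3" "\<not> S (range to_ac) (r i)" if "i < 3" for i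
      using that i0 by (auto simp: r_def)
    have "\<exists>\<gamma>' \<delta>'. i < 3 \<longrightarrow> laurent_poly \<gamma>' \<and> laurent_poly \<delta>' \<and> \<delta>' \<noteq> 0 \<and>
      (\<forall>K. field_closed K \<longrightarrow> range to_ac \<subseteq> K \<longrightarrow> splits_in K (to_ac \<gamma>') (to_ac \<delta>') \<longrightarrow> S K (r i))" for i
      using splits_in_approximation[OF char2 \<delta>[OF r(1)], of i "\<gamma> (r i)"] unfolding S_def by blast
    then obtain \<gamma>' \<delta>' where ap: "\<And>i. i < 3 \<Longrightarrow> laurent_poly (\<gamma>' i) \<and> laurent_poly (\<delta>' i) \<and> \<delta>' i \<noteq> 0 \<and>
      (\<forall>K. field_closed K \<longrightarrow> range to_ac \<subseteq> K \<longrightarrow> splits_in K (to_ac (\<gamma>' i)) (to_ac (\<delta>' i)) \<longrightarrow> S K (r i))"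
      by metis
    have "\<not> splits_in (range to_ac) (to_ac (\<gamma>' i)) (to_ac (\<delta>' i))" if "i < 3" for i
      using ap[OF that] r(2)[OF that] field_closed_range_to_ac by blast
    then obtain \<theta> s N where \<theta>: "\<theta> ^ 2 = to_ac s * \<theta> + to_ac N" "\<theta> \<notin> range to_ac"
      "\<forall>i<3. splits_in (simple_extension \<theta>) (to_ac (\<gamma>' i)) (to_ac (\<delta>' i))"
      using common_subfield_nonsplit[OF char2 sol4, of \<gamma>' \<delta>'] ap by auto
    have "S (simple_extension \<theta>) i" if i: "i < 3" for i
    proof (cases "S (range to_ac) i")
      case True
      then show ?thesis
        using S_mono range_to_ac_subset_simple_extension by blast
    next
      case False
      then have "r i = i"
        by (simp add: r_def)
      then show ?thesis
        using ap[OF i] \<theta>(3) i field_closed_simple_extension[OF charF \<theta>(1,2)]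
          range_to_ac_subset_simple_extension[of \<theta>] by metis
    qed
    then show ?thesis
      using \<theta>(1,2) unfolding S_def by blast
  qed
qed

section \<open>Four algebras without a common splitting field\<close>

text \<open>The leading term of \<open>f\<close> is \<open>c \<alpha>\<^sup>i \<beta>\<^sup>j\<close>, in the lexicographic order of the exponents \<open>(j, i)\<close>.\<close>

definition lead :: "'k::field fls fls \<Rightarrow> int \<Rightarrow> int \<Rightarrow> 'k \<Rightarrow> bool" where
  "lead f j i c \<longleftrightarrow> (\<forall>j'<j. fls_nth f j' = 0) \<and> (\<forall>i'<i. fls_nth (fls_nth f j) i' = 0) \<and>
     fls_nth (fls_nth f j) i = c \<and> c \<noteq> 0"

text \<open>All terms come strictly after (j, i) in the lexicographic order. The zero series
  qualifies, so mixed terms that may vanish need no separate treatment.\<close>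

definition above :: "'k::field fls fls \<Rightarrow> int \<Rightarrow> int \<Rightarrow> bool" where
  "above f j i \<longleftrightarrow> (\<forall>j'<j. fls_nth f j' = 0) \<and> (\<forall>i'\<le>i. fls_nth (fls_nth f j) i' = 0)"

lemma lead_exists:
  assumes "f \<noteq> 0"
  shows "\<exists>j i c. lead f j i c"
proof -
  define g where "g = fls_nth f (fls_subdegree f)"
  have "g \<noteq> 0"
    using assms by (simp add: g_def)
  then have "lead f (fls_subdegree f) (fls_subdegree g) (fls_nth g (fls_subdegree g))"
    by (simp add: lead_def g_def)
  then show ?thesis by blast
qed

lemma lead_nonzero: "lead f j i c \<Longrightarrow> f \<noteq> 0"
  by (auto simp: lead_def)

lemma above_0: "above 0 j i"
  by (simp add: above_def)

lemma above_add: "above f j i \<Longrightarrow> above g j i \<Longrightarrow> above (f + g) j i"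
  by (simp add: above_def)

lemma above_sum: "(\<And>k. k \<in> S \<Longrightarrow> above (f k) j i) \<Longrightarrow> above (sum f S) j i"
  by (induction S rule: infinite_finite_induct) (auto intro: above_0 above_add)

lemma lead_add_above: "lead f j i c \<Longrightarrow> above g j i \<Longrightarrow> lead (f + g) j i c"
  by (simp add: lead_def above_def)

lemma lead_imp_above:
  assumes "lead f j i c" "a < j \<or> a = j \<and> b < i"
  shows "above f a b"
  using assms by (auto simp: lead_def above_def)

lemma lead_unique:
  assumes "lead f j i c" "lead f j' i' c'"
  shows "j = j'" "i = i'" "c = c'"
proof -
  have nz: "fls_nth f j \<noteq> 0" "fls_nth f j' \<noteq> 0"
    using assms by (auto simp: lead_def)
  show j: "j = j'"
    using assms nz unfolding lead_def by (metis linorder_neqE)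
  show i: "i = i'"
    using assms j unfolding lead_def by (metis linorder_neqE)
  show "c = c'"
    using assms i j by (simp add: lead_def)
qed

lemma lead_mult:
  assumes "lead f j i c" "lead g j' i' c'"
  shows "lead (f * g) (j + j') (i + i') (c * c')"
proof -
  have *: "fls_subdegree h = n" if "fls_nth h n \<noteq> 0" "\<forall>k<n. fls_nth h k = 0" for h :: "'z::field fls" and n
    using that by (intro fls_subdegree_eqI) auto
  have nz: "fls_nth f j \<noteq> 0" "fls_nth g j' \<noteq> 0"
    using assms by (auto simp: lead_def)
  have sd: "fls_subdegree f = j" "fls_subdegree g = j'"
    using assms nz by (auto simp: lead_def intro!: *)
  have sd': "fls_subdegree (fls_nth f j) = i" "fls_subdegree (fls_nth g j') = i'"
    using assms by (auto simp: lead_def intro!: *)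
  have fg: "fls_nth (f * g) (j + j') = fls_nth f j * fls_nth g j'"
    using fls_times_base[of f g] by (simp add: sd)
  have "fls_nth (fls_nth f j * fls_nth g j') (i + i') = c * c'"
    using fls_times_base[of "fls_nth f j" "fls_nth g j'"] assms by (simp add: sd' lead_def)
  moreover have "fls_nth (fls_nth f j * fls_nth g j') k = 0" if "k < i + i'" for k
    using that by (intro fls_times_nth_eq0) (simp add: sd')
  moreover have "fls_nth (f * g) k = 0" if "k < j + j'" for k
    using that by (intro fls_times_nth_eq0) (simp add: sd)
  ultimately show ?thesis
    using assms by (simp add: lead_def fg)
qed

lemma lead_square: "lead f j i c \<Longrightarrow> lead (f ^ 2) (2 * j) (2 * i) (c ^ 2)"
  using lead_mult[of f j i c f j i c] by (simp add: power2_eq_square)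

lemma lex_minimum:
  fixes J I :: "'a \<Rightarrow> int"
  assumes "finite S" "S \<noteq> {}"
  shows "\<exists>k\<in>S. \<forall>l\<in>S. J k < J l \<or> J k = J l \<and> I k \<le> I l"
  using assms
proof (induction S rule: finite_ne_induct)
  case (insert x S)
  then obtain k where k: "k \<in> S" "\<forall>l\<in>S. J k < J l \<or> J k = J l \<and> I k \<le> I l"
    by blast
  show ?case
  proof (cases "J k < J x \<or> J k = J x \<and> I k \<le> I x")
    case True
    with k show ?thesis by blast
  next
    case False
    then have "\<forall>l\<in>insert x S. J x < J l \<or> J x = J l \<and> I x \<le> I l"
      using k(2) by force
    then show ?thesis by blast
  qed
qed auto

text \<open>Summands with pairwise different leading exponents cannot cancel, so the smallest one
  leads the sum.\<close>

lemma lead_sum: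
  assumes S: "finite S" "S \<noteq> {}" and l: "\<And>k. k \<in> S \<Longrightarrow> lead (f k) (J k) (I k) (C k)"
    and dist: "\<And>k l. k \<in> S \<Longrightarrow> l \<in> S \<Longrightarrow> k \<noteq> l \<Longrightarrow> J k \<noteq> J l \<or> I k \<noteq> I l"
  shows "\<exists>k\<in>S. lead (sum f S) (J k) (I k) (C k) \<and> (\<forall>l\<in>S. J k < J l \<or> J k = J l \<and> I k \<le> I l)"
proof -
  obtain k where k: "k \<in> S" "\<forall>l\<in>S. J k < J l \<or> J k = J l \<and> I k \<le> I l"
    using lex_minimum[OF S] by blast
  have "above (f l) (J k) (I k)" if "l \<in> S - {k}" for l
  proof (rule lead_imp_above)
    show "lead (f l) (J l) (I l) (C l)"
      using l that by simp
    have "J k < J l \<or> J k = J l \<and> I k \<le> I l" "J k \<noteq> J l \<or> I k \<noteq> I l"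
      using k that dist[of k l] by auto
    then show "J k < J l \<or> J k = J l \<and> I k < I l"
      by auto
  qed
  then have "lead (f k + sum f (S - {k})) (J k) (I k) (C k)"
    using l[OF k(1)] by (intro lead_add_above above_sum) auto
  then show ?thesis
    using k S(1) by (auto simp: sum.remove)
qed

text \<open>The reduced norm of t + s x + (z + w x) y, an element of trace s.\<close>

definition norm_form :: "'a::comm_ring_1 \<Rightarrow> 'a \<Rightarrow> 'a \<Rightarrow> 'a \<Rightarrow> 'a \<Rightarrow> 'a \<Rightarrow> 'a" where
  "norm_form \<gamma> \<delta> s t z w = t ^ 2 + s * t + \<gamma> * s ^ 2 + \<delta> * (z ^ 2 + z * w + \<gamma> * w ^ 2)"

text \<open>When the values of \<open>1\<close>, \<open>\<gamma>\<close>, \<open>\<delta>\<close>, \<open>\<gamma>\<delta>\<close> are distinct modulo 2 and \<open>\<gamma>\<close> has a pole, the square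
  terms of the norm form have distinct values and the mixed terms \<open>s t\<close> and \<open>\<delta> z w\<close> are of higher order.\<close>

lemma lead_norm_form:
  fixes \<gamma> \<delta> t z w s :: "'k::field fls fls"
  assumes \<gamma>: "lead \<gamma> g1 g2 cg" and \<delta>: "lead \<delta> d1 d2 cd"
    and neg: "g1 < 0 \<or> g1 = 0 \<and> g2 < 0"
    and par: "odd g1 \<or> odd g2" "odd d1 \<or> odd d2" "odd (g1 + d1) \<or> odd (g2 + d2)"
    and s: "s = 0 \<or> s = 1" and nz: "t \<noteq> 0 \<or> s \<noteq> 0 \<or> z \<noteq> 0 \<or> w \<noteq> 0"
  shows "\<exists>j i c. lead (norm_form \<gamma> \<delta> s t z w) j i c \<and>
    (even j \<and> even i \<and> t \<noteq> 0 \<or> s = 1 \<and> j = g1 \<and> i = g2 \<and> c = cg \<or>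
     even (j - d1) \<and> even (i - d2) \<and> z \<noteq> 0 \<or> even (j - (g1 + d1)) \<and> even (i - (g2 + d2)) \<and> w \<noteq> 0) \<and>
    (s = 1 \<longrightarrow> j < g1 \<or> j = g1 \<and> i \<le> g2)"
proof -
  have "\<exists>j i c. f \<noteq> 0 \<longrightarrow> lead f j i c" for f :: "'k fls fls"
    using lead_exists by blast
  then obtain tj ti tc zj zi zc wj wi wc where t: "t \<noteq> 0 \<Longrightarrow> lead t tj ti tc"
    and z: "z \<noteq> 0 \<Longrightarrow> lead z zj zi zc" and w: "w \<noteq> 0 \<Longrightarrow> lead w wj wi wc"
    by metis
  define f where "f = (\<lambda>k::nat. if k = 0 then t ^ 2 else if k = 1 then \<gamma> * s ^ 2 else if k = 2 then \<delta> * z ^ 2 else \<gamma> * \<delta> * w ^ 2)"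
  define J where "J = (\<lambda>k::nat. if k = 0 then 2 * tj else if k = 1 then g1 else if k = 2 then d1 + 2 * zj else g1 + d1 + 2 * wj)"
  define I where "I = (\<lambda>k::nat. if k = 0 then 2 * ti else if k = 1 then g2 else if k = 2 then d2 + 2 * zi else g2 + d2 + 2 * wi)"
  define C where "C = (\<lambda>k::nat. if k = 0 then tc ^ 2 else if k = 1 then cg else if k = 2 then cd * zc ^ 2 else cg * cd * wc ^ 2)"
  define S where "S = {k. k < 4 \<and> f k \<noteq> 0}"
  have \<gamma>\<delta>: "\<gamma> \<noteq> 0" "\<delta> \<noteq> 0"
    using \<gamma> \<delta> lead_nonzero by auto
  have four: "k = 0 \<or> k = 1 \<or> k = 2 \<or> k = 3" if "k < 4" for k :: nat
    using that by auto
  have S: "finite S" "S \<subseteq> {..<4}"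
    by (auto simp: S_def)
  have mem: "0 \<in> S \<longleftrightarrow> t \<noteq> 0" "1 \<in> S \<longleftrightarrow> s \<noteq> 0" "2 \<in> S \<longleftrightarrow> z \<noteq> 0" "3 \<in> S \<longleftrightarrow> w \<noteq> 0"
    using \<gamma>\<delta> by (auto simp: S_def f_def)
  have "S \<noteq> {}"
    using nz mem by blast
  have lf: "lead (f k) (J k) (I k) (C k)" if "k \<in> S" for k
  proof -
    have "k < 4"
      using that by (simp add: S_def)
    then consider "k = 0" | "k = 1" | "k = 2" | "k = 3"
      using four by blast
    then show ?thesis
    proof cases
      case 1
      then show ?thesis
        using t mem that by (simp add: f_def J_def I_def C_def lead_square)
    next
      case 2
      then have "s = 1"
        using s mem that by auto
      then show ?thesis
        using \<gamma> 2 by (simp add: f_def J_def I_def C_def)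
    next
      case 3
      then show ?thesis
        using lead_mult[OF \<delta> lead_square[OF z]] mem that by (simp add: f_def J_def I_def C_def)
    next
      case 4
      then show ?thesis
        using lead_mult[OF lead_mult[OF \<gamma> \<delta>] lead_square[OF w]] mem that by (simp add: f_def J_def I_def C_def)
    qed
  qed
  have dist: "J k \<noteq> J l \<or> I k \<noteq> I l" if "k \<in> S" "l \<in> S" "k \<noteq> l" for k l
  proof -
    \<comment> \<open>The classes of the four exponent pairs modulo 2 are those of 1, \<gamma>,
      \<delta> and \<gamma>\<delta>. Squares do not affect them, and the hypotheses
      \<open>par\<close> make them distinct.\<close>
    define p where "p = (\<lambda>k. (even (J k), even (I k)))"
    have p: "p 0 = (True, True)" "p 1 = (even g1, even g2)" "p 2 = (even d1, even d2)"
      "p 3 = (even g1 = even d1, even g2 = even d2)"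
      by (auto simp: p_def J_def I_def)
    have "p 0 \<noteq> p 1" "p 0 \<noteq> p 2" "p 0 \<noteq> p 3" "p 1 \<noteq> p 2" "p 1 \<noteq> p 3" "p 2 \<noteq> p 3"
      using par unfolding p prod.inject even_add by argo+
    moreover have "k < 4" "l < 4"
      using that by (auto simp: S_def)
    ultimately have "p k \<noteq> p l"
      using four[of k] four[of l] \<open>k \<noteq> l\<close> by metis
    then show ?thesis
      unfolding p_def by auto
  qed
  have "\<exists>k\<in>S. lead (sum f S) (J k) (I k) (C k) \<and> (\<forall>l\<in>S. J k < J l \<or> J k = J l \<and> I k \<le> I l)"
    by (rule lead_sum[OF S(1) \<open>S \<noteq> {}\<close> lf dist])
  then obtain k where k: "k \<in> S" and lk: "lead (sum f S) (J k) (I k) (C k)"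
    and min': "\<forall>l\<in>S. J k < J l \<or> J k = J l \<and> I k \<le> I l"
    by (elim bexE conjE)
  have min: "J k < J l \<or> J k = J l \<and> I k \<le> I l" if "l \<in> S" for l
    using min' that by (rule bspec)
  have "sum f S = sum f {..<4}"
    by (rule sum.mono_neutral_left) (auto simp: S_def)
  then have sumf: "sum f S = t ^ 2 + \<gamma> * s ^ 2 + \<delta> * z ^ 2 + \<gamma> * \<delta> * w ^ 2"
    by (simp add: f_def numeral_eq_Suc)
  have st: "above (s * t) (J k) (I k)"
  proof (cases "s = 0 \<or> t = 0")
    case True
    then show ?thesis by (auto simp: above_0)
  next
    case False
    then have "J k < 2 * tj \<or> J k = 2 * tj \<and> I k \<le> 2 * ti" "J k < g1 \<or> J k = g1 \<and> I k \<le> g2"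
      using min[of 0] min[of 1] mem by (auto simp: J_def I_def)
    \<comment> \<open>Write v for the exponent of \<open>t\<close>. The minimum is at most 2 v and
      at most the negative exponent of \<gamma>; for negative v the first bound is below v, for
      nonnegative v the second one is.\<close>
    then have "J k < tj \<or> J k = tj \<and> I k < ti"
      using neg by (cases "tj < 0"; cases "tj = 0") auto
    then show ?thesis
      using False s lead_imp_above[OF t] by auto
  qed
  have zw: "above (\<delta> * (z * w)) (J k) (I k)"
  proof (cases "z = 0 \<or> w = 0")
    case True
    then show ?thesis by (auto simp: above_0)
  next
    case False
    then have "J k < d1 + 2 * zj \<or> J k = d1 + 2 * zj \<and> I k \<le> d2 + 2 * zi"
      "J k < g1 + d1 + 2 * wj \<or> J k = g1 + d1 + 2 * wj \<and> I k \<le> g2 + d2 + 2 * wi"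
      using min[of 2] min[of 3] mem by (auto simp: J_def I_def)
    \<comment> \<open>The mean of the two bounds is the exponent of \<delta> z w plus half of that
      of \<gamma>, which is negative.\<close>
    then have "J k < d1 + (zj + wj) \<or> J k = d1 + (zj + wj) \<and> I k < d2 + (zi + wi)"
      using neg by auto
    then show ?thesis
      using False lead_imp_above[OF lead_mult[OF \<delta> lead_mult[OF z w]]] by auto
  qed
  have "norm_form \<gamma> \<delta> s t z w = sum f S + (s * t + \<delta> * (z * w))"
    unfolding norm_form_def sumf by (simp add: algebra_simps)
  then have lead: "lead (norm_form \<gamma> \<delta> s t z w) (J k) (I k) (C k)"
    using lead_add_above[OF lk above_add[OF st zw]] by simp
  have "s = 1 \<longrightarrow> J k < g1 \<or> J k = g1 \<and> I k \<le> g2"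
    using min[of 1] mem by (auto simp: J_def I_def)
  moreover have "even (J k) \<and> even (I k) \<and> t \<noteq> 0 \<or> s = 1 \<and> J k = g1 \<and> I k = g2 \<and> C k = cg \<or>
     even (J k - d1) \<and> even (I k - d2) \<and> z \<noteq> 0 \<or> even (J k - (g1 + d1)) \<and> even (I k - (g2 + d2)) \<and> w \<noteq> 0"
    using four[of k] k mem s by (auto simp: S_def J_def I_def C_def)
  ultimately show ?thesis
    using lead by blast
qed

text \<open>The equations say that \<open>\<gamma> = T\<^sup>2 + T + \<delta> Z\<^sup>2\<close> for \<open>T = t\<^sub>0 + t\<^sub>1 \<theta>\<close>, \<open>Z = z\<^sub>0 + z\<^sub>1 \<theta>\<close> with \<open>\<theta>\<^sup>2 = s \<theta> + N\<close>;
  then \<open>[\<gamma>,\<delta>)\<close> contains a root of \<open>x\<^sup>2 + s x + N\<close> outside of the centre.\<close>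

lemma splitting_imp_norm_form:
  fixes \<gamma> \<delta> :: "'a::field"
  assumes char2: "CHAR('a) = 2" and \<delta>: "\<delta> \<noteq> 0" and s: "s = 0 \<or> s = 1"
    and eq1: "\<gamma> = t0 ^ 2 + N * t1 ^ 2 + t0 + \<delta> * (z0 ^ 2 + N * z1 ^ 2)"
    and eq2: "s * t1 ^ 2 + t1 + \<delta> * (s * z1 ^ 2) = 0"
    and ns: "\<not> splits_in UNIV \<gamma> \<delta>"
  shows "\<exists>t z w. N = norm_form \<gamma> \<delta> s t z w \<and> (s = 1 \<or> z \<noteq> 0 \<or> w \<noteq> 0)"
proof -
  note two = char2_two_eq_zero[OF char2]
  have nz: "t1 \<noteq> 0 \<or> z1 \<noteq> 0"
  proof (rule ccontr)
    assume "\<not> (t1 \<noteq> 0 \<or> z1 \<noteq> 0)"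
    then have "\<gamma> = t0 ^ 2 + t0 + \<delta> * z0 ^ 2"
      using eq1 by simp
    then show False
      using ns unfolding splits_in_def by blast
  qed
  show ?thesis
  proof (cases "s = 0")
    case True
    then have "t1 = 0" "z1 \<noteq> 0"
      using eq2 nz by auto
    have "(t0 ^ 2 + t0 + \<delta> * z0 ^ 2) + \<delta> * N * z1 ^ 2 = \<gamma>"
      using eq1 \<open>t1 = 0\<close> by (simp add: algebra_simps)
    from char2_move[OF char2 this] have "N = (t0 ^ 2 + t0 + \<delta> * z0 ^ 2 + \<gamma>) / (\<delta> * z1 ^ 2)"
      using \<delta> \<open>z1 \<noteq> 0\<close> by (simp add: field_simps)
    \<comment> \<open>For s = 0 the equations are linear in \<open>N\<close>; the quotient is the
      norm of z0/z1 + (t0 + x) y / (\<delta> z1).\<close>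
    also have "\<dots> = norm_form \<gamma> \<delta> s (z0 / z1) (t0 / (\<delta> * z1)) (1 / (\<delta> * z1))"
      using \<delta> \<open>z1 \<noteq> 0\<close> True by (simp add: norm_form_def field_simps power2_eq_square)
    finally show ?thesis
      using \<delta> \<open>z1 \<noteq> 0\<close> by (intro exI[of _ "z0 / z1"] exI[of _ "t0 / (\<delta> * z1)"] exI[of _ "1 / (\<delta> * z1)"]) simp
  next
    case False
    then have s1: "s = 1"
      using s by simp
    have "t1 \<noteq> 0"
      using eq2 nz s1 \<delta> by auto
    \<comment> \<open>For s = 1 the second equation says that 1/t1 = 1 + \<delta> m^2 is the norm of
      1 + m y.\<close>
    define m where "m = z1 / t1"
    have "t1 + (t1 ^ 2 + \<delta> * z1 ^ 2) = 0"
      using eq2 s1 by (simp add: algebra_simps)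
    from char2_move[OF char2 this] have t1: "t1 ^ 2 + \<delta> * z1 ^ 2 = t1"
      by simp
    then have "t1 * (1 + \<delta> * m ^ 2) = 1"
      using \<open>t1 \<noteq> 0\<close> by (simp add: m_def field_simps power2_eq_square)
    then have inv: "1 / t1 = 1 + \<delta> * m ^ 2"
      using \<open>t1 \<noteq> 0\<close> by (simp add: field_simps)
    have "(t0 ^ 2 + t0 + \<delta> * z0 ^ 2) + N * (t1 ^ 2 + \<delta> * z1 ^ 2) = \<gamma>"
      using eq1 by (simp add: algebra_simps)
    from char2_move[OF char2 this] have "N * t1 = t0 ^ 2 + t0 + \<delta> * z0 ^ 2 + \<gamma>"
      unfolding t1 .
    then have "N = (1 / t1) * (t0 ^ 2 + t0 + \<delta> * z0 ^ 2 + \<gamma>)"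
      using \<open>t1 \<noteq> 0\<close> by (simp add: field_simps)
    \<comment> \<open>Multiplicativity of the norm: t0 + x + z0 y times 1 + m y equals t0 + \<delta>
      m z0 + x + (z0 + m t0 + m x) y. The subtracted term is a multiple of 2.\<close>
    also have "\<dots> = norm_form \<gamma> \<delta> s (t0 + \<delta> * m * z0) (z0 + m * t0) m - 2 * (t0 * \<delta> * m * z0 * 2 + \<delta> * m * z0)"
      unfolding inv s1 norm_form_def by (simp add: algebra_simps power2_eq_square)
    also have "\<dots> = norm_form \<gamma> \<delta> s (t0 + \<delta> * m * z0) (z0 + m * t0) m"
      by (simp add: two)
    finally show ?thesis
      using s1 by blast
  qed
qed

theorem four_without_common_splitting:
  assumes char2: "CHAR('k::alg_closed_field) = 2"
  shows "\<exists>\<gamma> \<delta> :: nat \<Rightarrow> 'k fls fls. (\<forall>i<4. \<delta> i \<noteq> 0) \<and>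
    \<not> (\<exists>s N. (s = 0 \<or> s = 1) \<and> (\<forall>i<4. \<exists>t0 t1 z0 z1.
      \<gamma> i = t0 ^ 2 + N * t1 ^ 2 + t0 + \<delta> i * (z0 ^ 2 + N * z1 ^ 2) \<and>
      s * t1 ^ 2 + t1 + \<delta> i * (s * z1 ^ 2) = 0))"
proof -
  have charF: "CHAR('k fls fls) = 2"
    by (simp add: char2)
  \<comment> \<open>A root of T^2 + T + 1 is a concrete element different from 0 and 1.\<close>
  obtain u :: 'k where "poly [:1, 1, 1:] u = 0"
    using alg_closed_imp_poly_has_root[of "[:1, 1, 1 :: 'k:]"] by auto
  then have u: "u \<noteq> 0" "u \<noteq> 1"
    using char2_add_self[OF char2, of 1] by auto
  define a b a' b' :: "'k fls fls" where "a = fls_const fls_X" and "b = fls_X"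
    and "a' = fls_const fls_X_inv" and "b' = fls_X_inv"
  have l: "lead a 0 1 1" "lead b 1 0 1" "lead a' 0 (-1) 1" "lead b' (-1) 0 1" "lead (fls_const (fls_const u)) 0 0 u"
    using u by (auto simp: lead_def a_def b_def a'_def b'_def)
  have l1: "lead (a' * b') (-1) (-1) 1" and l4: "lead (fls_const (fls_const u) * (a' * b')) (-1) (-1) u"
    using lead_mult[OF l(3,4)] lead_mult[OF l(5) lead_mult[OF l(3,4)]] by simp_all
  define \<gamma> where "\<gamma> = (\<lambda>i::nat. if i = 0 then a' * b' else if i = 1 then a' else if i = 2 then b' else fls_const (fls_const u) * (a' * b'))"
  define \<delta> where "\<delta> = (\<lambda>i::nat. if i = 1 then b else a)"
  have nf0: "\<exists>j i c. lead (norm_form (a' * b') a s t z w) j i c \<and>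
      (even j \<and> even i \<and> t \<noteq> 0 \<or> s = 1 \<and> j = - 1 \<and> i = - 1 \<and> c = 1 \<or> even j \<and> odd i \<and> z \<noteq> 0 \<or> odd j \<and> even i \<and> w \<noteq> 0) \<and>
      (s = 1 \<longrightarrow> j < - 1 \<or> j = - 1 \<and> i \<le> - 1)"
    if "s = 0 \<or> s = 1" "t \<noteq> 0 \<or> s \<noteq> 0 \<or> z \<noteq> 0 \<or> w \<noteq> 0" for s t z w :: "'k fls fls"
    using lead_norm_form[OF l1 l(1) _ _ _ _ that] by simp
  have nf1: "\<exists>j i c. lead (norm_form a' b s t z w) j i c \<and>
      (even j \<and> even i \<and> t \<noteq> 0 \<or> s = 1 \<and> j = 0 \<and> i = - 1 \<and> c = 1 \<or> odd j \<and> even i \<and> z \<noteq> 0 \<or> odd j \<and> odd i \<and> w \<noteq> 0) \<and>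
      (s = 1 \<longrightarrow> j < 0 \<or> j = 0 \<and> i \<le> - 1)"
    if "s = 0 \<or> s = 1" "t \<noteq> 0 \<or> s \<noteq> 0 \<or> z \<noteq> 0 \<or> w \<noteq> 0" for s t z w :: "'k fls fls"
    using lead_norm_form[OF l(3) l(2) _ _ _ _ that] by simp
  have nf2: "\<exists>j i c. lead (norm_form b' a s t z w) j i c \<and>
      (even j \<and> even i \<and> t \<noteq> 0 \<or> s = 1 \<and> j = - 1 \<and> i = 0 \<and> c = 1 \<or> even j \<and> odd i \<and> z \<noteq> 0 \<or> odd j \<and> odd i \<and> w \<noteq> 0) \<and>
      (s = 1 \<longrightarrow> j < - 1 \<or> j = - 1 \<and> i \<le> 0)"
    if "s = 0 \<or> s = 1" "t \<noteq> 0 \<or> s \<noteq> 0 \<or> z \<noteq> 0 \<or> w \<noteq> 0" for s t z w :: "'k fls fls"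
    using lead_norm_form[OF l(4) l(1) _ _ _ _ that] by simp
  have nf3: "\<exists>j i c. lead (norm_form (fls_const (fls_const u) * (a' * b')) a s t z w) j i c \<and>
      (even j \<and> even i \<and> t \<noteq> 0 \<or> s = 1 \<and> j = - 1 \<and> i = - 1 \<and> c = u \<or> even j \<and> odd i \<and> z \<noteq> 0 \<or> odd j \<and> even i \<and> w \<noteq> 0) \<and>
      (s = 1 \<longrightarrow> j < - 1 \<or> j = - 1 \<and> i \<le> - 1)"
    if "s = 0 \<or> s = 1" "t \<noteq> 0 \<or> s \<noteq> 0 \<or> z \<noteq> 0 \<or> w \<noteq> 0" for s t z w :: "'k fls fls"
    using lead_norm_form[OF l4 l(1) _ _ _ _ that] by simp
  have \<delta>: "\<delta> i \<noteq> 0" for i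
    using l lead_nonzero by (auto simp: \<delta>_def)
  \<comment> \<open>A splitting over the base field would be a zero of the norm form with s = 1, but
    the norm form has a leading term there.\<close>
  have ns: "\<not> splits_in UNIV (\<gamma> i) (\<delta> i)" for i
  proof
    assume "splits_in UNIV (\<gamma> i) (\<delta> i)"
    then obtain t z where "\<gamma> i = t ^ 2 + t + \<delta> i * z ^ 2"
      by (auto simp: splits_in_def)
    moreover have "norm_form (\<gamma> i) (\<delta> i) 1 t z 0 = (t ^ 2 + t + \<delta> i * z ^ 2) + \<gamma> i"
      by (simp add: norm_form_def)
    ultimately have "norm_form (\<gamma> i) (\<delta> i) 1 t z 0 = 0"
      using char2_add_self[OF charF, of "\<gamma> i"] by simp
    moreover have "\<exists>j k c. lead (norm_form (\<gamma> i) (\<delta> i) 1 t z 0) j k c"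
    proof -
      have s: "(1::'k fls fls) = 0 \<or> (1::'k fls fls) = 1" "t \<noteq> 0 \<or> (1::'k fls fls) \<noteq> 0 \<or> z \<noteq> 0 \<or> (0::'k fls fls) \<noteq> 0"
        by simp_all
      consider "i = 0" | "i = 1" | "i = 2" | "i \<noteq> 0" "i \<noteq> 1" "i \<noteq> 2"
        by blast
      then show ?thesis
      proof cases
        case 1
        then show ?thesis using nf0[OF s] unfolding \<gamma>_def \<delta>_def by (simp, blast)
      next
        case 2
        then show ?thesis using nf1[OF s] unfolding \<gamma>_def \<delta>_def by (simp, blast)
      next
        case 3
        then show ?thesis using nf2[OF s] unfolding \<gamma>_def \<delta>_def by (simp, blast)
      next
        case 4
        then show ?thesis using nf3[OF s] unfolding \<gamma>_def \<delta>_def by (simp, blast)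
      qed
    qed
    ultimately show False
      using lead_nonzero by metis
  qed
  have key: False if s: "s = 0 \<or> s = 1" and ex: "\<forall>i<4. \<exists>t0 t1 z0 z1.
      \<gamma> i = t0 ^ 2 + N * t1 ^ 2 + t0 + \<delta> i * (z0 ^ 2 + N * z1 ^ 2) \<and>
      s * t1 ^ 2 + t1 + \<delta> i * (s * z1 ^ 2) = 0" for s N
  proof -
    have "\<exists>t z w. N = norm_form (\<gamma> i) (\<delta> i) s t z w \<and> (s = 1 \<or> z \<noteq> 0 \<or> w \<noteq> 0)" if i: "i < 4" for i
    proof -
      obtain t0 t1 z0 z1 where "\<gamma> i = t0 ^ 2 + N * t1 ^ 2 + t0 + \<delta> i * (z0 ^ 2 + N * z1 ^ 2)"
        "s * t1 ^ 2 + t1 + \<delta> i * (s * z1 ^ 2) = 0"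
        using ex[rule_format, OF i] by (elim exE conjE)
      then show ?thesis
        by (rule splitting_imp_norm_form[OF charF \<delta> s _ _ ns])
    qed
    then have "\<exists>t z w. i < 4 \<longrightarrow> N = norm_form (\<gamma> i) (\<delta> i) s t z w \<and> (s = 1 \<or> z \<noteq> 0 \<or> w \<noteq> 0)" for i
      by blast
    then have "\<forall>i. \<exists>t z w. i < 4 \<longrightarrow> N = norm_form (\<gamma> i) (\<delta> i) s t z w \<and> (s = 1 \<or> z \<noteq> 0 \<or> w \<noteq> 0)"
      by (rule allI)
    then obtain t z w where tzw': "\<forall>i. i < 4 \<longrightarrow> N = norm_form (\<gamma> i) (\<delta> i) s (t i) (z i) (w i) \<and> (s = 1 \<or> z i \<noteq> 0 \<or> w i \<noteq> 0)"
      unfolding choice_iff by (elim exE)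
    have tzw: "N = norm_form (\<gamma> i) (\<delta> i) s (t i) (z i) (w i) \<and> (s = 1 \<or> z i \<noteq> 0 \<or> w i \<noteq> 0)" if "i < 4" for i
      using tzw' that by (elim allE impE)
    text \<open>Shifting \<open>\<theta>\<close> by \<open>t 0\<close> kills the first variable of the first norm form, so that its square no
      longer competes for the leading term of \<open>N'\<close>.\<close>
    define N' where "N' = N + t 0 ^ 2 + s * t 0"
    have N': "N' = norm_form (\<gamma> i) (\<delta> i) s (t i + t 0) (z i) (w i)" if "i < 4" for i
      using tzw[OF that] unfolding N'_def norm_form_def
      by (simp add: char2_square_add[OF charF] algebra_simps)
    have N0: "N' = norm_form (a' * b') a s 0 (z 0) (w 0)"
      using N'[of 0] char2_add_self[OF charF] by (simp add: \<gamma>_def \<delta>_def)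
    have N1: "N' = norm_form a' b s (t 1 + t 0) (z 1) (w 1)"
      using N'[of 1] by (simp add: \<gamma>_def \<delta>_def)
    have N2: "N' = norm_form b' a s (t 2 + t 0) (z 2) (w 2)"
      using N'[of 2] by (simp add: \<gamma>_def \<delta>_def)
    have N3: "N' = norm_form (fls_const (fls_const u) * (a' * b')) a s (t 3 + t 0) (z 3) (w 3)"
      using N'[of 3] by (simp add: \<gamma>_def \<delta>_def)
    have nzi: "r \<noteq> 0 \<or> s \<noteq> 0 \<or> z i \<noteq> 0 \<or> w i \<noteq> 0" if "i < 4" for i and r :: "'k fls fls"
      using tzw[OF that] by auto
    obtain j i c where jic: "lead N' j i c"
      and c0: "s = 1 \<and> j = - 1 \<and> i = - 1 \<and> c = 1 \<or> even j \<and> odd i \<or> odd j \<and> even i"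
        "s = 1 \<longrightarrow> j < - 1 \<or> j = - 1 \<and> i \<le> - 1"
    proof -
      have "\<exists>j i c. lead N' j i c \<and>
        (s = 1 \<and> j = - 1 \<and> i = - 1 \<and> c = 1 \<or> even j \<and> odd i \<or> odd j \<and> even i) \<and>
        (s = 1 \<longrightarrow> j < - 1 \<or> j = - 1 \<and> i \<le> - 1)"
        using nf0[OF s nzi[OF zero_less_numeral, of 0]] unfolding N0[symmetric] by fast
      then show ?thesis
        using that by (elim exE conjE)
    qed
    have c1: "even j \<and> even i \<or> s = 1 \<and> j = 0 \<and> i = - 1 \<or> odd j"
      using nf1[OF s nzi[of 1 "t 1 + t 0"]] lead_unique[OF jic] unfolding N1[symmetric] by auto
    have c2: "even j \<and> even i \<or> s = 1 \<and> j = - 1 \<and> i = 0 \<or> odd i"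
      using nf2[OF s nzi[of 2 "t 2 + t 0"]] lead_unique[OF jic] unfolding N2[symmetric] by auto
    have c3: "even j \<and> even i \<or> s = 1 \<and> c = u \<or> even j \<and> odd i \<or> odd j \<and> even i"
      using nf3[OF s nzi[of 3 "t 3 + t 0"]] lead_unique[OF jic] unfolding N3[symmetric] by auto
    \<comment> \<open>\<open>c0\<close> leaves for (j, i) the classes (even, odd) and (odd, even),
      or the pair (-1, -1) with coefficient 1. \<open>c1\<close> excludes (even, odd) but for (0,
      -1), and \<open>c2\<close> excludes (odd, even) but for (-1, 0); both exceptions violate the
      bound in \<open>c0\<close>. In the last case \<open>c3\<close> forces the coefficient
      \<open>u\<close>.\<close>
    show False
      using c0 c1 c2 c3 u by auto
  qed
  have no: "\<not> (\<exists>s N. (s = 0 \<or> s = 1) \<and> (\<forall>i<4. \<exists>t0 t1 z0 z1.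
      \<gamma> i = t0 ^ 2 + N * t1 ^ 2 + t0 + \<delta> i * (z0 ^ 2 + N * z1 ^ 2) \<and>
      s * t1 ^ 2 + t1 + \<delta> i * (s * z1 ^ 2) = 0))"
    by - (rule notI, elim exE conjE, rule key)
  have "\<forall>i<4. \<delta> i \<noteq> 0"
    using \<delta> by simp
  from this no show ?thesis
    by (rule exI[of _ \<gamma>, OF exI[of _ \<delta>, OF conjI]])
qed

section \<open>Monoid algebras and their quotients\<close>

lemma type_ring_simps [simp]:
  "carrier (ring_of_type_algebra :: 'r::comm_ring_1 ring) = UNIV"
  "a \<otimes>\<^bsub>(ring_of_type_algebra :: 'r ring)\<^esub> b = a * b"
  "a \<oplus>\<^bsub>(ring_of_type_algebra :: 'r ring)\<^esub> b = a + b"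
  "\<zero>\<^bsub>(ring_of_type_algebra :: 'r ring)\<^esub> = 0"
  "\<one>\<^bsub>(ring_of_type_algebra :: 'r ring)\<^esub> = 1"
  by (simp_all add: ring_of_type_algebra_def)

lemma int_ring_eq_type_ring: "int_ring = ring_of_type_algebra"
  by (simp add: ring_of_type_algebra_def)

lemma finsum_type_ring:
  assumes "finite A"
  shows "finsum (ring_of_type_algebra :: 'r::comm_ring_1 ring) f A = sum f A"
proof -
  interpret ring "ring_of_type_algebra :: 'r ring"
    by (rule ring_from_type_algebra)
  show ?thesis
    using assms by (induction A rule: finite_induct) (auto simp: Pi_def)
qed

text \<open>One treatment for two uses: the free algebra, with words as monoid, and the integral
  monoid ring of \<open>A \<times>\<times> B\<close> that covers the tensor product.\<close>

locale monoid_ring = M?: monoid M for M :: "('m, 'q) monoid_scheme" (structure) +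
  fixes P :: "('r::comm_ring_1, 'm \<Rightarrow> 'r) ualg"
  defines P_def: "P \<equiv> monoid_algebra ring_of_type_algebra M"
begin

lemma mem_carrier: "f \<in> carrier P \<longleftrightarrow> {u. f u \<noteq> 0} \<subseteq> carrier M \<and> finite {u. f u \<noteq> 0}"
  by (simp add: P_def monoid_algebra_def fun_supp_def)

lemma
  shows zero_P: "\<zero>\<^bsub>P\<^esub> = (\<lambda>u. 0)"
    and one_P: "\<one>\<^bsub>P\<^esub> = single ring_of_type_algebra \<one> 1"
    and add_P: "f \<oplus>\<^bsub>P\<^esub> g = (\<lambda>u. f u + g u)"
    and scalar_P: "scalar P = single ring_of_type_algebra \<one>"
  by (simp_all add: P_def monoid_algebra_def)

lemma mult_P:
  assumes "finite A" "finite B" "{u. f u \<noteq> 0} \<subseteq> A" "{u. g u \<noteq> 0} \<subseteq> B"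
  shows "(f \<otimes>\<^bsub>P\<^esub> g) x = (\<Sum>u\<in>A. \<Sum>v\<in>B. if u \<otimes> v = x then f u * g v else 0)"
proof -
  let ?A = "{u. f u \<noteq> 0}" and ?B = "{u. g u \<noteq> 0}"
  have fin: "finite ?A" "finite ?B"
    using assms finite_subset by blast+
  have "(f \<otimes>\<^bsub>P\<^esub> g) x = (\<Sum>u\<in>?A. \<Sum>v\<in>?B. if u \<otimes> v = x then f u * g v else 0)"
    using fin by (simp add: P_def monoid_algebra_def fun_supp_def finsum_type_ring cong: if_cong)
  also have "\<dots> = (\<Sum>u\<in>?A. \<Sum>v\<in>B. if u \<otimes> v = x then f u * g v else 0)"
    using assms by (intro sum.cong sum.mono_neutral_left) auto
  also have "\<dots> = (\<Sum>u\<in>A. \<Sum>v\<in>B. if u \<otimes> v = x then f u * g v else 0)"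
    using assms by (intro sum.mono_neutral_left) (auto cong: if_cong)
  finally show ?thesis .
qed

text \<open>Summing a product against a test function \<open>h\<close> moves \<open>h\<close> to the
  products of monoid elements. Both ways of bracketing three factors thereby become the same triple
  sum.\<close>

lemma sum_mult_P:
  assumes "finite A" "finite B" "{u. f u \<noteq> 0} \<subseteq> A" "{u. g u \<noteq> 0} \<subseteq> B"
    and "finite C" "\<And>u v. u \<in> A \<Longrightarrow> v \<in> B \<Longrightarrow> u \<otimes> v \<in> C"
  shows "(\<Sum>y\<in>C. (f \<otimes>\<^bsub>P\<^esub> g) y * h y) = (\<Sum>u\<in>A. \<Sum>v\<in>B. f u * g v * h (u \<otimes> v))"
proof -
  have "(\<Sum>y\<in>C. (f \<otimes>\<^bsub>P\<^esub> g) y * h y) =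
    (\<Sum>y\<in>C. \<Sum>u\<in>A. \<Sum>v\<in>B. if u \<otimes> v = y then f u * g v * h y else 0)"
    unfolding mult_P[OF assms(1-4)] sum_distrib_right by (intro sum.cong) auto
  also have "\<dots> = (\<Sum>u\<in>A. \<Sum>v\<in>B. \<Sum>y\<in>C. if u \<otimes> v = y then f u * g v * h y else 0)"
    by (subst sum.swap) (intro sum.cong refl sum.swap)
  also have "\<dots> = (\<Sum>u\<in>A. \<Sum>v\<in>B. f u * g v * h (u \<otimes> v))"
    using assms by (intro sum.cong refl) (simp add: sum.delta')
  finally show ?thesis .
qed

lemma mult_P_nonzero:
  assumes "f \<in> carrier P" "g \<in> carrier P" "(f \<otimes>\<^bsub>P\<^esub> g) x \<noteq> 0"
  shows "x \<in> (\<lambda>(u, v). u \<otimes> v) ` ({u. f u \<noteq> 0} \<times> {u. g u \<noteq> 0})"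
proof -
  have "(f \<otimes>\<^bsub>P\<^esub> g) x = (\<Sum>u\<in>{u. f u \<noteq> 0}. \<Sum>v\<in>{u. g u \<noteq> 0}. if u \<otimes> v = x then f u * g v else 0)"
    using assms by (intro mult_P) (auto simp: mem_carrier)
  with assms(3) have "(\<Sum>u\<in>{u. f u \<noteq> 0}. \<Sum>v\<in>{u. g u \<noteq> 0}. if u \<otimes> v = x then f u * g v else 0) \<noteq> 0"
    by simp
  then obtain u where u: "u \<in> {u. f u \<noteq> 0}"
    "(\<Sum>v\<in>{u. g u \<noteq> 0}. if u \<otimes> v = x then f u * g v else 0) \<noteq> 0"
    by (rule sum.not_neutral_contains_not_neutral)
  from u(2) obtain v where v: "v \<in> {u. g u \<noteq> 0}" "(if u \<otimes> v = x then f u * g v else 0) \<noteq> 0"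
    by (rule sum.not_neutral_contains_not_neutral)
  then have "x = u \<otimes> v"
    by (auto split: if_splits)
  then show ?thesis
    using u(1) v(1) by blast
qed

lemma mult_P_closed:
  assumes "f \<in> carrier P" "g \<in> carrier P"
  shows "f \<otimes>\<^bsub>P\<^esub> g \<in> carrier P"
proof -
  have "{x. (f \<otimes>\<^bsub>P\<^esub> g) x \<noteq> 0} \<subseteq> (\<lambda>(u, v). u \<otimes> v) ` ({u. f u \<noteq> 0} \<times> {u. g u \<noteq> 0})"
    using mult_P_nonzero[OF assms] by blast
  moreover have "finite ((\<lambda>(u, v). u \<otimes> v) ` ({u. f u \<noteq> 0} \<times> {u. g u \<noteq> 0}))"
    using assms by (auto simp: mem_carrier)
  moreover have "(\<lambda>(u, v). u \<otimes> v) ` ({u. f u \<noteq> 0} \<times> {u. g u \<noteq> 0}) \<subseteq> carrier M"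
    using assms by (auto simp: mem_carrier)
  ultimately show ?thesis
    unfolding mem_carrier by (meson finite_subset order_trans)
qed

lemma add_P_closed:
  assumes "f \<in> carrier P" "g \<in> carrier P"
  shows "f \<oplus>\<^bsub>P\<^esub> g \<in> carrier P"
proof -
  have "{u. f u + g u \<noteq> 0} \<subseteq> {u. f u \<noteq> 0} \<union> {u. g u \<noteq> 0}"
    by auto
  then show ?thesis
    using assms unfolding mem_carrier add_P by (meson finite_UnI finite_subset le_sup_iff order_trans)
qed

lemma single_in_P: "u \<in> carrier M \<Longrightarrow> single ring_of_type_algebra u c \<in> carrier P"
  by (auto simp: mem_carrier single_def)

lemma mult_P_assoc:
  assumes "f \<in> carrier P" "g \<in> carrier P" "h \<in> carrier P"
  shows "(f \<otimes>\<^bsub>P\<^esub> g) \<otimes>\<^bsub>P\<^esub> h = f \<otimes>\<^bsub>P\<^esub> (g \<otimes>\<^bsub>P\<^esub> h)"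
proof
  fix x
  define A B D where "A = {u. f u \<noteq> 0}" and "B = {u. g u \<noteq> 0}" and "D = {u. h u \<noteq> 0}"
  define C where "C = (\<lambda>(u, v). u \<otimes> v) ` (A \<times> B)"
  define E where "E = (\<lambda>(u, v). u \<otimes> v) ` (B \<times> D)"
  have fin: "finite A" "finite B" "finite D" "finite C" "finite E"
    using assms by (auto simp: A_def B_def C_def D_def E_def mem_carrier)
  have M: "A \<subseteq> carrier M" "B \<subseteq> carrier M" "D \<subseteq> carrier M"
    using assms by (auto simp: A_def B_def D_def mem_carrier)
  have sC: "{x. (f \<otimes>\<^bsub>P\<^esub> g) x \<noteq> 0} \<subseteq> C" and sE: "{x. (g \<otimes>\<^bsub>P\<^esub> h) x \<noteq> 0} \<subseteq> E"
    using mult_P_nonzero assms unfolding A_def B_def C_def D_def E_def by blast+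
  have "((f \<otimes>\<^bsub>P\<^esub> g) \<otimes>\<^bsub>P\<^esub> h) x = (\<Sum>y\<in>C. \<Sum>w\<in>D. if y \<otimes> w = x then (f \<otimes>\<^bsub>P\<^esub> g) y * h w else 0)"
    by (rule mult_P) (use fin sC in \<open>auto simp: D_def\<close>)
  also have "\<dots> = (\<Sum>w\<in>D. \<Sum>y\<in>C. (f \<otimes>\<^bsub>P\<^esub> g) y * (if y \<otimes> w = x then h w else 0))"
    by (subst sum.swap) (intro sum.cong refl, simp)
  also have "\<dots> = (\<Sum>w\<in>D. \<Sum>u\<in>A. \<Sum>v\<in>B. f u * g v * (if u \<otimes> v \<otimes> w = x then h w else 0))"
    by (intro sum.cong refl sum_mult_P fin) (auto simp: A_def B_def C_def)
  also have "\<dots> = (\<Sum>u\<in>A. \<Sum>w\<in>D. \<Sum>v\<in>B. f u * g v * (if u \<otimes> v \<otimes> w = x then h w else 0))"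
    by (rule sum.swap)
  also have "\<dots> = (\<Sum>u\<in>A. \<Sum>v\<in>B. \<Sum>w\<in>D. f u * g v * (if u \<otimes> v \<otimes> w = x then h w else 0))"
    by (intro sum.cong refl sum.swap)
  also have "\<dots> = (\<Sum>u\<in>A. \<Sum>v\<in>B. \<Sum>w\<in>D. g v * h w * (if u \<otimes> (v \<otimes> w) = x then f u else 0))"
    using M by (intro sum.cong refl) (auto simp: m_assoc subset_iff mult_ac)
  also have "\<dots> = (\<Sum>u\<in>A. \<Sum>y\<in>E. (g \<otimes>\<^bsub>P\<^esub> h) y * (if u \<otimes> y = x then f u else 0))"
    by (intro sum.cong refl sum_mult_P[symmetric] fin) (auto simp: B_def D_def E_def)
  also have "\<dots> = (\<Sum>u\<in>A. \<Sum>y\<in>E. if u \<otimes> y = x then f u * (g \<otimes>\<^bsub>P\<^esub> h) y else 0)"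
    by (intro sum.cong refl) simp
  also have "\<dots> = (f \<otimes>\<^bsub>P\<^esub> (g \<otimes>\<^bsub>P\<^esub> h)) x"
    by (rule mult_P[symmetric]) (use fin sE in \<open>auto simp: A_def\<close>)
  finally show "((f \<otimes>\<^bsub>P\<^esub> g) \<otimes>\<^bsub>P\<^esub> h) x = (f \<otimes>\<^bsub>P\<^esub> (g \<otimes>\<^bsub>P\<^esub> h)) x" .
qed

lemma one_mult_P:
  assumes "f \<in> carrier P"
  shows "\<one>\<^bsub>P\<^esub> \<otimes>\<^bsub>P\<^esub> f = f" "f \<otimes>\<^bsub>P\<^esub> \<one>\<^bsub>P\<^esub> = f"
proof -
  let ?A = "{u. f u \<noteq> 0}"
  have A: "finite ?A" "?A \<subseteq> carrier M"
    using assms by (auto simp: mem_carrier)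
  have one: "\<one>\<^bsub>P\<^esub> = (\<lambda>x. if x = \<one> then 1 else 0)"
    by (simp add: one_P single_def cong: if_cong)
  have "(\<one>\<^bsub>P\<^esub> \<otimes>\<^bsub>P\<^esub> f) x = f x" for x
  proof -
    have "(\<one>\<^bsub>P\<^esub> \<otimes>\<^bsub>P\<^esub> f) x = (\<Sum>u\<in>{\<one>}. \<Sum>v\<in>?A. if u \<otimes> v = x then \<one>\<^bsub>P\<^esub> u * f v else 0)"
      by (rule mult_P) (use A in \<open>auto simp: one\<close>)
    also have "\<dots> = (\<Sum>v\<in>?A. if \<one> \<otimes> v = x then f v else 0)"
      by (simp add: one cong: if_cong)
    also have "\<dots> = (\<Sum>v\<in>?A. if v = x then f v else 0)"
      using A by (intro sum.cong refl) auto
    finally show ?thesis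
      using A by (simp add: sum.delta)
  qed
  then show "\<one>\<^bsub>P\<^esub> \<otimes>\<^bsub>P\<^esub> f = f" by blast
  have "(f \<otimes>\<^bsub>P\<^esub> \<one>\<^bsub>P\<^esub>) x = f x" for x
  proof -
    have "(f \<otimes>\<^bsub>P\<^esub> \<one>\<^bsub>P\<^esub>) x = (\<Sum>u\<in>?A. \<Sum>v\<in>{\<one>}. if u \<otimes> v = x then f u * \<one>\<^bsub>P\<^esub> v else 0)"
      by (rule mult_P) (use A in \<open>auto simp: one\<close>)
    also have "\<dots> = (\<Sum>u\<in>?A. if u \<otimes> \<one> = x then f u else 0)"
      by (simp add: one cong: if_cong)
    also have "\<dots> = (\<Sum>u\<in>?A. if u = x then f u else 0)"
      using A by (intro sum.cong refl) auto
    finally show ?thesis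
      using A by (simp add: sum.delta)
  qed
  then show "f \<otimes>\<^bsub>P\<^esub> \<one>\<^bsub>P\<^esub> = f" by blast
qed

lemma add_mult_P:
  assumes "f \<in> carrier P" "g \<in> carrier P" "h \<in> carrier P"
  shows "(f \<oplus>\<^bsub>P\<^esub> g) \<otimes>\<^bsub>P\<^esub> h = (f \<otimes>\<^bsub>P\<^esub> h) \<oplus>\<^bsub>P\<^esub> (g \<otimes>\<^bsub>P\<^esub> h)"
    "h \<otimes>\<^bsub>P\<^esub> (f \<oplus>\<^bsub>P\<^esub> g) = (h \<otimes>\<^bsub>P\<^esub> f) \<oplus>\<^bsub>P\<^esub> (h \<otimes>\<^bsub>P\<^esub> g)"
proof -
  define A B where "A = {u. f u \<noteq> 0} \<union> {u. g u \<noteq> 0}" and "B = {u. h u \<noteq> 0}"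
  have fin: "finite A" "finite B"
    using assms by (auto simp: A_def B_def mem_carrier)
  have s: "{u. f u \<noteq> 0} \<subseteq> A" "{u. g u \<noteq> 0} \<subseteq> A" "{u. f u + g u \<noteq> 0} \<subseteq> A" "{u. h u \<noteq> 0} \<subseteq> B"
    by (auto simp: A_def B_def)
  show "(f \<oplus>\<^bsub>P\<^esub> g) \<otimes>\<^bsub>P\<^esub> h = (f \<otimes>\<^bsub>P\<^esub> h) \<oplus>\<^bsub>P\<^esub> (g \<otimes>\<^bsub>P\<^esub> h)"
  proof
    fix x
    have "((f \<oplus>\<^bsub>P\<^esub> g) \<otimes>\<^bsub>P\<^esub> h) x = (\<Sum>u\<in>A. \<Sum>v\<in>B. if u \<otimes> v = x then (f u + g u) * h v else 0)"
      unfolding add_P using s by (intro mult_P fin)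
    also have "\<dots> = (f \<otimes>\<^bsub>P\<^esub> h) x + (g \<otimes>\<^bsub>P\<^esub> h) x"
      unfolding mult_P[OF fin s(1,4)] mult_P[OF fin s(2,4)] sum.distrib[symmetric]
      by (intro sum.cong refl) (simp add: distrib_right)
    finally show "((f \<oplus>\<^bsub>P\<^esub> g) \<otimes>\<^bsub>P\<^esub> h) x = ((f \<otimes>\<^bsub>P\<^esub> h) \<oplus>\<^bsub>P\<^esub> (g \<otimes>\<^bsub>P\<^esub> h)) x"
      by (simp add: add_P)
  qed
  show "h \<otimes>\<^bsub>P\<^esub> (f \<oplus>\<^bsub>P\<^esub> g) = (h \<otimes>\<^bsub>P\<^esub> f) \<oplus>\<^bsub>P\<^esub> (h \<otimes>\<^bsub>P\<^esub> g)"
  proof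
    fix x
    have "(h \<otimes>\<^bsub>P\<^esub> (f \<oplus>\<^bsub>P\<^esub> g)) x = (\<Sum>u\<in>B. \<Sum>v\<in>A. if u \<otimes> v = x then h u * (f v + g v) else 0)"
      unfolding add_P using s by (intro mult_P fin)
    also have "\<dots> = (h \<otimes>\<^bsub>P\<^esub> f) x + (h \<otimes>\<^bsub>P\<^esub> g) x"
      unfolding mult_P[OF fin(2,1) s(4,1)] mult_P[OF fin(2,1) s(4,2)] sum.distrib[symmetric]
      by (intro sum.cong refl) (simp add: distrib_left)
    finally show "(h \<otimes>\<^bsub>P\<^esub> (f \<oplus>\<^bsub>P\<^esub> g)) x = ((h \<otimes>\<^bsub>P\<^esub> f) \<oplus>\<^bsub>P\<^esub> (h \<otimes>\<^bsub>P\<^esub> g)) x"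
      by (simp add: add_P)
  qed
qed

lemma ring_P: "ring P"
proof (rule ringI)
  show "abelian_group P"
  proof (rule abelian_groupI)
    show "\<exists>g\<in>carrier P. g \<oplus>\<^bsub>P\<^esub> f = \<zero>\<^bsub>P\<^esub>" if "f \<in> carrier P" for f
      using that by (intro bexI[of _ "\<lambda>u. - f u"]) (simp_all add: add_P zero_P mem_carrier)
  qed (use add_P_closed in \<open>auto simp: add_P zero_P mem_carrier add_ac\<close>)
  show "Group.monoid P"
    by (rule monoidI) (use mult_P_closed mult_P_assoc one_mult_P single_in_P in \<open>auto simp: one_P\<close>)
qed (rule add_mult_P; assumption)+

lemma single_mult_single:
  assumes "u \<in> carrier M" "v \<in> carrier M"
  shows "single ring_of_type_algebra u c \<otimes>\<^bsub>P\<^esub> single ring_of_type_algebra v d =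
    single ring_of_type_algebra (u \<otimes> v) (c * d)"
proof
  fix x
  have "(single ring_of_type_algebra u c \<otimes>\<^bsub>P\<^esub> single ring_of_type_algebra v d) x =
    (\<Sum>u'\<in>{u}. \<Sum>v'\<in>{v}. if u' \<otimes> v' = x
      then single ring_of_type_algebra u c u' * single ring_of_type_algebra v d v' else 0)"
    by (rule mult_P) (auto simp: single_def)
  then show "(single ring_of_type_algebra u c \<otimes>\<^bsub>P\<^esub> single ring_of_type_algebra v d) x =
      single ring_of_type_algebra (u \<otimes> v) (c * d) x"
    by (auto simp: single_def)
qed

lemma P_induct [consumes 1, case_names zero single add]:
  assumes "f \<in> carrier P"
    and zero: "Q \<zero>\<^bsub>P\<^esub>"
    and single: "\<And>u c. u \<in> carrier M \<Longrightarrow> Q (single ring_of_type_algebra u c)"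
    and add: "\<And>f g. f \<in> carrier P \<Longrightarrow> g \<in> carrier P \<Longrightarrow> Q f \<Longrightarrow> Q g \<Longrightarrow> Q (f \<oplus>\<^bsub>P\<^esub> g)"
  shows "Q f"
proof -
  have "finite {u. f u \<noteq> 0}" "{u. f u \<noteq> 0} \<subseteq> carrier M"
    using assms(1) by (auto simp: mem_carrier)
  moreover have "\<forall>f. {u. f u \<noteq> 0} \<subseteq> S \<longrightarrow> S \<subseteq> carrier M \<longrightarrow> Q f" if "finite S" for S
    using that(1)
  proof (induction rule: finite_induct)
    case empty
    have "f = \<zero>\<^bsub>P\<^esub>" if "{u. f u \<noteq> 0} \<subseteq> {}" for f
      using that by (auto simp: zero_P)
    then show ?case
      using zero by metis
  next
    case (insert v S)
    show ?case
    proof (intro allI impI)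
      fix f :: "'m \<Rightarrow> 'r"
      assume f: "{u. f u \<noteq> 0} \<subseteq> insert v S" and M: "insert v S \<subseteq> carrier M"
      define g where "g = f(v := 0)"
      have g: "{u. g u \<noteq> 0} \<subseteq> S"
        using f by (auto simp: g_def)
      have f_eq: "f = single ring_of_type_algebra v (f v) \<oplus>\<^bsub>P\<^esub> g"
        by (auto simp: add_P g_def single_def)
      have "g \<in> carrier P" "v \<in> carrier M" "Q g"
        unfolding mem_carrier using g M insert.hyps insert.IH finite_subset[OF g] by auto
      then show "Q f"
        by (subst f_eq) (intro add single single_in_P)
    qed
  qed
  ultimately show ?thesis
    by blast
qed

text \<open>The map of the universal property: \<open>\<sigma>\<close> acts on coefficients,
  \<open>\<phi>\<close> on monoid elements. It is multiplicative when the values of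
  \<open>\<sigma>\<close> commute with those of \<open>\<phi>\<close>.\<close>

definition eval :: "('c, 'z) ring_scheme \<Rightarrow> ('r \<Rightarrow> 'c) \<Rightarrow> ('m \<Rightarrow> 'c) \<Rightarrow> ('m \<Rightarrow> 'r) \<Rightarrow> 'c" where
  "eval S \<sigma> \<phi> f = (\<Oplus>\<^bsub>S\<^esub>u\<in>{u. f u \<noteq> 0}. \<sigma> (f u) \<otimes>\<^bsub>S\<^esub> \<phi> u)"

context
  fixes S :: "('c, 'z) ring_scheme" and \<sigma> :: "'r \<Rightarrow> 'c" and \<phi> :: "'m \<Rightarrow> 'c"
  assumes S: "ring S" and \<sigma>: "\<sigma> \<in> ring_hom ring_of_type_algebra S"
    and \<phi>: "\<phi> \<in> hom M S" "\<phi> \<one> = \<one>\<^bsub>S\<^esub>"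
    and central: "\<And>c u. u \<in> carrier M \<Longrightarrow> \<sigma> c \<otimes>\<^bsub>S\<^esub> \<phi> u = \<phi> u \<otimes>\<^bsub>S\<^esub> \<sigma> c"
begin

interpretation S: ring S by (rule S)

lemma \<sigma>_simps: "\<sigma> c \<in> carrier S" "\<sigma> (c + d) = \<sigma> c \<oplus>\<^bsub>S\<^esub> \<sigma> d" "\<sigma> (c * d) = \<sigma> c \<otimes>\<^bsub>S\<^esub> \<sigma> d" "\<sigma> 1 = \<one>\<^bsub>S\<^esub>" "\<sigma> 0 = \<zero>\<^bsub>S\<^esub>"
proof -
  show *: "\<sigma> c \<in> carrier S" "\<sigma> (c + d) = \<sigma> c \<oplus>\<^bsub>S\<^esub> \<sigma> d" "\<sigma> (c * d) = \<sigma> c \<otimes>\<^bsub>S\<^esub> \<sigma> d" "\<sigma> 1 = \<one>\<^bsub>S\<^esub>" for c d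
    using ring_hom_closed[OF \<sigma>, of c] ring_hom_add[OF \<sigma>, of c d] ring_hom_mult[OF \<sigma>, of c d] ring_hom_one[OF \<sigma>]
    by simp_all
  show "\<sigma> 0 = \<zero>\<^bsub>S\<^esub>"
    using *(2)[of 0 0] *(1)[of 0] by (metis S.add.l_cancel_one add_0_right)
qed

lemma \<phi>_simps: "u \<in> carrier M \<Longrightarrow> \<phi> u \<in> carrier S"
  "u \<in> carrier M \<Longrightarrow> v \<in> carrier M \<Longrightarrow> \<phi> (u \<otimes> v) = \<phi> u \<otimes>\<^bsub>S\<^esub> \<phi> v"
  using \<phi> by (auto simp: hom_def)

lemma eval_eq:
  assumes "finite A" "{u. f u \<noteq> 0} \<subseteq> A" "A \<subseteq> carrier M"
  shows "eval S \<sigma> \<phi> f = (\<Oplus>\<^bsub>S\<^esub>u\<in>A. \<sigma> (f u) \<otimes>\<^bsub>S\<^esub> \<phi> u)"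
  unfolding eval_def using assms
  by (intro S.add.finprod_mono_neutral_cong_left)
    (auto simp: \<sigma>_simps \<phi>_simps subset_iff)

lemma eval_single: "u \<in> carrier M \<Longrightarrow> eval S \<sigma> \<phi> (single ring_of_type_algebra u c) = \<sigma> c \<otimes>\<^bsub>S\<^esub> \<phi> u"
  by (subst eval_eq[of "{u}"]) (auto simp: single_def \<sigma>_simps \<phi>_simps)

lemma eval_closed: "f \<in> carrier P \<Longrightarrow> eval S \<sigma> \<phi> f \<in> carrier S"
  unfolding eval_def by (intro S.finsum_closed) (auto simp: mem_carrier \<sigma>_simps \<phi>_simps)

lemma eval_add:
  assumes "f \<in> carrier P" "g \<in> carrier P"
  shows "eval S \<sigma> \<phi> (f \<oplus>\<^bsub>P\<^esub> g) = eval S \<sigma> \<phi> f \<oplus>\<^bsub>S\<^esub> eval S \<sigma> \<phi> g"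
proof -
  define A where "A = {u. f u \<noteq> 0} \<union> {u. g u \<noteq> 0}"
  have A: "finite A" "A \<subseteq> carrier M" "{u. f u \<noteq> 0} \<subseteq> A" "{u. g u \<noteq> 0} \<subseteq> A" "{u. f u + g u \<noteq> 0} \<subseteq> A"
    using assms by (auto simp: mem_carrier A_def)
  have eq: "eval S \<sigma> \<phi> k = (\<Oplus>\<^bsub>S\<^esub>u\<in>A. \<sigma> (k u) \<otimes>\<^bsub>S\<^esub> \<phi> u)" if "{u. k u \<noteq> 0} \<subseteq> A" for k
    using that A by (intro eval_eq)
  have "eval S \<sigma> \<phi> (f \<oplus>\<^bsub>P\<^esub> g) = (\<Oplus>\<^bsub>S\<^esub>u\<in>A. \<sigma> (f u) \<otimes>\<^bsub>S\<^esub> \<phi> u \<oplus>\<^bsub>S\<^esub> \<sigma> (g u) \<otimes>\<^bsub>S\<^esub> \<phi> u)"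
    unfolding add_P eq[OF A(5)] using A
    by (intro S.finsum_cong') (auto simp: \<sigma>_simps \<phi>_simps S.l_distr subset_iff)
  also have "\<dots> = eval S \<sigma> \<phi> f \<oplus>\<^bsub>S\<^esub> eval S \<sigma> \<phi> g"
    unfolding eq[OF A(3)] eq[OF A(4)] using A
    by (intro S.finsum_addf) (auto simp: \<sigma>_simps \<phi>_simps)
  finally show ?thesis .
qed

lemma eval_zero: "eval S \<sigma> \<phi> \<zero>\<^bsub>P\<^esub> = \<zero>\<^bsub>S\<^esub>"
  by (simp add: eval_def zero_P)

lemma eval_mult:
  assumes f: "f \<in> carrier P" and g: "g \<in> carrier P"
  shows "eval S \<sigma> \<phi> (f \<otimes>\<^bsub>P\<^esub> g) = eval S \<sigma> \<phi> f \<otimes>\<^bsub>S\<^esub> eval S \<sigma> \<phi> g"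
proof -
  interpret P: ring P by (rule ring_P)
  have s: "eval S \<sigma> \<phi> (single ring_of_type_algebra u c \<otimes>\<^bsub>P\<^esub> g) =
    eval S \<sigma> \<phi> (single ring_of_type_algebra u c) \<otimes>\<^bsub>S\<^esub> eval S \<sigma> \<phi> g" if u: "u \<in> carrier M" for u c
    using g
  proof (induction rule: P_induct)
    case zero
    show ?case
      using u single_in_P[OF u] by (simp add: eval_zero eval_closed)
  next
    case (single v d)
    have "\<sigma> c \<otimes>\<^bsub>S\<^esub> \<sigma> d \<otimes>\<^bsub>S\<^esub> (\<phi> u \<otimes>\<^bsub>S\<^esub> \<phi> v) = \<sigma> c \<otimes>\<^bsub>S\<^esub> \<phi> u \<otimes>\<^bsub>S\<^esub> (\<sigma> d \<otimes>\<^bsub>S\<^esub> \<phi> v)"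
    proof -
      note cl = \<sigma>_simps(1) \<phi>_simps(1)[OF u] \<phi>_simps(1)[OF single]
      have "\<sigma> c \<otimes>\<^bsub>S\<^esub> \<sigma> d \<otimes>\<^bsub>S\<^esub> (\<phi> u \<otimes>\<^bsub>S\<^esub> \<phi> v) = \<sigma> c \<otimes>\<^bsub>S\<^esub> (\<sigma> d \<otimes>\<^bsub>S\<^esub> \<phi> u) \<otimes>\<^bsub>S\<^esub> \<phi> v"
        using cl by (simp add: S.m_assoc)
      then show ?thesis
        unfolding central[OF u, of d] using cl by (simp add: S.m_assoc)
    qed
    then show ?case
      using u single by (simp add: single_mult_single eval_single \<sigma>_simps \<phi>_simps)
  next
    case (add f g)
    then show ?case
      using single_in_P[OF u] by (simp add: P.r_distr eval_add eval_closed S.r_distr)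
  qed
  show ?thesis
    using f
  proof (induction rule: P_induct)
    case zero
    show ?case
      using g by (simp add: eval_zero eval_closed)
  next
    case (single u c)
    then show ?case by (rule s)
  next
    case (add f g')
    then show ?case
      using g by (simp add: P.l_distr eval_add eval_closed S.l_distr)
  qed
qed

lemma eval_hom: "eval S \<sigma> \<phi> \<in> ring_hom P S"
  using \<phi> by (intro ring_hom_memI eval_closed eval_mult eval_add)
    (auto simp: one_P eval_single \<sigma>_simps)

end

end

lemma single_int_ring: "single int_ring = single ring_of_type_algebra"
  unfolding int_ring_eq_type_ring ..

lemma make_ualg_simps [simp]:
  "carrier (make_ualg R s) = carrier R" "monoid.mult (make_ualg R s) = monoid.mult R" "monoid.one (make_ualg R s) = monoid.one R"
  "ring.zero (make_ualg R s) = ring.zero R" "ring.add (make_ualg R s) = ring.add R" "scalar (make_ualg R s) = s"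
  by (simp_all add: make_ualg_def ring.defs ualg.defs)

lemma ring_make_ualg:
  assumes "ring R"
  shows "ring (make_ualg R s)"
proof -
  interpret ring R by fact
  show ?thesis
    by (rule ringI; (rule abelian_groupI monoidI)?)
      (auto simp: a_ac m_assoc l_distr r_distr intro: l_neg a_inv_closed)
qed

section \<open>Quotient rings and tensor products\<close>

lemma quotient_cases:
  assumes "C \<in> carrier (P Quot J)"
  obtains p where "p \<in> carrier P" "C = J +>\<^bsub>P\<^esub> p"
  using assms by (auto simp: FactRing_simps)

text \<open>\<open>h\<close> is constant on each coset of \<open>J\<close>, so the induced map picks
  the only element of the image of the coset.\<close>

lemma factor_hom:
  assumes J: "ideal J P" and S: "ring S" and h: "h \<in> ring_hom P S"
    and ker: "\<And>j. j \<in> J \<Longrightarrow> h j = \<zero>\<^bsub>S\<^esub>"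
  shows "\<exists>k\<in>ring_hom (P Quot J) S. \<forall>p\<in>carrier P. k (J +>\<^bsub>P\<^esub> p) = h p"
proof -
  interpret J: ideal J P by fact
  interpret S: ring S by fact
  define k where "k = (\<lambda>C. the_elem (h ` C))"
  have k: "k (J +>\<^bsub>P\<^esub> p) = h p" if p: "p \<in> carrier P" for p
  proof -
    have "h ` (J +>\<^bsub>P\<^esub> p) = {h p}"
    proof
      show "h ` (J +>\<^bsub>P\<^esub> p) \<subseteq> {h p}"
        using p ker J.a_subset ring_hom_add[OF h] ring_hom_closed[OF h] by (auto simp: a_r_coset_def')
      show "{h p} \<subseteq> h ` (J +>\<^bsub>P\<^esub> p)"
        using J.a_rcos_self[OF p] by blast
    qed
    then show ?thesis
      by (simp add: k_def)
  qed
  have *: "(J +>\<^bsub>P\<^esub> p) \<otimes>\<^bsub>P Quot J\<^esub> (J +>\<^bsub>P\<^esub> q) = J +>\<^bsub>P\<^esub> (p \<otimes>\<^bsub>P\<^esub> q)"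
    "(J +>\<^bsub>P\<^esub> p) \<oplus>\<^bsub>P Quot J\<^esub> (J +>\<^bsub>P\<^esub> q) = J +>\<^bsub>P\<^esub> (p \<oplus>\<^bsub>P\<^esub> q)" if "p \<in> carrier P" "q \<in> carrier P" for p q
    using that ring_hom_mult[OF J.rcos_ring_hom] ring_hom_add[OF J.rcos_ring_hom] by simp_all
  have "k \<in> ring_hom (P Quot J) S"
  proof (rule ring_hom_memI)
    show "k \<one>\<^bsub>P Quot J\<^esub> = \<one>\<^bsub>S\<^esub>"
      using k[of "\<one>\<^bsub>P\<^esub>"] ring_hom_one[OF h] by (simp add: FactRing_def)
  qed (use k * ring_hom_closed[OF h] ring_hom_mult[OF h] ring_hom_add[OF h] in \<open>auto elim!: quotient_cases\<close>)
  then show ?thesis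
    using k by blast
qed

locale tensor_product =
  A: ring A + B: ring B
  for A :: "('f, 'a) ualg" and B :: "('f, 'b) ualg" and F :: "('f, 'm) ring_scheme"
begin

abbreviation P where "P \<equiv> tensor_cover A B"
abbreviation J where "J \<equiv> tensor_ideal F A B"
abbreviation T where "T \<equiv> tensor F A B"

definition tens :: "'a \<Rightarrow> 'b \<Rightarrow> ('a \<times> 'b \<Rightarrow> int) set" where
  "tens a b = J +>\<^bsub>P\<^esub> single int_ring (a, b) 1"

definition e :: "'a \<Rightarrow> 'b \<Rightarrow> 'a \<times> 'b \<Rightarrow> int" where
  "e a b = single int_ring (a, b) 1"

sublocale M: monoid_ring "A \<times>\<times> B" P
  unfolding int_ring_eq_type_ring
  by (intro monoid_ring.intro DirProd_monoid A.monoid_axioms B.monoid_axioms reflexive)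

sublocale P: ring P
  by (rule M.ring_P)

lemma e_closed: "a \<in> carrier A \<Longrightarrow> b \<in> carrier B \<Longrightarrow> e a b \<in> carrier P"
  unfolding e_def single_int_ring
  using M.single_in_P[of "(a, b)" 1] by (simp add: DirProd_def single_int_ring)

definition relations :: "('a \<times> 'b \<Rightarrow> int) set" where
  "relations = {e (a \<oplus>\<^bsub>A\<^esub> a') b \<ominus>\<^bsub>P\<^esub> (e a b \<oplus>\<^bsub>P\<^esub> e a' b) | a a' b.
            a \<in> carrier A \<and> a' \<in> carrier A \<and> b \<in> carrier B} \<union>
         {e a (b \<oplus>\<^bsub>B\<^esub> b') \<ominus>\<^bsub>P\<^esub> (e a b \<oplus>\<^bsub>P\<^esub> e a b') | a b b'.
            a \<in> carrier A \<and> b \<in> carrier B \<and> b' \<in> carrier B} \<union>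
         {e (scalar A c \<otimes>\<^bsub>A\<^esub> a) b \<ominus>\<^bsub>P\<^esub> e a (scalar B c \<otimes>\<^bsub>B\<^esub> b) | c a b.
            c \<in> carrier F \<and> a \<in> carrier A \<and> b \<in> carrier B}"

lemma J_eq: "J = Idl\<^bsub>P\<^esub> relations"
  by (simp add: tensor_ideal_def Let_def relations_def e_def)

end

locale scalar_tensor_product = tensor_product A B F
  for A :: "('f, 'a) ualg" and B :: "('f, 'b) ualg" and F :: "('f, 'm) ring_scheme" +
  assumes sA: "\<And>c. c \<in> carrier F \<Longrightarrow> scalar A c \<in> carrier A"
    and sB: "\<And>c. c \<in> carrier F \<Longrightarrow> scalar B c \<in> carrier B"
begin

lemma relations_closed: "relations \<subseteq> carrier P"
  using sA sB by (auto simp: relations_def intro!: P.minus_closed P.add.m_closed e_closed)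

sublocale J: ideal J P
  unfolding J_eq by (rule P.genideal_ideal[OF relations_closed])

lemma T_simps:
  "carrier T = carrier (P Quot J)" "monoid.mult T = monoid.mult (P Quot J)" "monoid.one T = monoid.one (P Quot J)"
  "ring.zero T = ring.zero (P Quot J)" "ring.add T = ring.add (P Quot J)" "scalar T b = tens \<one>\<^bsub>A\<^esub> b"
  by (simp_all add: tensor_def Let_def tens_def)

lemma ring_T: "ring T"
  unfolding tensor_def Let_def by (intro ring_make_ualg J.quotient_is_ring)

sublocale T: ring T
  by (rule ring_T)

lemma tens_eq: "tens a b = J +>\<^bsub>P\<^esub> e a b"
  by (simp add: tens_def e_def)

lemma rcos_closed: "p \<in> carrier P \<Longrightarrow> J +>\<^bsub>P\<^esub> p \<in> carrier T"
  using ring_hom_closed[OF J.rcos_ring_hom] by (simp add: T_simps)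

lemma rcos:
  assumes "p \<in> carrier P" "q \<in> carrier P"
  shows "(J +>\<^bsub>P\<^esub> p) \<otimes>\<^bsub>T\<^esub> (J +>\<^bsub>P\<^esub> q) = J +>\<^bsub>P\<^esub> (p \<otimes>\<^bsub>P\<^esub> q)"
    "(J +>\<^bsub>P\<^esub> p) \<oplus>\<^bsub>T\<^esub> (J +>\<^bsub>P\<^esub> q) = J +>\<^bsub>P\<^esub> (p \<oplus>\<^bsub>P\<^esub> q)"
  using assms ring_hom_mult[OF J.rcos_ring_hom, of p q] ring_hom_add[OF J.rcos_ring_hom, of p q]
  by (simp_all add: T_simps)

lemma rcos_eqI:
  assumes "p \<in> carrier P" "q \<in> carrier P" "p \<ominus>\<^bsub>P\<^esub> q \<in> J"
  shows "J +>\<^bsub>P\<^esub> p = J +>\<^bsub>P\<^esub> q"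
  using assms P.quotient_eq_iff_same_a_r_cos[OF J.ideal_axioms] by blast

lemma relations_in_J: "relations \<subseteq> J"
  unfolding J_eq by (rule P.genideal_self[OF relations_closed])

lemma tens_closed: "a \<in> carrier A \<Longrightarrow> b \<in> carrier B \<Longrightarrow> tens a b \<in> carrier T"
  by (simp add: tens_eq rcos_closed e_closed)

lemma tens_add_left:
  assumes "a \<in> carrier A" "a' \<in> carrier A" "b \<in> carrier B"
  shows "tens (a \<oplus>\<^bsub>A\<^esub> a') b = tens a b \<oplus>\<^bsub>T\<^esub> tens a' b"
proof -
  have "e (a \<oplus>\<^bsub>A\<^esub> a') b \<ominus>\<^bsub>P\<^esub> (e a b \<oplus>\<^bsub>P\<^esub> e a' b) \<in> J"
    using assms relations_in_J unfolding relations_def by blast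
  then show ?thesis
    using assms by (simp add: tens_eq rcos e_closed rcos_eqI)
qed

lemma tens_add_right:
  assumes "a \<in> carrier A" "b \<in> carrier B" "b' \<in> carrier B"
  shows "tens a (b \<oplus>\<^bsub>B\<^esub> b') = tens a b \<oplus>\<^bsub>T\<^esub> tens a b'"
proof -
  have "e a (b \<oplus>\<^bsub>B\<^esub> b') \<ominus>\<^bsub>P\<^esub> (e a b \<oplus>\<^bsub>P\<^esub> e a b') \<in> J"
    using assms relations_in_J unfolding relations_def by blast
  then show ?thesis
    using assms by (simp add: tens_eq rcos e_closed rcos_eqI)
qed

lemma tens_scalar:
  assumes "c \<in> carrier F" "a \<in> carrier A" "b \<in> carrier B"
  shows "tens (scalar A c \<otimes>\<^bsub>A\<^esub> a) b = tens a (scalar B c \<otimes>\<^bsub>B\<^esub> b)"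
proof -
  have "e (scalar A c \<otimes>\<^bsub>A\<^esub> a) b \<ominus>\<^bsub>P\<^esub> e a (scalar B c \<otimes>\<^bsub>B\<^esub> b) \<in> J"
    using assms relations_in_J unfolding relations_def by blast
  then show ?thesis
    using assms sA sB by (simp add: tens_eq e_closed rcos_eqI)
qed

lemma tens_mult:
  assumes "a \<in> carrier A" "a' \<in> carrier A" "b \<in> carrier B" "b' \<in> carrier B"
  shows "tens a b \<otimes>\<^bsub>T\<^esub> tens a' b' = tens (a \<otimes>\<^bsub>A\<^esub> a') (b \<otimes>\<^bsub>B\<^esub> b')"
proof -
  have "e a b \<otimes>\<^bsub>P\<^esub> e a' b' = e (a \<otimes>\<^bsub>A\<^esub> a') (b \<otimes>\<^bsub>B\<^esub> b')"
    using M.single_mult_single[of "(a, b)" "(a', b')" 1 1] assms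
    by (simp add: e_def single_int_ring DirProd_def)
  then show ?thesis
    using assms by (simp add: tens_eq rcos e_closed)
qed

lemma tens_one: "tens \<one>\<^bsub>A\<^esub> \<one>\<^bsub>B\<^esub> = \<one>\<^bsub>T\<^esub>"
proof -
  have "e \<one>\<^bsub>A\<^esub> \<one>\<^bsub>B\<^esub> = \<one>\<^bsub>P\<^esub>"
    unfolding M.one_P by (simp add: e_def single_int_ring)
  then show ?thesis
    by (simp add: T_simps FactRing_def tens_eq)
qed

lemma tens_zero_right: "a \<in> carrier A \<Longrightarrow> tens a \<zero>\<^bsub>B\<^esub> = \<zero>\<^bsub>T\<^esub>"
  using tens_add_right[of a "\<zero>\<^bsub>B\<^esub>" "\<zero>\<^bsub>B\<^esub>"] tens_closed[of a "\<zero>\<^bsub>B\<^esub>"]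
  by (simp add: T.add.l_cancel_one)

text \<open>Negation is among the cases because the covering ring has integer coefficients:
  multiples of a generator are reached by steps of 1 and -1.\<close>

lemma T_induct [consumes 1, case_names tens add minus]:
  assumes "\<tau> \<in> carrier T"
    and tens: "\<And>a b. a \<in> carrier A \<Longrightarrow> b \<in> carrier B \<Longrightarrow> Q (tens a b)"
    and add: "\<And>\<sigma> \<tau>. \<sigma> \<in> carrier T \<Longrightarrow> \<tau> \<in> carrier T \<Longrightarrow> Q \<sigma> \<Longrightarrow> Q \<tau> \<Longrightarrow> Q (\<sigma> \<oplus>\<^bsub>T\<^esub> \<tau>)"
    and minus: "\<And>\<sigma>. \<sigma> \<in> carrier T \<Longrightarrow> Q \<sigma> \<Longrightarrow> Q (\<ominus>\<^bsub>T\<^esub> \<sigma>)"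
  shows "Q \<tau>"
proof -
  have Q0: "Q \<zero>\<^bsub>T\<^esub>"
    using tens[OF A.zero_closed B.zero_closed] by (simp add: tens_zero_right)
  have J0: "J +>\<^bsub>P\<^esub> \<zero>\<^bsub>P\<^esub> = \<zero>\<^bsub>T\<^esub>"
    using P.a_rcos_zero[OF J.ideal_axioms J.zero_closed] by (simp add: T_simps FactRing_def)
  obtain p where p: "p \<in> carrier P" "\<tau> = J +>\<^bsub>P\<^esub> p"
    using assms(1) unfolding T_simps by (rule quotient_cases)
  from p(1) have "Q (J +>\<^bsub>P\<^esub> p)"
  proof (induction rule: M.P_induct)
    case zero
    show ?case
      using Q0 by (simp add: J0)
  next
    case (single u n)
    obtain a b where u: "u = (a, b)" "a \<in> carrier A" "b \<in> carrier B"
      using single by (auto simp: DirProd_def)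
    define s where "s = (\<lambda>n. single (ring_of_type_algebra :: int ring) u n)"
    have s: "s n \<in> carrier P" for n
      using M.single_in_P[OF single] by (simp add: s_def)
    have s_add: "J +>\<^bsub>P\<^esub> s (m + n) = (J +>\<^bsub>P\<^esub> s m) \<oplus>\<^bsub>T\<^esub> (J +>\<^bsub>P\<^esub> s n)" for m n
      using rcos(2)[OF s s, of m n] by (simp add: M.add_P s_def single_def cong: if_cong)
        (simp add: if_distrib cong: if_cong)
    have s1: "J +>\<^bsub>P\<^esub> s 1 = tens a b"
      by (simp add: tens_eq e_def s_def u single_int_ring)
    have s0: "J +>\<^bsub>P\<^esub> s 0 = \<zero>\<^bsub>T\<^esub>"
    proof -
      have "s 0 = \<zero>\<^bsub>P\<^esub>"
        by (auto simp: s_def single_def M.zero_P)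
      then show ?thesis by (simp add: J0)
    qed
    have "J +>\<^bsub>P\<^esub> s (- 1) = \<ominus>\<^bsub>T\<^esub> tens a b"
      using s_add[of "- 1" 1] u by (intro T.minus_equality[symmetric] tens_closed rcos_closed s) (simp_all add: s0 s1)
    then have Q': "Q (J +>\<^bsub>P\<^esub> s (- 1))" "Q (J +>\<^bsub>P\<^esub> s 1)"
      using u by (simp_all add: s1 tens minus tens_closed)
    have "Q (J +>\<^bsub>P\<^esub> s n)"
    proof (induction n rule: int_induct[where k = 0])
      case base
      then show ?case using Q0 by (simp add: s0)
    next
      case (step1 i)
      then show ?case using Q' s by (simp add: s_add add rcos_closed[OF s])
    next
      case (step2 i)
      then show ?case using Q' add[OF rcos_closed[OF s] rcos_closed[OF s]] s_add[of i "- 1"] by simp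
    qed
    then show ?case by (simp add: s_def)
  next
    case (add f g)
    then show ?case using assms(3)[OF rcos_closed rcos_closed] rcos(2) by simp
  qed
  then show ?thesis by (simp add: p)
qed

text \<open>The universal property of the tensor product for targets of characteristic 2: the map on
  the monoid ring induced by \<open>\<phi>\<close> kills the bilinearity relations and hence the
  ideal they generate.\<close>

lemma T_hom:
  fixes S :: "('c, 'z) ring_scheme"
  assumes S: "ring S" and char2: "\<one>\<^bsub>S\<^esub> \<oplus>\<^bsub>S\<^esub> \<one>\<^bsub>S\<^esub> = \<zero>\<^bsub>S\<^esub>"
    and closed: "\<And>a b. a \<in> carrier A \<Longrightarrow> b \<in> carrier B \<Longrightarrow> \<phi> a b \<in> carrier S"
    and add_left: "\<And>a a' b. a \<in> carrier A \<Longrightarrow> a' \<in> carrier A \<Longrightarrow> b \<in> carrier B \<Longrightarrow>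
      \<phi> (a \<oplus>\<^bsub>A\<^esub> a') b = \<phi> a b \<oplus>\<^bsub>S\<^esub> \<phi> a' b"
    and add_right: "\<And>a b b'. a \<in> carrier A \<Longrightarrow> b \<in> carrier B \<Longrightarrow> b' \<in> carrier B \<Longrightarrow>
      \<phi> a (b \<oplus>\<^bsub>B\<^esub> b') = \<phi> a b \<oplus>\<^bsub>S\<^esub> \<phi> a b'"
    and scalar: "\<And>c a b. c \<in> carrier F \<Longrightarrow> a \<in> carrier A \<Longrightarrow> b \<in> carrier B \<Longrightarrow>
      \<phi> (scalar A c \<otimes>\<^bsub>A\<^esub> a) b = \<phi> a (scalar B c \<otimes>\<^bsub>B\<^esub> b)"
    and mult: "\<And>a a' b b'. a \<in> carrier A \<Longrightarrow> a' \<in> carrier A \<Longrightarrow> b \<in> carrier B \<Longrightarrow> b' \<in> carrier B \<Longrightarrow>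
      \<phi> (a \<otimes>\<^bsub>A\<^esub> a') (b \<otimes>\<^bsub>B\<^esub> b') = \<phi> a b \<otimes>\<^bsub>S\<^esub> \<phi> a' b'"
    and one: "\<phi> \<one>\<^bsub>A\<^esub> \<one>\<^bsub>B\<^esub> = \<one>\<^bsub>S\<^esub>"
  shows "\<exists>h\<in>ring_hom T S. \<forall>a\<in>carrier A. \<forall>b\<in>carrier B. h (tens a b) = \<phi> a b"
proof -
  interpret S: ring S by fact
  \<comment> \<open>In characteristic 2 the integers act on \<open>S\<close> through their parity.\<close>
  define \<sigma> where "\<sigma> = (\<lambda>n::int. if even n then \<zero>\<^bsub>S\<^esub> else \<one>\<^bsub>S\<^esub>)"
  have \<sigma>: "\<sigma> \<in> ring_hom ring_of_type_algebra S"
    using char2 by (intro ring_hom_memI) (auto simp: \<sigma>_def)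
  define h where "h = M.eval S \<sigma> (\<lambda>(a, b). \<phi> a b)"
  have hom: "(\<lambda>(a, b). \<phi> a b) \<in> hom (A \<times>\<times> B) S" "(\<lambda>(a, b). \<phi> a b) \<one>\<^bsub>A \<times>\<times> B\<^esub> = \<one>\<^bsub>S\<^esub>"
    using closed mult one by (auto simp: hom_def DirProd_def)
  have central: "\<sigma> n \<otimes>\<^bsub>S\<^esub> (\<lambda>(a, b). \<phi> a b) u = (\<lambda>(a, b). \<phi> a b) u \<otimes>\<^bsub>S\<^esub> \<sigma> n" if "u \<in> carrier (A \<times>\<times> B)" for n u
    using that closed by (auto simp: \<sigma>_def DirProd_def)
  have h: "h \<in> ring_hom P S"
    unfolding h_def by (rule M.eval_hom[OF S \<sigma> hom central])
  have he: "h (e a b) = \<phi> a b" if "a \<in> carrier A" "b \<in> carrier B" for a b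
    using M.eval_single[OF S \<sigma> hom central, of "(a, b)" 1] that closed
    by (simp add: h_def e_def single_int_ring DirProd_def \<sigma>_def)
  interpret h: ring_hom_ring P S h
    by (intro ring_hom_ringI2 P.ring_axioms S h)
  have "relations \<subseteq> a_kernel P S h"
  proof
    have minus: "h (f \<ominus>\<^bsub>P\<^esub> g) = \<zero>\<^bsub>S\<^esub>" if "f \<in> carrier P" "g \<in> carrier P" "h f = h g" for f g
      using that by (simp add: a_minus_def S.r_neg)
    fix r
    assume "r \<in> relations"
    then show "r \<in> a_kernel P S h"
      unfolding relations_def a_kernel_def' using sA sB
      by (elim UnE) (auto intro!: minus simp: e_closed he add_left add_right scalar)
  qed
  then have "J \<subseteq> a_kernel P S h"
    unfolding J_eq by (rule P.genideal_minimal[OF h.kernel_is_ideal])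
  then have kerJ: "h j = \<zero>\<^bsub>S\<^esub>" if "j \<in> J" for j
    using that
    unfolding a_kernel_def' by fast
  have "\<exists>k\<in>ring_hom (P Quot J) S. \<forall>p\<in>carrier P. k (J +>\<^bsub>P\<^esub> p) = h p"
    by (rule factor_hom[OF J.ideal_axioms S h]) (rule kerJ)
  then obtain k where k: "k \<in> ring_hom (P Quot J) S" "\<forall>p\<in>carrier P. k (J +>\<^bsub>P\<^esub> p) = h p"
    by (elim bexE)
  have "k \<in> ring_hom T S"
    using k(1) by (simp add: ring_hom_def T_simps)
  then show ?thesis
    using k(2) he by (intro bexI[of _ k]) (auto simp: tens_eq e_closed)
qed

end

section \<open>Quaternion algebras\<close>

locale quaternion =
  fixes \<gamma> \<delta> :: "'f::field"
begin

abbreviation F :: "'f ring" where "F \<equiv> ring_of_type_algebra"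
abbreviation P where "P \<equiv> free_alg F"
abbreviation A where "A \<equiv> quaternion_algebra F \<gamma> \<delta>"
abbreviation I where "I \<equiv> quaternion_ideal F \<gamma> \<delta>"

lemma monoid_free_monoid: "Group.monoid (free_monoid :: 'a list monoid)"
  by (rule monoidI) (auto simp: free_monoid_def)

sublocale M: monoid_ring free_monoid P
  by (intro monoid_ring.intro monoid_free_monoid reflexive)

sublocale P: ring P
  by (rule M.ring_P)

definition w :: "gen list \<Rightarrow> 'f \<Rightarrow> gen list \<Rightarrow> 'f" where
  "w = single F"

lemma w_closed: "w u c \<in> carrier P"
  unfolding w_def by (rule M.single_in_P) (simp add: free_monoid_def)

lemma w_mult: "w u c \<otimes>\<^bsub>P\<^esub> w v d = w (u @ v) (c * d)"
  using M.single_mult_single[of u v c d] by (simp add: w_def free_monoid_def)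

lemma w_add: "w u c \<oplus>\<^bsub>P\<^esub> w u d = w u (c + d)"
  by (auto simp: M.add_P w_def single_def)

lemma w_one: "w [] 1 = \<one>\<^bsub>P\<^esub>" and w_scalar: "scalar P c = w [] c"
  by (simp_all add: M.one_P M.scalar_P w_def) (simp_all add: free_monoid_def)

definition relations :: "(gen list \<Rightarrow> 'f) set" where
  "relations = (let x = w [Gx] 1; y = w [Gy] 1 in
     {(x \<otimes>\<^bsub>P\<^esub> x \<oplus>\<^bsub>P\<^esub> x) \<ominus>\<^bsub>P\<^esub> scalar P \<gamma>, y \<otimes>\<^bsub>P\<^esub> y \<ominus>\<^bsub>P\<^esub> scalar P \<delta>,
      y \<otimes>\<^bsub>P\<^esub> x \<ominus>\<^bsub>P\<^esub> (x \<oplus>\<^bsub>P\<^esub> \<one>\<^bsub>P\<^esub>) \<otimes>\<^bsub>P\<^esub> y})"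

lemma I_eq: "I = Idl\<^bsub>P\<^esub> relations"
  by (simp add: quaternion_ideal_def relations_def w_def Let_def)

lemma relations_closed: "relations \<subseteq> carrier P"
  by (simp add: relations_def Let_def w_closed w_scalar)

sublocale I: ideal I P
  unfolding I_eq by (rule P.genideal_ideal[OF relations_closed])

definition s :: "'f \<Rightarrow> (gen list \<Rightarrow> 'f) set" where "s c = I +>\<^bsub>P\<^esub> w [] c"
definition x :: "(gen list \<Rightarrow> 'f) set" where "x = I +>\<^bsub>P\<^esub> w [Gx] 1"
definition y :: "(gen list \<Rightarrow> 'f) set" where "y = I +>\<^bsub>P\<^esub> w [Gy] 1"

lemma A_simps:
  "carrier A = carrier (P Quot I)" "monoid.mult A = monoid.mult (P Quot I)" "monoid.one A = monoid.one (P Quot I)"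
  "ring.zero A = ring.zero (P Quot I)" "ring.add A = ring.add (P Quot I)" "scalar A = s"
  by (simp_all add: quaternion_algebra_def Let_def s_def w_scalar fun_eq_iff)

sublocale A: ring A
  unfolding quaternion_algebra_def Let_def by (intro ring_make_ualg I.quotient_is_ring)

lemma rcos_closed: "p \<in> carrier P \<Longrightarrow> I +>\<^bsub>P\<^esub> p \<in> carrier A"
  using ring_hom_closed[OF I.rcos_ring_hom] by (simp add: A_simps)

lemma rcos:
  assumes "p \<in> carrier P" "q \<in> carrier P"
  shows "(I +>\<^bsub>P\<^esub> p) \<otimes>\<^bsub>A\<^esub> (I +>\<^bsub>P\<^esub> q) = I +>\<^bsub>P\<^esub> (p \<otimes>\<^bsub>P\<^esub> q)"
    "(I +>\<^bsub>P\<^esub> p) \<oplus>\<^bsub>A\<^esub> (I +>\<^bsub>P\<^esub> q) = I +>\<^bsub>P\<^esub> (p \<oplus>\<^bsub>P\<^esub> q)"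
  using assms ring_hom_mult[OF I.rcos_ring_hom, of p q] ring_hom_add[OF I.rcos_ring_hom, of p q]
  by (simp_all add: A_simps)

lemma s_closed [simp]: "s c \<in> carrier A" and x_closed [simp]: "x \<in> carrier A" and y_closed [simp]: "y \<in> carrier A"
  by (simp_all add: s_def x_def y_def rcos_closed w_closed)

lemma s_hom: "s c \<oplus>\<^bsub>A\<^esub> s d = s (c + d)" "s c \<otimes>\<^bsub>A\<^esub> s d = s (c * d)" "s 1 = \<one>\<^bsub>A\<^esub>" "s 0 = \<zero>\<^bsub>A\<^esub>"
proof -
  show *: "s c \<oplus>\<^bsub>A\<^esub> s d = s (c + d)" "s c \<otimes>\<^bsub>A\<^esub> s d = s (c * d)" "s 1 = \<one>\<^bsub>A\<^esub>" for c d
    by (simp_all add: s_def rcos w_closed w_add w_mult) (simp add: w_one A_simps FactRing_def)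
  show "s 0 = \<zero>\<^bsub>A\<^esub>"
    using *(1)[of 0 0] s_closed[of 0] by (simp add: A.add.l_cancel_one)
qed

lemma s_central:
  assumes "a \<in> carrier A"
  shows "s c \<otimes>\<^bsub>A\<^esub> a = a \<otimes>\<^bsub>A\<^esub> s c"
proof -
  obtain p where p: "p \<in> carrier P" "a = I +>\<^bsub>P\<^esub> p"
    using assms unfolding A_simps by (rule quotient_cases)
  have "w [] c \<otimes>\<^bsub>P\<^esub> p = p \<otimes>\<^bsub>P\<^esub> w [] c"
    using p(1)
  proof (induction rule: M.P_induct)
    case zero
    show ?case by (simp add: w_closed)
  next
    case (single u d)
    show ?case
      using w_mult[of "[]" c u d] w_mult[of u d "[]" c] by (simp add: w_def mult.commute)
  next
    case (add f g)
    then show ?case by (simp add: P.l_distr P.r_distr w_closed)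
  qed
  then show ?thesis
    by (simp add: s_def p rcos w_closed)
qed

lemma rcos_eqI: "p \<in> carrier P \<Longrightarrow> q \<in> carrier P \<Longrightarrow> p \<ominus>\<^bsub>P\<^esub> q \<in> I \<Longrightarrow> I +>\<^bsub>P\<^esub> p = I +>\<^bsub>P\<^esub> q"
  using P.quotient_eq_iff_same_a_r_cos[OF I.ideal_axioms] by blast

lemma presentation:
  "x \<otimes>\<^bsub>A\<^esub> x \<oplus>\<^bsub>A\<^esub> x = s \<gamma>" "y \<otimes>\<^bsub>A\<^esub> y = s \<delta>" "y \<otimes>\<^bsub>A\<^esub> x = x \<otimes>\<^bsub>A\<^esub> y \<oplus>\<^bsub>A\<^esub> y"
proof -
  have "relations \<subseteq> I"
    unfolding I_eq by (rule P.genideal_self[OF relations_closed])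
  then have "(w [Gx] 1 \<otimes>\<^bsub>P\<^esub> w [Gx] 1 \<oplus>\<^bsub>P\<^esub> w [Gx] 1) \<ominus>\<^bsub>P\<^esub> w [] \<gamma> \<in> I"
    "w [Gy] 1 \<otimes>\<^bsub>P\<^esub> w [Gy] 1 \<ominus>\<^bsub>P\<^esub> w [] \<delta> \<in> I"
    "w [Gy] 1 \<otimes>\<^bsub>P\<^esub> w [Gx] 1 \<ominus>\<^bsub>P\<^esub> (w [Gx] 1 \<oplus>\<^bsub>P\<^esub> \<one>\<^bsub>P\<^esub>) \<otimes>\<^bsub>P\<^esub> w [Gy] 1 \<in> I"
    unfolding relations_def Let_def w_scalar by simp_all
  from rcos_eqI[OF _ _ this(1)] rcos_eqI[OF _ _ this(2)] rcos_eqI[OF _ _ this(3)]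
  show "x \<otimes>\<^bsub>A\<^esub> x \<oplus>\<^bsub>A\<^esub> x = s \<gamma>" "y \<otimes>\<^bsub>A\<^esub> y = s \<delta>" "y \<otimes>\<^bsub>A\<^esub> x = x \<otimes>\<^bsub>A\<^esub> y \<oplus>\<^bsub>A\<^esub> y"
    by (simp_all add: x_def y_def s_def rcos w_closed P.l_distr)
qed

text \<open>Words are built letter by letter from the left, so scalars, sums and left multiplication
  by the two generators reach everything.\<close>

lemma A_induct [consumes 1, case_names scalar add x y]:
  assumes "a \<in> carrier A"
    and scalar: "\<And>c. Q (s c)"
    and add: "\<And>a b. a \<in> carrier A \<Longrightarrow> b \<in> carrier A \<Longrightarrow> Q a \<Longrightarrow> Q b \<Longrightarrow> Q (a \<oplus>\<^bsub>A\<^esub> b)"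
    and x: "\<And>a. a \<in> carrier A \<Longrightarrow> Q a \<Longrightarrow> Q (x \<otimes>\<^bsub>A\<^esub> a)"
    and y: "\<And>a. a \<in> carrier A \<Longrightarrow> Q a \<Longrightarrow> Q (y \<otimes>\<^bsub>A\<^esub> a)"
  shows "Q a"
proof -
  obtain p where p: "p \<in> carrier P" "a = I +>\<^bsub>P\<^esub> p"
    using assms(1) unfolding A_simps by (rule quotient_cases)
  have "Q (I +>\<^bsub>P\<^esub> p)"
    using p(1)
  proof (induction rule: M.P_induct)
    case zero
    have "I +>\<^bsub>P\<^esub> \<zero>\<^bsub>P\<^esub> = s 0"
      using P.a_rcos_zero[OF I.ideal_axioms I.zero_closed] by (simp add: s_hom A_simps FactRing_def)
    then show ?case
      using scalar by simp
  next
    case (single u c)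
    have "Q (I +>\<^bsub>P\<^esub> w u c)"
    proof (induction u)
      case Nil
      then show ?case
        using scalar by (simp add: s_def)
    next
      case (Cons g u)
      have "I +>\<^bsub>P\<^esub> w (g # u) c = (I +>\<^bsub>P\<^esub> w [g] 1) \<otimes>\<^bsub>A\<^esub> (I +>\<^bsub>P\<^esub> w u c)"
        by (simp add: rcos w_closed w_mult)
      then show ?case
        using x[OF rcos_closed[OF w_closed] Cons.IH] y[OF rcos_closed[OF w_closed] Cons.IH]
        by (cases g) (simp_all add: x_def y_def)
    qed
    then show ?case by (simp add: w_def)
  next
    case (add f g)
    then show ?case using assms(3)[OF rcos_closed rcos_closed] rcos(2) by simp
  qed
  then show ?thesis by (simp add: p)
qed

definition comb :: "'f \<Rightarrow> 'f \<Rightarrow> 'f \<Rightarrow> 'f \<Rightarrow> (gen list \<Rightarrow> 'f) set" where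
  "comb c0 c1 c2 c3 = s c0 \<oplus>\<^bsub>A\<^esub> s c1 \<otimes>\<^bsub>A\<^esub> x \<oplus>\<^bsub>A\<^esub> s c2 \<otimes>\<^bsub>A\<^esub> y \<oplus>\<^bsub>A\<^esub> s c3 \<otimes>\<^bsub>A\<^esub> (x \<otimes>\<^bsub>A\<^esub> y)"

lemma comb_add: "comb c0 c1 c2 c3 \<oplus>\<^bsub>A\<^esub> comb d0 d1 d2 d3 = comb (c0 + d0) (c1 + d1) (c2 + d2) (c3 + d3)"
proof -
  have *: "(a \<oplus>\<^bsub>A\<^esub> b) \<oplus>\<^bsub>A\<^esub> (a' \<oplus>\<^bsub>A\<^esub> b') = (a \<oplus>\<^bsub>A\<^esub> a') \<oplus>\<^bsub>A\<^esub> (b \<oplus>\<^bsub>A\<^esub> b')"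
    if "a \<in> carrier A" "a' \<in> carrier A" "b \<in> carrier A" "b' \<in> carrier A" for a a' b b'
    using that by (simp add: A.a_ac)
  have 4: "(a \<oplus>\<^bsub>A\<^esub> b \<oplus>\<^bsub>A\<^esub> c \<oplus>\<^bsub>A\<^esub> d) \<oplus>\<^bsub>A\<^esub> (a' \<oplus>\<^bsub>A\<^esub> b' \<oplus>\<^bsub>A\<^esub> c' \<oplus>\<^bsub>A\<^esub> d') =
    (a \<oplus>\<^bsub>A\<^esub> a') \<oplus>\<^bsub>A\<^esub> (b \<oplus>\<^bsub>A\<^esub> b') \<oplus>\<^bsub>A\<^esub> (c \<oplus>\<^bsub>A\<^esub> c') \<oplus>\<^bsub>A\<^esub> (d \<oplus>\<^bsub>A\<^esub> d')"
    if "a \<in> carrier A" "a' \<in> carrier A" "b \<in> carrier A" "b' \<in> carrier A"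
      "c \<in> carrier A" "c' \<in> carrier A" "d \<in> carrier A" "d' \<in> carrier A" for a a' b b' c c' d d'
    using that *[of "a \<oplus>\<^bsub>A\<^esub> b \<oplus>\<^bsub>A\<^esub> c" "a' \<oplus>\<^bsub>A\<^esub> b' \<oplus>\<^bsub>A\<^esub> c'" d d'] *[of "a \<oplus>\<^bsub>A\<^esub> b" "a' \<oplus>\<^bsub>A\<^esub> b'" c c']
      *[of a a' b b'] by simp
  show ?thesis
    unfolding comb_def s_hom(1)[symmetric] by (subst 4) (simp_all add: A.l_distr)
qed

lemma comb_terms:
  "s c = comb c 0 0 0" "s c \<otimes>\<^bsub>A\<^esub> x = comb 0 c 0 0" "s c \<otimes>\<^bsub>A\<^esub> y = comb 0 0 c 0"
  "s c \<otimes>\<^bsub>A\<^esub> (x \<otimes>\<^bsub>A\<^esub> y) = comb 0 0 0 c"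
  by (simp_all add: comb_def s_hom(4))

lemma s_lcomm: "a \<in> carrier A \<Longrightarrow> b \<in> carrier A \<Longrightarrow> a \<otimes>\<^bsub>A\<^esub> (s c \<otimes>\<^bsub>A\<^esub> b) = s c \<otimes>\<^bsub>A\<^esub> (a \<otimes>\<^bsub>A\<^esub> b)"
  using A.m_assoc[of a "s c" b] A.m_assoc[of "s c" a b] s_central[of a c] by simp

lemma x_comb:
  assumes "CHAR('f) = 2"
  shows "x \<otimes>\<^bsub>A\<^esub> comb c0 c1 c2 c3 = comb (c1 * \<gamma>) (c0 + c1) (c3 * \<gamma>) (c2 + c3)"
proof -
  have "s (1 + 1) = \<zero>\<^bsub>A\<^esub>"
    using assms of_nat_CHAR[where 'a = 'f] by (simp add: s_hom)
  then have two: "\<one>\<^bsub>A\<^esub> \<oplus>\<^bsub>A\<^esub> \<one>\<^bsub>A\<^esub> = \<zero>\<^bsub>A\<^esub>"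
    using s_hom(1)[of 1 1] by (simp add: s_hom(3))
  have xx: "x \<otimes>\<^bsub>A\<^esub> x = s \<gamma> \<oplus>\<^bsub>A\<^esub> x"
  proof -
    have "x \<oplus>\<^bsub>A\<^esub> x = (\<one>\<^bsub>A\<^esub> \<oplus>\<^bsub>A\<^esub> \<one>\<^bsub>A\<^esub>) \<otimes>\<^bsub>A\<^esub> x"
      by (simp add: A.l_distr)
    then have "x \<oplus>\<^bsub>A\<^esub> x = \<zero>\<^bsub>A\<^esub>"
      by (simp add: two)
    then show ?thesis
      by (simp add: A.a_assoc flip: presentation(1))
  qed
  have xxy: "x \<otimes>\<^bsub>A\<^esub> (x \<otimes>\<^bsub>A\<^esub> y) = s \<gamma> \<otimes>\<^bsub>A\<^esub> y \<oplus>\<^bsub>A\<^esub> x \<otimes>\<^bsub>A\<^esub> y"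
    by (simp add: xx A.l_distr flip: A.m_assoc)
  have ss: "s c \<otimes>\<^bsub>A\<^esub> (s d \<otimes>\<^bsub>A\<^esub> a) = s (c * d) \<otimes>\<^bsub>A\<^esub> a" if "a \<in> carrier A" for c d a
    using that by (simp add: s_hom flip: A.m_assoc)
  have "x \<otimes>\<^bsub>A\<^esub> comb c0 c1 c2 c3 =
    s c0 \<otimes>\<^bsub>A\<^esub> x \<oplus>\<^bsub>A\<^esub> (s (c1 * \<gamma>) \<oplus>\<^bsub>A\<^esub> s c1 \<otimes>\<^bsub>A\<^esub> x) \<oplus>\<^bsub>A\<^esub> s c2 \<otimes>\<^bsub>A\<^esub> (x \<otimes>\<^bsub>A\<^esub> y) \<oplus>\<^bsub>A\<^esub>
      (s (c3 * \<gamma>) \<otimes>\<^bsub>A\<^esub> y \<oplus>\<^bsub>A\<^esub> s c3 \<otimes>\<^bsub>A\<^esub> (x \<otimes>\<^bsub>A\<^esub> y))"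
    by (simp add: comb_def A.r_distr s_lcomm[of x] s_central[of x, symmetric] xx xxy ss s_hom)
  also have "\<dots> = comb (c1 * \<gamma>) (c0 + c1) (c3 * \<gamma>) (c2 + c3)"
    unfolding comb_terms(2-4) unfolding comb_terms(1) comb_add by simp
  finally show ?thesis .
qed

lemma y_comb: "y \<otimes>\<^bsub>A\<^esub> comb c0 c1 c2 c3 = comb (c2 * \<delta> + c3 * \<delta>) (c3 * \<delta>) (c0 + c1) c1"
proof -
  have yxy: "y \<otimes>\<^bsub>A\<^esub> (x \<otimes>\<^bsub>A\<^esub> y) = s \<delta> \<otimes>\<^bsub>A\<^esub> x \<oplus>\<^bsub>A\<^esub> s \<delta>"
  proof -
    have "y \<otimes>\<^bsub>A\<^esub> (x \<otimes>\<^bsub>A\<^esub> y) = (y \<otimes>\<^bsub>A\<^esub> x) \<otimes>\<^bsub>A\<^esub> y"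
      by (simp add: A.m_assoc)
    also have "\<dots> = x \<otimes>\<^bsub>A\<^esub> (y \<otimes>\<^bsub>A\<^esub> y) \<oplus>\<^bsub>A\<^esub> y \<otimes>\<^bsub>A\<^esub> y"
      unfolding presentation(3) by (simp add: A.l_distr A.m_assoc)
    finally show ?thesis
      by (simp add: presentation(2) s_central)
  qed
  have ss: "s c \<otimes>\<^bsub>A\<^esub> (s d \<otimes>\<^bsub>A\<^esub> a) = s (c * d) \<otimes>\<^bsub>A\<^esub> a" if "a \<in> carrier A" for c d a
    using that by (simp add: s_hom flip: A.m_assoc)
  have "y \<otimes>\<^bsub>A\<^esub> comb c0 c1 c2 c3 =
    s c0 \<otimes>\<^bsub>A\<^esub> y \<oplus>\<^bsub>A\<^esub> (s c1 \<otimes>\<^bsub>A\<^esub> (x \<otimes>\<^bsub>A\<^esub> y) \<oplus>\<^bsub>A\<^esub> s c1 \<otimes>\<^bsub>A\<^esub> y) \<oplus>\<^bsub>A\<^esub> s (c2 * \<delta>) \<oplus>\<^bsub>A\<^esub>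
      (s (c3 * \<delta>) \<otimes>\<^bsub>A\<^esub> x \<oplus>\<^bsub>A\<^esub> s (c3 * \<delta>))"
    by (simp add: comb_def A.r_distr s_lcomm[of y] s_central[of y, symmetric] presentation(2,3) yxy ss s_hom)
  also have "\<dots> = comb (c2 * \<delta> + c3 * \<delta>) (c3 * \<delta>) (c0 + c1) c1"
    unfolding comb_terms(2-4) unfolding comb_terms(1) comb_add by simp
  finally show ?thesis .
qed

text \<open>The span of 1, x, y, xy contains the scalars and is stable under left multiplication by
  x and y. Independence is not addressed here; in \<open>splitsI\<close> the injectivity of the map
  to matrices takes its place.\<close>

lemma spanned:
  assumes "CHAR('f) = 2" "a \<in> carrier A"
  shows "\<exists>c0 c1 c2 c3. a = comb c0 c1 c2 c3"
  using assms(2)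
proof (induction rule: A_induct)
  case (scalar c)
  have "s c = comb c 0 0 0"
    by (simp add: comb_def s_hom)
  then show ?case by blast
next
  case (add a b)
  then show ?case by (metis comb_add)
next
  case (x a)
  then show ?case by (metis x_comb[OF assms(1)])
next
  case (y a)
  then show ?case by (metis y_comb)
qed

text \<open>The universal property of the presentation: matrices satisfying the three relations
  define a representation of the algebra.\<close>

lemma A_hom:
  fixes S :: "('c, 'z) ring_scheme"
  assumes S: "ring S" and \<sigma>: "\<sigma> \<in> ring_hom F S"
    and central: "\<And>c a. a \<in> carrier S \<Longrightarrow> \<sigma> c \<otimes>\<^bsub>S\<^esub> a = a \<otimes>\<^bsub>S\<^esub> \<sigma> c"
    and X: "p \<in> carrier S" "p \<otimes>\<^bsub>S\<^esub> p \<oplus>\<^bsub>S\<^esub> p = \<sigma> \<gamma>"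
    and Y: "q \<in> carrier S" "q \<otimes>\<^bsub>S\<^esub> q = \<sigma> \<delta>" "q \<otimes>\<^bsub>S\<^esub> p = (p \<oplus>\<^bsub>S\<^esub> \<one>\<^bsub>S\<^esub>) \<otimes>\<^bsub>S\<^esub> q"
  shows "\<exists>h\<in>ring_hom A S. h x = p \<and> h y = q \<and> (\<forall>c. h (s c) = \<sigma> c)"
proof -
  interpret S: ring S by fact
  define g where "g = (\<lambda>z. case z of Gx \<Rightarrow> p | Gy \<Rightarrow> q)"
  define \<phi> where "\<phi> = (\<lambda>u. foldr (\<lambda>z a. g z \<otimes>\<^bsub>S\<^esub> a) u \<one>\<^bsub>S\<^esub>)"
  have g: "g z \<in> carrier S" for z
    using X Y by (cases z) (auto simp: g_def)
  have \<phi>_closed: "\<phi> u \<in> carrier S" for u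
    by (induction u) (auto simp: \<phi>_def g)
  have \<phi>_append: "\<phi> (u @ v) = \<phi> u \<otimes>\<^bsub>S\<^esub> \<phi> v" for u v
    using \<phi>_closed g by (induction u) (auto simp: \<phi>_def S.m_assoc)
  have hom: "\<phi> \<in> hom free_monoid S" "\<phi> \<one>\<^bsub>free_monoid\<^esub> = \<one>\<^bsub>S\<^esub>"
    using \<phi>_closed \<phi>_append by (auto simp: hom_def free_monoid_def) (simp add: \<phi>_def)
  have c: "\<sigma> d \<otimes>\<^bsub>S\<^esub> \<phi> u = \<phi> u \<otimes>\<^bsub>S\<^esub> \<sigma> d" for d u
    by (rule central[OF \<phi>_closed])
  define h where "h = M.eval S \<sigma> \<phi>"
  have h: "h \<in> ring_hom P S"
    unfolding h_def by (rule M.eval_hom[OF S \<sigma> hom c])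
  have \<sigma>_closed: "\<sigma> d \<in> carrier S" for d
    using ring_hom_closed[OF \<sigma>] by simp
  have \<sigma>_one: "\<sigma> 1 = \<one>\<^bsub>S\<^esub>"
    using ring_hom_one[OF \<sigma>] by simp
  have "h (w u d) = \<sigma> d \<otimes>\<^bsub>S\<^esub> \<phi> u" for u d
    unfolding h_def w_def by (rule M.eval_single[OF S \<sigma> hom c]) (simp add: free_monoid_def)
  then have hw: "h (w [Gx] 1) = p" "h (w [Gy] 1) = q" "h (w [] d) = \<sigma> d" for d
    using X(1) Y(1) \<sigma>_closed by (simp_all add: \<phi>_def g_def \<sigma>_one)
  interpret h: ring_hom_ring P S h
    by (intro ring_hom_ringI2 P.ring_axioms S h)
  have minus: "h (f \<ominus>\<^bsub>P\<^esub> g) = \<zero>\<^bsub>S\<^esub>" if "f \<in> carrier P" "g \<in> carrier P" "h f = h g" for f g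
    using that by (simp add: a_minus_def S.r_neg)
  have "relations \<subseteq> a_kernel P S h"
    unfolding relations_def Let_def a_kernel_def' w_scalar
    by (auto intro!: minus simp: w_closed hw X Y)
  then have "I \<subseteq> a_kernel P S h"
    unfolding I_eq by (rule P.genideal_minimal[OF h.kernel_is_ideal])
  then have ker: "h j = \<zero>\<^bsub>S\<^esub>" if "j \<in> I" for j
    using that unfolding a_kernel_def' by fast
  have "\<exists>k\<in>ring_hom (P Quot I) S. \<forall>p\<in>carrier P. k (I +>\<^bsub>P\<^esub> p) = h p"
    by (rule factor_hom[OF I.ideal_axioms S h]) (rule ker)
  then obtain k where k: "k \<in> ring_hom (P Quot I) S" "\<forall>p\<in>carrier P. k (I +>\<^bsub>P\<^esub> p) = h p"
    by (elim bexE)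
  have "k \<in> ring_hom A S"
    using k(1) by (simp add: ring_hom_def A_simps)
  moreover have "k x = p" "k y = q" "\<forall>c. k (s c) = \<sigma> c"
    using k(2) hw by (simp_all add: x_def y_def s_def w_closed)
  ultimately show ?thesis
    by (intro bexI[of _ k]) auto
qed

end

section \<open>Splitting by two-by-two matrices\<close>

locale matrices = K: field K for K :: "('f, 'k) ualg"
begin

abbreviation S where "S \<equiv> mat2 K"

lemma mem_S: "m \<in> carrier S \<longleftrightarrow> (\<forall>i j. m i j \<in> carrier K)"
  by (simp add: mat2_def)

lemma S_simps:
  "(m \<oplus>\<^bsub>S\<^esub> n) = (\<lambda>i j. m i j \<oplus>\<^bsub>K\<^esub> n i j)" "\<zero>\<^bsub>S\<^esub> = (\<lambda>i j. \<zero>\<^bsub>K\<^esub>)"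
  "\<one>\<^bsub>S\<^esub> = (\<lambda>i j. if i = j then \<one>\<^bsub>K\<^esub> else \<zero>\<^bsub>K\<^esub>)"
  "scalar S c = (\<lambda>i j. if i = j then c else \<zero>\<^bsub>K\<^esub>)"
  by (simp_all add: mat2_def)

lemma S_mult:
  assumes "m \<in> carrier S" "n \<in> carrier S"
  shows "m \<otimes>\<^bsub>S\<^esub> n = (\<lambda>i j. m i True \<otimes>\<^bsub>K\<^esub> n True j \<oplus>\<^bsub>K\<^esub> m i False \<otimes>\<^bsub>K\<^esub> n False j)"
proof (intro ext)
  fix i j
  have "(m \<otimes>\<^bsub>S\<^esub> n) i j = (\<Oplus>\<^bsub>K\<^esub>l\<in>{True, False}. m i l \<otimes>\<^bsub>K\<^esub> n l j)"
    by (simp add: mat2_def UNIV_bool insert_commute)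
  also have "\<dots> = m i True \<otimes>\<^bsub>K\<^esub> n True j \<oplus>\<^bsub>K\<^esub> m i False \<otimes>\<^bsub>K\<^esub> n False j"
    using assms by (subst K.finsum_insert) (auto simp: mem_S)
  finally show "(m \<otimes>\<^bsub>S\<^esub> n) i j = m i True \<otimes>\<^bsub>K\<^esub> n True j \<oplus>\<^bsub>K\<^esub> m i False \<otimes>\<^bsub>K\<^esub> n False j" .
qed

lemma S_mult_closed: "m \<in> carrier S \<Longrightarrow> n \<in> carrier S \<Longrightarrow> m \<otimes>\<^bsub>S\<^esub> n \<in> carrier S"
  by (subst S_mult) (auto simp: mem_S)

lemma interchange:
  assumes "a \<in> carrier K" "b \<in> carrier K" "c \<in> carrier K" "d \<in> carrier K"
  shows "(a \<oplus>\<^bsub>K\<^esub> b) \<oplus>\<^bsub>K\<^esub> (c \<oplus>\<^bsub>K\<^esub> d) = (a \<oplus>\<^bsub>K\<^esub> c) \<oplus>\<^bsub>K\<^esub> (b \<oplus>\<^bsub>K\<^esub> d)"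
  using assms by (simp add: K.a_ac)

lemma ring_S: "ring S"
proof (rule ringI)
  show "abelian_group S"
  proof (rule abelian_groupI)
    show "\<exists>n\<in>carrier S. n \<oplus>\<^bsub>S\<^esub> m = \<zero>\<^bsub>S\<^esub>" if "m \<in> carrier S" for m
      using that by (intro bexI[of _ "\<lambda>i j. \<ominus>\<^bsub>K\<^esub> m i j"]) (auto simp: S_simps mem_S K.l_neg)
  qed (auto simp: S_simps mem_S K.a_ac)
  show "Group.monoid S"
  proof (rule monoidI)
    fix l m n
    assume c: "l \<in> carrier S" "m \<in> carrier S" "n \<in> carrier S"
    have e: "l i j \<in> carrier K" "m i j \<in> carrier K" "n i j \<in> carrier K" for i j
      using c by (auto simp: mem_S)
    show "(l \<otimes>\<^bsub>S\<^esub> m) \<otimes>\<^bsub>S\<^esub> n = l \<otimes>\<^bsub>S\<^esub> (m \<otimes>\<^bsub>S\<^esub> n)"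
    proof (intro ext)
      fix i j
      have "((l \<otimes>\<^bsub>S\<^esub> m) \<otimes>\<^bsub>S\<^esub> n) i j =
        (l i True \<otimes>\<^bsub>K\<^esub> (m True True \<otimes>\<^bsub>K\<^esub> n True j) \<oplus>\<^bsub>K\<^esub> l i False \<otimes>\<^bsub>K\<^esub> (m False True \<otimes>\<^bsub>K\<^esub> n True j)) \<oplus>\<^bsub>K\<^esub>
        (l i True \<otimes>\<^bsub>K\<^esub> (m True False \<otimes>\<^bsub>K\<^esub> n False j) \<oplus>\<^bsub>K\<^esub> l i False \<otimes>\<^bsub>K\<^esub> (m False False \<otimes>\<^bsub>K\<^esub> n False j))"
        unfolding S_mult[OF S_mult_closed[OF c(1,2)] c(3)] unfolding S_mult[OF c(1,2)]
        using e by (simp add: K.l_distr K.m_assoc)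
      also have "\<dots> = (l \<otimes>\<^bsub>S\<^esub> (m \<otimes>\<^bsub>S\<^esub> n)) i j"
        unfolding S_mult[OF c(1) S_mult_closed[OF c(2,3)]] unfolding S_mult[OF c(2,3)]
        using e by (subst interchange) (simp_all add: K.r_distr)
      finally show "((l \<otimes>\<^bsub>S\<^esub> m) \<otimes>\<^bsub>S\<^esub> n) i j = (l \<otimes>\<^bsub>S\<^esub> (m \<otimes>\<^bsub>S\<^esub> n)) i j" .
    qed
  next
    fix m
    assume c: "m \<in> carrier S"
    have one: "\<one>\<^bsub>S\<^esub> \<in> carrier S"
      by (simp add: S_simps mem_S)
    have e: "m i j \<in> carrier K" for i j
      using c by (auto simp: mem_S)
    show "\<one>\<^bsub>S\<^esub> \<otimes>\<^bsub>S\<^esub> m = m" "m \<otimes>\<^bsub>S\<^esub> \<one>\<^bsub>S\<^esub> = m"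
      unfolding S_mult[OF one c] S_mult[OF c one] using e by (auto simp: S_simps fun_eq_iff)
  qed (rule S_mult_closed, assumption+, simp add: S_simps mem_S)
next
  fix l m n
  assume c: "l \<in> carrier S" "m \<in> carrier S" "n \<in> carrier S"
  then have s: "l \<oplus>\<^bsub>S\<^esub> m \<in> carrier S"
    by (auto simp: S_simps mem_S)
  have e: "l i j \<in> carrier K" "m i j \<in> carrier K" "n i j \<in> carrier K" for i j
    using c by (auto simp: mem_S)
  show "(l \<oplus>\<^bsub>S\<^esub> m) \<otimes>\<^bsub>S\<^esub> n = l \<otimes>\<^bsub>S\<^esub> n \<oplus>\<^bsub>S\<^esub> m \<otimes>\<^bsub>S\<^esub> n"
    unfolding S_mult[OF s c(3)] S_mult[OF c(1,3)] S_mult[OF c(2,3)]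
    using e by (simp add: S_simps K.l_distr interchange)
  show "n \<otimes>\<^bsub>S\<^esub> (l \<oplus>\<^bsub>S\<^esub> m) = n \<otimes>\<^bsub>S\<^esub> l \<oplus>\<^bsub>S\<^esub> n \<otimes>\<^bsub>S\<^esub> m"
    unfolding S_mult[OF c(3) s] S_mult[OF c(3,1)] S_mult[OF c(3,2)]
    using e by (simp add: S_simps K.r_distr interchange)
qed

lemma scalar_closed: "b \<in> carrier K \<Longrightarrow> scalar S b \<in> carrier S"
  by (simp add: S_simps mem_S)

lemma mult_scalar:
  assumes "b \<in> carrier K" "m \<in> carrier S"
  shows "m \<otimes>\<^bsub>S\<^esub> scalar S b = (\<lambda>i j. m i j \<otimes>\<^bsub>K\<^esub> b)" "scalar S b \<otimes>\<^bsub>S\<^esub> m = (\<lambda>i j. m i j \<otimes>\<^bsub>K\<^esub> b)"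
proof -
  have e: "m i j \<in> carrier K" for i j
    using assms by (auto simp: mem_S)
  have "(m \<otimes>\<^bsub>S\<^esub> scalar S b) i j = m i j \<otimes>\<^bsub>K\<^esub> b" "(scalar S b \<otimes>\<^bsub>S\<^esub> m) i j = m i j \<otimes>\<^bsub>K\<^esub> b" for i j
    unfolding S_mult[OF assms(2) scalar_closed[OF assms(1)]] S_mult[OF scalar_closed[OF assms(1)] assms(2)]
    using e assms(1) by (cases i; cases j; simp add: S_simps K.m_comm)+
  then show "m \<otimes>\<^bsub>S\<^esub> scalar S b = (\<lambda>i j. m i j \<otimes>\<^bsub>K\<^esub> b)" "scalar S b \<otimes>\<^bsub>S\<^esub> m = (\<lambda>i j. m i j \<otimes>\<^bsub>K\<^esub> b)"
    by blast+
qed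

lemma scalar_mult: "b \<in> carrier K \<Longrightarrow> c \<in> carrier K \<Longrightarrow> scalar S b \<otimes>\<^bsub>S\<^esub> scalar S c = scalar S (b \<otimes>\<^bsub>K\<^esub> c)"
  by (simp add: mult_scalar scalar_closed) (auto simp: S_simps fun_eq_iff)

end

locale char2_extension = matrices K
  for K :: "('f::field, 'k) ualg" +
  assumes char2: "CHAR('f) = 2" and scalar_hom: "scalar K \<in> ring_hom ring_of_type_algebra K"
begin

abbreviation \<kappa> where "\<kappa> \<equiv> scalar K"

lemma \<kappa>_closed [simp]: "\<kappa> c \<in> carrier K"
  and \<kappa>_add: "\<kappa> (c + d) = \<kappa> c \<oplus>\<^bsub>K\<^esub> \<kappa> d" and \<kappa>_mult: "\<kappa> (c * d) = \<kappa> c \<otimes>\<^bsub>K\<^esub> \<kappa> d" and \<kappa>_one: "\<kappa> 1 = \<one>\<^bsub>K\<^esub>"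
  using ring_hom_closed[OF scalar_hom, of c] ring_hom_add[OF scalar_hom, of c d]
    ring_hom_mult[OF scalar_hom, of c d] ring_hom_one[OF scalar_hom]
  by simp_all

lemma \<kappa>_zero: "\<kappa> 0 = \<zero>\<^bsub>K\<^esub>"
  using \<kappa>_add[of 0 0] \<kappa>_closed[of 0] by (metis K.add.l_cancel_one add_0_right)

lemma \<kappa>_eq_0_iff: "\<kappa> c = \<zero>\<^bsub>K\<^esub> \<longleftrightarrow> c = 0"
proof
  assume "\<kappa> c = \<zero>\<^bsub>K\<^esub>"
  then have "\<kappa> (c * inverse c) = \<zero>\<^bsub>K\<^esub>"
    by (simp only: \<kappa>_mult) simp
  then show "c = 0"
    by (cases "c = 0") (simp_all add: \<kappa>_one)
qed (simp add: \<kappa>_zero)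

lemma double [simp]: "a \<in> carrier K \<Longrightarrow> a \<oplus>\<^bsub>K\<^esub> a = \<zero>\<^bsub>K\<^esub>"
proof -
  assume a: "a \<in> carrier K"
  have "\<one>\<^bsub>K\<^esub> \<oplus>\<^bsub>K\<^esub> \<one>\<^bsub>K\<^esub> = \<kappa> (1 + 1)"
    by (simp only: \<kappa>_add \<kappa>_one)
  also have "\<dots> = \<zero>\<^bsub>K\<^esub>"
    using char2 of_nat_CHAR[where 'a = 'f] by (simp add: \<kappa>_zero)
  finally have "a \<otimes>\<^bsub>K\<^esub> (\<one>\<^bsub>K\<^esub> \<oplus>\<^bsub>K\<^esub> \<one>\<^bsub>K\<^esub>) = \<zero>\<^bsub>K\<^esub>"
    using a by simp
  then show ?thesis
    using a by (simp add: K.r_distr)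
qed

lemma double' [simp]: "a \<in> carrier K \<Longrightarrow> b \<in> carrier K \<Longrightarrow> a \<oplus>\<^bsub>K\<^esub> (a \<oplus>\<^bsub>K\<^esub> b) = b"
  by (simp flip: K.a_assoc)

lemma eq_if_sum_zero: "a \<in> carrier K \<Longrightarrow> b \<in> carrier K \<Longrightarrow> a \<oplus>\<^bsub>K\<^esub> b = \<zero>\<^bsub>K\<^esub> \<Longrightarrow> a = b"
  by (metis K.r_zero double')

end

section \<open>Comparison of the tensor product with matrices\<close>

locale splitting = quaternion \<gamma> \<delta> + char2_extension K
  for \<gamma> \<delta> :: "'f::field" and K :: "('f, 'k) ualg" +
  assumes \<delta>_nonzero: "\<delta> \<noteq> 0"
begin

sublocale tensor: scalar_tensor_product A K F
  by unfold_locales (simp_all add: A_simps(6))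

abbreviation T where "T \<equiv> tensor F A K"
abbreviation tens where "tens \<equiv> tensor.tens"

text \<open>Combinations of 1, x, y, xy with coefficients in \<open>K\<close>. They exhaust the
  tensor product, so a kernel computation on four coordinates decides injectivity.\<close>

definition dec :: "'k \<Rightarrow> 'k \<Rightarrow> 'k \<Rightarrow> 'k \<Rightarrow> ((gen list \<Rightarrow> 'f) set \<times> 'k \<Rightarrow> int) set" where
  "dec b0 b1 b2 b3 = tens \<one>\<^bsub>A\<^esub> b0 \<oplus>\<^bsub>T\<^esub> tens x b1 \<oplus>\<^bsub>T\<^esub> tens y b2 \<oplus>\<^bsub>T\<^esub> tens (x \<otimes>\<^bsub>A\<^esub> y) b3"

lemma dec_add:
  assumes "b0 \<in> carrier K" "b1 \<in> carrier K" "b2 \<in> carrier K" "b3 \<in> carrier K"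
    "c0 \<in> carrier K" "c1 \<in> carrier K" "c2 \<in> carrier K" "c3 \<in> carrier K"
  shows "dec b0 b1 b2 b3 \<oplus>\<^bsub>T\<^esub> dec c0 c1 c2 c3 =
    dec (b0 \<oplus>\<^bsub>K\<^esub> c0) (b1 \<oplus>\<^bsub>K\<^esub> c1) (b2 \<oplus>\<^bsub>K\<^esub> c2) (b3 \<oplus>\<^bsub>K\<^esub> c3)"
proof -
  have *: "(a \<oplus>\<^bsub>T\<^esub> b) \<oplus>\<^bsub>T\<^esub> (a' \<oplus>\<^bsub>T\<^esub> b') = (a \<oplus>\<^bsub>T\<^esub> a') \<oplus>\<^bsub>T\<^esub> (b \<oplus>\<^bsub>T\<^esub> b')"
    if "a \<in> carrier T" "a' \<in> carrier T" "b \<in> carrier T" "b' \<in> carrier T" for a a' b b'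
    using that by (simp add: tensor.T.a_ac)
  have 4: "(a \<oplus>\<^bsub>T\<^esub> b \<oplus>\<^bsub>T\<^esub> c \<oplus>\<^bsub>T\<^esub> d) \<oplus>\<^bsub>T\<^esub> (a' \<oplus>\<^bsub>T\<^esub> b' \<oplus>\<^bsub>T\<^esub> c' \<oplus>\<^bsub>T\<^esub> d') =
    (a \<oplus>\<^bsub>T\<^esub> a') \<oplus>\<^bsub>T\<^esub> (b \<oplus>\<^bsub>T\<^esub> b') \<oplus>\<^bsub>T\<^esub> (c \<oplus>\<^bsub>T\<^esub> c') \<oplus>\<^bsub>T\<^esub> (d \<oplus>\<^bsub>T\<^esub> d')"
    if "a \<in> carrier T" "a' \<in> carrier T" "b \<in> carrier T" "b' \<in> carrier T"
      "c \<in> carrier T" "c' \<in> carrier T" "d \<in> carrier T" "d' \<in> carrier T" for a a' b b' c c' d d'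
    using that *[of "a \<oplus>\<^bsub>T\<^esub> b \<oplus>\<^bsub>T\<^esub> c" "a' \<oplus>\<^bsub>T\<^esub> b' \<oplus>\<^bsub>T\<^esub> c'" d d'] *[of "a \<oplus>\<^bsub>T\<^esub> b" "a' \<oplus>\<^bsub>T\<^esub> b'" c c']
      *[of a a' b b'] by simp
  show ?thesis
    unfolding dec_def using assms by (subst 4) (simp_all add: tensor.tens_add_right tensor.tens_closed)
qed

lemma tens_s: "a \<in> carrier A \<Longrightarrow> b \<in> carrier K \<Longrightarrow> tens (s c \<otimes>\<^bsub>A\<^esub> a) b = tens a (\<kappa> c \<otimes>\<^bsub>K\<^esub> b)"
  using tensor.tens_scalar[of c a b] by (simp add: A_simps(6))

lemma tens_comb:
  assumes "b \<in> carrier K"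
  shows "tens (comb c0 c1 c2 c3) b = dec (\<kappa> c0 \<otimes>\<^bsub>K\<^esub> b) (\<kappa> c1 \<otimes>\<^bsub>K\<^esub> b) (\<kappa> c2 \<otimes>\<^bsub>K\<^esub> b) (\<kappa> c3 \<otimes>\<^bsub>K\<^esub> b)"
  using assms tens_s[of "\<one>\<^bsub>A\<^esub>" b c0] by (simp add: comb_def dec_def tensor.tens_add_left tens_s)

lemma T_double: "\<sigma> \<in> carrier T \<Longrightarrow> \<sigma> \<oplus>\<^bsub>T\<^esub> \<sigma> = \<zero>\<^bsub>T\<^esub>"
proof -
  assume \<sigma>: "\<sigma> \<in> carrier T"
  have "\<one>\<^bsub>T\<^esub> \<oplus>\<^bsub>T\<^esub> \<one>\<^bsub>T\<^esub> = tens \<one>\<^bsub>A\<^esub> (\<one>\<^bsub>K\<^esub> \<oplus>\<^bsub>K\<^esub> \<one>\<^bsub>K\<^esub>)"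
    by (simp add: tensor.tens_add_right tensor.tens_one del: double)
  then have "(\<one>\<^bsub>T\<^esub> \<oplus>\<^bsub>T\<^esub> \<one>\<^bsub>T\<^esub>) \<otimes>\<^bsub>T\<^esub> \<sigma> = \<zero>\<^bsub>T\<^esub>"
    using \<sigma> by (simp add: tensor.tens_zero_right)
  then show ?thesis
    using \<sigma> by (simp add: tensor.T.l_distr)
qed

lemma T_decomposition:
  assumes "\<tau> \<in> carrier T"
  shows "\<exists>b0\<in>carrier K. \<exists>b1\<in>carrier K. \<exists>b2\<in>carrier K. \<exists>b3\<in>carrier K. \<tau> = dec b0 b1 b2 b3"
  using assms
proof (induction rule: tensor.T_induct)
  case (tens a b)
  obtain c0 c1 c2 c3 where a_eq: "a = comb c0 c1 c2 c3"
    using spanned[OF char2 tens(1)] by blast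
  then show ?case
    unfolding a_eq using tens by (intro bexI[OF _ K.m_closed[OF \<kappa>_closed tens(2)]]) (rule tens_comb)
next
  case (add \<sigma> \<tau>)
  from add.IH(1) obtain b0 b1 b2 b3 where b: "b0 \<in> carrier K" "b1 \<in> carrier K" "b2 \<in> carrier K" "b3 \<in> carrier K"
    "\<sigma> = dec b0 b1 b2 b3"
    by (elim bexE)
  from add.IH(2) obtain c0 c1 c2 c3 where c: "c0 \<in> carrier K" "c1 \<in> carrier K" "c2 \<in> carrier K" "c3 \<in> carrier K"
    "\<tau> = dec c0 c1 c2 c3"
    by (elim bexE)
  show ?case
    unfolding b(5) c(5) dec_add[OF b(1-4) c(1-4)]
    by (rule bexI)+ (rule refl, (intro K.add.m_closed b c)+)
next
  case (minus \<sigma>)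
  have "\<ominus>\<^bsub>T\<^esub> \<sigma> = \<sigma>"
    using minus T_double by (intro tensor.T.minus_equality) auto
  then show ?case
    using minus by simp
qed

lemma splitsI:
  assumes t: "t \<in> carrier K" and z: "z \<in> carrier K"
    and \<gamma>_eq: "\<kappa> \<gamma> = t \<otimes>\<^bsub>K\<^esub> t \<oplus>\<^bsub>K\<^esub> t \<oplus>\<^bsub>K\<^esub> \<kappa> \<delta> \<otimes>\<^bsub>K\<^esub> (z \<otimes>\<^bsub>K\<^esub> z)"
  shows "splits F K A"
proof -
  interpret S: ring S by (rule ring_S)
  define d where "d = \<kappa> \<delta>"
  have d: "d \<in> carrier K" "d \<noteq> \<zero>\<^bsub>K\<^esub>"
    by (simp_all add: d_def \<kappa>_eq_0_iff \<delta>_nonzero)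
  \<comment> \<open>\<open>q\<close> is a companion matrix with square d. \<open>p\<close> has trace
    1 and determinant t^2 + t + d z^2, so the theorem of Cayley and Hamilton gives p^2 + p =
    \<gamma>; its entries are arranged so that q p = (p + 1) q.\<close>
  define p q pq where
    "p = (\<lambda>i j. if i then (if j then t else d \<otimes>\<^bsub>K\<^esub> z) else (if j then z else t \<oplus>\<^bsub>K\<^esub> \<one>\<^bsub>K\<^esub>))" and
    "q = (\<lambda>i j. if i then (if j then \<zero>\<^bsub>K\<^esub> else d) else (if j then \<one>\<^bsub>K\<^esub> else \<zero>\<^bsub>K\<^esub>))" and
    "pq = (\<lambda>i j. if i then (if j then d \<otimes>\<^bsub>K\<^esub> z else t \<otimes>\<^bsub>K\<^esub> d) else (if j then t \<oplus>\<^bsub>K\<^esub> \<one>\<^bsub>K\<^esub> else z \<otimes>\<^bsub>K\<^esub> d))"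
  have p: "p \<in> carrier S" and q: "q \<in> carrier S" and p1: "p \<oplus>\<^bsub>S\<^esub> \<one>\<^bsub>S\<^esub> \<in> carrier S"
    using t z d by (auto simp: p_def q_def mem_S S_simps)
  have pq: "p \<otimes>\<^bsub>S\<^esub> q = pq"
    unfolding S_mult[OF p q] using t z d by (auto simp: p_def q_def pq_def fun_eq_iff)
  have pp: "p \<otimes>\<^bsub>S\<^esub> p \<oplus>\<^bsub>S\<^esub> p = scalar S (\<kappa> \<gamma>)"
    unfolding S_mult[OF p p] S_simps \<gamma>_eq d_def[symmetric] using t z d
    by (auto simp: p_def fun_eq_iff K.l_distr K.r_distr K.a_ac K.m_ac)
  have qq: "q \<otimes>\<^bsub>S\<^esub> q = scalar S (\<kappa> \<delta>)"
    unfolding S_mult[OF q q] S_simps d_def[symmetric] using t z d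
    by (auto simp: q_def fun_eq_iff)
  have qp: "q \<otimes>\<^bsub>S\<^esub> p = (p \<oplus>\<^bsub>S\<^esub> \<one>\<^bsub>S\<^esub>) \<otimes>\<^bsub>S\<^esub> q"
    unfolding S_mult[OF q p] S_mult[OF p1 q] unfolding S_simps using t z d
    by (auto simp: p_def q_def fun_eq_iff K.l_distr K.r_distr K.a_ac K.m_ac)
  have \<sigma>: "(\<lambda>c. scalar S (\<kappa> c)) \<in> ring_hom F S"
    by (intro ring_hom_memI)
      (auto simp: scalar_closed scalar_mult \<kappa>_mult \<kappa>_one \<kappa>_add, auto simp: S_simps fun_eq_iff)
  have central: "scalar S b \<otimes>\<^bsub>S\<^esub> m = m \<otimes>\<^bsub>S\<^esub> scalar S b" if "m \<in> carrier S" "b \<in> carrier K" for m b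
    using that by (simp add: mult_scalar)
  obtain h where h: "h \<in> ring_hom A S" "h x = p" "h y = q" "\<And>c. h (s c) = scalar S (\<kappa> c)"
  proof -
    have "\<exists>h\<in>ring_hom A S. h x = p \<and> h y = q \<and> (\<forall>c. h (s c) = scalar S (\<kappa> c))"
      by (rule A_hom[OF ring_S \<sigma> central p pp q qq qp]) simp_all
    then show ?thesis
      using that by (elim bexE conjE) simp
  qed
  have h_closed: "a \<in> carrier A \<Longrightarrow> h a \<in> carrier S" for a
    using ring_hom_closed[OF h(1)] by simp
  have scalar_add: "scalar S (b \<oplus>\<^bsub>K\<^esub> c) = scalar S b \<oplus>\<^bsub>S\<^esub> scalar S c" if "b \<in> carrier K" "c \<in> carrier K" for b c
    using that by (auto simp: S_simps fun_eq_iff)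
  have scalar_one: "scalar S \<one>\<^bsub>K\<^esub> = \<one>\<^bsub>S\<^esub>"
    by (simp add: S_simps)
  have S_two: "\<one>\<^bsub>S\<^esub> \<oplus>\<^bsub>S\<^esub> \<one>\<^bsub>S\<^esub> = \<zero>\<^bsub>S\<^esub>"
    by (auto simp: S_simps fun_eq_iff)
  have "\<exists>k\<in>ring_hom T S. \<forall>a\<in>carrier A. \<forall>b\<in>carrier K. k (tens a b) = h a \<otimes>\<^bsub>S\<^esub> scalar S b"
  proof (rule tensor.T_hom[OF ring_S S_two])
    fix c a b assume *: "c \<in> carrier F" "a \<in> carrier A" "b \<in> carrier K"
    have "h (scalar A c \<otimes>\<^bsub>A\<^esub> a) = h a \<otimes>\<^bsub>S\<^esub> scalar S (\<kappa> c)"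
      using * ring_hom_mult[OF h(1), of "s c" a] h(4) central h_closed by (simp add: A_simps(6))
    then show "h (scalar A c \<otimes>\<^bsub>A\<^esub> a) \<otimes>\<^bsub>S\<^esub> scalar S b = h a \<otimes>\<^bsub>S\<^esub> scalar S (\<kappa> c \<otimes>\<^bsub>K\<^esub> b)"
      using * h_closed scalar_closed by (simp add: S.m_assoc scalar_mult)
  next
    fix a a' b b' assume *: "a \<in> carrier A" "a' \<in> carrier A" "b \<in> carrier K" "b' \<in> carrier K"
    have "h a' \<otimes>\<^bsub>S\<^esub> (scalar S b \<otimes>\<^bsub>S\<^esub> scalar S b') = scalar S b \<otimes>\<^bsub>S\<^esub> (h a' \<otimes>\<^bsub>S\<^esub> scalar S b')"
      using * h_closed scalar_closed central[of "h a'" b] by (simp flip: S.m_assoc)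
    then show "h (a \<otimes>\<^bsub>A\<^esub> a') \<otimes>\<^bsub>S\<^esub> scalar S (b \<otimes>\<^bsub>K\<^esub> b') = h a \<otimes>\<^bsub>S\<^esub> scalar S b \<otimes>\<^bsub>S\<^esub> (h a' \<otimes>\<^bsub>S\<^esub> scalar S b')"
      using * h_closed scalar_closed by (simp add: ring_hom_mult[OF h(1)] S.m_assoc flip: scalar_mult)
  qed (use h_closed scalar_closed ring_hom_add[OF h(1)] ring_hom_one[OF h(1)]
      in \<open>auto simp: S.l_distr S.r_distr scalar_add scalar_one\<close>)
  then obtain k where k: "k \<in> ring_hom T S"
    and k_tens': "\<forall>a\<in>carrier A. \<forall>b\<in>carrier K. k (tens a b) = h a \<otimes>\<^bsub>S\<^esub> scalar S b"
    by (elim bexE)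
  have k_tens: "k (tens a b) = h a \<otimes>\<^bsub>S\<^esub> scalar S b" if "a \<in> carrier A" "b \<in> carrier K" for a b
    using k_tens' that by simp
  have k_dec: "k (dec b0 b1 b2 b3) = (\<lambda>i j. (if i = j then b0 else \<zero>\<^bsub>K\<^esub>) \<oplus>\<^bsub>K\<^esub> p i j \<otimes>\<^bsub>K\<^esub> b1 \<oplus>\<^bsub>K\<^esub>
      q i j \<otimes>\<^bsub>K\<^esub> b2 \<oplus>\<^bsub>K\<^esub> pq i j \<otimes>\<^bsub>K\<^esub> b3)"
    if b: "b0 \<in> carrier K" "b1 \<in> carrier K" "b2 \<in> carrier K" "b3 \<in> carrier K" for b0 b1 b2 b3
  proof -
    have "h (x \<otimes>\<^bsub>A\<^esub> y) = pq" "h \<one>\<^bsub>A\<^esub> = \<one>\<^bsub>S\<^esub>"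
      using ring_hom_mult[OF h(1), of x y] ring_hom_one[OF h(1)] by (simp_all add: h pq)
    moreover have "pq \<in> carrier S"
      using p q pq S_mult_closed by blast
    ultimately show ?thesis
      using b p q S.one_closed by (simp add: dec_def ring_hom_add[OF k] tensor.tens_closed k_tens h mult_scalar(1) scalar_closed S_simps(1))
        (auto simp: S_simps(4) S_simps(3) fun_eq_iff)
  qed
  have inj: "dec b0 b1 b2 b3 = \<zero>\<^bsub>T\<^esub>" if b: "b0 \<in> carrier K" "b1 \<in> carrier K" "b2 \<in> carrier K" "b3 \<in> carrier K"
    and k0: "k (dec b0 b1 b2 b3) = \<zero>\<^bsub>S\<^esub>" for b0 b1 b2 b3
  proof -
    have e: "(if i = j then b0 else \<zero>\<^bsub>K\<^esub>) \<oplus>\<^bsub>K\<^esub> p i j \<otimes>\<^bsub>K\<^esub> b1 \<oplus>\<^bsub>K\<^esub> q i j \<otimes>\<^bsub>K\<^esub> b2 \<oplus>\<^bsub>K\<^esub> pq i j \<otimes>\<^bsub>K\<^esub> b3 = \<zero>\<^bsub>K\<^esub>" for i j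
      using k0 unfolding k_dec[OF b] S_simps(2) by (simp add: fun_eq_iff)
    have e1: "b0 \<oplus>\<^bsub>K\<^esub> t \<otimes>\<^bsub>K\<^esub> b1 \<oplus>\<^bsub>K\<^esub> d \<otimes>\<^bsub>K\<^esub> z \<otimes>\<^bsub>K\<^esub> b3 = \<zero>\<^bsub>K\<^esub>"
      and e2: "d \<otimes>\<^bsub>K\<^esub> z \<otimes>\<^bsub>K\<^esub> b1 \<oplus>\<^bsub>K\<^esub> d \<otimes>\<^bsub>K\<^esub> b2 \<oplus>\<^bsub>K\<^esub> t \<otimes>\<^bsub>K\<^esub> d \<otimes>\<^bsub>K\<^esub> b3 = \<zero>\<^bsub>K\<^esub>"
      and e3: "z \<otimes>\<^bsub>K\<^esub> b1 \<oplus>\<^bsub>K\<^esub> b2 \<oplus>\<^bsub>K\<^esub> (t \<oplus>\<^bsub>K\<^esub> \<one>\<^bsub>K\<^esub>) \<otimes>\<^bsub>K\<^esub> b3 = \<zero>\<^bsub>K\<^esub>"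
      and e4: "b0 \<oplus>\<^bsub>K\<^esub> (t \<oplus>\<^bsub>K\<^esub> \<one>\<^bsub>K\<^esub>) \<otimes>\<^bsub>K\<^esub> b1 \<oplus>\<^bsub>K\<^esub> z \<otimes>\<^bsub>K\<^esub> d \<otimes>\<^bsub>K\<^esub> b3 = \<zero>\<^bsub>K\<^esub>"
      using e[of True True] e[of True False] e[of False True] e[of False False] b t z d
      by (simp_all add: p_def q_def pq_def)
    \<comment> \<open>The diagonal entries of the matrix differ by \<open>b1\<close>; likewise d
      times the lower left entry and the upper right entry differ by d \<open>b3\<close>.\<close>
    have "b1 = (b0 \<oplus>\<^bsub>K\<^esub> t \<otimes>\<^bsub>K\<^esub> b1 \<oplus>\<^bsub>K\<^esub> d \<otimes>\<^bsub>K\<^esub> z \<otimes>\<^bsub>K\<^esub> b3) \<oplus>\<^bsub>K\<^esub> (b0 \<oplus>\<^bsub>K\<^esub> (t \<oplus>\<^bsub>K\<^esub> \<one>\<^bsub>K\<^esub>) \<otimes>\<^bsub>K\<^esub> b1 \<oplus>\<^bsub>K\<^esub> z \<otimes>\<^bsub>K\<^esub> d \<otimes>\<^bsub>K\<^esub> b3)"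
      using b t z d by (simp add: K.l_distr K.r_distr K.a_ac K.m_ac)
    then have b1: "b1 = \<zero>\<^bsub>K\<^esub>"
      unfolding e1 e4 by simp
    have "d \<otimes>\<^bsub>K\<^esub> b3 = d \<otimes>\<^bsub>K\<^esub> (z \<otimes>\<^bsub>K\<^esub> b1 \<oplus>\<^bsub>K\<^esub> b2 \<oplus>\<^bsub>K\<^esub> (t \<oplus>\<^bsub>K\<^esub> \<one>\<^bsub>K\<^esub>) \<otimes>\<^bsub>K\<^esub> b3) \<oplus>\<^bsub>K\<^esub>
      (d \<otimes>\<^bsub>K\<^esub> z \<otimes>\<^bsub>K\<^esub> b1 \<oplus>\<^bsub>K\<^esub> d \<otimes>\<^bsub>K\<^esub> b2 \<oplus>\<^bsub>K\<^esub> t \<otimes>\<^bsub>K\<^esub> d \<otimes>\<^bsub>K\<^esub> b3)"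
      using b t z d by (simp add: K.l_distr K.r_distr K.a_ac K.m_ac)
    then have "d \<otimes>\<^bsub>K\<^esub> b3 = \<zero>\<^bsub>K\<^esub>"
      unfolding e2 e3 using d by simp
    then have b3: "b3 = \<zero>\<^bsub>K\<^esub>"
      using K.integral d b by blast
    have "b2 = \<zero>\<^bsub>K\<^esub>" "b0 = \<zero>\<^bsub>K\<^esub>"
      using e1 e3 b t z d unfolding b1 b3 by simp_all
    then show ?thesis
      by (simp add: b1 b3 dec_def tensor.tens_zero_right)
  qed
  have "inj_on k (carrier T)"
  proof (rule inj_onI)
    fix \<sigma> \<tau>
    assume *: "\<sigma> \<in> carrier T" "\<tau> \<in> carrier T" "k \<sigma> = k \<tau>"
    have "k (\<sigma> \<oplus>\<^bsub>T\<^esub> \<tau>) = k \<tau> \<oplus>\<^bsub>S\<^esub> k \<tau>"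
      using * by (simp add: ring_hom_add[OF k])
    also have "\<dots> = \<zero>\<^bsub>S\<^esub>"
      using ring_hom_closed[OF k *(2)] by (auto simp: S_simps mem_S fun_eq_iff)
    finally have k0: "k (\<sigma> \<oplus>\<^bsub>T\<^esub> \<tau>) = \<zero>\<^bsub>S\<^esub>" .
    have "\<sigma> \<oplus>\<^bsub>T\<^esub> \<tau> \<in> carrier T"
      using * by simp
    from T_decomposition[OF this] have "\<sigma> \<oplus>\<^bsub>T\<^esub> \<tau> = \<zero>\<^bsub>T\<^esub>"
      using inj k0 by (elim bexE) auto
    then have "\<ominus>\<^bsub>T\<^esub> \<tau> = \<sigma>"
      using * by (intro tensor.T.minus_equality) auto
    moreover have "\<ominus>\<^bsub>T\<^esub> \<tau> = \<tau>"
      using * T_double by (intro tensor.T.minus_equality) auto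
    ultimately show "\<sigma> = \<tau>" by simp
  qed
  moreover have "k ` carrier T = carrier S"
  proof
    show "k ` carrier T \<subseteq> carrier S"
      using ring_hom_closed[OF k] by blast
    show "carrier S \<subseteq> k ` carrier T"
    proof
      fix m
      assume "m \<in> carrier S"
      then have m: "m i j \<in> carrier K" for i j
        by (simp add: mem_S)
      \<comment> \<open>Solution of the linear system for a given matrix: the sum of the diagonal
        entries is \<open>b1\<close>, the lower left entry plus the upper right one divided by d is
        \<open>b3\<close>, and \<open>b2\<close>, \<open>b0\<close> follow by substitution.\<close>
      define u where "u = inv\<^bsub>K\<^esub> d \<otimes>\<^bsub>K\<^esub> m True False"
      have d': "inv\<^bsub>K\<^esub> d \<in> carrier K" "d \<otimes>\<^bsub>K\<^esub> inv\<^bsub>K\<^esub> d = \<one>\<^bsub>K\<^esub>"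
        using d K.field_Units by auto
      have u: "u \<in> carrier K" "d \<otimes>\<^bsub>K\<^esub> u = m True False"
        using m d' d by (simp_all add: u_def flip: K.m_assoc)
      define b1 b3 where "b1 = m True True \<oplus>\<^bsub>K\<^esub> m False False" and "b3 = m False True \<oplus>\<^bsub>K\<^esub> u"
      define b2 b0 where "b2 = u \<oplus>\<^bsub>K\<^esub> z \<otimes>\<^bsub>K\<^esub> b1 \<oplus>\<^bsub>K\<^esub> t \<otimes>\<^bsub>K\<^esub> b3" and "b0 = m True True \<oplus>\<^bsub>K\<^esub> t \<otimes>\<^bsub>K\<^esub> b1 \<oplus>\<^bsub>K\<^esub> d \<otimes>\<^bsub>K\<^esub> z \<otimes>\<^bsub>K\<^esub> b3"
      have b13: "b1 \<in> carrier K" "b3 \<in> carrier K"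
        using m u by (simp_all add: b1_def b3_def)
      have b: "b0 \<in> carrier K" "b2 \<in> carrier K"
        using m u t z d b13 by (simp_all add: b2_def b0_def)
      have FF: "m False False = m True True \<oplus>\<^bsub>K\<^esub> b1" and FT: "m False True = u \<oplus>\<^bsub>K\<^esub> b3"
        using m u by (simp_all add: b1_def b3_def K.a_ac)
      define e f g where "e = t \<otimes>\<^bsub>K\<^esub> b1" and "f = d \<otimes>\<^bsub>K\<^esub> z \<otimes>\<^bsub>K\<^esub> b3" and "g = t \<otimes>\<^bsub>K\<^esub> b3"
      define w where "w = z \<otimes>\<^bsub>K\<^esub> b1"
      have efg: "e \<in> carrier K" "f \<in> carrier K" "g \<in> carrier K" "w \<in> carrier K"
        using t z d b13 by (simp_all add: e_def f_def g_def w_def)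
      have zd: "z \<otimes>\<^bsub>K\<^esub> d \<otimes>\<^bsub>K\<^esub> b3 = f"
        using z d by (simp add: f_def K.m_comm)
      have b0: "b0 = m True True \<oplus>\<^bsub>K\<^esub> e \<oplus>\<^bsub>K\<^esub> f" and b2: "b2 = u \<oplus>\<^bsub>K\<^esub> w \<oplus>\<^bsub>K\<^esub> g"
        by (simp_all add: b0_def b2_def e_def f_def g_def w_def)
      have *: "(a \<oplus>\<^bsub>K\<^esub> e \<oplus>\<^bsub>K\<^esub> f) \<oplus>\<^bsub>K\<^esub> e \<oplus>\<^bsub>K\<^esub> f = a" "(a \<oplus>\<^bsub>K\<^esub> e \<oplus>\<^bsub>K\<^esub> f) \<oplus>\<^bsub>K\<^esub> (e \<oplus>\<^bsub>K\<^esub> b1) \<oplus>\<^bsub>K\<^esub> f = a \<oplus>\<^bsub>K\<^esub> b1"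
        "w \<oplus>\<^bsub>K\<^esub> (a \<oplus>\<^bsub>K\<^esub> w \<oplus>\<^bsub>K\<^esub> g) \<oplus>\<^bsub>K\<^esub> (g \<oplus>\<^bsub>K\<^esub> b3) = a \<oplus>\<^bsub>K\<^esub> b3" "w \<oplus>\<^bsub>K\<^esub> (a \<oplus>\<^bsub>K\<^esub> w \<oplus>\<^bsub>K\<^esub> g) \<oplus>\<^bsub>K\<^esub> g = a"
        if "a \<in> carrier K" for a
        using that efg b13 by (simp_all add: K.a_ac)
      have TF: "d \<otimes>\<^bsub>K\<^esub> z \<otimes>\<^bsub>K\<^esub> b1 \<oplus>\<^bsub>K\<^esub> d \<otimes>\<^bsub>K\<^esub> b2 \<oplus>\<^bsub>K\<^esub> t \<otimes>\<^bsub>K\<^esub> d \<otimes>\<^bsub>K\<^esub> b3 = m True False"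
      proof -
        have "d \<otimes>\<^bsub>K\<^esub> z \<otimes>\<^bsub>K\<^esub> b1 \<oplus>\<^bsub>K\<^esub> d \<otimes>\<^bsub>K\<^esub> b2 \<oplus>\<^bsub>K\<^esub> t \<otimes>\<^bsub>K\<^esub> d \<otimes>\<^bsub>K\<^esub> b3 = d \<otimes>\<^bsub>K\<^esub> (w \<oplus>\<^bsub>K\<^esub> b2 \<oplus>\<^bsub>K\<^esub> g)"
          using t z d b b13 by (simp add: w_def g_def K.r_distr K.m_assoc K.m_lcomm[of t])
        then show ?thesis
          using *(4)[OF u(1)] u(2) by (simp add: b2)
      qed
      have "k (dec b0 b1 b2 b3) i j = m i j" for i j
        unfolding k_dec[OF b(1) b13(1) b(2) b13(2)]
      proof (cases i; cases j)
        assume "i" "j"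
        then show "(if i = j then b0 else \<zero>\<^bsub>K\<^esub>) \<oplus>\<^bsub>K\<^esub> p i j \<otimes>\<^bsub>K\<^esub> b1 \<oplus>\<^bsub>K\<^esub> q i j \<otimes>\<^bsub>K\<^esub> b2 \<oplus>\<^bsub>K\<^esub> pq i j \<otimes>\<^bsub>K\<^esub> b3 = m i j"
          using *(1)[of "m True True"] b m efg by (simp add: p_def q_def pq_def b0 flip: e_def f_def)
      next
        assume "i" "\<not> j"
        then show "(if i = j then b0 else \<zero>\<^bsub>K\<^esub>) \<oplus>\<^bsub>K\<^esub> p i j \<otimes>\<^bsub>K\<^esub> b1 \<oplus>\<^bsub>K\<^esub> q i j \<otimes>\<^bsub>K\<^esub> b2 \<oplus>\<^bsub>K\<^esub> pq i j \<otimes>\<^bsub>K\<^esub> b3 = m i j"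
          using TF z d b13 by (simp add: p_def q_def pq_def)
      next
        assume "\<not> i" "j"
        then show "(if i = j then b0 else \<zero>\<^bsub>K\<^esub>) \<oplus>\<^bsub>K\<^esub> p i j \<otimes>\<^bsub>K\<^esub> b1 \<oplus>\<^bsub>K\<^esub> q i j \<otimes>\<^bsub>K\<^esub> b2 \<oplus>\<^bsub>K\<^esub> pq i j \<otimes>\<^bsub>K\<^esub> b3 = m i j"
          using *(3)[OF u(1)] b b13 t z FT u efg by (simp add: p_def q_def pq_def b2 K.l_distr flip: g_def w_def)
      next
        assume "\<not> i" "\<not> j"
        then show "(if i = j then b0 else \<zero>\<^bsub>K\<^esub>) \<oplus>\<^bsub>K\<^esub> p i j \<otimes>\<^bsub>K\<^esub> b1 \<oplus>\<^bsub>K\<^esub> q i j \<otimes>\<^bsub>K\<^esub> b2 \<oplus>\<^bsub>K\<^esub> pq i j \<otimes>\<^bsub>K\<^esub> b3 = m i j"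
          using *(2)[of "m True True"] b b13 t m FF zd efg by (simp add: p_def q_def pq_def b0 K.l_distr flip: e_def)
      qed
      then have "k (dec b0 b1 b2 b3) = m" by blast
      moreover have "dec b0 b1 b2 b3 \<in> carrier T"
        using b b13 by (simp add: dec_def tensor.tens_closed)
      ultimately show "m \<in> k ` carrier T" by blast
    qed
  qed
  ultimately have "k \<in> ring_iso T S"
    using k by (simp add: ring_iso_def bij_betw_def)
  moreover have "k (scalar T b) = scalar S b" if "b \<in> carrier K" for b
    using that ring_hom_one[OF h(1)] scalar_closed by (simp add: tensor.T_simps(6) k_tens)
  ultimately show ?thesis
    unfolding splits_def ualg_iso_def by blast
qed

text \<open>An isomorphism provides matrices for x and y. The upper left entries of the three
  defining relations already yield the solution.\<close>

lemma splitsD: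
  assumes "splits F K A"
  shows "\<exists>t\<in>carrier K. \<exists>z\<in>carrier K. \<kappa> \<gamma> = t \<otimes>\<^bsub>K\<^esub> t \<oplus>\<^bsub>K\<^esub> t \<oplus>\<^bsub>K\<^esub> \<kappa> \<delta> \<otimes>\<^bsub>K\<^esub> (z \<otimes>\<^bsub>K\<^esub> z)"
proof -
  obtain k where "k \<in> ring_iso T S" and k_scalar: "\<And>b. b \<in> carrier K \<Longrightarrow> k (scalar T b) = scalar S b"
    using assms unfolding splits_def ualg_iso_def by blast
  then have k: "k \<in> ring_hom T S"
    by (simp add: ring_iso_def)
  define f where "f = (\<lambda>a. k (tens a \<one>\<^bsub>K\<^esub>))"
  have f_closed: "f a \<in> carrier S" if "a \<in> carrier A" for a
    using that ring_hom_closed[OF k] by (simp add: f_def tensor.tens_closed)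
  have f_add: "f (a \<oplus>\<^bsub>A\<^esub> b) = f a \<oplus>\<^bsub>S\<^esub> f b" if "a \<in> carrier A" "b \<in> carrier A" for a b
    using that by (simp add: f_def tensor.tens_add_left tensor.tens_closed ring_hom_add[OF k])
  have f_mult: "f (a \<otimes>\<^bsub>A\<^esub> b) = f a \<otimes>\<^bsub>S\<^esub> f b" if "a \<in> carrier A" "b \<in> carrier A" for a b
    using that tensor.tens_mult[of a b "\<one>\<^bsub>K\<^esub>" "\<one>\<^bsub>K\<^esub>"]
    by (simp add: f_def tensor.tens_closed flip: ring_hom_mult[OF k])
  have f_s: "f (s c) = scalar S (\<kappa> c)" for c
    using tens_s[of "\<one>\<^bsub>A\<^esub>" "\<one>\<^bsub>K\<^esub>" c] k_scalar[of "\<kappa> c"] by (simp add: f_def tensor.T_simps(6))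
  define a b c where "a = f x True True" and "b = f x True False" and "c = f x False True"
  define p q r where "p = f y True True" and "q = f y True False" and "r = f y False True"
  have fx: "f x \<in> carrier S" and fy: "f y \<in> carrier S"
    by (simp_all add: f_closed)
  then have cl: "a \<in> carrier K" "b \<in> carrier K" "c \<in> carrier K" "p \<in> carrier K" "q \<in> carrier K" "r \<in> carrier K"
    by (simp_all add: a_def b_def c_def p_def q_def r_def mem_S)
  have "f x \<otimes>\<^bsub>S\<^esub> f x \<oplus>\<^bsub>S\<^esub> f x = scalar S (\<kappa> \<gamma>)" "f y \<otimes>\<^bsub>S\<^esub> f y = scalar S (\<kappa> \<delta>)"
    "f y \<otimes>\<^bsub>S\<^esub> f x = f x \<otimes>\<^bsub>S\<^esub> f y \<oplus>\<^bsub>S\<^esub> f y"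
    by (simp_all add: presentation flip: f_mult f_add f_s)
  from this[THEN fun_cong, THEN fun_cong, of True True]
  have g: "\<kappa> \<gamma> = a \<otimes>\<^bsub>K\<^esub> a \<oplus>\<^bsub>K\<^esub> b \<otimes>\<^bsub>K\<^esub> c \<oplus>\<^bsub>K\<^esub> a" and d: "\<kappa> \<delta> = p \<otimes>\<^bsub>K\<^esub> p \<oplus>\<^bsub>K\<^esub> q \<otimes>\<^bsub>K\<^esub> r"
    and tr: "p \<otimes>\<^bsub>K\<^esub> a \<oplus>\<^bsub>K\<^esub> q \<otimes>\<^bsub>K\<^esub> c = a \<otimes>\<^bsub>K\<^esub> p \<oplus>\<^bsub>K\<^esub> b \<otimes>\<^bsub>K\<^esub> r \<oplus>\<^bsub>K\<^esub> p"
    by (simp_all add: S_mult fx fy S_simps flip: a_def b_def c_def p_def q_def r_def)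
  have pbr: "p \<oplus>\<^bsub>K\<^esub> b \<otimes>\<^bsub>K\<^esub> r = q \<otimes>\<^bsub>K\<^esub> c"
  proof -
    have "p \<oplus>\<^bsub>K\<^esub> b \<otimes>\<^bsub>K\<^esub> r = a \<otimes>\<^bsub>K\<^esub> p \<oplus>\<^bsub>K\<^esub> (a \<otimes>\<^bsub>K\<^esub> p \<oplus>\<^bsub>K\<^esub> b \<otimes>\<^bsub>K\<^esub> r \<oplus>\<^bsub>K\<^esub> p)"
      using cl by (simp add: K.a_ac)
    also have "\<dots> = q \<otimes>\<^bsub>K\<^esub> c"
      unfolding tr[symmetric] using cl by (simp add: K.m_comm[of p a])
    finally show ?thesis .
  qed
  show ?thesis
  proof (cases "q = \<zero>\<^bsub>K\<^esub>")
    case True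
    \<comment> \<open>With q = 0 the relation for \<delta> reads \<delta> = p^2, and a square is
      handled by t = \<gamma>, z = \<gamma>/p.\<close>
    define m where "m = inv\<^bsub>K\<^esub> p \<otimes>\<^bsub>K\<^esub> \<kappa> \<gamma>"
    have "p \<noteq> \<zero>\<^bsub>K\<^esub>"
    proof
      assume "p = \<zero>\<^bsub>K\<^esub>"
      then have "\<kappa> \<delta> = \<zero>\<^bsub>K\<^esub>"
        unfolding d using cl True by simp
      then show False
        by (simp add: \<kappa>_eq_0_iff \<delta>_nonzero)
    qed
    then have p': "inv\<^bsub>K\<^esub> p \<in> carrier K" "p \<otimes>\<^bsub>K\<^esub> inv\<^bsub>K\<^esub> p = \<one>\<^bsub>K\<^esub>"
      using cl K.field_Units by auto
    then have m: "m \<in> carrier K" "p \<otimes>\<^bsub>K\<^esub> m = \<kappa> \<gamma>"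
      using cl by (simp_all add: m_def flip: K.m_assoc)
    have "\<kappa> \<delta> \<otimes>\<^bsub>K\<^esub> (m \<otimes>\<^bsub>K\<^esub> m) = (p \<otimes>\<^bsub>K\<^esub> m) \<otimes>\<^bsub>K\<^esub> (p \<otimes>\<^bsub>K\<^esub> m)"
      using cl m(1) True by (simp add: d K.m_ac)
    then have "\<kappa> \<gamma> = \<kappa> \<gamma> \<otimes>\<^bsub>K\<^esub> \<kappa> \<gamma> \<oplus>\<^bsub>K\<^esub> \<kappa> \<gamma> \<oplus>\<^bsub>K\<^esub> \<kappa> \<delta> \<otimes>\<^bsub>K\<^esub> (m \<otimes>\<^bsub>K\<^esub> m)"
      unfolding m(2) by (simp add: K.a_ac)
    then show ?thesis
      using m by (intro bexI[of _ "\<kappa> \<gamma>"] bexI[of _ m]) auto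
  next
    case False
    \<comment> \<open>This m makes the upper right entry of f(x) + m f(y) vanish. The element x + m
      y satisfies T^2 + T = \<gamma> + \<delta> m^2, so the diagonal entry a + m p of the triangular
      matrix does too.\<close>
    define m where "m = b \<otimes>\<^bsub>K\<^esub> inv\<^bsub>K\<^esub> q"
    have q': "inv\<^bsub>K\<^esub> q \<in> carrier K" "inv\<^bsub>K\<^esub> q \<otimes>\<^bsub>K\<^esub> q = \<one>\<^bsub>K\<^esub>"
      using False cl K.field_Units by auto
    have m: "m \<in> carrier K" "q \<otimes>\<^bsub>K\<^esub> m = b"
      using cl q' by (simp_all add: m_def K.m_assoc K.m_comm[of q])
    define n where "n = p \<otimes>\<^bsub>K\<^esub> m"
    have n: "n \<in> carrier K"
      using cl m by (simp add: n_def)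
    have "n \<oplus>\<^bsub>K\<^esub> b \<otimes>\<^bsub>K\<^esub> r \<otimes>\<^bsub>K\<^esub> m = (q \<otimes>\<^bsub>K\<^esub> c) \<otimes>\<^bsub>K\<^esub> m"
      unfolding pbr[symmetric] n_def using cl m(1) by (simp add: K.l_distr)
    also have "\<dots> = b \<otimes>\<^bsub>K\<^esub> c"
      unfolding m(2)[symmetric] using cl m(1) by (simp add: K.m_ac)
    finally have nb: "n \<oplus>\<^bsub>K\<^esub> b \<otimes>\<^bsub>K\<^esub> r \<otimes>\<^bsub>K\<^esub> m = b \<otimes>\<^bsub>K\<^esub> c" .
    have "\<kappa> \<delta> \<otimes>\<^bsub>K\<^esub> (m \<otimes>\<^bsub>K\<^esub> m) = n \<otimes>\<^bsub>K\<^esub> n \<oplus>\<^bsub>K\<^esub> (q \<otimes>\<^bsub>K\<^esub> m) \<otimes>\<^bsub>K\<^esub> r \<otimes>\<^bsub>K\<^esub> m"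
      unfolding d n_def using cl m(1) by (simp add: K.l_distr K.r_distr K.m_ac)
    then have dm: "\<kappa> \<delta> \<otimes>\<^bsub>K\<^esub> (m \<otimes>\<^bsub>K\<^esub> m) = n \<otimes>\<^bsub>K\<^esub> n \<oplus>\<^bsub>K\<^esub> b \<otimes>\<^bsub>K\<^esub> r \<otimes>\<^bsub>K\<^esub> m"
      unfolding m(2) .
    have sq: "(a \<oplus>\<^bsub>K\<^esub> n) \<otimes>\<^bsub>K\<^esub> (a \<oplus>\<^bsub>K\<^esub> n) = a \<otimes>\<^bsub>K\<^esub> a \<oplus>\<^bsub>K\<^esub> n \<otimes>\<^bsub>K\<^esub> n"
      using cl n by (simp add: K.l_distr K.r_distr K.a_ac K.m_comm[of n a])
    have "(a \<oplus>\<^bsub>K\<^esub> n) \<otimes>\<^bsub>K\<^esub> (a \<oplus>\<^bsub>K\<^esub> n) \<oplus>\<^bsub>K\<^esub> (a \<oplus>\<^bsub>K\<^esub> n) \<oplus>\<^bsub>K\<^esub> \<kappa> \<delta> \<otimes>\<^bsub>K\<^esub> (m \<otimes>\<^bsub>K\<^esub> m) =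
      a \<otimes>\<^bsub>K\<^esub> a \<oplus>\<^bsub>K\<^esub> (n \<oplus>\<^bsub>K\<^esub> b \<otimes>\<^bsub>K\<^esub> r \<otimes>\<^bsub>K\<^esub> m) \<oplus>\<^bsub>K\<^esub> a"
      unfolding sq dm using cl n m(1) by (simp add: K.a_ac)
    then have "\<kappa> \<gamma> = (a \<oplus>\<^bsub>K\<^esub> n) \<otimes>\<^bsub>K\<^esub> (a \<oplus>\<^bsub>K\<^esub> n) \<oplus>\<^bsub>K\<^esub> (a \<oplus>\<^bsub>K\<^esub> n) \<oplus>\<^bsub>K\<^esub> \<kappa> \<delta> \<otimes>\<^bsub>K\<^esub> (m \<otimes>\<^bsub>K\<^esub> m)"
      unfolding nb g by simp
    then show ?thesis
      using m n cl by (intro bexI[of _ "a \<oplus>\<^bsub>K\<^esub> n"] bexI[of _ m]) auto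
  qed
qed

end

section \<open>Quadratic extensions\<close>

text \<open>The algebra F[T]/(T^2 - s T - N), with (a, b) standing for a + b \<theta>. Pairs are
  used because \<open>linked\<close> asks for a carrier in this type.\<close>

definition pair_extension :: "'f::field \<Rightarrow> 'f \<Rightarrow> ('f, 'f \<times> 'f) ualg" where
  "pair_extension s N =
     \<lparr>carrier = UNIV,
      monoid.mult = (\<lambda>(a, b) (c, d). (a * c + N * (b * d), a * d + b * c + s * (b * d))),
      monoid.one = (1, 0), ring.zero = (0, 0), ring.add = (\<lambda>(a, b) (c, d). (a + c, b + d)),
      scalar = (\<lambda>c. (c, 0))\<rparr>"

lemma pair_extension_simps [simp]:
  "carrier (pair_extension s N) = UNIV"
  "(a, b) \<otimes>\<^bsub>pair_extension s N\<^esub> (c, d) = (a * c + N * (b * d), a * d + b * c + s * (b * d))"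
  "(a, b) \<oplus>\<^bsub>pair_extension s N\<^esub> (c, d) = (a + c, b + d)"
  "\<one>\<^bsub>pair_extension s N\<^esub> = (1, 0)" "\<zero>\<^bsub>pair_extension s N\<^esub> = (0, 0)"
  "scalar (pair_extension s N) c = (c, 0)"
  by (simp_all add: pair_extension_def)

lemma cring_pair_extension: "cring (pair_extension s N)"
proof (rule cringI)
  show "abelian_group (pair_extension s N)"
  proof (rule abelian_groupI)
    show "\<exists>y\<in>carrier (pair_extension s N). y \<oplus>\<^bsub>pair_extension s N\<^esub> x = \<zero>\<^bsub>pair_extension s N\<^esub>" for x
      by (cases x, rule bexI[of _ "(- fst x, - snd x)"]) auto
  qed (auto simp: add_ac)
  show "Group.comm_monoid (pair_extension s N)"
    by (rule comm_monoidI) (auto simp: algebra_simps)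
qed (auto simp: algebra_simps)

context
  fixes \<theta> :: "'f::field alg_closure" and s N :: 'f
  assumes char2: "CHAR('f) = 2" and \<theta>: "\<theta> ^ 2 = to_ac s * \<theta> + to_ac N" "\<theta> \<notin> range to_ac"
begin

definition emb :: "'f \<times> 'f \<Rightarrow> 'f alg_closure" where
  "emb p = to_ac (fst p) + to_ac (snd p) * \<theta>"

lemma emb_mult: "emb (p \<otimes>\<^bsub>pair_extension s N\<^esub> q) = emb p * emb q"
proof -
  obtain a b c d where pq: "p = (a, b)" "q = (c, d)"
    by (metis surj_pair)
  have "emb p * emb q = to_ac (a * c) + to_ac (a * d + b * c) * \<theta> + to_ac (b * d) * \<theta> ^ 2"
    by (simp add: pq emb_def algebra_simps power2_eq_square)
  also have "\<dots> = emb (p \<otimes>\<^bsub>pair_extension s N\<^esub> q)"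
    unfolding \<theta>(1) by (simp add: pq emb_def algebra_simps)
  finally show ?thesis by simp
qed

lemma emb_add: "emb (p \<oplus>\<^bsub>pair_extension s N\<^esub> q) = emb p + emb q"
  by (cases p; cases q) (simp add: emb_def algebra_simps)

lemma emb_eq_0_iff: "emb p = 0 \<longleftrightarrow> p = (0, 0)"
  using simple_extension_eq_0_iff[OF \<theta>(2), of "fst p" "snd p"] by (auto simp: emb_def prod_eq_iff)

lemma emb_inj: "emb p = emb q \<Longrightarrow> p = q"
proof -
  assume "emb p = emb q"
  then have "emb (fst p - fst q, snd p - snd q) = 0"
    by (simp add: emb_def algebra_simps)
  then show ?thesis
    unfolding emb_eq_0_iff by (simp add: prod_eq_iff)
qed

lemma range_emb: "simple_extension \<theta> = range emb"
  by (auto simp: simple_extension_def emb_def image_iff, blast)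

text \<open>Inverses are transported back from the algebraic closure, where the image of
  \<open>emb\<close> is closed under inversion. The dimension is obtained by adjoining 1 and then
  (0, 1) to the zero space.\<close>

lemma quadratic_pair_extension: "quadratic_extension (ring_of_type_algebra :: 'f ring) (pair_extension s N)"
  unfolding quadratic_extension_def
proof (intro conjI)
  interpret E: cring "pair_extension s N"
    by (rule cring_pair_extension)
  show "field (pair_extension s N)"
  proof (rule E.cring_fieldI2)
    fix p assume "p \<noteq> \<zero>\<^bsub>pair_extension s N\<^esub>"
    then have "emb p \<noteq> 0"
      by (simp add: emb_eq_0_iff)
    moreover have "inverse (emb p) \<in> simple_extension \<theta>"
      using field_closed_simple_extension[OF char2 \<theta>] unfolding field_closed_def range_emb by blast
    then obtain q where "inverse (emb p) = emb q"
      unfolding range_emb by blast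
    ultimately have "emb (p \<otimes>\<^bsub>pair_extension s N\<^esub> q) = 1"
      unfolding emb_mult by (metis right_inverse)
    also have "1 = emb \<one>\<^bsub>pair_extension s N\<^esub>"
      by (simp add: emb_def)
    finally show "\<exists>q\<in>carrier (pair_extension s N). p \<otimes>\<^bsub>pair_extension s N\<^esub> q = \<one>\<^bsub>pair_extension s N\<^esub>"
      using emb_inj by (intro bexI[of _ q]) auto
  qed simp
  show "scalar (pair_extension s N) \<in> ring_hom ring_of_type_algebra (pair_extension s N)"
    by (rule ring_hom_memI) auto
  let ?k = "scalar (pair_extension s N) ` carrier ring_of_type_algebra"
  have k: "?k = {(a, 0) | a. True}"
    by auto
  have le: "E.line_extension ?k v E = {(c, 0) \<otimes>\<^bsub>pair_extension s N\<^esub> v \<oplus>\<^bsub>pair_extension s N\<^esub> e | c e. e \<in> E}" for v E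
    unfolding E.line_extension_def k r_coset_def set_add_def set_mult_def by auto
  have d1: "E.dimension (Suc 0) ?k (E.line_extension ?k \<one>\<^bsub>pair_extension s N\<^esub> {\<zero>\<^bsub>pair_extension s N\<^esub>})"
    by (rule E.Suc_dim[OF _ _ E.zero_dim]) auto
  have nm: "(0, 1) \<notin> E.line_extension ?k \<one>\<^bsub>pair_extension s N\<^esub> {\<zero>\<^bsub>pair_extension s N\<^esub>}"
    unfolding le by simp
  have "E.dimension (Suc (Suc 0)) ?k
    (E.line_extension ?k (0, 1) (E.line_extension ?k \<one>\<^bsub>pair_extension s N\<^esub> {\<zero>\<^bsub>pair_extension s N\<^esub>}))"
    by (rule E.Suc_dim[OF _ nm d1]) simp
  also have "E.line_extension ?k (0, 1) (E.line_extension ?k \<one>\<^bsub>pair_extension s N\<^esub> {\<zero>\<^bsub>pair_extension s N\<^esub>}) = UNIV"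
    unfolding le by auto
  finally show "E.dimension 2 ?k (carrier (pair_extension s N))"
    by (simp add: numeral_2_eq_2)
qed

lemma splits_pair_extension:
  assumes "splits_in (simple_extension \<theta>) (to_ac \<gamma>) (to_ac \<delta>)" "\<delta> \<noteq> 0"
  shows "splits ring_of_type_algebra (pair_extension s N) (quaternion_algebra ring_of_type_algebra \<gamma> \<delta>)"
proof -
  interpret E: field "pair_extension s N"
    using quadratic_pair_extension by (simp add: quadratic_extension_def)
  interpret splitting \<gamma> \<delta> "pair_extension s N"
    using quadratic_pair_extension char2 assms(2)
    by unfold_locales (simp_all add: quadratic_extension_def)
  obtain t z where "to_ac \<gamma> = emb t ^ 2 + emb t + to_ac \<delta> * emb z ^ 2"
    using assms(1) unfolding splits_in_def range_emb by blast
  moreover have "to_ac c = emb (scalar (pair_extension s N) c)" for c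
    by (simp add: emb_def)
  ultimately have "emb (scalar (pair_extension s N) \<gamma>) = emb (t \<otimes>\<^bsub>pair_extension s N\<^esub> t \<oplus>\<^bsub>pair_extension s N\<^esub> t
      \<oplus>\<^bsub>pair_extension s N\<^esub> scalar (pair_extension s N) \<delta> \<otimes>\<^bsub>pair_extension s N\<^esub> (z \<otimes>\<^bsub>pair_extension s N\<^esub> z))"
    by (simp only: emb_mult emb_add power2_eq_square)
  then show ?thesis
    by (intro splitsI[of t z] emb_inj) simp_all
qed

end

section \<open>Generators and coordinates of an arbitrary quadratic extension\<close>

context char2_extension
begin

text \<open>Dimension 2 means that \<open>K\<close> is spanned by some v and w over the base field;
  their quotient v/w generates \<open>K\<close> together with 1.\<close>

lemma quadratic_generator:
  assumes "ring.dimension K 2 (scalar K ` carrier ring_of_type_algebra) (carrier K)"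
  shows "\<exists>\<theta>\<in>carrier K. \<exists>s N. (s = 0 \<or> s = 1) \<and> \<theta> \<otimes>\<^bsub>K\<^esub> \<theta> = \<kappa> N \<oplus>\<^bsub>K\<^esub> \<kappa> s \<otimes>\<^bsub>K\<^esub> \<theta> \<and>
    (\<forall>a\<in>carrier K. \<exists>u v. a = \<kappa> u \<oplus>\<^bsub>K\<^esub> \<kappa> v \<otimes>\<^bsub>K\<^esub> \<theta>) \<and> (\<forall>u v. \<kappa> u \<oplus>\<^bsub>K\<^esub> \<kappa> v \<otimes>\<^bsub>K\<^esub> \<theta> = \<zero>\<^bsub>K\<^esub> \<longrightarrow> u = 0 \<and> v = 0)"
proof -
  let ?k = "scalar K ` carrier ring_of_type_algebra"
  have le: "K.line_extension ?k v E = {\<kappa> c \<otimes>\<^bsub>K\<^esub> v \<oplus>\<^bsub>K\<^esub> e | c e. e \<in> E}" for v E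
    unfolding K.line_extension_def r_coset_def set_add_def set_mult_def by auto
  from assms obtain v E where v: "v \<in> carrier K" "v \<notin> E" and E: "K.dimension (Suc 0) ?k E"
    and K_eq: "carrier K = K.line_extension ?k v E"
    by (cases rule: K.dimension.cases) (auto simp: numeral_2_eq_2)
  from E obtain w E0 where w0: "w \<in> carrier K" "w \<notin> E0" and E0: "K.dimension 0 ?k E0"
    and E_eq0: "E = K.line_extension ?k w E0"
    by (cases rule: K.dimension.cases) auto
  from E0 have "E0 = {\<zero>\<^bsub>K\<^esub>}"
    by (cases rule: K.dimension.cases) auto
  with w0 E_eq0 have w: "w \<in> carrier K" "w \<noteq> \<zero>\<^bsub>K\<^esub>" and E_eq: "E = K.line_extension ?k w {\<zero>\<^bsub>K\<^esub>}"
    by auto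
  have E_eq': "E = {\<kappa> c \<otimes>\<^bsub>K\<^esub> w | c. True}"
    unfolding E_eq le using w by auto
  have w': "inv\<^bsub>K\<^esub> w \<in> carrier K" "w \<otimes>\<^bsub>K\<^esub> inv\<^bsub>K\<^esub> w = \<one>\<^bsub>K\<^esub>" "inv\<^bsub>K\<^esub> w \<otimes>\<^bsub>K\<^esub> w = \<one>\<^bsub>K\<^esub>"
    using w K.field_Units by auto
  define \<eta> where "\<eta> = v \<otimes>\<^bsub>K\<^esub> inv\<^bsub>K\<^esub> w"
  have \<eta>: "\<eta> \<in> carrier K"
    using v w' by (simp add: \<eta>_def)
  have span: "\<exists>c d. a = \<kappa> c \<oplus>\<^bsub>K\<^esub> \<kappa> d \<otimes>\<^bsub>K\<^esub> \<eta>" if a: "a \<in> carrier K" for a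
  proof -
    have "a \<otimes>\<^bsub>K\<^esub> w \<in> K.line_extension ?k v E"
      unfolding K_eq[symmetric] using a w by simp
    then obtain c d where aw: "a \<otimes>\<^bsub>K\<^esub> w = \<kappa> d \<otimes>\<^bsub>K\<^esub> v \<oplus>\<^bsub>K\<^esub> \<kappa> c \<otimes>\<^bsub>K\<^esub> w"
      unfolding le unfolding E_eq' by blast
    have "a = a \<otimes>\<^bsub>K\<^esub> w \<otimes>\<^bsub>K\<^esub> inv\<^bsub>K\<^esub> w"
      using a w w' by (simp add: K.m_assoc)
    also have "\<dots> = \<kappa> d \<otimes>\<^bsub>K\<^esub> \<eta> \<oplus>\<^bsub>K\<^esub> \<kappa> c"
      unfolding aw using v w w' by (simp add: \<eta>_def K.l_distr K.m_assoc)
    also have "\<dots> = \<kappa> c \<oplus>\<^bsub>K\<^esub> \<kappa> d \<otimes>\<^bsub>K\<^esub> \<eta>"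
      using \<eta> by (intro K.a_comm) simp_all
    finally show ?thesis
      by - (rule exI[of _ c], rule exI[of _ d])
  qed
  have indep: "c = 0 \<and> d = 0" if eq: "\<kappa> c \<oplus>\<^bsub>K\<^esub> \<kappa> d \<otimes>\<^bsub>K\<^esub> \<eta> = \<zero>\<^bsub>K\<^esub>" for c d
  proof -
    have eq': "\<kappa> c = \<kappa> d \<otimes>\<^bsub>K\<^esub> \<eta>"
      by (rule eq_if_sum_zero[OF _ _ eq]) (simp_all add: \<eta>)
    have "d = 0"
    proof (rule ccontr)
      assume "d \<noteq> 0"
      have "\<kappa> (c / d) = \<kappa> (inverse d) \<otimes>\<^bsub>K\<^esub> (\<kappa> d \<otimes>\<^bsub>K\<^esub> \<eta>)"
        unfolding eq'[symmetric] \<kappa>_mult[symmetric] by (simp add: field_simps)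
      also have "\<dots> = \<eta>"
        using \<open>d \<noteq> 0\<close> \<eta> by (simp add: \<kappa>_one flip: K.m_assoc \<kappa>_mult)
      finally have "v = \<kappa> (c / d) \<otimes>\<^bsub>K\<^esub> w"
        using v w w' by (simp add: \<eta>_def K.m_assoc)
      with v(2) show False
        unfolding E_eq' by blast
    qed
    with eq \<eta> show ?thesis
      by (simp add: \<kappa>_zero \<kappa>_eq_0_iff)
  qed
  obtain N s where sN: "\<eta> \<otimes>\<^bsub>K\<^esub> \<eta> = \<kappa> N \<oplus>\<^bsub>K\<^esub> \<kappa> s \<otimes>\<^bsub>K\<^esub> \<eta>"
    using span[of "\<eta> \<otimes>\<^bsub>K\<^esub> \<eta>"] \<eta> by auto
  show ?thesis
  proof (cases "s = 0")
    case True
    have "\<forall>a\<in>carrier K. \<exists>u v. a = \<kappa> u \<oplus>\<^bsub>K\<^esub> \<kappa> v \<otimes>\<^bsub>K\<^esub> \<eta>"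
      "\<forall>u v. \<kappa> u \<oplus>\<^bsub>K\<^esub> \<kappa> v \<otimes>\<^bsub>K\<^esub> \<eta> = \<zero>\<^bsub>K\<^esub> \<longrightarrow> u = 0 \<and> v = 0"
      by (rule ballI, erule span) (intro allI impI, erule indep)
    with True sN \<eta> show ?thesis
      by - (rule bexI[of _ \<eta>], rule exI[of _ s], rule exI[of _ N], rule conjI, simp, (intro conjI; assumption))
  next
    case False
    \<comment> \<open>Dividing the generator by its nonzero trace s normalises the trace to 1; a
      trace 0 is left as it is.\<close>
    define \<theta> where "\<theta> = \<kappa> (inverse s) \<otimes>\<^bsub>K\<^esub> \<eta>"
    have \<theta>: "\<theta> \<in> carrier K"
      using \<eta> by (simp add: \<theta>_def)
    have scale: "\<kappa> d \<otimes>\<^bsub>K\<^esub> \<theta> = \<kappa> (d * inverse s) \<otimes>\<^bsub>K\<^esub> \<eta>" for d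
      using \<eta> by (simp add: \<theta>_def \<kappa>_mult K.m_assoc)
    have "\<theta> \<otimes>\<^bsub>K\<^esub> \<theta> = \<kappa> (inverse s) \<otimes>\<^bsub>K\<^esub> \<kappa> (inverse s) \<otimes>\<^bsub>K\<^esub> (\<eta> \<otimes>\<^bsub>K\<^esub> \<eta>)"
      using \<eta> by (simp add: \<theta>_def K.m_ac)
    also have "\<dots> = \<kappa> (inverse s * inverse s * N) \<oplus>\<^bsub>K\<^esub> \<kappa> (inverse s * inverse s * s) \<otimes>\<^bsub>K\<^esub> \<eta>"
      unfolding sN using \<eta> by (simp add: K.r_distr \<kappa>_mult K.m_assoc)
    also have "\<dots> = \<kappa> (inverse s * inverse s * N) \<oplus>\<^bsub>K\<^esub> \<kappa> 1 \<otimes>\<^bsub>K\<^esub> \<theta>"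
      unfolding scale using False by (simp add: mult.assoc)
    finally have sq: "\<theta> \<otimes>\<^bsub>K\<^esub> \<theta> = \<kappa> (inverse s * inverse s * N) \<oplus>\<^bsub>K\<^esub> \<kappa> 1 \<otimes>\<^bsub>K\<^esub> \<theta>" .
    have "\<exists>u v. a = \<kappa> u \<oplus>\<^bsub>K\<^esub> \<kappa> v \<otimes>\<^bsub>K\<^esub> \<theta>" if a: "a \<in> carrier K" for a
    proof -
      obtain c d where "a = \<kappa> c \<oplus>\<^bsub>K\<^esub> \<kappa> d \<otimes>\<^bsub>K\<^esub> \<eta>"
        using span[OF a] by blast
      then have "a = \<kappa> c \<oplus>\<^bsub>K\<^esub> \<kappa> (d * s) \<otimes>\<^bsub>K\<^esub> \<theta>"
        unfolding scale using False by (simp add: mult.assoc)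
      then show ?thesis by blast
    qed
    then have span': "\<forall>a\<in>carrier K. \<exists>u v. a = \<kappa> u \<oplus>\<^bsub>K\<^esub> \<kappa> v \<otimes>\<^bsub>K\<^esub> \<theta>"
      by (rule ballI)
    have "u = 0 \<and> v = 0" if "\<kappa> u \<oplus>\<^bsub>K\<^esub> \<kappa> v \<otimes>\<^bsub>K\<^esub> \<theta> = \<zero>\<^bsub>K\<^esub>" for u v
      using indep[of u "v * inverse s"] that False unfolding scale by simp
    then have "\<forall>u v. \<kappa> u \<oplus>\<^bsub>K\<^esub> \<kappa> v \<otimes>\<^bsub>K\<^esub> \<theta> = \<zero>\<^bsub>K\<^esub> \<longrightarrow> u = 0 \<and> v = 0"
      by (intro allI impI)
    with sq span' \<theta> show ?thesis
      by - (rule bexI[of _ \<theta>], rule exI[of _ 1], rule exI[of _ "inverse s * inverse s * N"],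
        rule conjI, simp, (intro conjI; assumption))
  qed
qed

text \<open>The splitting equation is compared coefficientwise in the basis 1, \<theta>. Squaring is
  additive in characteristic 2, so no mixed terms appear.\<close>

lemma quadratic_coordinates:
  assumes \<theta>: "\<theta> \<in> carrier K" and sq: "\<theta> \<otimes>\<^bsub>K\<^esub> \<theta> = \<kappa> N \<oplus>\<^bsub>K\<^esub> \<kappa> s \<otimes>\<^bsub>K\<^esub> \<theta>"
    and span: "\<forall>a\<in>carrier K. \<exists>u v. a = \<kappa> u \<oplus>\<^bsub>K\<^esub> \<kappa> v \<otimes>\<^bsub>K\<^esub> \<theta>"
    and indep: "\<forall>u v. \<kappa> u \<oplus>\<^bsub>K\<^esub> \<kappa> v \<otimes>\<^bsub>K\<^esub> \<theta> = \<zero>\<^bsub>K\<^esub> \<longrightarrow> u = 0 \<and> v = 0"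
    and tz: "t \<in> carrier K" "z \<in> carrier K" "\<kappa> \<gamma> = t \<otimes>\<^bsub>K\<^esub> t \<oplus>\<^bsub>K\<^esub> t \<oplus>\<^bsub>K\<^esub> \<kappa> \<delta> \<otimes>\<^bsub>K\<^esub> (z \<otimes>\<^bsub>K\<^esub> z)"
  shows "\<exists>t0 t1 z0 z1. \<gamma> = t0 ^ 2 + N * t1 ^ 2 + t0 + \<delta> * (z0 ^ 2 + N * z1 ^ 2) \<and>
      s * t1 ^ 2 + t1 + \<delta> * (s * z1 ^ 2) = 0"
proof -
  define c where "c = (\<lambda>u v. \<kappa> u \<oplus>\<^bsub>K\<^esub> \<kappa> v \<otimes>\<^bsub>K\<^esub> \<theta>)"
  have c_closed: "c u v \<in> carrier K" for u v
    using \<theta> by (simp add: c_def)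
  have c_add: "c u v \<oplus>\<^bsub>K\<^esub> c u' v' = c (u + u') (v + v')" for u v u' v'
    using \<theta> by (simp add: c_def \<kappa>_add K.l_distr interchange)
  have \<kappa>_c: "\<kappa> u = c u 0" for u
    using \<theta> by (simp add: c_def \<kappa>_zero)
  have scale: "\<kappa> d \<otimes>\<^bsub>K\<^esub> c u v = c (d * u) (d * v)" for d u v
    using \<theta> by (simp add: c_def K.r_distr \<kappa>_mult K.m_assoc)
  have c_sq: "c u v \<otimes>\<^bsub>K\<^esub> c u v = c (u ^ 2 + N * v ^ 2) (s * v ^ 2)" for u v
  proof -
    have "c u v \<otimes>\<^bsub>K\<^esub> c u v = \<kappa> u \<otimes>\<^bsub>K\<^esub> \<kappa> u \<oplus>\<^bsub>K\<^esub> (\<kappa> v \<otimes>\<^bsub>K\<^esub> \<kappa> v) \<otimes>\<^bsub>K\<^esub> (\<theta> \<otimes>\<^bsub>K\<^esub> \<theta>)"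
      using \<theta> by (simp add: c_def K.l_distr K.r_distr K.a_ac K.m_ac)
    also have "\<dots> = \<kappa> (u * u) \<oplus>\<^bsub>K\<^esub> \<kappa> (v * v) \<otimes>\<^bsub>K\<^esub> c N s"
      by (simp add: sq c_def \<kappa>_mult)
    also have "\<dots> = c (u ^ 2 + N * v ^ 2) (s * v ^ 2)"
      unfolding scale unfolding \<kappa>_c c_add by (simp add: power2_eq_square mult_ac)
    finally show ?thesis .
  qed
  obtain t0 t1 where t: "t = c t0 t1"
    using span tz(1) unfolding c_def by blast
  obtain z0 z1 where z: "z = c z0 z1"
    using span tz(2) unfolding c_def by blast
  define U V where "U = t0 ^ 2 + N * t1 ^ 2 + t0 + \<delta> * (z0 ^ 2 + N * z1 ^ 2)" and "V = s * t1 ^ 2 + t1 + \<delta> * (s * z1 ^ 2)"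
  have "c \<gamma> 0 = c U V"
    using tz(3) unfolding t z c_sq scale c_add U_def V_def by (simp add: \<kappa>_c)
  then have "c (\<gamma> + U) V = c U V \<oplus>\<^bsub>K\<^esub> c U V"
    using c_add[of \<gamma> 0 U V] by simp
  also have "\<dots> = \<zero>\<^bsub>K\<^esub>"
    using c_closed by simp
  finally have "\<gamma> + U = 0" "V = 0"
    using indep unfolding c_def by blast+
  moreover have "\<gamma> = U" if "\<gamma> + U = 0"
    using char2_move[OF char2, of \<gamma> U 0] that by simp
  ultimately show ?thesis
    unfolding U_def V_def by blast
qed

end

theorem mainTheorem1:
  assumes "CHAR('k :: alg_closed_field) = 2"
  shows "m_linked (ring_of_type_algebra :: 'k fls fls ring) 3 \<and>
         \<not> m_linked (ring_of_type_algebra :: 'k fls fls ring) 4"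
proof
  let ?F = "ring_of_type_algebra :: 'k fls fls ring"
  have charF: "CHAR('k fls fls) = 2" and charE: "CHAR('k fls) = 2"
    using assms by simp_all
  show "m_linked ?F 3"
    unfolding m_linked_def
  proof (intro allI impI)
    fix \<gamma> \<delta> :: "nat \<Rightarrow> 'k fls fls"
    assume "\<forall>i<3. \<gamma> i \<in> carrier ?F \<and> \<delta> i \<in> carrier ?F - {\<zero>\<^bsub>?F\<^esub>}"
    then have \<delta>: "\<delta> i \<noteq> 0" if "i < 3" for i
      using that by auto
    \<comment> \<open>The constant 2 for the field of series in \<alpha> is what is passed on; going
      to polynomials in \<beta> doubles it to 4.\<close>
    have "\<exists>\<theta> s N. \<theta> ^ 2 = to_ac s * \<theta> + to_ac N \<and> \<theta> \<notin> range to_ac \<and>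
        (\<forall>i<3. splits_in (simple_extension \<theta>) (to_ac (\<gamma> i)) (to_ac (\<delta> i)))"
      by (rule common_splitting_extension[OF charE quadrics_solvable_fls[OF assms] \<delta>])
    then obtain \<theta> s N where \<theta>: "\<theta> ^ 2 = to_ac s * \<theta> + to_ac N" "\<theta> \<notin> range to_ac"
      and sp: "\<forall>i<3. splits_in (simple_extension \<theta>) (to_ac (\<gamma> i)) (to_ac (\<delta> i))"
      by (elim exE conjE)
    show "linked ?F 3 (\<lambda>i. quaternion_algebra ?F (\<gamma> i) (\<delta> i))"
      unfolding linked_def
      using quadratic_pair_extension[OF charF \<theta>] splits_pair_extension[OF charF \<theta>] sp \<delta> by blast
  qed
  show "\<not> m_linked ?F 4"
  proof
    assume linked: "m_linked ?F 4"
    obtain \<gamma> \<delta> :: "nat \<Rightarrow> 'k fls fls" where \<delta>: "\<forall>i<4. \<delta> i \<noteq> 0" and no: "\<not> (\<exists>s N. (s = 0 \<or> s = 1) \<and> (\<forall>i<4. \<exists>t0 t1 z0 z1.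
        \<gamma> i = t0 ^ 2 + N * t1 ^ 2 + t0 + \<delta> i * (z0 ^ 2 + N * z1 ^ 2) \<and> s * t1 ^ 2 + t1 + \<delta> i * (s * z1 ^ 2) = 0))"
      using four_without_common_splitting[OF assms] by (elim exE conjE)
    have "linked ?F 4 (\<lambda>i. quaternion_algebra ?F (\<gamma> i) (\<delta> i))"
      using linked \<delta> unfolding m_linked_def by simp
    then obtain K :: "('k fls fls, 'k fls fls \<times> 'k fls fls) ualg" where K: "quadratic_extension ?F K"
      and split: "\<forall>i<4. splits ?F K (quaternion_algebra ?F (\<gamma> i) (\<delta> i))"
      unfolding linked_def by blast
    interpret K: field K
      using K by (simp add: quadratic_extension_def)
    interpret char2_extension K
      using K charF by unfold_locales (simp_all add: quadratic_extension_def)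
    have "ring.dimension K 2 (scalar K ` carrier ?F) (carrier K)"
      using K by (simp add: quadratic_extension_def)
    from quadratic_generator[OF this] obtain \<theta> s N where \<theta>: "\<theta> \<in> carrier K"
      and s: "s = 0 \<or> s = 1" and gen: "\<theta> \<otimes>\<^bsub>K\<^esub> \<theta> = scalar K N \<oplus>\<^bsub>K\<^esub> scalar K s \<otimes>\<^bsub>K\<^esub> \<theta>"
      "\<forall>a\<in>carrier K. \<exists>u v. a = scalar K u \<oplus>\<^bsub>K\<^esub> scalar K v \<otimes>\<^bsub>K\<^esub> \<theta>"
      "\<forall>u v. scalar K u \<oplus>\<^bsub>K\<^esub> scalar K v \<otimes>\<^bsub>K\<^esub> \<theta> = \<zero>\<^bsub>K\<^esub> \<longrightarrow> u = 0 \<and> v = 0"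
      by (elim bexE exE conjE)
    have "\<exists>t0 t1 z0 z1. \<gamma> i = t0 ^ 2 + N * t1 ^ 2 + t0 + \<delta> i * (z0 ^ 2 + N * z1 ^ 2) \<and>
        s * t1 ^ 2 + t1 + \<delta> i * (s * z1 ^ 2) = 0" if i: "i < 4" for i
    proof -
      interpret splitting "\<gamma> i" "\<delta> i" K
        using \<delta> i by unfold_locales simp
      obtain t z where "t \<in> carrier K" "z \<in> carrier K"
        "scalar K (\<gamma> i) = t \<otimes>\<^bsub>K\<^esub> t \<oplus>\<^bsub>K\<^esub> t \<oplus>\<^bsub>K\<^esub> scalar K (\<delta> i) \<otimes>\<^bsub>K\<^esub> (z \<otimes>\<^bsub>K\<^esub> z)"
        using splitsD split i by blast
      then show ?thesis
        by (rule quadratic_coordinates[OF \<theta> gen])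
    qed
    then have "\<exists>s N. (s = 0 \<or> s = 1) \<and> (\<forall>i<4. \<exists>t0 t1 z0 z1.
        \<gamma> i = t0 ^ 2 + N * t1 ^ 2 + t0 + \<delta> i * (z0 ^ 2 + N * z1 ^ 2) \<and> s * t1 ^ 2 + t1 + \<delta> i * (s * z1 ^ 2) = 0)"
      using s by - (rule exI[of _ s], rule exI[of _ N], simp)
    with no show False by (rule notE)
  qed
qed

end
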